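(* Let $0<e=m$ (extremal Reissner-Nordström) and let $\Sigma_0$ and $\Sigma_1$ be spacelike slices as described in the context. Then there exists a sequence $\{u_i\}_{i\in\mathbb{N}}$ of solutions to the wave equation $\Box_gu_i=0$ with initial energy $E_0^{n_{\Sigma_0}}(u_i)=1$ on $\Sigma_0$ such that the $n_{\Sigma_1}$-energy on $\Sigma_1$ goes to infinity, i.e. $E_1^{n_{\Sigma_1}}(u_i)\to\infty$ for $i\to\infty$.
   Context: Spacetime. Let $m>0$ and $D(r)=1-\frac{2m}r+\frac{m^2}{r^2}=\frac{(r-m)^2}{r^2}$. The extremal Reissner-Nordström exterior (region $I$) is $\mathbb{R}\times(m,\infty)\times\mathbb{S}^2$ with $g=-D\,dt^2+D^{-1}dr^2+r^2d\theta^2+r^2\sin^2\theta\,d\varphi^2$; consider its maximal analytic extension. Put $v=t+r_I^*$ in $I$, $\frac{dr^*_I}{dr}=\frac1D$; the coordinates $(v,r,\theta,\varphi)$, $r\in(0,\infty)$, with $g=-D\,dv^2+dv\otimes dr+dr\otimes dv+r^2d\theta^2+r^2\sin^2\theta\,d\varphi^2$ cover region $I$ ($r>m$) and region $II$ ($0<r<m$), separated by the event horizon $\mathcal{H}^+=\{r=m\}$, with $-\partial_r|_v$ future directed. In $II$ let $\frac{dr_{II}^*}{dr}=\frac1D$, $t=v-r_{II}^*$ and $u=t-r_{II}^*$; the outgoing coordinates $(u,r,\theta,\varphi)$, with $g=-D\,du^2-du\otimes dr-dr\otimes du+r^2d\theta^2+r^2\sin^2\theta\,d\varphi^2$, cover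 region $II$ ($0<r<m$) and region $III$ ($r>m$), separated by the Cauchy horizon $\{r=m\}$ of this chart (where $v\to\infty$). Slices (both represented by curves in the Penrose diagram). $\Sigma_0$ is a spacelike slice which asymptotes to a $\{t=\mathrm{const}\}$ hypersurface at spatial infinity $i^0$ of region $I$ and extends through the event horizon $\mathcal{H}^+$ into region $II$; its domain of dependence $\mathcal{D}(\Sigma_0)$ is globally hyperbolic. $\Sigma_1$ is a spacelike slice contained in region $II\cap\mathcal{D}(\Sigma_0)$, to the future of $\Sigma_0$, which reaches the Cauchy horizon between $II$ and $III$ and is extendible across it as a smooth spacelike slice into region $III$. Energy. $n_{\Sigma_j}$ is the future directed unit normal of $\Sigma_j$. $\mathbb{T}(u)=\frac12\overline{du}\otimes du+\frac12du\otimes\overline{du}-\frac12g\,g^{-1}(du,\overline{du})$ and $E_j^{n_{\Sigma_j}}(u)=\int_{\Sigma_j}\mathbb{T}(u)(n_{\Sigma_j},n_{\Sigma_j})\,\mathrm{vol}_{\Sigma_j}$, $j=0,1$. Solutions are smooth functions on $\mathcal{D}(\Sigma_0)$. *)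

theory Defs
  imports "HOL-Analysis.Analysis"
begin

text \<open>
  Smooth functions. The recursion uses unrestricted derivatives, so it is meant for open sets \<open>S\<close>.
\<close>

primrec Ck_on :: "nat \<Rightarrow> 'a::euclidean_space set \<Rightarrow> ('a \<Rightarrow> 'b::real_normed_vector) \<Rightarrow> bool" where
  "Ck_on 0 S f \<longleftrightarrow> continuous_on S f"
| "Ck_on (Suc k) S f \<longleftrightarrow> (\<forall>x\<in>S. f differentiable (at x)) \<and>
     (\<forall>b\<in>Basis. Ck_on k S (\<lambda>x. frechet_derivative f (at x) b))"

definition smooth_on :: "'a::euclidean_space set \<Rightarrow> ('a \<Rightarrow> 'b::real_normed_vector) \<Rightarrow> bool" where
  "smooth_on S f \<longleftrightarrow> (\<forall>k. Ck_on k S f)"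


text \<open>
  Pseudo-Riemannian geometry in a coordinate patch of \<open>real^4\<close>: \<open>g p X Y\<close> is the metric at \<open>p\<close>
  applied to the vectors \<open>X\<close>, \<open>Y\<close>, and covectors are given by their values on the coordinate basis.
\<close>

type_synonym metric = "real^4 \<Rightarrow> real^4 \<Rightarrow> real^4 \<Rightarrow> real"

definition gram :: "metric \<Rightarrow> real^4 \<Rightarrow> real^4^4" where
  "gram g p = (\<chi> i j. g p (axis i 1) (axis j 1))"

definition inverse_metric :: "metric \<Rightarrow> real^4 \<Rightarrow> (real^4 \<Rightarrow> complex) \<Rightarrow> (real^4 \<Rightarrow> complex) \<Rightarrow> complex" where
  "inverse_metric g p \<alpha> \<beta> =
     (\<Sum>i\<in>UNIV. \<Sum>j\<in>UNIV. complex_of_real (matrix_inv (gram g p) $ i $ j) * \<alpha> (axis i 1) * \<beta> (axis j 1))"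

definition differential :: "(real^4 \<Rightarrow> complex) \<Rightarrow> real^4 \<Rightarrow> real^4 \<Rightarrow> complex" where
  "differential u p X = frechet_derivative u (at p) X"

definition box :: "metric \<Rightarrow> (real^4 \<Rightarrow> complex) \<Rightarrow> real^4 \<Rightarrow> complex" where
  "box g u p = (1 / sqrt \<bar>det (gram g p)\<bar>) *\<^sub>R
     (\<Sum>i\<in>UNIV. frechet_derivative
        (\<lambda>q. \<Sum>j\<in>UNIV. (sqrt \<bar>det (gram g q)\<bar> * matrix_inv (gram g q) $ i $ j) *\<^sub>R
               differential u q (axis j 1))
        (at p) (axis i 1))"

definition stress_energy :: "metric \<Rightarrow> (real^4 \<Rightarrow> complex) \<Rightarrow> real^4 \<Rightarrow> real^4 \<Rightarrow> real^4 \<Rightarrow> complex" where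
  "stress_energy g u p X Y =
     1/2 * cnj (differential u p X) * differential u p Y
     + 1/2 * differential u p X * cnj (differential u p Y)
     - 1/2 * complex_of_real (g p X Y) *
         inverse_metric g p (differential u p) (\<lambda>Z. cnj (differential u p Z))"


text \<open>
  The maximal analytic extension of the extremal Reissner-Nordstroem exterior
  is an infinite chain of regions: \<open>Region n\<close> is an exterior (\<open>r > m\<close>) for even \<open>n\<close> and an interior
  (\<open>0 < r < m\<close>) for odd \<open>n\<close>, and \<open>Horizon n\<close> separates \<open>Region n\<close> from \<open>Region (n + 1)\<close>. Thus
  regions I, II, III are \<open>Region 0\<close>, \<open>Region 1\<close>, \<open>Region 2\<close>, the event horizon is \<open>Horizon 0\<close>
  and the Cauchy horizon between II and III is \<open>Horizon 1\<close>.

  The sphere coordinates and \<open>r\<close> are merged into \<open>x = r \<omega>\<close> with \<open>x\<close> in \<open>real^3\<close> minus the origin and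
  \<open>\<omega>\<close> in the unit sphere, so that \<open>r = norm x\<close> and the round part \<open>r^2 (d\<theta>^2 + sin^2 \<theta> d\<phi>^2)\<close> of
  the metric is \<open>|dx|^2 - dr^2\<close>. The real argument of \<open>Region\<close> is \<open>t\<close>; that of \<open>Horizon\<close> is the
  null coordinate \<open>v\<close> (even index) or \<open>u\<close> (odd index) of the chart which covers it.
\<close>

datatype ern = Region int real "real^3" | Horizon int real "real^3"

definition D :: "real \<Rightarrow> real \<Rightarrow> real" where
  "D m r = 1 - 2 * m / r + m\<^sup>2 / r\<^sup>2"

text \<open>A primitive of \<open>1 / D\<close> on each of \<open>(0, m)\<close> and \<open>(m, \<infinity>)\<close>.\<close>

definition rstar :: "real \<Rightarrow> real \<Rightarrow> real" where
  "rstar m r = r + 2 * m * ln \<bar>r - m\<bar> - m\<^sup>2 / (r - m)"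

lemma rstar_deriv:
  assumes "r > 0" "r \<noteq> m"
  shows "(rstar m has_real_derivative 1 / D m r) (at r)"
proof -
  have eq: "1 / D m r = 1 + 2 * m / (r - m) + m\<^sup>2 / (r - m)\<^sup>2"
  proof -
    have "D m r = (r - m)\<^sup>2 / r\<^sup>2"
      using assms by (simp add: D_def field_simps power2_eq_square)
    then have "1 / D m r = r\<^sup>2 / (r - m)\<^sup>2" by simp
    also have "r\<^sup>2 = (r - m)\<^sup>2 + 2 * m * (r - m) + m\<^sup>2"
      by (simp add: power2_eq_square algebra_simps)
    finally show ?thesis
      using assms by (simp add: add_divide_distrib power2_eq_square)
  qed
  have ln_abs: "((\<lambda>r. ln \<bar>r - m\<bar>) has_real_derivative 1 / (r - m)) (at r)"
  proof (cases "r > m")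
    case True
    have "((\<lambda>r. ln (r - m)) has_real_derivative 1 / (r - m)) (at r)"
      using True by (auto intro!: derivative_eq_intros)
    then show ?thesis
      by (rule has_field_derivative_transform_within_open[where S = "{m<..}"]) (use True in auto)
  next
    case False
    have "((\<lambda>r. ln (m - r)) has_real_derivative 1 / (r - m)) (at r)"
      using False assms by (auto intro!: derivative_eq_intros simp: field_simps)
    then show ?thesis
      by (rule has_field_derivative_transform_within_open[where S = "{..<m}"]) (use False assms in auto)
  qed
  have "((\<lambda>r. m\<^sup>2 / (r - m)) has_real_derivative - (m\<^sup>2 / (r - m)\<^sup>2)) (at r)"
    using assms by (auto intro!: derivative_eq_intros simp: power2_eq_square)
  from DERIV_diff[OF DERIV_add[OF DERIV_ident DERIV_cmult[OF ln_abs, of "2 * m"]] this]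
  show ?thesis
    unfolding rstar_def[abs_def] eq by simp
qed

text \<open>
  Charts. Chart \<open>n\<close> has coordinates \<open>(s, x)\<close> and covers \<open>Region n\<close>, \<open>Horizon n\<close> and
  \<open>Region (n + 1)\<close>; it is ingoing with \<open>s = v = t + r*\<close> for even \<open>n\<close>, and outgoing with
  \<open>s = u = t - r*\<close> for odd \<open>n\<close>.
\<close>

definition coord :: "real \<Rightarrow> real^3 \<Rightarrow> real^4" where
  "coord s x = s *\<^sub>R axis 1 1 + (x $ 1) *\<^sub>R axis 2 1 + (x $ 2) *\<^sub>R axis 3 1 + (x $ 3) *\<^sub>R axis 4 1"

definition spat :: "real^4 \<Rightarrow> real^3" where
  "spat q = vector [q $ 2, q $ 3, q $ 4]"

lemma coord_nth [simp]:
  "coord s x $ 1 = s" "coord s x $ 2 = x $ 1" "coord s x $ 3 = x $ 2" "coord s x $ 4 = x $ 3"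
  by (simp_all add: coord_def axis_def)

lemma spat_coord [simp]: "spat (coord s x) = x"
  by (simp add: spat_def vec_eq_iff forall_3)

definition rad :: "real^4 \<Rightarrow> real" where
  "rad q = norm (spat q)"

definition orient :: "int \<Rightarrow> real" where
  "orient n = (if even n then 1 else - 1)"

definition chart_dom :: "(real^4) set" where
  "chart_dom = {q. spat q \<noteq> 0}"

definition chart :: "real \<Rightarrow> int \<Rightarrow> real^4 \<Rightarrow> ern" where
  "chart m n q =
     (if rad q = m then Horizon n (q $ 1) (spat q)
      else Region (if even n \<longleftrightarrow> rad q > m then n else n + 1)
             (q $ 1 - orient n * rstar m (rad q)) (spat q))"

definition ern_space :: "real \<Rightarrow> ern set" where
  "ern_space m = (\<Union>n. chart m n ` chart_dom)"

definition chart_preimage :: "real \<Rightarrow> int \<Rightarrow> ern set \<Rightarrow> (real^4) set" where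
  "chart_preimage m n U = {q \<in> chart_dom. chart m n q \<in> U}"

definition ern_top :: "real \<Rightarrow> ern topology" where
  "ern_top m = topology (\<lambda>U. U \<subseteq> ern_space m \<and> (\<forall>n. open (chart_preimage m n U)))"

lemma openin_ern_top:
  "openin (ern_top m) U \<longleftrightarrow> U \<subseteq> ern_space m \<and> (\<forall>n. open (chart_preimage m n U))"
proof -
  have "istopology (\<lambda>U. U \<subseteq> ern_space m \<and> (\<forall>n. open (chart_preimage m n U)))"
    unfolding istopology_def
  proof (intro conjI allI impI, goal_cases)
    case (1 S T) then show ?case by blast
  next
    case (2 S T n)
    have "chart_preimage m n (S \<inter> T) = chart_preimage m n S \<inter> chart_preimage m n T"
      by (auto simp: chart_preimage_def)
    with 2 show ?case by auto
  next
    case (3 K) then show ?case by blast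
  next
    case (4 K n)
    have "chart_preimage m n (\<Union>K) = (\<Union>S\<in>K. chart_preimage m n S)"
      by (auto simp: chart_preimage_def)
    with 4 show ?case by auto
  qed
  then show ?thesis by (simp add: ern_top_def topology_inverse')
qed

definition radial_part :: "real^4 \<Rightarrow> real^4 \<Rightarrow> real" where
  "radial_part q X = (spat q \<bullet> spat X) / rad q"

text \<open>
  In chart \<open>n\<close>: \<open>- D ds^2 + orient n * (ds dr + dr ds) + (|dx|^2 - dr^2)\<close>.
\<close>

definition ern_metric :: "real \<Rightarrow> int \<Rightarrow> metric" where
  "ern_metric m n q X Y =
     - D m (rad q) * (X $ 1) * (Y $ 1)
     + orient n * ((X $ 1) * radial_part q Y + radial_part q X * (Y $ 1))
     + (spat X \<bullet> spat Y - radial_part q X * radial_part q Y)"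

text \<open>
  Time orientation: the null vector field \<open>- \<partial>_r\<close> at constant \<open>v\<close> in ingoing charts, and \<open>\<partial>_r\<close> at
  constant \<open>u\<close> in outgoing charts, is future directed.
\<close>

definition future_null :: "int \<Rightarrow> real^4 \<Rightarrow> real^4" where
  "future_null n q = coord 0 ((- orient n / rad q) *\<^sub>R spat q)"

definition future_causal :: "real \<Rightarrow> int \<Rightarrow> real^4 \<Rightarrow> real^4 \<Rightarrow> bool" where
  "future_causal m n q X \<longleftrightarrow> X \<noteq> 0 \<and> ern_metric m n q X X \<le> 0 \<and>
     (ern_metric m n q X (future_null n q) < 0 \<or> (\<exists>c>0. X = c *\<^sub>R future_null n q))"


text \<open>
  Causal curves are continuous, piecewise \<open>C^1\<close> and future directed, on a parameter interval \<open>J\<close>.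
\<close>

definition causal_curve :: "real \<Rightarrow> real set \<Rightarrow> (real \<Rightarrow> ern) \<Rightarrow> bool" where
  "causal_curve m J \<gamma> \<longleftrightarrow>
     (\<forall>s\<in>J. \<exists>n c c' e S. e > 0 \<and> finite S \<and>
        continuous_on (J \<inter> ball s e) c \<and> continuous_on (J \<inter> ball s e - S) c' \<and>
        (\<forall>\<tau>\<in>J \<inter> ball s e. c \<tau> \<in> chart_dom \<and> \<gamma> \<tau> = chart m n (c \<tau>)) \<and>
        (\<forall>\<tau>\<in>J \<inter> ball s e - S. (c has_vector_derivative c' \<tau>) (at \<tau> within J) \<and>
           future_causal m n (c \<tau>) (c' \<tau>)))"

definition causally_precedes :: "real \<Rightarrow> ern \<Rightarrow> ern \<Rightarrow> bool" where
  "causally_precedes m p q \<longleftrightarrow> p \<in> ern_space m \<and> q \<in> ern_space m \<and>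
     (p = q \<or> (\<exists>\<gamma>. causal_curve m {0..1} \<gamma> \<and> \<gamma> 0 = p \<and> \<gamma> 1 = q))"

definition causal_future :: "real \<Rightarrow> ern set \<Rightarrow> ern set" where
  "causal_future m A = {q. \<exists>p\<in>A. causally_precedes m p q}"

definition causal_past :: "real \<Rightarrow> ern set \<Rightarrow> ern set" where
  "causal_past m A = {q. \<exists>p\<in>A. causally_precedes m q p}"

definition future_dom_dep :: "real \<Rightarrow> ern set \<Rightarrow> ern set" where
  "future_dom_dep m A = {p \<in> ern_space m. \<forall>\<gamma>.
     causal_curve m {..0} \<gamma> \<and> \<gamma> 0 = p \<and> (\<nexists>q. limitin (ern_top m) \<gamma> q at_bot)
     \<longrightarrow> \<gamma> ` {..0} \<inter> A \<noteq> {}}"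

definition past_dom_dep :: "real \<Rightarrow> ern set \<Rightarrow> ern set" where
  "past_dom_dep m A = {p \<in> ern_space m. \<forall>\<gamma>.
     causal_curve m {0..} \<gamma> \<and> \<gamma> 0 = p \<and> (\<nexists>q. limitin (ern_top m) \<gamma> q at_top)
     \<longrightarrow> \<gamma> ` {0..} \<inter> A \<noteq> {}}"

definition dom_dep :: "real \<Rightarrow> ern set \<Rightarrow> ern set" where
  "dom_dep m A = future_dom_dep m A \<union> past_dom_dep m A"

definition strongly_causal_at :: "real \<Rightarrow> ern \<Rightarrow> bool" where
  "strongly_causal_at m p \<longleftrightarrow>
     (\<forall>U. openin (ern_top m) U \<and> p \<in> U \<longrightarrow>
        (\<exists>V. openin (ern_top m) V \<and> p \<in> V \<and> V \<subseteq> U \<and>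
           (\<forall>\<gamma>. causal_curve m {0..1} \<gamma> \<and> \<gamma> 0 \<in> V \<and> \<gamma> 1 \<in> V \<longrightarrow> \<gamma> ` {0..1} \<subseteq> U)))"

definition globally_hyperbolic :: "real \<Rightarrow> ern set \<Rightarrow> bool" where
  "globally_hyperbolic m H \<longleftrightarrow> H \<subseteq> ern_space m \<and> (\<forall>p\<in>H. strongly_causal_at m p) \<and>
     (\<forall>p\<in>H. \<forall>q\<in>H. compactin (ern_top m) (causal_future m {p} \<inter> causal_past m {q}) \<and>
        causal_future m {p} \<inter> causal_past m {q} \<subseteq> H)"


text \<open>Solutions of the wave equation; only the values on \<open>A\<close> (meant to be open) matter.\<close>

definition wave_solution :: "real \<Rightarrow> ern set \<Rightarrow> (ern \<Rightarrow> complex) \<Rightarrow> bool" where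
  "wave_solution m A u \<longleftrightarrow>
     (\<forall>n. smooth_on (chart_preimage m n A) (u \<circ> chart m n) \<and>
        (\<forall>q\<in>chart_preimage m n A. box (ern_metric m n) (u \<circ> chart m n) q = 0))"


text \<open>
  Spherically symmetric slices. A spacelike curve in the \<open>(s, r)\<close> plane of a chart has
  \<open>orient n * s' * r' > 0\<close>, because \<open>- D s'^2 + 2 orient n s' r' > 0\<close> and \<open>D \<ge> 0\<close>.
  So \<open>r\<close> can always be taken as parameter, and the slice is a graph \<open>s = f r\<close> with \<open>r\<close> ranging over
  an open interval \<open>R\<close>; as a hypersurface it is parametrized by the \<open>x\<close> with \<open>norm x \<in> R\<close>.
\<close>

lemma spacelike_radial:
  assumes "rad q > 0" "ern_metric m n q X X > 0" "spat X = c *\<^sub>R spat q"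
  shows "orient n * X $ 1 * radial_part q X > 0"
proof -
  have rp: "radial_part q X = c * rad q"
    using assms
    by (simp add: radial_part_def rad_def power2_norm_eq_inner[symmetric] power2_eq_square)
  have "spat X \<bullet> spat X = (c * rad q)\<^sup>2"
    using assms(3) by (simp add: rad_def power2_norm_eq_inner power_mult_distrib)
      (simp add: power2_eq_square)
  moreover have "D m (rad q) = ((rad q - m) / rad q)\<^sup>2"
    using assms by (simp add: D_def field_simps power2_eq_square)
  ultimately have "- (((rad q - m) / rad q * X $ 1)\<^sup>2) + 2 * (orient n * X $ 1 * radial_part q X) > 0"
    using assms(2) unfolding ern_metric_def rp by (simp add: power2_eq_square algebra_simps)
  then show ?thesis by (smt (verit) zero_le_power2)
qed

definition graph_map :: "(real \<Rightarrow> real) \<Rightarrow> real^3 \<Rightarrow> real^4" where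
  "graph_map f x = coord (f (norm x)) x"

definition slice :: "real \<Rightarrow> int \<Rightarrow> (real \<Rightarrow> real) \<Rightarrow> real set \<Rightarrow> ern set" where
  "slice m n f R = {chart m n (graph_map f x) |x. norm x \<in> R}"

definition tangent :: "(real \<Rightarrow> real) \<Rightarrow> real^3 \<Rightarrow> real^3 \<Rightarrow> real^4" where
  "tangent f x w = frechet_derivative (graph_map f) (at x) w"

definition induced_metric :: "real \<Rightarrow> int \<Rightarrow> (real \<Rightarrow> real) \<Rightarrow> real^3 \<Rightarrow> real^3 \<Rightarrow> real^3 \<Rightarrow> real" where
  "induced_metric m n f x w z = ern_metric m n (graph_map f x) (tangent f x w) (tangent f x z)"

definition spacelike_slice :: "real \<Rightarrow> int \<Rightarrow> (real \<Rightarrow> real) \<Rightarrow> real set \<Rightarrow> bool" where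
  "spacelike_slice m n f R \<longleftrightarrow> smooth_on R f \<and>
     (\<forall>x. norm x \<in> R \<longrightarrow> (\<forall>w. w \<noteq> 0 \<longrightarrow> induced_metric m n f x w w > 0))"

definition unit_normal :: "real \<Rightarrow> int \<Rightarrow> (real \<Rightarrow> real) \<Rightarrow> real^3 \<Rightarrow> real^4" where
  "unit_normal m n f x = (THE N. future_causal m n (graph_map f x) N \<and>
     ern_metric m n (graph_map f x) N N = - 1 \<and>
     (\<forall>w. ern_metric m n (graph_map f x) N (tangent f x w) = 0))"

definition volume_density :: "real \<Rightarrow> int \<Rightarrow> (real \<Rightarrow> real) \<Rightarrow> real^3 \<Rightarrow> real" where
  "volume_density m n f x =
     sqrt (det ((\<chi> i j. induced_metric m n f x (axis i 1) (axis j 1)) :: real^3^3))"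

definition energy :: "real \<Rightarrow> int \<Rightarrow> (real \<Rightarrow> real) \<Rightarrow> real set \<Rightarrow> (ern \<Rightarrow> complex) \<Rightarrow> ennreal" where
  "energy m n f R u =
     (\<integral>\<^sup>+ x\<in>{x. norm x \<in> R}.
        ennreal (Re (stress_energy (ern_metric m n) (u \<circ> chart m n) (graph_map f x)
                       (unit_normal m n f x) (unit_normal m n f x))
                 * volume_density m n f x) \<partial>lborel)"

text \<open>
  The initial slice \<open>v = h r\<close>, \<open>r > r0\<close>, crosses the event horizon into region II and
  satisfies \<open>t = v - r* \<longrightarrow> const\<close> at spatial infinity.
\<close>

definition initial_slice :: "real \<Rightarrow> real \<Rightarrow> (real \<Rightarrow> real) \<Rightarrow> bool" where
  "initial_slice m r0 h \<longleftrightarrow> 0 \<le> r0 \<and> r0 < m \<and> spacelike_slice m 0 h {r0<..} \<and>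
     (\<exists>t0. ((\<lambda>r. h r - rstar m r) \<longlongrightarrow> t0) at_top) \<and>
     globally_hyperbolic m (dom_dep m (slice m 0 h {r0<..}))"

text \<open>
  The slice \<open>u = k r\<close>, \<open>r1 < r < m\<close>, in region II reaches the Cauchy horizon \<open>r = m\<close> of the outgoing
  chart; \<open>k\<close> restricted to \<open>(r1, m)\<close> is the slice itself, its values on \<open>[m, r2)\<close> are the extension
  into region III.
\<close>

definition extendible_slice :: "real \<Rightarrow> real \<Rightarrow> (real \<Rightarrow> real) \<Rightarrow> bool" where
  "extendible_slice m r1 k \<longleftrightarrow> 0 \<le> r1 \<and> r1 < m \<and> (\<exists>r2>m. spacelike_slice m 1 k {r1<..<r2})"

end

theory Submission
  imports Defs "HOL-Real_Asymp.Real_Asymp"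
begin

text \<open>
  Spherically symmetric solutions \<open>P (v, r) / r\<close> already suffice. Label an outgoing null ray by the
  radius \<open>U\<close> at which it meets a reference cone \<open>v = vref\<close> and put \<open>s = v - vref\<close>; the wave equation
  then becomes \<open>\<partial>\<^sub>s \<partial>\<^sub>U P = c P\<close> with \<open>c\<close> smooth across the event horizon. An ingoing packet whose
  profile rises from \<open>0\<close> to \<open>1\<close> on an interval of \<open>v\<close> of length \<open>\<eta>\<close> is created by a source located in
  the past of the initial slice; subtracting the advanced solution of the same source gives a
  homogeneous solution whose data on the initial slice have compact support. This support matters
  because the slice may degenerate towards its ends.

  Let the packet cross the initial slice near a point \<open>r\<^sub>i\<close>, and let \<open>\<eta>\<close> tend to \<open>0\<close>. Its energy there is
  at most \<open>C / \<eta>\<close>, where \<open>C\<close> does not depend on \<open>r\<^sub>i\<close>. On the second slice the coordinate \<open>v\<close> is a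
  function of \<open>r\<close> with slope about \<open>2 / D\<close>, so that the packet is squeezed into a shell of thickness
  at most \<open>\<eta> D\<close>, and its energy is at least \<open>c / (\<eta> D)\<close>. As \<open>r\<^sub>i\<close> tends to infinity, this shell approaches
  the Cauchy horizon, \<open>D\<close> tends to \<open>0\<close> there, and the ratio of the two energies is unbounded.
\<close>

section \<open>Calculus of smooth functions\<close>

text \<open>Apart from its leading term the energy on the initial slice is not controlled as
  \<open>ri\<close> grows: the potential leaves a tail behind the packet, about whose size nothing
  uniform is claimed. But the tail stays bounded as \<eta> tends to 0, because the Goursat bounds
  see the data only through their supremum, whereas the leading term is of order 1 / \<eta>. This
  dictates the dependence of the constants: the smallness of \<open>D\<close> depends on the wanted
  amplification only, \<open>ri\<close> on that smallness, the tail constants on \<open>ri\<close>,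
  and \<eta> on all of them. Uniformity of the leading coefficient requires the slope of the slice
  at \<open>ri\<close> to stay away from the null slope; convergence of \<open>h - rstar\<close>
  grants this at arbitrarily large radii, not necessarily at all of them. On the second slice no
  energy is computed: by Cauchy-Schwarz, the jump of the field across a thin shell bounds it below.
  Rays are labelled by a radius because the null coordinate \<open>u\<close> is infinite on the
  event horizon; the price is a proof that the flow of \<open>D d/dr\<close> is smooth at its
  degenerate fixed point \<open>m\<close>.\<close>

lemma Ck_on_subset: "Ck_on k T f \<Longrightarrow> S \<subseteq> T \<Longrightarrow> Ck_on k S f"
  by (induction k arbitrary: f) (auto intro: continuous_on_subset)

lemma Ck_on_cong:
  assumes "open S" "\<And>x. x \<in> S \<Longrightarrow> f x = g x" "Ck_on k S f"
  shows "Ck_on k S g"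
  using assms(2,3)
proof (induction k arbitrary: f g)
  case 0
  then show ?case by (metis Ck_on.simps(1) continuous_on_cong)
next
  case (Suc k)
  have d: "frechet_derivative f (at x) = frechet_derivative g (at x) \<and> g differentiable (at x)"
    if "x \<in> S" for x
  proof -
    have f: "f differentiable (at x)" using Suc.prems that by simp
    then have "(g has_derivative frechet_derivative f (at x)) (at x)"
      using has_derivative_transform_within_open[OF _ assms(1) that] Suc.prems(1)
      by (auto simp: frechet_derivative_works)
    then show ?thesis using frechet_derivative_at differentiable_def by blast
  qed
  have "Ck_on k S (\<lambda>x. frechet_derivative g (at x) b)" if "b \<in> Basis" for b
    by (rule Suc.IH[of "\<lambda>x. frechet_derivative f (at x) b"]) (use d Suc.prems that in auto)
  then show ?case using d by auto
qed

text \<open>Frees later smoothness proofs from \<open>frechet_derivative\<close>: by uniqueness of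
  derivatives on an open set, any explicitly computed derivative may stand in for it.\<close>

lemma Ck_on_SucI:
  assumes "open S" "\<And>x. x \<in> S \<Longrightarrow> (f has_derivative f' x) (at x)"
    "\<And>b. b \<in> Basis \<Longrightarrow> Ck_on k S (\<lambda>x. f' x b)"
  shows "Ck_on (Suc k) S f"
proof -
  have "frechet_derivative f (at x) = f' x" if "x \<in> S" for x
    using assms(2)[OF that] by (metis frechet_derivative_at)
  then have "Ck_on k S (\<lambda>x. frechet_derivative f (at x) b)" if "b \<in> Basis" for b
    using Ck_on_cong[OF assms(1) _ assms(3)[OF that]] by auto
  then show ?thesis using assms(2) by (auto simp: differentiable_def)
qed

text \<open>\<open>Ck_on\<close> asks for continuity only at the last order, so lowering the order
  rests on differentiability implying continuity.\<close>

lemma Ck_on_SucD: "Ck_on (Suc k) S f \<Longrightarrow> Ck_on k S f"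
proof (induction k arbitrary: f)
  case 0
  then show ?case
    by (auto intro!: continuous_at_imp_continuous_on differentiable_imp_continuous_within)
next
  case (Suc k)
  then show ?case by auto
qed

lemma Ck_on_const: "Ck_on k S (\<lambda>x. c)"
  by (induction k arbitrary: c) auto

lemma Ck_on_bounded_linear_compose:
  assumes "open S" "bounded_linear L" "Ck_on k S f"
  shows "Ck_on k S (\<lambda>x. L (f x))"
  using assms(3)
proof (induction k arbitrary: f)
  case 0
  then show ?case
    using bounded_linear.continuous_on[OF assms(2)] by auto
next
  case (Suc k)
  have "((\<lambda>x. L (f x)) has_derivative (\<lambda>h. L (frechet_derivative f (at x) h))) (at x)" if "x \<in> S" for x
    using Suc.prems that
    by (intro bounded_linear.has_derivative[OF assms(2)]) (auto simp: frechet_derivative_works)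
  then show ?case
    by (rule Ck_on_SucI[OF assms(1)]) (use Suc in auto)
qed

lemma Ck_on_bounded_linear:
  assumes "open S" "bounded_linear L"
  shows "Ck_on k S L"
proof (cases k)
  case 0
  then show ?thesis
    using bounded_linear.continuous_on[OF assms(2) continuous_on_id] by auto
next
  case (Suc j)
  have "Ck_on (Suc j) S L"
    by (rule Ck_on_SucI[OF assms(1) bounded_linear_imp_has_derivative[OF assms(2)]]) (rule Ck_on_const)
  then show ?thesis using Suc by simp
qed

lemma Ck_on_add:
  assumes "open S" "Ck_on k S f" "Ck_on k S g"
  shows "Ck_on k S (\<lambda>x. f x + g x)"
  using assms(2,3)
proof (induction k arbitrary: f g)
  case 0
  then show ?case by (auto intro: continuous_intros)
next
  case (Suc k)
  have "((\<lambda>x. f x + g x) has_derivative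
      (\<lambda>h. frechet_derivative f (at x) h + frechet_derivative g (at x) h)) (at x)" if "x \<in> S" for x
    using Suc.prems that by (intro has_derivative_add) (auto simp: frechet_derivative_works)
  then show ?case
    by (rule Ck_on_SucI[OF assms(1)]) (use Suc in auto)
qed

lemma Ck_on_sum:
  assumes "open S" "\<And>i. i \<in> I \<Longrightarrow> Ck_on k S (f i)"
  shows "Ck_on k S (\<lambda>x. \<Sum>i\<in>I. f i x)"
  using assms(2)
  by (induction I rule: infinite_finite_induct)
    (auto intro!: Ck_on_const Ck_on_add[OF assms(1)])

lemma Ck_on_bilinear:
  assumes "open S" "bounded_bilinear p" "Ck_on k S f" "Ck_on k S g"
  shows "Ck_on k S (\<lambda>x. p (f x) (g x))"
  using assms(3,4)
proof (induction k arbitrary: f g)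
  case 0
  then show ?case by (auto intro: bounded_bilinear.continuous_on[OF assms(2)])
next
  case (Suc k)
  have "((\<lambda>x. p (f x) (g x)) has_derivative
      (\<lambda>h. p (f x) (frechet_derivative g (at x) h) + p (frechet_derivative f (at x) h) (g x))) (at x)"
    if "x \<in> S" for x
    using Suc.prems that
    by (intro bounded_bilinear.FDERIV[OF assms(2)]) (auto simp: frechet_derivative_works)
  then show ?case
  proof (rule Ck_on_SucI[OF assms(1)])
    fix b :: 'a assume b: "b \<in> Basis"
    show "Ck_on k S (\<lambda>x. p (f x) (frechet_derivative g (at x) b) + p (frechet_derivative f (at x) b) (g x))"
      using Suc.prems b Suc.prems[THEN Ck_on_SucD]
      by (intro Ck_on_add assms(1) Suc.IH) auto
  qed
qed

text \<open>The derivative of \<open>g\<close> is expanded over the basis, which turns the chain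
  rule into a finite sum of products: partial derivatives of \<open>g\<close> composed with
  \<open>f\<close>, times components of the derivative of \<open>f\<close>. The induction therefore
  runs over all \<open>g\<close> with \<open>f\<close> fixed.\<close>

lemma Ck_on_compose:
  fixes f :: "'a::euclidean_space \<Rightarrow> 'b::euclidean_space" and g :: "'b \<Rightarrow> 'c::real_normed_vector"
  assumes "open S" "open T" "f ` S \<subseteq> T" "Ck_on k S f" "Ck_on k T g"
  shows "Ck_on k S (\<lambda>x. g (f x))"
  using assms(4,5)
proof (induction k arbitrary: g)
  case 0
  then show ?case using assms(3) by (auto intro: continuous_on_compose2)
next
  case (Suc k)
  let ?f' = "\<lambda>x. frechet_derivative f (at x)" and ?g' = "\<lambda>y. frechet_derivative g (at y)"
  have "((\<lambda>x. g (f x)) has_derivative (\<lambda>h. \<Sum>b\<in>Basis. (?f' x h \<bullet> b) *\<^sub>R ?g' (f x) b)) (at x)"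
    if "x \<in> S" for x
  proof -
    have df: "(f has_derivative ?f' x) (at x)" and dg: "(g has_derivative ?g' (f x)) (at (f x))"
      using Suc.prems that assms(3) by (auto simp: frechet_derivative_works)
    have lin: "linear (?g' (f x))"
      using dg by (simp add: has_derivative_linear)
    have "?g' (f x) (?f' x h) = (\<Sum>b\<in>Basis. (?f' x h \<bullet> b) *\<^sub>R ?g' (f x) b)" for h
    proof -
      have "?g' (f x) (?f' x h) = ?g' (f x) (\<Sum>b\<in>Basis. (?f' x h \<bullet> b) *\<^sub>R b)"
        by (simp only: euclidean_representation)
      then show ?thesis by (simp add: linear_sum[OF lin] linear_scale[OF lin])
    qed
    then show ?thesis
      using diff_chain_at[OF df dg] by (simp add: o_def)
  qed
  then show ?case
  proof (rule Ck_on_SucI[OF assms(1)])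
    fix b :: 'a assume b: "b \<in> Basis"
    show "Ck_on k S (\<lambda>x. \<Sum>c\<in>Basis. (?f' x b \<bullet> c) *\<^sub>R ?g' (f x) c)"
      using Suc.prems b Ck_on_SucD[OF Suc.prems(1)]
      by (intro Ck_on_sum assms(1) Ck_on_bilinear[OF _ bounded_bilinear_scaleR] Suc.IH
          Ck_on_bounded_linear_compose[OF _ bounded_linear_inner_left]) auto
  qed
qed

lemma Ck_on_Union:
  assumes "\<And>x. x \<in> S \<Longrightarrow> \<exists>T. open T \<and> x \<in> T \<and> Ck_on k T f"
  shows "Ck_on k S f"
  using assms
proof (induction k arbitrary: f)
  case 0
  then have "isCont f x" if "x \<in> S" for x
    using that by (metis Ck_on.simps(1) continuous_on_eq_continuous_at)
  then show ?case by (simp add: continuous_at_imp_continuous_on)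
next
  case (Suc k)
  have "Ck_on k S (\<lambda>x. frechet_derivative f (at x) b)" if "b \<in> Basis" for b
    by (rule Suc.IH) (use Suc.prems that in fastforce)
  then show ?case using Suc.prems by fastforce
qed

lemma smooth_on_subset: "smooth_on T f \<Longrightarrow> S \<subseteq> T \<Longrightarrow> smooth_on S f"
  unfolding smooth_on_def using Ck_on_subset by blast

lemma smooth_on_cong:
  "open S \<Longrightarrow> (\<And>x. x \<in> S \<Longrightarrow> f x = g x) \<Longrightarrow> smooth_on S f \<Longrightarrow> smooth_on S g"
  unfolding smooth_on_def using Ck_on_cong by blast

lemma smooth_on_local:
  "(\<And>x. x \<in> S \<Longrightarrow> \<exists>T. open T \<and> x \<in> T \<and> smooth_on T f) \<Longrightarrow> smooth_on S f"
  unfolding smooth_on_def by (meson Ck_on_Union)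

lemma smooth_on_const: "smooth_on S (\<lambda>x. c)"
  by (simp add: smooth_on_def Ck_on_const)

lemma smooth_on_bounded_linear: "open S \<Longrightarrow> bounded_linear L \<Longrightarrow> smooth_on S L"
  by (simp add: smooth_on_def Ck_on_bounded_linear)

lemma smooth_on_bounded_linear_compose:
  "open S \<Longrightarrow> bounded_linear L \<Longrightarrow> smooth_on S f \<Longrightarrow> smooth_on S (\<lambda>x. L (f x))"
  by (simp add: smooth_on_def Ck_on_bounded_linear_compose)

lemma smooth_on_ident: "open S \<Longrightarrow> smooth_on S (\<lambda>x. x)"
  by (rule smooth_on_bounded_linear) auto

lemma smooth_on_add: "open S \<Longrightarrow> smooth_on S f \<Longrightarrow> smooth_on S g \<Longrightarrow> smooth_on S (\<lambda>x. f x + g x)"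
  by (simp add: smooth_on_def Ck_on_add)

lemma smooth_on_bilinear:
  "open S \<Longrightarrow> bounded_bilinear p \<Longrightarrow> smooth_on S f \<Longrightarrow> smooth_on S g \<Longrightarrow> smooth_on S (\<lambda>x. p (f x) (g x))"
  by (simp add: smooth_on_def Ck_on_bilinear)

lemma smooth_on_mult:
  fixes f g :: "'a::euclidean_space \<Rightarrow> real"
  shows "open S \<Longrightarrow> smooth_on S f \<Longrightarrow> smooth_on S g \<Longrightarrow> smooth_on S (\<lambda>x. f x * g x)"
  by (rule smooth_on_bilinear[OF _ bounded_bilinear_mult])

lemma smooth_on_minus: "open S \<Longrightarrow> smooth_on S f \<Longrightarrow> smooth_on S (\<lambda>x. - f x)"
  by (rule smooth_on_bounded_linear_compose[where L = uminus]) (auto intro: bounded_linear_minus bounded_linear_ident)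

lemma smooth_on_diff: "open S \<Longrightarrow> smooth_on S f \<Longrightarrow> smooth_on S g \<Longrightarrow> smooth_on S (\<lambda>x. f x - g x)"
  using smooth_on_add[OF _ _ smooth_on_minus, of S f g] by simp

lemma smooth_on_power:
  fixes f :: "'a::euclidean_space \<Rightarrow> real"
  shows "open S \<Longrightarrow> smooth_on S f \<Longrightarrow> smooth_on S (\<lambda>x. f x ^ n)"
  by (induction n) (auto intro: smooth_on_const smooth_on_mult)

lemma smooth_on_compose:
  fixes f :: "'a::euclidean_space \<Rightarrow> 'b::euclidean_space"
  shows "open S \<Longrightarrow> open T \<Longrightarrow> f ` S \<subseteq> T \<Longrightarrow> smooth_on S f \<Longrightarrow> smooth_on T g \<Longrightarrow> smooth_on S (\<lambda>x. g (f x))"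
  unfolding smooth_on_def using Ck_on_compose by blast

lemma smooth_on_imp_continuous_on: "smooth_on S f \<Longrightarrow> continuous_on S f"
  unfolding smooth_on_def using Ck_on.simps(1) by blast

lemma smooth_on_differentiable: "smooth_on S f \<Longrightarrow> x \<in> S \<Longrightarrow> f differentiable (at x)"
  unfolding smooth_on_def using Ck_on.simps(2) by blast

lemma smooth_on_frechet: "smooth_on S f \<Longrightarrow> b \<in> Basis \<Longrightarrow> smooth_on S (\<lambda>x. frechet_derivative f (at x) b)"
  unfolding smooth_on_def using Ck_on.simps(2) by blast

lemma Ck_on_Pair:
  assumes "open S" "Ck_on k S f" "Ck_on k S g"
  shows "Ck_on k S (\<lambda>x. (f x, g x))"
proof -
  have "Ck_on k S (\<lambda>x. (f x, 0) + (0, g x))"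
    by (intro Ck_on_add assms Ck_on_bounded_linear_compose[where L = "\<lambda>y. (y, 0)"]
        Ck_on_bounded_linear_compose[where L = "\<lambda>y. (0, y)"] bounded_linear_intros)
  then show ?thesis by simp
qed

lemma smooth_on_Pair:
  "open S \<Longrightarrow> smooth_on S f \<Longrightarrow> smooth_on S g \<Longrightarrow> smooth_on S (\<lambda>x. (f x, g x))"
  by (simp add: smooth_on_def Ck_on_Pair)

lemma smooth_on_fst: "open S \<Longrightarrow> smooth_on S fst" and smooth_on_snd: "open S \<Longrightarrow> smooth_on S snd"
  by (rule smooth_on_bounded_linear, assumption, rule bounded_linear_fst,
      rule smooth_on_bounded_linear, assumption, rule bounded_linear_snd)

lemma Ck_on_real_SucI:
  fixes f :: "real \<Rightarrow> real"
  assumes "open S" "\<And>x. x \<in> S \<Longrightarrow> (f has_real_derivative f' x) (at x)" "Ck_on k S f'"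
  shows "Ck_on (Suc k) S f"
  by (rule Ck_on_SucI[OF assms(1), where f' = "\<lambda>x h. f' x * h"])
    (use assms(2,3) in \<open>auto simp: has_field_derivative_def\<close>)

lemma smooth_on_real_derivI:
  fixes f :: "real \<Rightarrow> real"
  assumes "open S" "\<And>x. x \<in> S \<Longrightarrow> (f has_real_derivative f' x) (at x)" "smooth_on S f'"
  shows "smooth_on S f"
  unfolding smooth_on_def
  using Ck_on_real_SucI[OF assms(1,2)] assms(3) Ck_on_SucD smooth_on_def by blast

lemma smooth_on_exp: "smooth_on S (exp :: real \<Rightarrow> real)"
proof -
  have "Ck_on k UNIV (exp :: real \<Rightarrow> real)" for k
  proof (induction k)
    case (Suc k)
    then show ?case by (intro Ck_on_real_SucI[of _ _ exp]) (auto intro: DERIV_exp)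
  qed (auto intro: continuous_intros)
  then have "smooth_on UNIV (exp :: real \<Rightarrow> real)" by (simp add: smooth_on_def)
  then show ?thesis by (rule smooth_on_subset) auto
qed

lemma smooth_on_inverse_real: "smooth_on (- {0}) (inverse :: real \<Rightarrow> real)"
proof -
  have "Ck_on k (- {0}) (inverse :: real \<Rightarrow> real)" for k
  proof (induction k)
    case 0
    show ?case by (auto intro!: continuous_intros)
  next
    case (Suc k)
    have "Ck_on k (- {0}) (\<lambda>x::real. - (inverse x * inverse x))"
      by (intro Ck_on_bounded_linear_compose[where L = uminus] Ck_on_bilinear[OF _ bounded_bilinear_mult] Suc)
        (auto intro: bounded_linear_minus bounded_linear_ident)
    then show ?case
      by (rule Ck_on_real_SucI[rotated 2]) (auto intro!: derivative_eq_intros simp: power2_eq_square)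
  qed
  then show ?thesis by (simp add: smooth_on_def)
qed

lemma smooth_on_divide:
  fixes f g :: "'a::euclidean_space \<Rightarrow> real"
  assumes "open S" "smooth_on S f" "smooth_on S g" "\<And>x. x \<in> S \<Longrightarrow> g x \<noteq> 0"
  shows "smooth_on S (\<lambda>x. f x / g x)"
proof -
  have "smooth_on S (\<lambda>x. inverse (g x))"
    by (rule smooth_on_compose[OF _ _ _ _ smooth_on_inverse_real]) (use assms in auto)
  then show ?thesis
    using smooth_on_mult[OF assms(1,2)] by (simp add: divide_inverse)
qed

lemma smooth_on_ln: "smooth_on {0<..} (ln :: real \<Rightarrow> real)"
  by (rule smooth_on_real_derivI[where f' = inverse])
    (auto intro: DERIV_ln smooth_on_subset[OF smooth_on_inverse_real])

lemma smooth_on_sqrt: "smooth_on {0<..} sqrt"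
proof -
  have "smooth_on {0<..} (\<lambda>x::real. exp (ln x / 2))"
    by (intro smooth_on_compose[OF _ _ _ _ smooth_on_exp, of _ UNIV] smooth_on_divide smooth_on_ln smooth_on_const) auto
  then show ?thesis
    by (rule smooth_on_cong[rotated 2]) (auto simp: powr_half_sqrt[symmetric] powr_def)
qed

section \<open>Functions of two real variables and their partial derivatives\<close>

definition fpair :: "real \<Rightarrow> real \<Rightarrow> real \<times> real \<Rightarrow> real" where
  "fpair a b = (\<lambda>h. a * fst h + b * snd h)"

lemma Basis_real_prod: "(Basis :: (real \<times> real) set) = {(1, 0), (0, 1)}"
  by (auto simp: Basis_prod_def)

lemma Ck_on_fpair:
  assumes "open S" "\<And>p. p \<in> S \<Longrightarrow> (f has_derivative fpair (fx p) (fy p)) (at p)"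
    "Ck_on k S fx" "Ck_on k S fy"
  shows "Ck_on (Suc k) S f"
  by (rule Ck_on_SucI[OF assms(1,2)]) (use assms(3,4) in \<open>auto simp: Basis_real_prod fpair_def\<close>)

definition pd1 :: "(real \<times> real \<Rightarrow> real) \<Rightarrow> real \<times> real \<Rightarrow> real" where
  "pd1 f p = frechet_derivative f (at p) (1, 0)"

definition pd2 :: "(real \<times> real \<Rightarrow> real) \<Rightarrow> real \<times> real \<Rightarrow> real" where
  "pd2 f p = frechet_derivative f (at p) (0, 1)"

lemma pd_eq:
  assumes "(f has_derivative fpair a b) (at p)"
  shows "pd1 f p = a" "pd2 f p = b"
  using frechet_derivative_at[OF assms, symmetric] by (auto simp: pd1_def pd2_def fpair_def)

lemma has_derivative_pd:
  assumes "f differentiable (at p)"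
  shows "(f has_derivative fpair (pd1 f p) (pd2 f p)) (at p)"
proof -
  let ?L = "frechet_derivative f (at p)"
  have d: "(f has_derivative ?L) (at p)" using assms by (simp add: frechet_derivative_works)
  then have lin: "linear ?L" by (simp add: has_derivative_linear)
  have "?L h = fpair (pd1 f p) (pd2 f p) h" for h
  proof -
    have "?L h = ?L (fst h *\<^sub>R (1, 0) + snd h *\<^sub>R (0, 1))" by simp
    also have "\<dots> = fst h *\<^sub>R ?L (1, 0) + snd h *\<^sub>R ?L (0, 1)"
      by (simp only: linear_add[OF lin] linear_scale[OF lin])
    finally have "?L h = fst h *\<^sub>R ?L (1, 0) + snd h *\<^sub>R ?L (0, 1)" .
    then show ?thesis by (simp add: fpair_def pd1_def pd2_def)
  qed
  then show ?thesis using d by (metis ext)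
qed

lemma smooth_on_pd:
  assumes "smooth_on S f"
  shows "smooth_on S (pd1 f)" "smooth_on S (pd2 f)"
  using smooth_on_frechet[OF assms] by (auto simp: pd1_def[abs_def] pd2_def[abs_def] Basis_real_prod)

lemma smooth_on_has_derivative_pd:
  "smooth_on S f \<Longrightarrow> p \<in> S \<Longrightarrow> (f has_derivative fpair (pd1 f p) (pd2 f p)) (at p)"
  by (intro has_derivative_pd smooth_on_differentiable)

lemma has_real_derivative_fpair_compose:
  assumes "(f has_derivative fpair a b) (at (g t, h t))"
    "(g has_real_derivative g') (at t within T)" "(h has_real_derivative h') (at t within T)"
  shows "((\<lambda>t. f (g t, h t)) has_real_derivative a * g' + b * h') (at t within T)"
proof -
  have "((\<lambda>t. (g t, h t)) has_derivative (\<lambda>y. (g' * y, h' * y))) (at t within T)"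
    using assms(2,3) by (intro has_derivative_Pair) (auto simp: has_field_derivative_def)
  from has_derivative_compose[OF this assms(1)] show ?thesis
    unfolding has_field_derivative_def
    by (rule has_derivative_eq_rhs) (auto simp: fpair_def algebra_simps)
qed

text \<open>One continuous partial derivative suffices for total differentiability; the other need
  only exist. The integral operators and the function \<open>H\<close> below get their total
  derivatives this way from one-variable calculus.\<close>

lemma has_derivative_fpairI:
  assumes "open S" "p \<in> S"
    and 1: "\<And>x y. (x, y) \<in> S \<Longrightarrow> ((\<lambda>x. f (x, y)) has_real_derivative fx (x, y)) (at x)"
    and 2: "\<And>x y. (x, y) \<in> S \<Longrightarrow> ((\<lambda>y. f (x, y)) has_real_derivative fy (x, y)) (at y)"
    and c: "continuous_on S fy"
  shows "(f has_derivative fpair (fx p) (fy p)) (at p)"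
proof -
  obtain x y where p: "p = (x, y)" by (cases p)
  obtain A B where AB: "open A" "open B" "x \<in> A" "y \<in> B" "A \<times> B \<subseteq> S"
    using assms(1,2) p open_prod_elim by (metis mem_Sigma_iff)
  obtain e where e: "e > 0" "ball y e \<subseteq> B" using AB open_contains_ball by blast
  let ?Y = "ball y e"
  let ?fy = "\<lambda>x y. blinfun_scaleR_left (fy (x, y))"
  have sub: "A \<times> ?Y \<subseteq> S" using AB e by auto
  have cc: "continuous_on (A \<times> ?Y) (\<lambda>(x, y). ?fy x y)"
    unfolding case_prod_unfold prod.collapse
    by (intro continuous_intros continuous_on_subset[OF c sub])
  have "((\<lambda>(x, y). f (x, y)) has_derivative (\<lambda>(tx, ty). (\<lambda>h. fx (x, y) * h) tx + blinfun_apply (?fy x y) ty))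
      (at (x, y) within A \<times> ?Y)"
  proof (rule has_derivative_partialsI)
    show "((\<lambda>x. f (x, y)) has_derivative (*) (fx (x, y))) (at x within A)"
      using 1[of x y] assms(2) p by (auto simp: has_field_derivative_def intro: has_derivative_at_withinI)
    show "((\<lambda>y. f (x', y)) has_derivative blinfun_apply (?fy x' y')) (at y' within ?Y)"
      if "x' \<in> A" "y' \<in> ?Y" for x' y'
    proof -
      have "(x', y') \<in> S" using that sub by auto
      then have "((\<lambda>y. f (x', y)) has_derivative (*) (fy (x', y'))) (at y')"
        using 2 by (auto simp: has_field_derivative_def)
      then have "((\<lambda>y. f (x', y)) has_derivative blinfun_apply (?fy x' y')) (at y')"
        by (rule has_derivative_eq_rhs) auto
      then show ?thesis by (rule has_derivative_at_withinI)
    qed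
    show "continuous (at (x, y) within A \<times> ?Y) (\<lambda>(x, y). ?fy x y)"
      by (rule cc[unfolded continuous_on_eq_continuous_within, rule_format]) (use AB e in auto)
  qed (use e in auto)
  then have "((\<lambda>(x, y). f (x, y)) has_derivative fpair (fx p) (fy p)) (at (x, y) within A \<times> ?Y)"
    by (rule has_derivative_eq_rhs) (auto simp: fpair_def p)
  then have "(f has_derivative fpair (fx p) (fy p)) (at p within A \<times> ?Y)"
    by (simp add: p)
  moreover have "at p within A \<times> ?Y = at p"
    using AB e p by (intro at_within_open) (auto intro: open_Times)
  ultimately show ?thesis by simp
qed

section \<open>The Goursat problem\<close>

text \<open>Integrals from a base point, rescaled to \<open>[0, 1]\<close> so that both directions are treated alike.\<close>

definition I1 :: "real \<Rightarrow> (real \<times> real \<Rightarrow> real) \<Rightarrow> real \<times> real \<Rightarrow> real" where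
  "I1 a f p = (fst p - a) * integral {0..1} (\<lambda>\<theta>. f (a + \<theta> * (fst p - a), snd p))"

definition I2 :: "real \<Rightarrow> (real \<times> real \<Rightarrow> real) \<Rightarrow> real \<times> real \<Rightarrow> real" where
  "I2 b f p = (snd p - b) * integral {0..1} (\<lambda>\<theta>. f (fst p, b + \<theta> * (snd p - b)))"

lemma I2_swap: "I2 b f p = I1 b (\<lambda>q. f (prod.swap q)) (prod.swap p)"
  by (simp add: I1_def I2_def)

lemma convex_segment_real:
  fixes a :: real
  assumes "convex A" "a \<in> A" "x \<in> A" "0 \<le> \<theta>" "\<theta> \<le> 1"
  shows "a + \<theta> * (x - a) \<in> A"
  using convexD_alt[OF assms] by (simp add: algebra_simps)

lemma continuous_on_segment:
  fixes f :: "real \<times> real \<Rightarrow> real"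
  assumes "continuous_on (A \<times> B) f" "convex A" "a \<in> A"
  shows "continuous_on ((A \<times> B) \<times> {0..1}) (\<lambda>(p, \<theta>). f (a + \<theta> * (fst p - a), snd p))"
proof -
  have "continuous_on ((A \<times> B) \<times> {0..1}) (\<lambda>x. f (a + snd x * (fst (fst x) - a), snd (fst x)))"
    by (rule continuous_on_compose2[OF assms(1)])
      (auto intro!: continuous_intros convex_segment_real assms)
  then show ?thesis by (simp add: case_prod_unfold)
qed

lemma I1_continuous:
  assumes "continuous_on (A \<times> B) f" "convex A" "a \<in> A"
  shows "continuous_on (A \<times> B) (I1 a f)"
proof -
  have "continuous_on (A \<times> B) (\<lambda>p. integral (cbox 0 1) (\<lambda>\<theta>. f (a + \<theta> * (fst p - a), snd p)))"
    by (rule integral_continuous_on_param) (use continuous_on_segment[OF assms] in auto)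
  then show ?thesis
    unfolding I1_def[abs_def] by (auto intro!: continuous_intros)
qed

lemma I1_integrable:
  fixes f :: "real \<times> real \<Rightarrow> real"
  assumes "continuous_on (A \<times> B) f" "convex A" "a \<in> A" "p \<in> A \<times> B"
  shows "(\<lambda>\<theta>. f (a + \<theta> * (fst p - a), snd p)) integrable_on {0..1}"
proof (rule integrable_continuous_interval)
  show "continuous_on {0..1} (\<lambda>\<theta>. f (a + \<theta> * (fst p - a), snd p))"
    by (rule continuous_on_compose2[OF assms(1)])
      (use assms in \<open>auto intro!: continuous_intros convex_segment_real\<close>)
qed

text \<open>By substitution the rescaled integral is a difference of two values of one
  antiderivative along the line. The antiderivative is taken on a compact interval that contains
  both the base point and a neighbourhood of \<open>x\<close>, so it does not matter on which side
  of \<open>a\<close> the point lies.\<close>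

lemma I1_deriv1:
  assumes f: "continuous_on (A \<times> B) f" and A: "convex A" "open A" "a \<in> A" and p: "x \<in> A" "y \<in> B"
  shows "((\<lambda>x. I1 a f (x, y)) has_real_derivative f (x, y)) (at x)"
proof -
  obtain e where e: "e > 0" "cball x e \<subseteq> A" using A(2) p(1) open_contains_cball by blast
  define c d where "c = min a (x - e)" and "d = max a (x + e)"
  have cd: "c \<in> A" "d \<in> A" using e A(3) by (auto simp: c_def d_def min_def max_def cball_def dist_real_def)
  have "is_interval A" using A(1) by (simp add: is_interval_convex_1)
  then have sub: "{c..d} \<subseteq> A" using cd by (meson atLeastAtMost_iff mem_is_interval_1_I subsetI)
  have "continuous_on {c..d} (\<lambda>x. f (x, y))"
    by (rule continuous_on_compose2[OF f]) (use sub p in \<open>auto intro!: continuous_intros\<close>)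
  from antiderivative_continuous[OF this] obtain G
    where G: "\<And>x. x \<in> {c..d} \<Longrightarrow> (G has_vector_derivative f (x, y)) (at x within {c..d})" by blast
  have xc: "x' \<in> {c..d}" if "x' \<in> ball x e" for x'
    using that by (auto simp: c_def d_def dist_real_def)
  have eq: "I1 a f (x', y) = G x' - G a" if x': "x' \<in> ball x e" for x'
  proof -
    have seg: "a + \<theta> * (x' - a) \<in> {c..d}" if "\<theta> \<in> {0..1}" for \<theta>
      by (rule convex_segment_real) (use that xc[OF x'] in \<open>auto simp: c_def d_def\<close>)
    have "((\<lambda>\<theta>. G (a + \<theta> * (x' - a))) has_vector_derivative ((x' - a) * f (a + \<theta> * (x' - a), y))) (at \<theta> within {0..1})"
      if "\<theta> \<in> {0..1}" for \<theta>
    proof -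
      have "((\<lambda>\<theta>. a + \<theta> * (x' - a)) has_vector_derivative (x' - a)) (at \<theta> within {0..1})"
        by (auto intro!: derivative_eq_intros simp: has_real_derivative_iff_has_vector_derivative[symmetric])
      from vector_diff_chain_within[OF this
          has_vector_derivative_within_subset[OF G[OF seg[OF that]] image_subsetI[OF seg]]]
      show ?thesis by (simp add: o_def)
    qed
    from fundamental_theorem_of_calculus[OF _ this]
    have "((\<lambda>\<theta>. (x' - a) * f (a + \<theta> * (x' - a), y)) has_integral (G x' - G a)) {0..1}" by simp
    then have "integral {0..1} (\<lambda>\<theta>. (x' - a) * f (a + \<theta> * (x' - a), y)) = G x' - G a"
      by (rule integral_unique)
    then show ?thesis by (simp add: I1_def)
  qed
  have "(G has_real_derivative f (x, y)) (at x within {c..d})"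
    using G[of x] xc[of x] e by (simp add: has_real_derivative_iff_has_vector_derivative)
  then have "(G has_real_derivative f (x, y)) (at x)"
    using at_within_interior[of x "{c..d}"] e
    by (simp add: c_def d_def min_less_iff_disj less_max_iff_disj)
  then have "((\<lambda>x. G x - G a) has_real_derivative f (x, y)) (at x)"
    by (auto intro!: derivative_eq_intros)
  then show ?thesis
    by (rule has_field_derivative_transform_within_open[where S = "ball x e"]) (use e eq in auto)
qed

lemma I1_deriv2:
  assumes f: "continuous_on (A \<times> B) f" and f2: "continuous_on (A \<times> B) f2"
    and A: "convex A" "a \<in> A" and B: "convex B" "open B" and p: "x \<in> A" "y \<in> B"
    and d: "\<And>x y. x \<in> A \<Longrightarrow> y \<in> B \<Longrightarrow> ((\<lambda>y. f (x, y)) has_real_derivative f2 (x, y)) (at y)"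
  shows "((\<lambda>y. I1 a f (x, y)) has_real_derivative I1 a f2 (x, y)) (at y)"
proof -
  have "((\<lambda>y. integral (cbox 0 1) (\<lambda>\<theta>. f (a + \<theta> * (x - a), y))) has_field_derivative
      integral (cbox 0 1) (\<lambda>\<theta>. f2 (a + \<theta> * (x - a), y))) (at y within B)"
  proof (rule leibniz_rule_field_derivative)
    show "((\<lambda>y. f (a + \<theta> * (x - a), y)) has_real_derivative f2 (a + \<theta> * (x - a), y')) (at y' within B)"
      if "y' \<in> B" "\<theta> \<in> cbox 0 1" for y' \<theta>
      using d[OF convex_segment_real[OF A p(1)] that(1)] that(2)
      by (auto intro: has_field_derivative_at_within)
    show "(\<lambda>\<theta>. f (a + \<theta> * (x - a), y')) integrable_on cbox 0 1" if "y' \<in> B" for y'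
      using I1_integrable[OF f A, of "(x, y')"] p that by simp
    have "continuous_on (B \<times> cbox 0 1) (\<lambda>z. f2 (a + snd z * (x - a), fst z))"
    proof (rule continuous_on_compose2[OF f2])
      show "continuous_on (B \<times> cbox 0 1) (\<lambda>z. (a + snd z * (x - a), fst z))"
        by (intro continuous_on_Pair continuous_on_add continuous_on_mult continuous_on_const
            continuous_on_fst continuous_on_snd continuous_on_id)
      show "(\<lambda>z. (a + snd z * (x - a), fst z)) ` (B \<times> cbox 0 1) \<subseteq> A \<times> B"
        by (intro image_subsetI, clarsimp, rule convex_segment_real[OF A p(1)]) auto
    qed
    then show "continuous_on (B \<times> cbox 0 1) (\<lambda>(y, \<theta>). f2 (a + \<theta> * (x - a), y))"
      by (simp add: case_prod_unfold)
  qed (use B p in auto)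
  then have "((\<lambda>y. integral {0..1} (\<lambda>\<theta>. f (a + \<theta> * (x - a), y))) has_field_derivative
      integral {0..1} (\<lambda>\<theta>. f2 (a + \<theta> * (x - a), y))) (at y)"
    by (simp only: at_within_open[OF p(2) B(2)] cbox_interval)
  from DERIV_cmult[OF this, of "x - a"] show ?thesis by (simp add: I1_def)
qed

text \<open>The partial derivatives of \<open>I1 a f\<close> are \<open>f\<close> and
  \<open>I1 a (pd2 f)\<close>. The first is covered by hypothesis, the second by induction, because
  \<open>pd2 f\<close> has one order less.\<close>

lemma I1_Ck:
  assumes A: "convex A" "open A" "a \<in> A" and B: "convex B" "open B" and f: "Ck_on k (A \<times> B) f"
  shows "Ck_on k (A \<times> B) (I1 a f)"
  using f
proof (induction k arbitrary: f)
  case 0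
  then show ?case using I1_continuous A by simp
next
  case (Suc k)
  have o: "open (A \<times> B)" using A B by (simp add: open_Times)
  have Cf: "Ck_on k (A \<times> B) f" by (rule Ck_on_SucD[OF Suc.prems])
  have C2: "Ck_on k (A \<times> B) (pd2 f)"
    using Suc.prems by (simp add: pd2_def[abs_def] Basis_real_prod)
  have cont: "Ck_on k S g \<Longrightarrow> continuous_on S g" for S and g :: "real \<times> real \<Rightarrow> real"
    by (induction k arbitrary: g) (use Ck_on_SucD in auto)
  have d: "((\<lambda>y. f (x, y)) has_real_derivative pd2 f (x, y)) (at y)" if "x \<in> A" "y \<in> B" for x y
  proof -
    have "(f has_derivative fpair (pd1 f (x, y)) (pd2 f (x, y))) (at (x, y))"
      using Suc.prems that by (intro has_derivative_pd) auto
    from has_real_derivative_fpair_compose[where f = f and g = "\<lambda>_. x" and h = "\<lambda>y. y" and t = y, OF this, of 0 UNIV 1] show ?thesis by simp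
  qed
  show ?case
  proof (rule Ck_on_fpair[OF o])
    show "(I1 a f has_derivative fpair (f p) (I1 a (pd2 f) p)) (at p)" if "p \<in> A \<times> B" for p
    proof (rule has_derivative_fpairI[OF o that])
      show "continuous_on (A \<times> B) (I1 a (pd2 f))"
        by (rule I1_continuous[OF cont[OF C2] A(1,3)])
    qed (auto intro!: I1_deriv1[OF cont[OF Cf] A] I1_deriv2[OF cont[OF Cf] cont[OF C2] A(1,3) B] d)
    show "Ck_on k (A \<times> B) (I1 a (pd2 f))" by (rule Suc.IH[OF C2])
  qed (rule Cf)
qed

lemma bounded_linear_swap: "bounded_linear (prod.swap :: real \<times> real \<Rightarrow> real \<times> real)"
proof -
  have "(prod.swap :: real \<times> real \<Rightarrow> real \<times> real) = (\<lambda>p. (snd p, fst p))" by auto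
  moreover have "bounded_linear (\<lambda>p :: real \<times> real. (snd p, fst p))"
    by (intro bounded_linear_Pair bounded_linear_fst bounded_linear_snd)
  ultimately show ?thesis by (simp only:)
qed

lemma Ck_on_swap:
  fixes f :: "real \<times> real \<Rightarrow> real"
  assumes "open A" "open B" "Ck_on k (A \<times> B) f"
  shows "Ck_on k (B \<times> A) (\<lambda>q. f (prod.swap q))"
  by (rule Ck_on_compose[OF _ _ _ Ck_on_bounded_linear[OF _ bounded_linear_swap] assms(3)])
    (use assms in \<open>auto intro: open_Times\<close>)

lemma continuous_on_swap: 
  fixes f :: "real \<times> real \<Rightarrow> real"
  assumes "continuous_on (A \<times> B) f" 
  shows "continuous_on (B \<times> A) (\<lambda>q. f (prod.swap q))"
  by (rule continuous_on_compose2[OF assms bounded_linear.continuous_on[OF bounded_linear_swap continuous_on_id]]) auto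

lemma I2_continuous:
  assumes "continuous_on (A \<times> B) f" "convex B" "b \<in> B"
  shows "continuous_on (A \<times> B) (I2 b f)"
  using continuous_on_swap[OF I1_continuous[OF continuous_on_swap[OF assms(1)] assms(2,3)]]
  by (simp add: I2_swap[abs_def])

lemma I2_integrable:
  fixes f :: "real \<times> real \<Rightarrow> real"
  assumes "continuous_on (A \<times> B) f" "convex B" "b \<in> B" "p \<in> A \<times> B"
  shows "(\<lambda>\<theta>. f (fst p, b + \<theta> * (snd p - b))) integrable_on {0..1}"
  using I1_integrable[OF continuous_on_swap[OF assms(1)] assms(2,3), of "prod.swap p"] assms(4) by auto

lemma I2_deriv2:
  assumes "continuous_on (A \<times> B) f" "convex B" "open B" "b \<in> B" "x \<in> A" "y \<in> B"
  shows "((\<lambda>y. I2 b f (x, y)) has_real_derivative f (x, y)) (at y)"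
  using I1_deriv1[OF continuous_on_swap[OF assms(1)] assms(2,3,4) assms(6,5)] by (simp add: I2_swap)

lemma I2_Ck:
  assumes "convex A" "open A" "convex B" "open B" "b \<in> B" "Ck_on k (A \<times> B) f"
  shows "Ck_on k (A \<times> B) (I2 b f)"
proof -
  have "Ck_on k (B \<times> A) (I1 b (\<lambda>q. f (prod.swap q)))"
    by (intro I1_Ck assms Ck_on_swap)
  from Ck_on_swap[OF assms(4,2) this] show ?thesis by (simp add: I2_swap[abs_def])
qed

section \<open>Picard iteration for the characteristic initial value problem\<close>

lemma exp_integral_bound:
  fixes \<kappa> x :: real
  assumes "\<kappa> > 0" "x \<ge> 0"
  shows "x * integral {0..1} (\<lambda>\<theta>. exp (\<kappa> * (\<theta> * x))) \<le> exp (\<kappa> * x) / \<kappa>"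
proof -
  have "((\<lambda>\<theta>. exp (\<kappa> * (\<theta> * x)) / \<kappa>) has_vector_derivative (x * exp (\<kappa> * (\<theta> * x)))) (at \<theta> within {0..1})" for \<theta>
    unfolding has_real_derivative_iff_has_vector_derivative[symmetric]
    using assms by (auto intro!: derivative_eq_intros simp: field_simps)
  from fundamental_theorem_of_calculus[OF zero_le_one this]
  have "((\<lambda>\<theta>. x * exp (\<kappa> * (\<theta> * x))) has_integral (exp (\<kappa> * x) / \<kappa> - 1 / \<kappa>)) {0..1}"
    by simp
  from integral_unique[OF this] show ?thesis using assms by simp
qed

locale goursat =
  fixes A B :: "real set" and a b :: real and c t0 :: "real \<times> real \<Rightarrow> real"
  assumes A: "convex A" "open A" "a \<in> A" and B: "convex B" "open B" "b \<in> B"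
    and c: "smooth_on (A \<times> B) c" and t0: "smooth_on (A \<times> B) t0"
begin

text \<open>\<open>T f\<close> has mixed derivative \<open>c * f\<close> and vanishes on both
  characteristic lines through \<open>(a, b)\<close>. The series \<open>sol\<close> solves
  \<open>u = t0 + T u\<close>: it agrees with \<open>t0\<close> on these lines, and its mixed
  derivative is that of \<open>t0\<close> plus \<open>c * u\<close>. Thus \<open>t0\<close> encodes
  the data and the source at once.\<close>

definition T :: "(real \<times> real \<Rightarrow> real) \<Rightarrow> real \<times> real \<Rightarrow> real" where
  "T f = I1 a (I2 b (\<lambda>q. c q * f q))"

definition t :: "nat \<Rightarrow> real \<times> real \<Rightarrow> real" where
  "t n = (T ^^ n) t0"

definition sol :: "real \<times> real \<Rightarrow> real" where
  "sol p = (\<Sum>n. t n p)"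

lemma opn: "open (A \<times> B)" using A B by (simp add: open_Times)

lemma cont_c: "continuous_on (A \<times> B) c" and cont_t0: "continuous_on (A \<times> B) t0"
  using c t0 by (auto intro: smooth_on_imp_continuous_on)

lemma cont_T: "continuous_on (A \<times> B) f \<Longrightarrow> continuous_on (A \<times> B) (T f)"
  unfolding T_def by (intro I1_continuous I2_continuous continuous_intros cont_c A B)

lemma cont_t: "continuous_on (A \<times> B) (t n)"
  by (induction n) (auto simp: t_def cont_t0 intro: cont_T)

lemma I1_bound:
  assumes f: "continuous_on (A \<times> B) f" and p: "x \<in> A" "y \<in> B"
    and K: "\<And>\<theta>. \<theta> \<in> {0..1} \<Longrightarrow> \<bar>f (a + \<theta> * (x - a), y)\<bar> \<le> K"
  shows "\<bar>I1 a f (x, y)\<bar> \<le> \<bar>x - a\<bar> * K"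
proof -
  have "norm (integral {0..1} (\<lambda>\<theta>. f (a + \<theta> * (x - a), y))) \<le> integral {0..1} (\<lambda>_::real. K)"
    by (rule integral_norm_bound_integral) (use I1_integrable[OF f A(1,3), of "(x, y)"] p K in auto)
  then show ?thesis by (simp add: I1_def abs_mult mult_left_mono)
qed

lemma I2_bound:
  assumes f: "continuous_on (A \<times> B) f" and p: "x \<in> A" "y \<in> B"
    and K: "\<And>\<theta>. \<theta> \<in> {0..1} \<Longrightarrow> \<bar>f (x, b + \<theta> * (y - b))\<bar> \<le> K"
  shows "\<bar>I2 b f (x, y)\<bar> \<le> \<bar>y - b\<bar> * K"
proof -
  have "norm (integral {0..1} (\<lambda>\<theta>. f (x, b + \<theta> * (y - b)))) \<le> integral {0..1} (\<lambda>_::real. K)"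
    by (rule integral_norm_bound_integral) (use I2_integrable[OF f B(1,3), of "(x, y)"] p K in auto)
  then show ?thesis by (simp add: I2_def abs_mult mult_left_mono)
qed

text \<open>In the weight \<open>exp (\<kappa> * \<bar>y - b\<bar>)\<close> an integration in the
  second variable gains a factor \<open>1 / \<kappa>\<close>, however long the interval.\<close>

lemma I2_bound_exp:
  assumes f: "continuous_on (A \<times> B) f" and p: "x \<in> A" "y \<in> B" and "\<kappa> > 0" "K \<ge> 0"
    and K: "\<And>\<theta>. \<theta> \<in> {0..1} \<Longrightarrow> \<bar>f (x, b + \<theta> * (y - b))\<bar> \<le> K * exp (\<kappa> * \<bar>\<theta> * (y - b)\<bar>)"
  shows "\<bar>I2 b f (x, y)\<bar> \<le> K * exp (\<kappa> * \<bar>y - b\<bar>) / \<kappa>"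
proof -
  have "norm (integral {0..1} (\<lambda>\<theta>. f (x, b + \<theta> * (y - b)))) \<le> integral {0..1} (\<lambda>\<theta>. K * exp (\<kappa> * (\<theta> * \<bar>y - b\<bar>)))"
  proof (rule integral_norm_bound_integral)
    show "(\<lambda>\<theta>. K * exp (\<kappa> * (\<theta> * \<bar>y - b\<bar>))) integrable_on {0..1}"
      by (intro integrable_continuous_interval continuous_intros)
  qed (use I2_integrable[OF f B(1,3), of "(x, y)"] p K in \<open>auto simp: abs_mult\<close>)
  then have "\<bar>I2 b f (x, y)\<bar> \<le> \<bar>y - b\<bar> * integral {0..1} (\<lambda>\<theta>. K * exp (\<kappa> * (\<theta> * \<bar>y - b\<bar>)))"
    by (simp add: I2_def abs_mult mult_left_mono)
  also have "\<dots> = K * (\<bar>y - b\<bar> * integral {0..1} (\<lambda>\<theta>. exp (\<kappa> * (\<theta> * \<bar>y - b\<bar>))))" by simp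
  also have "\<dots> \<le> K * (exp (\<kappa> * \<bar>y - b\<bar>) / \<kappa>)"
    using exp_integral_bound[of \<kappa> "\<bar>y - b\<bar>"] assms by (intro mult_left_mono) auto
  finally show ?thesis by simp
qed

definition box_ok :: "real set \<Rightarrow> real set \<Rightarrow> real \<Rightarrow> real \<Rightarrow> bool" where
  "box_ok X Y M L \<longleftrightarrow> convex X \<and> convex Y \<and> a \<in> X \<and> b \<in> Y \<and> X \<subseteq> A \<and> Y \<subseteq> B \<and> M > 0 \<and> L > 0 \<and>
     (\<forall>p\<in>X \<times> Y. \<bar>c p\<bar> \<le> M) \<and> (\<forall>x\<in>X. \<bar>x - a\<bar> \<le> L)"

text \<open>With \<kappa> = \<open>2 * M * L\<close> one application of \<open>T\<close> costs the
  factor \<open>L * M / \<kappa> = 1 / 2\<close>. The series is therefore geometric on boxes of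
  every size, and solutions need not be continued from small domains.\<close>

lemma t_bound:
  assumes Q: "box_ok X Y M L" and K: "\<And>p. p \<in> X \<times> Y \<Longrightarrow> \<bar>t0 p\<bar> \<le> K"
    and p: "x \<in> X" "y \<in> Y"
  shows "\<bar>t n (x, y)\<bar> \<le> K * (1/2) ^ n * exp (2 * M * L * \<bar>y - b\<bar>)"
  using p
proof (induction n arbitrary: x y)
  case 0
  have "K \<ge> 0" using K[of "(x, y)"] 0 by force
  moreover have "1 \<le> exp (2 * M * L * \<bar>y - b\<bar>)" using Q by (simp add: box_ok_def)
  ultimately show ?case using K[of "(x, y)"] 0 mult_left_mono[of 1 "exp (2 * M * L * \<bar>y - b\<bar>)" K]
    by (auto simp: t_def)
next
  case (Suc n)
  let ?\<kappa> = "2 * M * L"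
  have K0: "K \<ge> 0" using K[of "(x, y)"] Suc.prems by force
  have mL: "M > 0" "L > 0" "X \<subseteq> A" "Y \<subseteq> B" "convex X" "convex Y" "a \<in> X" "b \<in> Y" using Q by (auto simp: box_ok_def)
  have cf: "continuous_on (A \<times> B) (\<lambda>q. c q * t n q)" by (intro continuous_intros cont_c cont_t)
  have 1: "\<bar>I2 b (\<lambda>q. c q * t n q) (x', y)\<bar> \<le> (M * (K * (1/2) ^ n)) * exp (?\<kappa> * \<bar>y - b\<bar>) / ?\<kappa>"
    if x': "x' \<in> X" for x'
  proof (rule I2_bound_exp[OF cf])
    fix \<theta> :: real assume th: "\<theta> \<in> {0..1}"
    have y': "b + \<theta> * (y - b) \<in> Y" using convex_segment_real[of Y b y \<theta>] th Suc.prems mL by auto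
    have "\<bar>c (x', b + \<theta> * (y - b)) * t n (x', b + \<theta> * (y - b))\<bar>
        \<le> M * (K * (1/2) ^ n * exp (?\<kappa> * \<bar>b + \<theta> * (y - b) - b\<bar>))"
      unfolding abs_mult using Q x' y' Suc.IH[OF x' y'] K0 mL
      by (intro mult_mono) (auto simp: box_ok_def)
    then show "\<bar>c (x', b + \<theta> * (y - b)) * t n (x', b + \<theta> * (y - b))\<bar>
        \<le> M * (K * (1/2) ^ n) * exp (?\<kappa> * \<bar>\<theta> * (y - b)\<bar>)" by (simp add: mult.assoc)
  qed (use mL x' Suc.prems K0 in auto)
  have "\<bar>T (t n) (x, y)\<bar> \<le> \<bar>x - a\<bar> * ((M * (K * (1/2) ^ n)) * exp (?\<kappa> * \<bar>y - b\<bar>) / ?\<kappa>)"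
    unfolding T_def
    by (rule I1_bound[OF I2_continuous[OF cf B(1,3)]])
      (use mL Suc.prems 1 convex_segment_real[of X a x] in auto)
  also have "\<dots> \<le> L * ((M * (K * (1/2) ^ n)) * exp (?\<kappa> * \<bar>y - b\<bar>) / ?\<kappa>)"
    using Q Suc.prems K0 mL by (intro mult_right_mono) (auto simp: box_ok_def)
  also have "\<dots> = K * (1/2) ^ Suc n * exp (?\<kappa> * \<bar>y - b\<bar>)" using mL by (simp add: field_simps)
  finally show ?case by (simp add: t_def)
qed

lemma T_diff_bound:
  assumes Q: "box_ok X Y M L" and p: "x \<in> X" "y \<in> Y"
    and f: "continuous_on (A \<times> B) f" and K: "\<And>q. q \<in> X \<times> Y \<Longrightarrow> \<bar>f q\<bar> \<le> K"
  shows "\<bar>I1 a (\<lambda>q. c q * f q) (x, y)\<bar> \<le> L * (M * K)"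
    and "\<bar>I2 b (\<lambda>q. c q * f q) (x, y)\<bar> \<le> \<bar>y - b\<bar> * (M * K)"
    and "\<bar>T f (x, y)\<bar> \<le> L * (\<bar>y - b\<bar> * (M * K))"
proof -
  have mL: "M > 0" "L > 0" "X \<subseteq> A" "Y \<subseteq> B" "convex X" "convex Y" "a \<in> X" "b \<in> Y" using Q by (auto simp: box_ok_def)
  have K0: "K \<ge> 0" using K[of "(x, y)"] p by force
  have cf: "continuous_on (A \<times> B) (\<lambda>q. c q * f q)" by (intro continuous_intros cont_c f)
  have m: "\<bar>c q * f q\<bar> \<le> M * K" if "q \<in> X \<times> Y" for q
    unfolding abs_mult using that Q K mL by (intro mult_mono) (auto simp: box_ok_def)
  have xL: "\<bar>x - a\<bar> \<le> L" using Q p by (auto simp: box_ok_def)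
  have "\<bar>I1 a (\<lambda>q. c q * f q) (x, y)\<bar> \<le> \<bar>x - a\<bar> * (M * K)"
    by (rule I1_bound[OF cf]) (use mL p m convex_segment_real[of X a x] in auto)
  also have "\<dots> \<le> L * (M * K)" using xL mL K0 by (intro mult_right_mono) auto
  finally show "\<bar>I1 a (\<lambda>q. c q * f q) (x, y)\<bar> \<le> L * (M * K)" .
  have 2: "\<bar>I2 b (\<lambda>q. c q * f q) (x', y)\<bar> \<le> \<bar>y - b\<bar> * (M * K)" if "x' \<in> X" for x'
    by (rule I2_bound[OF cf]) (use mL p that m convex_segment_real[of Y b y] in auto)
  then show "\<bar>I2 b (\<lambda>q. c q * f q) (x, y)\<bar> \<le> \<bar>y - b\<bar> * (M * K)" using p by simp
  have "\<bar>T f (x, y)\<bar> \<le> \<bar>x - a\<bar> * (\<bar>y - b\<bar> * (M * K))" unfolding T_def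
    by (rule I1_bound[OF I2_continuous[OF cf B(1,3)]]) (use mL p 2 convex_segment_real[of X a x] in auto)
  also have "\<dots> \<le> L * (\<bar>y - b\<bar> * (M * K))" using xL mL K0 by (intro mult_right_mono) auto
  finally show "\<bar>T f (x, y)\<bar> \<le> L * (\<bar>y - b\<bar> * (M * K))" .
qed

lemma T_add:
  assumes f: "continuous_on (A \<times> B) f" and g: "continuous_on (A \<times> B) g" and p: "p \<in> A \<times> B"
  shows "T (\<lambda>q. f q + g q) p = T f p + T g p"
proof -
  have cf: "continuous_on (A \<times> B) (\<lambda>q. c q * f q)" by (intro continuous_intros cont_c f)
  have cg: "continuous_on (A \<times> B) (\<lambda>q. c q * g q)" by (intro continuous_intros cont_c g)
  have 2: "I2 b (\<lambda>q. c q * (f q + g q)) q = I2 b (\<lambda>q. c q * f q) q + I2 b (\<lambda>q. c q * g q) q"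
    if "q \<in> A \<times> B" for q
    using integral_add[OF I2_integrable[OF cf B(1,3) that] I2_integrable[OF cg B(1,3) that]]
    by (simp add: I2_def distrib_left)
  have "I1 a (I2 b (\<lambda>q. c q * (f q + g q))) p = I1 a (\<lambda>q. I2 b (\<lambda>q. c q * f q) q + I2 b (\<lambda>q. c q * g q) q) p"
    unfolding I1_def
    by (intro arg_cong2[where f = "(*)"] refl Henstock_Kurzweil_Integration.integral_cong 2)
      (use p A convex_segment_real in auto)
  also have "\<dots> = I1 a (I2 b (\<lambda>q. c q * f q)) p + I1 a (I2 b (\<lambda>q. c q * g q)) p"
    using integral_add[OF I1_integrable[OF I2_continuous[OF cf B(1,3)] A(1,3) p]
        I1_integrable[OF I2_continuous[OF cg B(1,3)] A(1,3) p]]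
    by (simp add: I1_def distrib_left)
  finally show ?thesis by (simp add: T_def)
qed

lemma T_sum: "p \<in> A \<times> B \<Longrightarrow> T (\<lambda>q. \<Sum>i<n. t i q) p = (\<Sum>i<n. t (Suc i) p)"
proof (induction n)
  case 0
  then show ?case by (simp add: T_def I1_def I2_def)
next
  case (Suc n)
  have "T (\<lambda>q. (\<Sum>i<n. t i q) + t n q) p = T (\<lambda>q. \<Sum>i<n. t i q) p + T (t n) p"
    by (rule T_add) (auto intro!: continuous_intros cont_t Suc.prems)
  then show ?case using Suc by (simp add: t_def)
qed

lemma box_exists:
  assumes "p \<in> A \<times> B"
  obtains X Y M L where "box_ok X Y M L" "p \<in> interior (X \<times> Y)" "compact X" "compact Y"
proof -
  obtain x y where p: "p = (x, y)" "x \<in> A" "y \<in> B" using assms by auto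
  have interval: "\<exists>Z. convex Z \<and> compact Z \<and> a \<in> Z \<and> x \<in> interior Z \<and> Z \<subseteq> A"
    if S: "convex A" "open A" "a \<in> A" "x \<in> A" for A :: "real set" and a x
  proof -
    obtain e where e: "e > 0" "cball x e \<subseteq> A" using S(2,4) open_contains_cball by blast
    define c d where "c = min a (x - e)" and "d = max a (x + e)"
    have cd: "c \<in> A" "d \<in> A" using e S(3) by (auto simp: c_def d_def min_def max_def cball_def dist_real_def)
    have "is_interval A" using S(1) by (simp add: is_interval_convex_1)
    then have sub: "{c..d} \<subseteq> A" using cd by (meson atLeastAtMost_iff mem_is_interval_1_I subsetI)
    show ?thesis by (rule exI[of _ "{c..d}"]) (use e sub in \<open>auto simp: c_def d_def\<close>)
  qed
  obtain X where X: "convex X" "compact X" "a \<in> X" "x \<in> interior X" "X \<subseteq> A" using interval A p by blast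
  obtain Y where Y: "convex Y" "compact Y" "b \<in> Y" "y \<in> interior Y" "Y \<subseteq> B" using interval B p by blast
  have "compact (c ` (X \<times> Y))"
    by (intro compact_continuous_image compact_Times X Y continuous_on_subset[OF cont_c]) (use X Y in auto)
  then obtain M where M: "M > 0" "\<And>p. p \<in> X \<times> Y \<Longrightarrow> \<bar>c p\<bar> \<le> M"
    using compact_imp_bounded bounded_pos by (metis image_eqI real_norm_def)
  have "bounded ((\<lambda>x. x - a) ` X)"
    by (intro compact_imp_bounded compact_continuous_image X continuous_intros)
  then obtain L where L: "L > 0" "\<And>x. x \<in> X \<Longrightarrow> \<bar>x - a\<bar> \<le> L"
    using bounded_pos by (metis image_eqI real_norm_def)
  show ?thesis
    by (rule that[of X Y M L]) (use X Y M L p in \<open>auto simp: box_ok_def interior_Times\<close>)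
qed

text \<open>Summation of \<open>t_bound\<close>; the factor 2 is the sum of the geometric series
  with ratio 1/2.\<close>

lemma sol_props:
  assumes Q: "box_ok X Y M L" and K: "\<And>p. p \<in> X \<times> Y \<Longrightarrow> \<bar>t0 p\<bar> \<le> K" and bY: "bounded Y"
  shows "uniform_limit (X \<times> Y) (\<lambda>n p. \<Sum>i<n. t i p) sol sequentially"
    and "\<And>x y. x \<in> X \<Longrightarrow> y \<in> Y \<Longrightarrow> \<bar>sol (x, y)\<bar> \<le> 2 * K * exp (2 * M * L * \<bar>y - b\<bar>)"
proof -
  obtain R where R: "\<And>y. y \<in> Y \<Longrightarrow> \<bar>y - b\<bar> \<le> R"
    using bounded_translation[OF bY, of "- b"] by (auto simp: bounded_iff)
  have ne: "(a, b) \<in> X \<times> Y" using Q by (simp add: box_ok_def)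
  have K0: "K \<ge> 0" using K[OF ne] by force
  have mL: "M > 0" "L > 0" using Q by (auto simp: box_ok_def)
  let ?C = "K * exp (2 * M * L * R)"
  have b: "norm (t n p) \<le> ?C * (1/2) ^ n" if pX: "p \<in> X \<times> Y" for n p
  proof -
    obtain x y where xy: "p = (x, y)" "x \<in> X" "y \<in> Y" using pX by auto
    have "\<bar>t n (x, y)\<bar> \<le> K * (1/2) ^ n * exp (2 * M * L * \<bar>y - b\<bar>)" by (rule t_bound[OF Q K xy(2,3)])
    also have "\<dots> \<le> K * (1/2) ^ n * exp (2 * M * L * R)" using R[OF xy(3)] K0 mL by (intro mult_left_mono) auto
    finally show ?thesis using xy by (simp add: mult.commute mult.left_commute)
  qed
  show "uniform_limit (X \<times> Y) (\<lambda>n p. \<Sum>i<n. t i p) sol sequentially"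
    unfolding sol_def[abs_def] by (rule Weierstrass_m_test[OF b]) (auto intro!: summable_mult summable_geometric)
  fix x y assume xy: "x \<in> X" "y \<in> Y"
  let ?E = "exp (2 * M * L * \<bar>y - b\<bar>)"
  have sg: "(\<lambda>n. K * ?E * (1/2) ^ n) sums (K * ?E * 2)"
    using geometric_sums[of "1/2::real"] by (intro sums_mult) auto
  have b': "norm (t n (x, y)) \<le> K * ?E * (1/2) ^ n" for n
    using t_bound[OF Q K xy, of n] by (simp add: mult_ac)
  have "norm (sol (x, y)) \<le> (\<Sum>n. K * ?E * (1/2) ^ n)"
    unfolding sol_def by (rule norm_suminf_le[OF b' sums_summable[OF sg]])
  then show "\<bar>sol (x, y)\<bar> \<le> 2 * K * ?E" using sums_unique[OF sg] by simp
qed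

lemma t0_bounded:
  assumes "compact X" "compact Y" "X \<subseteq> A" "Y \<subseteq> B"
  shows "\<exists>K. \<forall>p\<in>X \<times> Y. \<bar>t0 p\<bar> \<le> K"
proof -
  have "compact (t0 ` (X \<times> Y))"
    by (intro compact_continuous_image compact_Times assms continuous_on_subset[OF cont_t0]) (use assms in auto)
  then have "bounded (t0 ` (X \<times> Y))" by (rule compact_imp_bounded)
  then show ?thesis by (auto simp: bounded_iff)
qed

lemma sol_continuous: "continuous_on (A \<times> B) sol"
proof (rule continuous_at_imp_continuous_on, rule ballI)
  fix p assume "p \<in> A \<times> B"
  then obtain X Y M L where Q: "box_ok X Y M L" "p \<in> interior (X \<times> Y)" "compact X" "compact Y"
    by (rule box_exists)
  then have XY: "X \<subseteq> A" "Y \<subseteq> B" by (auto simp: box_ok_def)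
  obtain K where K: "\<And>p. p \<in> X \<times> Y \<Longrightarrow> \<bar>t0 p\<bar> \<le> K" using t0_bounded[OF Q(3,4) XY] by blast
  have "continuous_on (X \<times> Y) sol"
    by (rule uniform_limit_theorem[OF _ sol_props(1)[OF Q(1) K compact_imp_bounded[OF Q(4)]]])
      (use XY in \<open>auto intro!: always_eventually continuous_on_sum continuous_on_subset[OF cont_t]\<close>)
  then show "isCont sol p" using Q(2) continuous_on_interior by blast
qed

lemma sol_eq:
  assumes "p \<in> A \<times> B"
  shows "sol p = t0 p + T sol p"
proof -
  obtain X Y M L where Q: "box_ok X Y M L" "p \<in> interior (X \<times> Y)" "compact X" "compact Y"
    using assms by (rule box_exists)
  then have XY: "X \<subseteq> A" "Y \<subseteq> B" by (auto simp: box_ok_def)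
  obtain x y where p: "p = (x, y)" "x \<in> X" "y \<in> Y" using subsetD[OF interior_subset Q(2)] by auto
  obtain K where K: "\<And>p. p \<in> X \<times> Y \<Longrightarrow> \<bar>t0 p\<bar> \<le> K" using t0_bounded[OF Q(3,4) XY] by blast
  note ul = sol_props(1)[OF Q(1) K compact_imp_bounded[OF Q(4)]]
  have "(\<lambda>n. T (\<lambda>q. \<Sum>i<n. t i q) p) \<longlonglongrightarrow> T sol p"
  proof (rule LIMSEQ_I)
    fix e :: real assume e: "e > 0"
    \<comment> \<open>The summand 1 keeps \<open>C\<close> positive when
      \<open>y = b\<close>.\<close>
    define C where "C = L * (\<bar>y - b\<bar> * M) + 1"
    have C: "C > 0" using Q(1) by (auto simp: C_def box_ok_def intro!: add_nonneg_pos mult_nonneg_nonneg)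
    from uniform_limitD[OF ul, of "e / C"] e C
    obtain N where N: "\<And>n q. n \<ge> N \<Longrightarrow> q \<in> X \<times> Y \<Longrightarrow> dist (\<Sum>i<n. t i q) (sol q) < e / C"
      by (auto simp: eventually_sequentially)
    show "\<exists>N. \<forall>n\<ge>N. norm (T (\<lambda>q. \<Sum>i<n. t i q) p - T sol p) < e"
    proof (intro exI allI impI)
      fix n assume n: "n \<ge> N"
      let ?d = "\<lambda>q. (\<Sum>i<n. t i q) - sol q"
      have cd: "continuous_on (A \<times> B) ?d" by (intro continuous_intros cont_t sol_continuous)
      have "T (\<lambda>q. ?d q + sol q) p = T ?d p + T sol p"
        by (rule T_add[OF cd sol_continuous assms])
      moreover have "\<bar>T ?d p\<bar> \<le> L * (\<bar>y - b\<bar> * (M * (e / C)))"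
        unfolding p(1) by (rule T_diff_bound(3)[OF Q(1) p(2,3) cd]) (use N[OF n] in \<open>auto simp: dist_real_def intro: less_imp_le\<close>)
      moreover have "L * (\<bar>y - b\<bar> * (M * (e / C))) < e"
        using C e by (simp add: field_simps C_def)
      ultimately show "norm (T (\<lambda>q. \<Sum>i<n. t i q) p - T sol p) < e" by simp
    qed
  qed
  then have 1: "(\<lambda>n. \<Sum>i<n. t (Suc i) p) \<longlonglongrightarrow> T sol p" using T_sum[OF assms] by simp
  have "(\<lambda>n. \<Sum>i<n. t i p) \<longlonglongrightarrow> sol p"
    by (rule tendsto_uniform_limitI[OF ul]) (use p in auto)
  then have "(\<lambda>n. \<Sum>i<Suc n. t i p) \<longlonglongrightarrow> sol p" by (rule LIMSEQ_Suc)
  then have "(\<lambda>n. t0 p + (\<Sum>i<n. t (Suc i) p)) \<longlonglongrightarrow> sol p"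
    by (simp add: sum.lessThan_Suc_shift t_def del: sum.lessThan_Suc)
  with tendsto_add[OF tendsto_const 1, of "t0 p"] show ?thesis using LIMSEQ_unique by blast
qed

lemma cont_csol: "continuous_on (A \<times> B) (\<lambda>q. c q * sol q)"
  by (intro continuous_intros cont_c sol_continuous)

lemma sol_has_derivative:
  assumes "p \<in> A \<times> B"
  shows "(sol has_derivative fpair (pd1 t0 p + I2 b (\<lambda>q. c q * sol q) p) (pd2 t0 p + I1 a (\<lambda>q. c q * sol q) p)) (at p)"
proof -
  let ?g = "\<lambda>q. c q * sol q"
  have "(T sol has_derivative fpair (I2 b ?g p) (I1 a ?g p)) (at p)"
  proof (rule has_derivative_fpairI[OF opn assms])
    show "continuous_on (A \<times> B) (I1 a ?g)" by (rule I1_continuous[OF cont_csol A(1,3)])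
    show "((\<lambda>x. T sol (x, y)) has_real_derivative I2 b ?g (x, y)) (at x)" if "(x, y) \<in> A \<times> B" for x y
      unfolding T_def using that by (intro I1_deriv1[OF I2_continuous[OF cont_csol B(1,3)] A]) auto
    show "((\<lambda>y. T sol (x, y)) has_real_derivative I1 a ?g (x, y)) (at y)" if "(x, y) \<in> A \<times> B" for x y
      unfolding T_def using that
      by (intro I1_deriv2[OF I2_continuous[OF cont_csol B(1,3)] cont_csol A(1,3) B(1,2)] I2_deriv2[OF cont_csol B]) auto
  qed
  then have "((\<lambda>q. t0 q + T sol q) has_derivative
      (\<lambda>h. fpair (pd1 t0 p) (pd2 t0 p) h + fpair (I2 b ?g p) (I1 a ?g p) h)) (at p)"
    by (intro has_derivative_add smooth_on_has_derivative_pd[OF t0 assms])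
  then have "((\<lambda>q. t0 q + T sol q) has_derivative fpair (pd1 t0 p + I2 b ?g p) (pd2 t0 p + I1 a ?g p)) (at p)"
    by (rule has_derivative_eq_rhs) (auto simp: fpair_def algebra_simps)
  then show ?thesis
    by (rule has_derivative_transform_within_open[OF _ opn assms]) (use sol_eq in auto)
qed

text \<open>Bootstrapping: the first derivatives of \<open>sol\<close> are those of
  \<open>t0\<close> plus integrals of \<open>c * sol\<close>, hence as regular as \<open>sol\<close>
  is already known to be.\<close>

lemma sol_smooth: "smooth_on (A \<times> B) sol"
proof -
  have "Ck_on k (A \<times> B) sol" for k
  proof (induction k)
    case 0
    then show ?case using sol_continuous by simp
  next
    case (Suc k)
    have "Ck_on k (A \<times> B) (\<lambda>q. c q * sol q)"
      using c Suc by (intro Ck_on_bilinear[OF opn bounded_bilinear_mult]) (auto simp: smooth_on_def)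
    then show ?case
      using smooth_on_pd[OF t0]
      by (intro Ck_on_fpair[OF opn sol_has_derivative] Ck_on_add[OF opn] I2_Ck I1_Ck A B)
        (auto simp: smooth_on_def)
  qed
  then show ?thesis by (simp add: smooth_on_def)
qed

lemma sol_pd:
  assumes "p \<in> A \<times> B"
  shows "pd1 sol p = pd1 t0 p + I2 b (\<lambda>q. c q * sol q) p" "pd2 sol p = pd2 t0 p + I1 a (\<lambda>q. c q * sol q) p"
  using pd_eq[OF sol_has_derivative[OF assms]] by auto

lemma sol_mixed:
  assumes "p \<in> A \<times> B"
  shows "pd2 (pd1 sol) p = pd2 (pd1 t0) p + c p * sol p"
proof -
  obtain x y where p: "p = (x, y)" "x \<in> A" "y \<in> B" using assms by auto
  have sl: "((\<lambda>y. f (x, y)) has_real_derivative pd2 f (x, y)) (at y)" if "smooth_on (A \<times> B) f" for f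
  proof -
    have "(f has_derivative fpair (pd1 f (x, y)) (pd2 f (x, y))) (at (x, y))"
      using that assms p by (intro smooth_on_has_derivative_pd) auto
    from has_real_derivative_fpair_compose[where f = f and g = "\<lambda>_. x" and h = "\<lambda>y. y" and t = y, OF this, of 0 UNIV 1] show ?thesis by simp
  qed
  have "((\<lambda>y. pd1 t0 (x, y) + I2 b (\<lambda>q. c q * sol q) (x, y)) has_real_derivative pd2 (pd1 t0) (x, y) + c (x, y) * sol (x, y)) (at y)"
    using p by (intro DERIV_add sl smooth_on_pd t0 I2_deriv2[OF cont_csol B])
  then have "((\<lambda>y. pd1 sol (x, y)) has_real_derivative pd2 (pd1 t0) (x, y) + c (x, y) * sol (x, y)) (at y)"
    by (rule has_field_derivative_transform_within_open[OF _ B(2) p(3)]) (use p sol_pd in auto)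
  with sl[OF smooth_on_pd(1)[OF sol_smooth]] show ?thesis using DERIV_unique p(1) by blast
qed

text \<open>The deviation from \<open>t0\<close>, also in first derivatives, is bounded through the
  supremum of \<open>t0\<close> alone. For the packet that supremum is 1 while a derivative of
  \<open>t0\<close> is of order 1 / \<eta>, so the deviation stays bounded as \<eta> tends to
  0.\<close>

lemma sol_bound:
  assumes Q: "box_ok X Y M L" "bounded Y" and K: "\<And>p. p \<in> X \<times> Y \<Longrightarrow> \<bar>t0 p\<bar> \<le> K"
    and R: "\<And>y. y \<in> Y \<Longrightarrow> \<bar>y - b\<bar> \<le> R" and p: "x \<in> X" "y \<in> Y"
  defines "K' \<equiv> 2 * K * exp (2 * M * L * R)"
  shows "\<bar>sol (x, y)\<bar> \<le> K'"
    and "\<bar>sol (x, y) - t0 (x, y)\<bar> \<le> L * (\<bar>y - b\<bar> * (M * K'))"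
    and "\<bar>pd1 sol (x, y) - pd1 t0 (x, y)\<bar> \<le> R * (M * K')"
    and "\<bar>pd2 sol (x, y) - pd2 t0 (x, y)\<bar> \<le> L * (M * K')"
proof -
  have mL: "M > 0" "L > 0" "X \<subseteq> A" "Y \<subseteq> B" "a \<in> X" "b \<in> Y" using Q by (auto simp: box_ok_def)
  have K0: "K \<ge> 0" using K[of "(a, b)"] mL by force
  have b: "\<bar>sol q\<bar> \<le> K'" if q: "q \<in> X \<times> Y" for q
  proof -
    obtain x y where xy: "q = (x, y)" "x \<in> X" "y \<in> Y" using q by auto
    have "\<bar>sol (x, y)\<bar> \<le> 2 * K * exp (2 * M * L * \<bar>y - b\<bar>)" by (rule sol_props(2)[OF Q(1) K Q(2) xy(2,3)])
    also have "\<dots> \<le> K'" unfolding K'_def using R[OF xy(3)] K0 mL by (intro mult_left_mono) auto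
    finally show ?thesis using xy by simp
  qed
  show "\<bar>sol (x, y)\<bar> \<le> K'" using b p by simp
  have pAB: "(x, y) \<in> A \<times> B" using p mL by auto
  have K'0: "K' \<ge> 0" using b[of "(x, y)"] p by force
  show "\<bar>sol (x, y) - t0 (x, y)\<bar> \<le> L * (\<bar>y - b\<bar> * (M * K'))"
    using T_diff_bound(3)[OF Q(1) p sol_continuous b] sol_eq[OF pAB] by simp
  have "\<bar>y - b\<bar> * (M * K') \<le> R * (M * K')" using R[OF p(2)] mL K'0 by (intro mult_right_mono) auto
  then show "\<bar>pd1 sol (x, y) - pd1 t0 (x, y)\<bar> \<le> R * (M * K')"
    using T_diff_bound(2)[OF Q(1) p sol_continuous b] sol_pd[OF pAB] by simp
  show "\<bar>pd2 sol (x, y) - pd2 t0 (x, y)\<bar> \<le> L * (M * K')"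
    using T_diff_bound(1)[OF Q(1) p sol_continuous b] sol_pd[OF pAB] by simp
qed

text \<open>The case \<open>K = 0\<close> of the bound, on boxes inside the half plane where \<open>t0\<close> vanishes.\<close>

lemma sol_zero:
  assumes "p \<in> A \<times> B" and H: "H = {q. fst q \<ge> a} \<or> H = {q. fst q \<le> a} \<or> H = {q. snd q \<ge> b} \<or> H = {q. snd q \<le> b}"
    and z: "\<And>q. q \<in> A \<times> B \<Longrightarrow> q \<in> H \<Longrightarrow> t0 q = 0" and "p \<in> H"
  shows "sol p = 0"
proof -
  obtain X Y M L where Q: "box_ok X Y M L" "p \<in> interior (X \<times> Y)" "compact X" "compact Y"
    using assms(1) by (rule box_exists)
  \<comment> \<open>Cutting a box with a half plane bounded by a characteristic line through the
    base point leaves a product of convex sets that still contains the base point.\<close>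
  obtain X' Y' where XY': "X' \<times> Y' = (X \<times> Y) \<inter> H" "convex X'" "convex Y'" "a \<in> X'" "b \<in> Y'" "X' \<subseteq> X" "Y' \<subseteq> Y"
  proof -
    have cv: "convex X" "convex Y" "a \<in> X" "b \<in> Y" using Q by (auto simp: box_ok_def)
    from H show ?thesis
    proof (elim disjE)
      assume "H = {q. fst q \<ge> a}"
      then show ?thesis by (intro that[of "X \<inter> {a..}" Y]) (use cv in \<open>auto intro: convex_Int\<close>)
    next
      assume "H = {q. fst q \<le> a}"
      then show ?thesis by (intro that[of "X \<inter> {..a}" Y]) (use cv in \<open>auto intro: convex_Int\<close>)
    next
      assume "H = {q. snd q \<ge> b}"
      then show ?thesis by (intro that[of X "Y \<inter> {b..}"]) (use cv in \<open>auto intro: convex_Int\<close>)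
    next
      assume "H = {q. snd q \<le> b}"
      then show ?thesis by (intro that[of X "Y \<inter> {..b}"]) (use cv in \<open>auto intro: convex_Int\<close>)
    qed
  qed
  have Q': "box_ok X' Y' M L" using Q(1) XY' unfolding box_ok_def by blast
  have "p \<in> X' \<times> Y'" using Q(2) assms(4) XY' interior_subset by blast
  then obtain x y where p: "p = (x, y)" "x \<in> X'" "y \<in> Y'" by auto
  have "\<bar>sol (x, y)\<bar> \<le> 2 * 0 * exp (2 * M * L * \<bar>y - b\<bar>)"
  proof (rule sol_props(2)[OF Q'])
    show "\<bar>t0 q\<bar> \<le> 0" if "q \<in> X' \<times> Y'" for q
    proof -
      have "q \<in> H" "q \<in> X \<times> Y" using that XY'(1) by auto
      moreover have "X \<times> Y \<subseteq> A \<times> B" using Q(1) by (auto simp: box_ok_def)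
      ultimately show ?thesis using z by auto
    qed
    show "bounded Y'" using Q(4) XY' bounded_subset compact_imp_bounded by blast
  qed (use p in auto)
  then show ?thesis using p by simp
qed

end

section \<open>The flow along outgoing null rays\<close>

lemma D_eq: "r \<noteq> 0 \<Longrightarrow> D m r = ((r - m) / r)\<^sup>2"
  by (simp add: D_def field_simps power2_eq_square)

lemma D_pos: "r > 0 \<Longrightarrow> r \<noteq> m \<Longrightarrow> D m r > 0"
  by (simp add: D_eq)

lemma D_nonneg: "r > 0 \<Longrightarrow> D m r \<ge> 0"
  by (simp add: D_eq)

lemma D_self: "m > 0 \<Longrightarrow> D m m = 0"
  by (simp add: D_eq)

lemma rstar_less:
  assumes "0 < r" "r < r'" "r' < m \<or> m < r"
  shows "rstar m r < rstar m r'"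
proof (rule DERIV_pos_imp_increasing[OF assms(2)])
  fix x assume "r \<le> x" "x \<le> r'"
  with assms show "\<exists>y. (rstar m has_real_derivative y) (at x) \<and> 0 < y"
    by (intro exI[of _ "1 / D m x"] conjI rstar_deriv) (auto simp: D_pos)
qed

lemma rstar_inj:
  assumes "0 < r" "0 < r'" "(r < m \<and> r' < m) \<or> (m < r \<and> m < r')" "rstar m r = rstar m r'"
  shows "r = r'"
  using rstar_less[of r r' m] rstar_less[of r' r m] assms by (cases r r' rule: linorder_cases) auto

lemma rstar_zero_less:
  assumes "m > 0" "0 < r" "r < m"
  shows "rstar m 0 < rstar m r"
proof (rule DERIV_pos_imp_increasing_open[OF assms(2)])
  fix x assume "0 < x" "x < r"
  with assms show "\<exists>y. (rstar m has_real_derivative y) (at x) \<and> 0 < y"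
    by (intro exI[of _ "1 / D m x"] conjI rstar_deriv) (auto simp: D_pos)
next
  show "continuous_on {0..r} (rstar m)"
    unfolding rstar_def[abs_def] using assms by (auto intro!: continuous_intros)
qed

lemma rstar_cont: "S \<subseteq> {0<..} - {m} \<Longrightarrow> continuous_on S (rstar m)"
  by (rule continuous_at_imp_continuous_on) (auto intro!: DERIV_isCont rstar_deriv)

lemma rstar_at_left: "m > 0 \<Longrightarrow> filterlim (rstar m) at_top (at_left m)"
  unfolding rstar_def[abs_def] by real_asymp

lemma rstar_at_right: "m > 0 \<Longrightarrow> filterlim (rstar m) at_bot (at_right m)"
  unfolding rstar_def[abs_def] by real_asymp

lemma rstar_at_top: "m > 0 \<Longrightarrow> filterlim (rstar m) at_top at_top"
  unfolding rstar_def[abs_def] by real_asymp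

lemma rstar_surj_inner:
  assumes "m > 0" "rstar m 0 < y"
  obtains r where "0 < r" "r < m" "rstar m r = y"
proof -
  have "eventually (\<lambda>r. y < rstar m r \<and> 0 < r \<and> r < m) (at_left m)"
    using filterlim_at_top_dense[THEN iffD1, OF rstar_at_left[OF assms(1)], rule_format, of y]
      eventually_at_left_real[OF assms(1)] by (auto elim: eventually_elim2)
  then obtain r where r: "y < rstar m r" "0 < r" "r < m"
    using eventually_happens'[of "at_left m"] by auto
  have "continuous_on {0..r} (rstar m)"
    unfolding rstar_def[abs_def] using r by (auto intro!: continuous_intros)
  then obtain x where "0 \<le> x" "x \<le> r" "rstar m x = y"
    using IVT'[of "rstar m" 0 y r] r assms by force
  then show ?thesis using that[of x] r assms by (cases "x = 0") auto
qed

lemma rstar_surj_outer: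
  assumes "m > 0"
  obtains r where "m < r" "rstar m r = y"
proof -
  have "eventually (\<lambda>r. rstar m r < y \<and> m < r) (at_right m)"
    using filterlim_at_bot_dense[THEN iffD1, OF rstar_at_right[OF assms], rule_format, of y]
      eventually_at_right_less[of m] by (auto elim: eventually_elim2)
  then obtain a where a: "rstar m a < y" "m < a"
    using eventually_happens'[of "at_right m"] by auto
  have "eventually (\<lambda>r. y < rstar m r \<and> a < r) at_top"
    using filterlim_at_top_dense[THEN iffD1, OF rstar_at_top[OF assms], rule_format, of y]
      eventually_gt_at_top[of a] by (rule eventually_conj)
  then obtain b where b: "y < rstar m b" "a < b"
    using eventually_happens'[OF trivial_limit_at_top_linorder] by blast
  have "continuous_on {a..b} (rstar m)" by (rule rstar_cont) (use a assms in auto)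
  then obtain x where "a \<le> x" "x \<le> b" "rstar m x = y"
    using IVT'[of "rstar m" a y b] a b by force
  then show ?thesis using that[of x] a by auto
qed

text \<open>\<open>fl m (r, \<sigma>)\<close> follows the vector field \<open>D d/dr\<close> for the
  time \<sigma>, which \<open>rstar\<close> turns into a translation. \<open>rstar\<close> maps the
  exterior onto the whole line but the interior only onto the values above the finite number
  \<open>rstar m 0\<close>; so only interior points can leave the domain, by running into
  \<open>r = 0\<close>.\<close>

definition flow_dom :: "real \<Rightarrow> (real \<times> real) set" where
  "flow_dom m = {(r, \<sigma>). r > 0 \<and> (r < m \<longrightarrow> rstar m 0 < rstar m r + \<sigma>)}"

definition fl :: "real \<Rightarrow> real \<times> real \<Rightarrow> real" where
  "fl m p = (if fst p = m then m else
     (SOME \<rho>. \<rho> > 0 \<and> (if fst p < m then \<rho> < m else m < \<rho>) \<and> rstar m \<rho> = rstar m (fst p) + snd p))"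

lemma fl_self [simp]: "fl m (m, \<sigma>) = m" by (simp add: fl_def)

lemma fl_props:
  assumes "m > 0" "(r, \<sigma>) \<in> flow_dom m" "r \<noteq> m"
  shows "fl m (r, \<sigma>) > 0" "r < m \<longleftrightarrow> fl m (r, \<sigma>) < m" "m < r \<longleftrightarrow> m < fl m (r, \<sigma>)"
    "rstar m (fl m (r, \<sigma>)) = rstar m r + \<sigma>"
proof -
  have fl_some: "fl m (r, \<sigma>) = (SOME \<rho>. \<rho> > 0 \<and> (if r < m then \<rho> < m else m < \<rho>) \<and> rstar m \<rho> = rstar m r + \<sigma>)"
    using assms(3) by (simp only: fl_def fst_conv snd_conv if_False)
  have "\<exists>\<rho>. \<rho> > 0 \<and> (if r < m then \<rho> < m else m < \<rho>) \<and> rstar m \<rho> = rstar m r + \<sigma>"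
  proof (cases "r < m")
    case True
    then have "rstar m 0 < rstar m r + \<sigma>" using assms by (auto simp: flow_dom_def)
    from rstar_surj_inner[OF assms(1) this] show ?thesis using True by (metis (full_types))
  next
    case False
    obtain \<rho> where "m < \<rho>" "rstar m \<rho> = rstar m r + \<sigma>" using rstar_surj_outer[OF assms(1)] .
    then show ?thesis using assms(1) False by (intro exI[of _ \<rho>]) auto
  qed
  from someI_ex[OF this] have *: "fl m (r, \<sigma>) > 0 \<and> (if r < m then fl m (r, \<sigma>) < m else m < fl m (r, \<sigma>)) \<and>
      rstar m (fl m (r, \<sigma>)) = rstar m r + \<sigma>"
    unfolding fl_some[symmetric] .
  then show "fl m (r, \<sigma>) > 0" "rstar m (fl m (r, \<sigma>)) = rstar m r + \<sigma>" by auto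
  show "r < m \<longleftrightarrow> fl m (r, \<sigma>) < m" "m < r \<longleftrightarrow> m < fl m (r, \<sigma>)"
    using * assms by (auto split: if_splits)
qed

lemma fl_eqI:
  assumes "m > 0" "r > 0" "\<rho> > 0" "(r < m \<and> \<rho> < m) \<or> (m < r \<and> m < \<rho>)" "rstar m \<rho> = rstar m r + \<sigma>"
  shows "(r, \<sigma>) \<in> flow_dom m" "fl m (r, \<sigma>) = \<rho>"
proof -
  show d: "(r, \<sigma>) \<in> flow_dom m"
    using assms rstar_zero_less[of m \<rho>] by (auto simp: flow_dom_def)
  show "fl m (r, \<sigma>) = \<rho>"
    by (rule rstar_inj[of _ _ m]) (use fl_props[OF assms(1) d] assms in auto)
qed

lemma fl_pos: "m > 0 \<Longrightarrow> (r, \<sigma>) \<in> flow_dom m \<Longrightarrow> fl m (r, \<sigma>) > 0"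
  using fl_props(1)[of m r \<sigma>] by (cases "r = m") auto

lemma fl_inverse:
  assumes "m > 0" "(r, \<sigma>) \<in> flow_dom m"
  shows "(fl m (r, \<sigma>), - \<sigma>) \<in> flow_dom m" "fl m (fl m (r, \<sigma>), - \<sigma>) = r"
proof -
  have "(fl m (r, \<sigma>), - \<sigma>) \<in> flow_dom m \<and> fl m (fl m (r, \<sigma>), - \<sigma>) = r"
  proof (cases "r = m")
    case True
    then show ?thesis using assms by (simp add: flow_dom_def)
  next
    case False
    have r: "r > 0" using assms by (simp add: flow_dom_def)
    note p = fl_props[OF assms False]
    show ?thesis using fl_eqI[OF assms(1) p(1) r, of "- \<sigma>"] p False by auto
  qed
  then show "(fl m (r, \<sigma>), - \<sigma>) \<in> flow_dom m" "fl m (fl m (r, \<sigma>), - \<sigma>) = r" by auto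
qed

text \<open>
  Writing \<open>r = m + Y\<close> and \<open>fl m (r, \<sigma>) = m + Y + Y\<^sup>2 z\<close> desingularizes the defining relation of the
  flow at the horizon: it becomes \<open>\<sigma> = H m (Y, z)\<close> with \<open>H\<close> regular at \<open>Y = 0\<close> and increasing
  in \<open>z\<close>.
\<close>

definition W :: "real \<Rightarrow> (real \<times> real) set" where
  "W m = {p. 1 + fst p * snd p > 0 \<and> m + fst p > 0 \<and> m + fst p + (fst p)\<^sup>2 * snd p > 0}"

definition H :: "real \<Rightarrow> real \<times> real \<Rightarrow> real" where
  "H m p = (fst p)\<^sup>2 * snd p + 2 * m * ln (1 + fst p * snd p) + m\<^sup>2 * snd p / (1 + fst p * snd p)"

definition HY :: "real \<Rightarrow> real \<times> real \<Rightarrow> real" where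
  "HY m p = 2 * fst p * snd p + 2 * m * snd p / (1 + fst p * snd p) - m\<^sup>2 * (snd p)\<^sup>2 / (1 + fst p * snd p)\<^sup>2"

text \<open>On the horizon, where \<open>fst p = 0\<close>, the value is \<open>m\<^sup>2\<close>;
  so solving for \<open>z\<close> is no more degenerate there than elsewhere.\<close>

definition Hz :: "real \<Rightarrow> real \<times> real \<Rightarrow> real" where
  "Hz m p = ((m + fst p + (fst p)\<^sup>2 * snd p) / (1 + fst p * snd p))\<^sup>2"

lemma open_W: "open (W m)"
  unfolding W_def by (intro open_Collect_conj open_Collect_less continuous_intros)

lemma W_smooth: "smooth_on (W m) (\<lambda>p. 1 + fst p * snd p)" "smooth_on (W m) fst" "smooth_on (W m) snd"
  by (intro smooth_on_add smooth_on_mult smooth_on_const smooth_on_fst smooth_on_snd open_W)+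

lemma HY_smooth: "smooth_on (W m) (HY m)"
  unfolding HY_def[abs_def]
  by (intro smooth_on_add smooth_on_diff smooth_on_mult smooth_on_divide smooth_on_power smooth_on_const
      W_smooth open_W) (auto simp: W_def)

lemma Hz_smooth: "smooth_on (W m) (Hz m)"
  unfolding Hz_def[abs_def]
  by (intro smooth_on_add smooth_on_mult smooth_on_divide smooth_on_power smooth_on_const
      W_smooth open_W) (auto simp: W_def)

lemma Hz_pos: "p \<in> W m \<Longrightarrow> Hz m p > 0"
  by (simp add: Hz_def W_def)

lemma H_has_derivative:
  assumes "p \<in> W m"
  shows "(H m has_derivative fpair (HY m p) (Hz m p)) (at p)"
proof (rule has_derivative_fpairI[OF open_W assms])
  fix x y assume xy: "(x, y) \<in> W m"
  then have pos: "1 + x * y > 0" by (simp add: W_def)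
  show "((\<lambda>x. H m (x, y)) has_real_derivative HY m (x, y)) (at x)"
    unfolding H_def HY_def using pos
    by (auto intro!: derivative_eq_intros simp: power2_eq_square mult_ac)
  have "2 * m * x / (1 + x * y) + (m\<^sup>2 * (1 + x * y) - m\<^sup>2 * y * x) / (1 + x * y)\<^sup>2 + x\<^sup>2
      = ((m + x + x\<^sup>2 * y) / (1 + x * y))\<^sup>2"
    using pos by (simp add: divide_simps) (simp add: power2_eq_square algebra_simps)
  then show "((\<lambda>y. H m (x, y)) has_real_derivative Hz m (x, y)) (at y)"
    unfolding H_def Hz_def using pos
    by (auto intro!: derivative_eq_intros simp: power2_eq_square mult_ac add_ac)
qed (rule smooth_on_imp_continuous_on[OF Hz_smooth])

lemma fl_H:
  assumes "m > 0" "(Y, z) \<in> W m"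
  shows "(m + Y, H m (Y, z)) \<in> flow_dom m" "fl m (m + Y, H m (Y, z)) = m + Y + Y\<^sup>2 * z"
proof -
  have w: "1 + Y * z > 0" "m + Y > 0" "m + Y + Y\<^sup>2 * z > 0" using assms(2) by (auto simp: W_def)
  have "(m + Y, H m (Y, z)) \<in> flow_dom m \<and> fl m (m + Y, H m (Y, z)) = m + Y + Y\<^sup>2 * z"
  proof (cases "Y = 0")
    case True
    then show ?thesis using assms by (simp add: flow_dom_def)
  next
    case False
    have f: "Y + Y\<^sup>2 * z = Y * (1 + Y * z)" by (simp add: power2_eq_square algebra_simps)
    have l: "ln \<bar>Y * (1 + Y * z)\<bar> = ln \<bar>Y\<bar> + ln (1 + Y * z)"
      using w False by (simp add: abs_mult ln_mult)
    have e: "m\<^sup>2 / Y - m\<^sup>2 / (Y * (1 + Y * z)) = m\<^sup>2 * z / (1 + Y * z)"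
    proof -
      have "m\<^sup>2 / Y = m\<^sup>2 * (1 + Y * z) / (Y * (1 + Y * z))" using w by simp
      then have "m\<^sup>2 / Y - m\<^sup>2 / (Y * (1 + Y * z)) = (m\<^sup>2 * (1 + Y * z) - m\<^sup>2) / (Y * (1 + Y * z))"
        by (simp add: diff_divide_distrib)
      also have "m\<^sup>2 * (1 + Y * z) - m\<^sup>2 = Y * (m\<^sup>2 * z)" by (simp add: algebra_simps)
      finally show ?thesis using False by simp
    qed
    have "rstar m (m + Y + Y\<^sup>2 * z) = rstar m (m + Y) + H m (Y, z)"
    proof -
      have f': "m + Y + Y\<^sup>2 * z - m = Y * (1 + Y * z)" "m + Y - m = Y" using f by auto
      show ?thesis
        unfolding rstar_def H_def fst_conv snd_conv f' l e[symmetric] by (simp add: distrib_left)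
    qed
    moreover have "(m + Y < m \<and> m + Y + Y\<^sup>2 * z < m) \<or> (m < m + Y \<and> m < m + Y + Y\<^sup>2 * z)"
    proof (cases "Y > 0")
      case True
      then have "Y * (1 + Y * z) > 0" using w by simp
      then show ?thesis using True f by linarith
    next
      case False
      then have "Y * (1 + Y * z) < 0" using w \<open>Y \<noteq> 0\<close> by (simp add: mult_less_0_iff)
      then show ?thesis using False \<open>Y \<noteq> 0\<close> f by linarith
    qed
    ultimately show ?thesis using fl_eqI[OF assms(1) w(2,3)] by blast
  qed
  then show "(m + Y, H m (Y, z)) \<in> flow_dom m" "fl m (m + Y, H m (Y, z)) = m + Y + Y\<^sup>2 * z" by auto
qed

text \<open>Off the horizon this is the defining formula solved for \<open>z\<close>; on it the
  value is forced by \<open>H m (0, z) = m\<^sup>2 * z\<close>.\<close>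

definition zf :: "real \<Rightarrow> real \<times> real \<Rightarrow> real" where
  "zf m p = (if fst p = 0 then snd p / m\<^sup>2 else (fl m (m + fst p, snd p) - m - fst p) / (fst p)\<^sup>2)"

definition zdom :: "real \<Rightarrow> (real \<times> real) set" where
  "zdom m = {p. (m + fst p, snd p) \<in> flow_dom m}"

lemma zf_left_inverse:
  assumes "m > 0" "p \<in> W m"
  shows "(fst p, H m p) \<in> zdom m" "zf m (fst p, H m p) = snd p"
  using fl_H[of m "fst p" "snd p"] assms
  by (auto simp: zdom_def zf_def H_def)

lemma zf_right_inverse:
  assumes "m > 0" "p \<in> zdom m"
  shows "(fst p, zf m p) \<in> W m" "H m (fst p, zf m p) = snd p"
proof -
  obtain Y \<sigma> where p: "p = (Y, \<sigma>)" by (cases p)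
  have d: "(m + Y, \<sigma>) \<in> flow_dom m" using assms p by (simp add: zdom_def)
  have mY: "m + Y > 0" using d by (simp add: flow_dom_def)
  have "(Y, zf m p) \<in> W m \<and> H m (Y, zf m p) = \<sigma>"
  proof (cases "Y = 0")
    case True
    then show ?thesis using assms p by (simp add: W_def zf_def H_def)
  next
    case False
    let ?\<rho> = "fl m (m + Y, \<sigma>)" and ?z = "zf m p"
    have z: "?z = (?\<rho> - m - Y) / Y\<^sup>2" using False by (simp add: zf_def p)
    have f: "fl m (m + Y, \<sigma>) > 0" "m + Y < m \<longleftrightarrow> ?\<rho> < m" "m < m + Y \<longleftrightarrow> m < ?\<rho>" "rstar m ?\<rho> = rstar m (m + Y) + \<sigma>"
      using fl_props[OF assms(1) d] False by auto
    have 1: "m + Y + Y\<^sup>2 * ?z = ?\<rho>" using False by (simp add: z)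
    have "1 + Y * ?z = (?\<rho> - m) / Y" using False by (simp add: z power2_eq_square field_simps)
    moreover have "(?\<rho> - m) / Y > 0" using f False by (auto simp: zero_less_divide_iff)
    ultimately have w: "(Y, ?z) \<in> W m" using 1 f mY by (simp add: W_def)
    have "rstar m (m + Y) + H m (Y, ?z) = rstar m ?\<rho>"
      using fl_H[OF assms(1) w] fl_props(4)[OF assms(1) fl_H(1)[OF assms(1) w]] False 1 by simp
    then show ?thesis using w f by simp
  qed
  then show "(fst p, zf m p) \<in> W m" "H m (fst p, zf m p) = snd p" using p by auto
qed

lemma zdom_image: "m > 0 \<Longrightarrow> zdom m = (\<lambda>p. (fst p, H m p)) ` W m"
proof (intro equalityI subsetI)
  assume m: "m > 0"
  fix p
  show "p \<in> (\<lambda>p. (fst p, H m p)) ` W m" if "p \<in> zdom m"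
    by (rule image_eqI[of _ _ "(fst p, zf m p)"]) (use zf_right_inverse[OF m that] in auto)
  show "p \<in> zdom m" if "p \<in> (\<lambda>p. (fst p, H m p)) ` W m"
    using that zf_left_inverse(1)[OF m] by auto
qed

lemma H_cont: "continuous_on (W m) (\<lambda>p. (fst p, H m p))"
  by (intro continuous_intros continuous_at_imp_continuous_on ballI has_derivative_continuous[OF H_has_derivative])

text \<open>Invariance of domain gives openness also at horizon points, where the description of the
  domain through \<open>rstar\<close> breaks down.\<close>

lemma open_zdom:
  assumes "m > 0"
  shows "open (zdom m)"
  unfolding zdom_image[OF assms]
proof (rule invariance_of_domain[OF H_cont open_W])
  show "inj_on (\<lambda>p. (fst p, H m p)) (W m)"
    by (rule inj_on_inverseI[where g = "\<lambda>p. (fst p, zf m p)"])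
      (use zf_left_inverse[OF assms] in auto)
qed

lemma zf_has_derivative:
  assumes "m > 0" "p \<in> zdom m"
  shows "(zf m has_derivative fpair (- HY m (fst p, zf m p) / Hz m (fst p, zf m p)) (1 / Hz m (fst p, zf m p))) (at p)"
proof -
  let ?q = "(fst p, zf m p)"
  let ?g' = "\<lambda>k. (fst k, (snd k - HY m ?q * fst k) / Hz m ?q)"
  note r = zf_right_inverse[OF assms]
  have "((\<lambda>p. (fst p, zf m p)) has_derivative ?g') (at p)"
  proof (rule has_derivative_inverse_strong_x[OF open_W _ H_cont])
    show "((\<lambda>p. (fst p, H m p)) has_derivative (\<lambda>h. (fst h, fpair (HY m ?q) (Hz m ?q) h))) (at (fst p, zf m p))"
      by (intro has_derivative_Pair has_derivative_fst has_derivative_ident H_has_derivative r)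
    show "(\<lambda>h. (fst h, fpair (HY m ?q) (Hz m ?q) h)) \<circ> ?g' = id"
      using Hz_pos[OF r(1)] by (auto simp: fpair_def fun_eq_iff)
  qed (use r zf_left_inverse[OF assms(1)] in auto)
  then have "((\<lambda>p. snd (fst p, zf m p)) has_derivative (\<lambda>k. snd (?g' k))) (at p)"
    by (rule has_derivative_snd)
  then have "(zf m has_derivative (\<lambda>k. (snd k - HY m ?q * fst k) / Hz m ?q)) (at p)" by simp
  then show ?thesis
    by (rule has_derivative_eq_rhs) (auto simp: fpair_def diff_divide_distrib)
qed

text \<open>Both partial derivatives of \<open>zf\<close> are smooth functions of
  \<open>(fst p, zf m p)\<close>, so each order of regularity of \<open>zf\<close> yields the
  next.\<close>

lemma zf_smooth:
  assumes m: "m > 0"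
  shows "smooth_on (zdom m) (zf m)"
proof -
  note o = open_zdom[OF m]
  have "Ck_on k (zdom m) (zf m)" for k
  proof (induction k)
    case 0
    then show ?case
      by (auto intro!: continuous_at_imp_continuous_on has_derivative_continuous[OF zf_has_derivative[OF m]])
  next
    case (Suc k)
    have pr: "Ck_on k (zdom m) (\<lambda>p. (fst p, zf m p))"
      by (intro Ck_on_Pair o Suc Ck_on_bounded_linear bounded_linear_fst)
    have c: "Ck_on k (zdom m) (\<lambda>p. f (fst p, zf m p))" if "smooth_on (W m) f" for f :: "_ \<Rightarrow> real"
    proof (rule Ck_on_compose[OF o open_W])
      show "(\<lambda>p. (fst p, zf m p)) ` zdom m \<subseteq> W m" using zf_right_inverse(1)[OF m] by blast
      show "Ck_on k (W m) f" using that by (simp add: smooth_on_def)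
    qed (rule pr)
    show ?case
    proof (rule Ck_on_fpair[OF o zf_has_derivative[OF m]])
      show "Ck_on k (zdom m) (\<lambda>p. - HY m (fst p, zf m p) / Hz m (fst p, zf m p))"
        by (rule c, intro smooth_on_divide smooth_on_minus open_W HY_smooth Hz_smooth)
          (use Hz_pos in force)
      show "Ck_on k (zdom m) (\<lambda>p. 1 / Hz m (fst p, zf m p))"
        by (rule c, intro smooth_on_divide smooth_on_const open_W HY_smooth Hz_smooth)
          (use Hz_pos in force)
    qed
  qed
  then show ?thesis by (simp add: smooth_on_def)
qed

lemma flow_dom_zdom: "flow_dom m = (\<lambda>p. (fst p - m, snd p)) -` zdom m"
  by (auto simp: zdom_def)

lemma open_flow_dom: "m > 0 \<Longrightarrow> open (flow_dom m)"
  unfolding flow_dom_zdom by (rule open_vimage[OF open_zdom]) (auto intro!: continuous_intros)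

lemma fl_smooth:
  assumes "m > 0"
  shows "smooth_on (flow_dom m) (fl m)"
proof -
  note o = open_flow_dom[OF assms]
  have "smooth_on (flow_dom m) (\<lambda>p. zf m (fst p - m, snd p))"
  proof (rule smooth_on_compose[OF o open_zdom[OF assms] _ _ zf_smooth[OF assms]])
    show "smooth_on (flow_dom m) (\<lambda>p. (fst p - m, snd p))"
      by (intro smooth_on_Pair smooth_on_diff smooth_on_fst smooth_on_snd smooth_on_const o)
  qed (auto simp: flow_dom_zdom)
  then have "smooth_on (flow_dom m) (\<lambda>p. fst p + (fst p - m)\<^sup>2 * zf m (fst p - m, snd p))"
    by (intro smooth_on_add smooth_on_mult smooth_on_power smooth_on_diff smooth_on_fst smooth_on_const o)
  then show ?thesis
  proof (rule smooth_on_cong[OF o, rotated])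
    fix p assume "p \<in> flow_dom m"
    show "fst p + (fst p - m)\<^sup>2 * zf m (fst p - m, snd p) = fl m p"
      by (cases p) (auto simp: zf_def)
  qed
qed

text \<open>Off the horizon, both identities come from differentiating
  \<open>rstar m (fl m (r, \<sigma>)) = rstar m r + \<sigma>\<close>. The second is multiplied
  through by \<open>D m r\<close> so that it persists at \<open>r = m\<close>, where it reads 0 =
  0.\<close>

lemma fl_pd:
  assumes m: "m > 0" and d: "(r, \<sigma>) \<in> flow_dom m"
  shows "pd2 (fl m) (r, \<sigma>) = D m (fl m (r, \<sigma>))"
    "D m r * pd1 (fl m) (r, \<sigma>) = D m (fl m (r, \<sigma>))"
proof -
  let ?\<rho> = "fl m (r, \<sigma>)"
  have fd: "(fl m has_derivative fpair (pd1 (fl m) (r, \<sigma>)) (pd2 (fl m) (r, \<sigma>))) (at (r, \<sigma>))"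
    by (rule smooth_on_has_derivative_pd[OF fl_smooth[OF m] d])
  have d1: "((\<lambda>r. fl m (r, \<sigma>)) has_real_derivative pd1 (fl m) (r, \<sigma>)) (at r)"
    using has_real_derivative_fpair_compose[where f = "fl m" and g = "\<lambda>r. r" and h = "\<lambda>_. \<sigma>" and t = r, OF fd, of 1 UNIV 0] by simp
  have d2: "((\<lambda>\<sigma>. fl m (r, \<sigma>)) has_real_derivative pd2 (fl m) (r, \<sigma>)) (at \<sigma>)"
    using has_real_derivative_fpair_compose[where f = "fl m" and g = "\<lambda>_. r" and h = "\<lambda>\<sigma>. \<sigma>" and t = \<sigma>, OF fd, of 0 UNIV 1] by simp
  have "pd2 (fl m) (r, \<sigma>) = D m ?\<rho> \<and> D m r * pd1 (fl m) (r, \<sigma>) = D m ?\<rho>"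
  proof (cases "r = m")
    case True
    have "((\<lambda>\<sigma>. fl m (r, \<sigma>)) has_real_derivative 0) (at \<sigma>)" using True by simp
    then have "pd2 (fl m) (r, \<sigma>) = 0" using d2 DERIV_unique by blast
    then show ?thesis using True m by (simp add: D_self)
  next
    case False
    have r: "r > 0" using d by (simp add: flow_dom_def)
    note p = fl_props[OF m d False]
    have \<rho>: "?\<rho> \<noteq> m" using p False by auto
    have Dp: "D m ?\<rho> > 0" "D m r > 0" using D_pos p r False \<rho> by auto
    have "open (flow_dom m \<inter> ({..<m} \<union> {m<..}) \<times> UNIV)"
      by (intro open_Int open_flow_dom m open_Times open_Un) auto
    moreover have "(r, \<sigma>) \<in> flow_dom m \<inter> ({..<m} \<union> {m<..}) \<times> UNIV" using d False by auto
    ultimately have "\<exists>S T. open S \<and> open T \<and> (r, \<sigma>) \<in> S \<times> T \<and> S \<times> T \<subseteq> flow_dom m \<inter> ({..<m} \<union> {m<..}) \<times> UNIV"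
      unfolding open_prod_def by blast
    then obtain S T where ST: "open S" "open T" "r \<in> S" "\<sigma> \<in> T"
      and sub: "S \<times> T \<subseteq> flow_dom m \<inter> ({..<m} \<union> {m<..}) \<times> UNIV"
      by blast
    note ch1 = DERIV_chain2[where g = "\<lambda>r. fl m (r, \<sigma>)", OF rstar_deriv[OF p(1) \<rho>] d1]
    note ch2 = DERIV_chain2[where g = "\<lambda>\<sigma>. fl m (r, \<sigma>)", OF rstar_deriv[OF p(1) \<rho>] d2]
    have "((\<lambda>\<sigma>. rstar m r + \<sigma>) has_real_derivative 1 / D m ?\<rho> * pd2 (fl m) (r, \<sigma>)) (at \<sigma>)"
      by (rule has_field_derivative_transform_within_open[OF ch2 ST(2,4)])
        (use fl_props(4)[OF m] sub ST in fastforce)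
    moreover have "((\<lambda>\<sigma>. rstar m r + \<sigma>) has_real_derivative 1) (at \<sigma>)" by (auto intro!: derivative_eq_intros)
    ultimately have 2: "1 / D m ?\<rho> * pd2 (fl m) (r, \<sigma>) = 1" using DERIV_unique by blast
    have "((\<lambda>r. rstar m r + \<sigma>) has_real_derivative 1 / D m ?\<rho> * pd1 (fl m) (r, \<sigma>)) (at r)"
      by (rule has_field_derivative_transform_within_open[OF ch1 ST(1,3)])
        (use fl_props(4)[OF m] sub ST in fastforce)
    moreover have "((\<lambda>r. rstar m r + \<sigma>) has_real_derivative 1 / D m r) (at r)"
      using rstar_deriv[OF r False] by (auto intro!: derivative_eq_intros)
    ultimately have 1: "1 / D m ?\<rho> * pd1 (fl m) (r, \<sigma>) = 1 / D m r" using DERIV_unique by blast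
    from 1 2 Dp show ?thesis by (simp add: field_simps)
  qed
  then show "pd2 (fl m) (r, \<sigma>) = D m ?\<rho>" "D m r * pd1 (fl m) (r, \<sigma>) = D m ?\<rho>" by auto
qed

text \<open>Flowing forth and back is the identity. The group law is needed because
  \<open>fl_pd\<close> leaves the derivative in \<open>r\<close> undetermined on the
  horizon.\<close>

lemma fl_pd1_inverse:
  assumes m: "m > 0" and d: "(r, \<sigma>) \<in> flow_dom m"
  shows "pd1 (fl m) (fl m (r, \<sigma>), - \<sigma>) * pd1 (fl m) (r, \<sigma>) = 1"
proof -
  let ?\<rho> = "fl m (r, \<sigma>)"
  have fd: "(fl m has_derivative fpair (pd1 (fl m) q) (pd2 (fl m) q)) (at q)" if "q \<in> flow_dom m" for q
    by (rule smooth_on_has_derivative_pd[OF fl_smooth[OF m] that])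
  have d1: "((\<lambda>r. fl m (r, \<sigma>)) has_real_derivative pd1 (fl m) (r, \<sigma>)) (at r)"
    using has_real_derivative_fpair_compose[where f = "fl m" and g = "\<lambda>r. r" and h = "\<lambda>_. \<sigma>" and t = r, OF fd[OF d], of 1 UNIV 0] by simp
  have d2: "((\<lambda>r. fl m (fl m (r, \<sigma>), - \<sigma>)) has_real_derivative pd1 (fl m) (?\<rho>, - \<sigma>) * pd1 (fl m) (r, \<sigma>)) (at r)"
    using has_real_derivative_fpair_compose[where f = "fl m" and g = "\<lambda>r. fl m (r, \<sigma>)" and h = "\<lambda>_. - \<sigma>" and t = r,
        OF fd[OF fl_inverse(1)[OF m d]] d1, of 0] by simp
  obtain S T where ST: "open S" "open T" "r \<in> S" "\<sigma> \<in> T" "S \<times> T \<subseteq> flow_dom m"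
    using open_flow_dom[OF m] d open_prod_elim[of _ "(r, \<sigma>)"] by (metis SigmaE2)
  have "((\<lambda>r. r) has_real_derivative pd1 (fl m) (?\<rho>, - \<sigma>) * pd1 (fl m) (r, \<sigma>)) (at r)"
    by (rule has_field_derivative_transform_within_open[OF d2 ST(1,3)])
      (use fl_inverse(2)[OF m] ST in auto)
  then show ?thesis using DERIV_ident DERIV_unique by blast
qed

section \<open>The wave operator on spherically symmetric functions\<close>

lemma smooth_slice1:
  "smooth_on S f \<Longrightarrow> (x, y) \<in> S \<Longrightarrow> ((\<lambda>x. f (x, y)) has_real_derivative pd1 f (x, y)) (at x)"
  using has_real_derivative_fpair_compose[where f = f and g = "\<lambda>x. x" and h = "\<lambda>_. y" and t = x,
      OF smooth_on_has_derivative_pd, of S 1 UNIV 0] by simp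

lemma smooth_slice2:
  "smooth_on S f \<Longrightarrow> (x, y) \<in> S \<Longrightarrow> ((\<lambda>y. f (x, y)) has_real_derivative pd2 f (x, y)) (at y)"
  using has_real_derivative_fpair_compose[where f = f and g = "\<lambda>_. x" and h = "\<lambda>y. y" and t = y,
      OF smooth_on_has_derivative_pd, of S 0 UNIV 1] by simp

lemma open_slices:
  fixes x y :: real
  assumes "open S" "(x, y) \<in> S"
  obtains A B where "open A" "open B" "convex A" "convex B" "x \<in> A" "y \<in> B" "A \<times> B \<subseteq> S"
proof -
  obtain A B where AB: "open A" "open B" "(x, y) \<in> A \<times> B" "A \<times> B \<subseteq> S"
    by (rule open_prod_elim[OF assms])
  have xy: "x \<in> A" "y \<in> B" using AB(3) by auto
  obtain d where d: "d > 0" "ball x d \<subseteq> A" using AB(1) xy(1) open_contains_ball by blast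
  obtain e where e: "e > 0" "ball y e \<subseteq> B" using AB(2) xy(2) open_contains_ball by blast
  have "ball x d \<times> ball y e \<subseteq> S" by (rule order_trans[OF Sigma_mono[OF d(2) e(2)] AB(4)])
  then show ?thesis
    by (rule that[OF open_ball open_ball convex_ball convex_ball centre_in_ball[THEN iffD2, OF d(1)]
          centre_in_ball[THEN iffD2, OF e(1)]])
qed

text \<open>Write \<open>f (x, y)\<close> as \<open>f (a, y)\<close> plus the integral of
  \<open>pd1 f\<close> from \<open>a\<close> to \<open>x\<close>, differentiate under the integral
  in \<open>y\<close>, and then in \<open>x\<close> at \<open>a\<close>.\<close>

lemma pd_mixed_symmetric:
  assumes S: "open S" "smooth_on S f" "p \<in> S"
  shows "pd1 (pd2 f) p = pd2 (pd1 f) p"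
proof -
  obtain a y where p: "p = (a, y)" by (cases p)
  obtain A B where AB: "open A" "open B" "convex A" "convex B" "a \<in> A" "y \<in> B" "A \<times> B \<subseteq> S"
    using open_slices S p by metis
  have sm: "smooth_on (A \<times> B) f" by (rule smooth_on_subset[OF S(2) AB(7)])
  note s1 = smooth_on_pd(1)[OF sm] and s2 = smooth_on_pd(2)[OF sm]
  note s12 = smooth_on_pd(2)[OF s1]
  note c = smooth_on_imp_continuous_on
  have eq: "f (x, y') = f (a, y') + I1 a (pd1 f) (x, y')" if xy: "x \<in> A" "y' \<in> B" for x y'
  proof -
    have "((\<lambda>x. f (x, y') - I1 a (pd1 f) (x, y')) has_field_derivative 0) (at x within A)" if "x \<in> A" for x
      using DERIV_diff[OF smooth_slice1[OF sm, of x y'] I1_deriv1[OF c[OF s1] AB(3,1,5), of x y']] that xy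
      by (auto intro: has_field_derivative_at_within)
    from has_field_derivative_zero_constant[OF AB(3) this]
    obtain k where "\<And>x. x \<in> A \<Longrightarrow> f (x, y') - I1 a (pd1 f) (x, y') = k" by blast
    from this[OF xy(1)] this[OF AB(5)] show ?thesis by (simp add: I1_def)
  qed
  have eq2: "pd2 f (x, y) = pd2 f (a, y) + I1 a (pd2 (pd1 f)) (x, y)" if x: "x \<in> A" for x
  proof -
    have "((\<lambda>y. f (a, y) + I1 a (pd1 f) (x, y)) has_real_derivative pd2 f (a, y) + I1 a (pd2 (pd1 f)) (x, y)) (at y)"
      using AB x
      by (intro DERIV_add smooth_slice2[OF sm] I1_deriv2[OF c[OF s1] c[OF s12]] smooth_slice2[OF s1]) auto
    then have "((\<lambda>y. f (x, y)) has_real_derivative pd2 f (a, y) + I1 a (pd2 (pd1 f)) (x, y)) (at y)"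
      by (rule has_field_derivative_transform_within_open[OF _ AB(2,6)]) (use eq[OF x] in auto)
    then show ?thesis using DERIV_unique[OF smooth_slice2[OF sm]] x AB by blast
  qed
  have "((\<lambda>x. pd2 f (a, y) + I1 a (pd2 (pd1 f)) (x, y)) has_real_derivative 0 + pd2 (pd1 f) (a, y)) (at a)"
    using AB by (intro DERIV_add DERIV_const I1_deriv1[OF c[OF s12]]) auto
  then have "((\<lambda>x. pd2 f (x, y)) has_real_derivative 0 + pd2 (pd1 f) (a, y)) (at a)"
    by (rule has_field_derivative_transform_within_open[OF _ AB(1,5)]) (use eq2 in auto)
  then show ?thesis using DERIV_unique[OF smooth_slice1[OF s2]] p AB by fastforce
qed

section \<open>Inverse metric and volume element in the Cartesian charts\<close>

lemma spat_nth [simp]: "spat q $ 1 = q $ 2" "spat q $ 2 = q $ 3" "spat q $ 3 = q $ 4"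
  by (simp_all add: spat_def)

lemma linear_spat: "bounded_linear spat"
  unfolding linear_conv_bounded_linear[symmetric]
  by (rule linearI) (auto simp: vec_eq_iff forall_3)

lemma inner_3: "(x :: real^3) \<bullet> y = x $ 1 * y $ 1 + x $ 2 * y $ 2 + x $ 3 * y $ 3"
  by (simp add: inner_vec_def sum_3)

lemma rad_square: "(rad q)\<^sup>2 = (q $ 2)\<^sup>2 + (q $ 3)\<^sup>2 + (q $ 4)\<^sup>2"
  by (simp add: rad_def power2_norm_eq_inner inner_3) (simp add: power2_eq_square)

lemma rad_pos: "q \<in> chart_dom \<Longrightarrow> rad q > 0"
  by (simp add: chart_dom_def rad_def)

lemma radial_unit:
  assumes "q \<in> chart_dom"
  shows "q $ 2 / rad q * (q $ 2 / rad q) + q $ 3 / rad q * (q $ 3 / rad q) + q $ 4 / rad q * (q $ 4 / rad q) = 1"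
proof -
  have "((q $ 2)\<^sup>2 + (q $ 3)\<^sup>2 + (q $ 4)\<^sup>2) / (rad q)\<^sup>2 = 1"
    using rad_pos[OF assms] by (simp flip: rad_square)
  then show ?thesis by (simp add: add_divide_distrib power2_eq_square)
qed

lemma open_chart_dom: "open chart_dom"
proof -
  have "chart_dom = spat -` (- {0})" by (auto simp: chart_dom_def)
  then show ?thesis
    using open_vimage[of "- {0 :: real^3}" spat] linear_continuous_on[OF linear_spat] by auto
qed

lemma radial_part_alt: "radial_part q X = (q $ 2 * X $ 2 + q $ 3 * X $ 3 + q $ 4 * X $ 4) / rad q"
  by (simp add: radial_part_def inner_3)

lemma rad_has_derivative:
  assumes "q \<in> chart_dom"
  shows "(rad has_derivative radial_part q) (at q)"
proof -
  have "((\<lambda>q. norm (spat q)) has_derivative (\<lambda>X. spat X \<bullet> sgn (spat q))) (at q)"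
    by (rule has_derivative_compose[OF bounded_linear_imp_has_derivative[OF linear_spat] has_derivative_norm])
      (use assms in \<open>auto simp: chart_dom_def\<close>)
  then show ?thesis
    unfolding rad_def[abs_def, symmetric]
    by (rule has_derivative_eq_rhs)
      (auto simp: radial_part_def rad_def sgn_div_norm inner_commute divide_inverse)
qed

lemma continuous_on_rad: "continuous_on S rad"
  unfolding rad_def by (intro continuous_intros linear_continuous_on[OF linear_spat, THEN continuous_on_subset]) auto

lemma rad_smooth: "smooth_on chart_dom rad"
proof -
  have "smooth_on chart_dom (\<lambda>q. sqrt ((q $ 2)\<^sup>2 + (q $ 3)\<^sup>2 + (q $ 4)\<^sup>2))"
  proof (rule smooth_on_compose[OF open_chart_dom open_greaterThan _ _ smooth_on_sqrt])
    show "smooth_on chart_dom (\<lambda>q. (q $ 2)\<^sup>2 + (q $ 3)\<^sup>2 + (q $ 4)\<^sup>2)"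
      by (intro smooth_on_add smooth_on_power open_chart_dom smooth_on_bounded_linear bounded_linear_vec_nth)
    show "(\<lambda>q. (q $ 2)\<^sup>2 + (q $ 3)\<^sup>2 + (q $ 4)\<^sup>2) ` chart_dom \<subseteq> {0<..}"
      using rad_pos rad_square by (metis (mono_tags, lifting) greaterThan_iff image_subsetI zero_less_power)
  qed
  then show ?thesis
    by (rule smooth_on_cong[OF open_chart_dom, rotated])
      (use rad_pos in \<open>auto simp: rad_square[symmetric] less_imp_le\<close>)
qed

lemma spherical_has_derivative:
  assumes "q \<in> chart_dom" "(f has_derivative fpair a b) (at (q $ 1, rad q))"
  shows "((\<lambda>q. f (q $ 1, rad q)) has_derivative (\<lambda>X. a * X $ 1 + b * radial_part q X)) (at q)"
proof -
  have "((\<lambda>q. (q $ 1, rad q)) has_derivative (\<lambda>X. (X $ 1, radial_part q X))) (at q)"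
    by (intro has_derivative_Pair rad_has_derivative assms bounded_linear_imp_has_derivative bounded_linear_vec_nth)
  from has_derivative_compose[OF this assms(2)] show ?thesis by (simp add: fpair_def)
qed

lemma orient_square [simp]: "orient n * orient n = 1"
  by (simp add: orient_def)

lemma orient_mult_orient [simp]: "orient n * (orient n * x) = x"
  by (simp add: orient_def)

text \<open>As a tensor: \<open>orient n\<close> times the symmetrized product of
  \<open>\<partial>\<^sub>s\<close> and \<open>\<partial>\<^sub>r\<close>, plus \<open>D\<close>
  times the square of \<open>\<partial>\<^sub>r\<close>, plus the flat inverse metric on the
  directions tangent to the spheres.\<close>

definition inv_gram :: "real \<Rightarrow> int \<Rightarrow> real^4 \<Rightarrow> real^4^4" where
  "inv_gram m n q = (\<chi> i j.
     orient n * ((axis i 1 :: real^4) $ 1 * radial_part q (axis j 1) + radial_part q (axis i 1) * (axis j 1 :: real^4) $ 1)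
     + (D m (rad q) - 1) * radial_part q (axis i 1) * radial_part q (axis j 1)
     + spat (axis i 1) \<bullet> spat (axis j 1))"

lemma det_4:
  "det (A :: 'a::comm_ring_1^4^4) =
     A$1$1 * (A$2$2 * (A$3$3 * A$4$4 - A$3$4 * A$4$3) - A$2$3 * (A$3$2 * A$4$4 - A$3$4 * A$4$2) + A$2$4 * (A$3$2 * A$4$3 - A$3$3 * A$4$2))
   - A$1$2 * (A$2$1 * (A$3$3 * A$4$4 - A$3$4 * A$4$3) - A$2$3 * (A$3$1 * A$4$4 - A$3$4 * A$4$1) + A$2$4 * (A$3$1 * A$4$3 - A$3$3 * A$4$1))
   + A$1$3 * (A$2$1 * (A$3$2 * A$4$4 - A$3$4 * A$4$2) - A$2$2 * (A$3$1 * A$4$4 - A$3$4 * A$4$1) + A$2$4 * (A$3$1 * A$4$2 - A$3$2 * A$4$1))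
   - A$1$4 * (A$2$1 * (A$3$2 * A$4$3 - A$3$3 * A$4$2) - A$2$2 * (A$3$1 * A$4$3 - A$3$3 * A$4$1) + A$2$3 * (A$3$1 * A$4$2 - A$3$2 * A$4$1))"
proof -
  have f1: "finite {2::4, 3, 4}" "1 \<notin> {2::4, 3, 4}" by auto
  have f2: "finite {3::4, 4}" "2 \<notin> {3::4, 4}" by auto
  have f3: "finite {4::4}" "3 \<notin> {4::4}" by auto
  show ?thesis
    unfolding det_def UNIV_4
    unfolding sum_over_permutations_insert[OF f1] sum_over_permutations_insert[OF f2] sum_over_permutations_insert[OF f3]
    unfolding permutes_sing
    by (simp add: sign_swap_id permutation_swap_id sign_compose permutation_compose sign_id swap_id_eq)
      (simp add: algebra_simps)
qed

text \<open>The coordinates \<open>x = r \<omega>\<close> absorb the factor \<open>r\<^sup>2\<close>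
  of the spheres, so the volume element is that of flat space and the wave operator becomes a plain
  divergence.\<close>

lemma gram_facts:
  assumes "q \<in> chart_dom"
  shows "gram (ern_metric m n) q ** inv_gram m n q = mat 1" "inv_gram m n q ** gram (ern_metric m n) q = mat 1"
    "det (gram (ern_metric m n) q) = - 1"
proof -
  define a b c where "a = q $ 2 / rad q" and "b = q $ 3 / rad q" and "c = q $ 4 / rad q"
  have abc: "a * a + b * b + c * c = 1"
    unfolding a_def b_def c_def by (rule radial_unit[OF assms])
  \<comment> \<open>\<open>(a, b, c)\<close> is a unit vector; these two equations eliminate every
    square of \<open>c\<close>, so that identities modulo the sphere relation become polynomial
    identities.\<close>
  have c2: "c * c = 1 - a * a - b * b" using abc by simp
  have c2': "c * (c * x) = x - a * a * x - b * b * x" for x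
    using c2 by (metis (no_types, opaque_lifting) left_diff_distrib mult.assoc mult_1)
  define d o1 where "d = D m (rad q)" and "o1 = orient n"
  have oo: "o1 * o1 = 1" "\<And>x. o1 * (o1 * x) = x" by (simp_all add: o1_def)
  have rp: "radial_part q (axis 1 1) = 0" "radial_part q (axis 2 1) = a" "radial_part q (axis 3 1) = b"
    "radial_part q (axis 4 1) = c"
    by (simp_all add: radial_part_alt axis_def a_def b_def c_def)
  show "gram (ern_metric m n) q ** inv_gram m n q = mat 1"
    by (simp add: vec_eq_iff forall_4 matrix_matrix_mult_def mat_def sum_4 gram_def ern_metric_def inv_gram_def
        rp inner_3 d_def[symmetric] o1_def[symmetric])
      (simp add: axis_def algebra_simps oo c2 c2')
  show "inv_gram m n q ** gram (ern_metric m n) q = mat 1"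
    by (simp add: vec_eq_iff forall_4 matrix_matrix_mult_def mat_def sum_4 gram_def ern_metric_def inv_gram_def
        rp inner_3 d_def[symmetric] o1_def[symmetric])
      (simp add: axis_def algebra_simps oo c2 c2')
  show "det (gram (ern_metric m n) q) = - 1"
    by (simp add: det_4 gram_def ern_metric_def rp inner_3 d_def[symmetric] o1_def[symmetric])
      (simp add: axis_def algebra_simps oo c2 c2')
qed

lemma matrix_inv_eqI:
  assumes "A ** B = mat 1" "B ** A = mat 1"
  shows "matrix_inv (A :: real^'n^'n) = B"
proof -
  have "A ** matrix_inv A = mat 1 \<and> matrix_inv A ** A = mat 1"
    unfolding matrix_inv_def by (rule someI[of _ B]) (use assms in simp)
  then have "matrix_inv A = matrix_inv A ** (A ** B)" using assms by simp
  also have "\<dots> = B" using \<open>A ** matrix_inv A = mat 1 \<and> matrix_inv A ** A = mat 1\<close> by (simp add: matrix_mul_assoc)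
  finally show ?thesis .
qed

lemma matrix_inv_gram: "q \<in> chart_dom \<Longrightarrow> matrix_inv (gram (ern_metric m n) q) = inv_gram m n q"
  by (intro matrix_inv_eqI gram_facts)

section \<open>Reduction to the radial equation for \<open>P = r u\<close>\<close>

definition D1 :: "real \<Rightarrow> real \<Rightarrow> real" where
  "D1 m r = 2 * m / r\<^sup>2 - 2 * m\<^sup>2 / r ^ 3"

lemma D_has_derivative: "r \<noteq> 0 \<Longrightarrow> (D m has_real_derivative D1 m r) (at r)"
  unfolding D_def[abs_def] D1_def
  by (rule derivative_eq_intros refl | simp)+ (simp add: field_simps power2_eq_square power3_eq_cube power4_eq_xxxx)

lemma D_smooth: "smooth_on (- {0}) (D m)" and D1_smooth: "smooth_on (- {0}) (D1 m)"
  unfolding D_def[abs_def] D1_def[abs_def]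
  by (intro smooth_on_add smooth_on_diff smooth_on_divide smooth_on_power smooth_on_const smooth_on_ident smooth_on_mult; force)+

text \<open>The factor \<open>r\<close> in \<open>P = r u\<close> removes the term with a single
  derivative in the null coordinate and leaves the potential \<open>D1 / r\<close>. The sign
  \<open>s\<close> is the orientation of the chart.\<close>

definition radial_wave :: "real \<Rightarrow> real \<Rightarrow> (real \<times> real \<Rightarrow> real) \<Rightarrow> real \<times> real \<Rightarrow> bool" where
  "radial_wave m s P p \<longleftrightarrow>
     2 * s * pd2 (pd1 P) p + D m (snd p) * pd2 (pd2 P) p + D1 m (snd p) * pd2 P p = D1 m (snd p) / snd p * P p"

lemma quotient_pd:
  assumes O: "open S" "S \<subseteq> {p. snd p > 0}" "smooth_on S P"
  defines "f \<equiv> \<lambda>p. P p / snd p"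
  shows "smooth_on S f" "\<And>p. p \<in> S \<Longrightarrow> pd1 f p = pd1 P p / snd p"
    "\<And>p. p \<in> S \<Longrightarrow> pd2 f p = pd2 P p / snd p - P p / (snd p)\<^sup>2"
proof -
  show sf: "smooth_on S f"
    unfolding f_def by (intro smooth_on_divide smooth_on_snd O) (use O in auto)
  fix p assume p: "p \<in> S"
  obtain s r where sr: "p = (s, r)" "r > 0" using p O(2) by (cases p) auto
  have "((\<lambda>s. f (s, r)) has_real_derivative pd1 P p / r) (at s)"
    unfolding f_def using smooth_slice1[OF O(3)] p sr by (auto intro!: derivative_eq_intros)
  then show "pd1 f p = pd1 P p / snd p" using DERIV_unique smooth_slice1[OF sf] p sr by fastforce
  have "((\<lambda>r. f (s, r)) has_real_derivative (pd2 P p * r - P p) / (r * r)) (at r)"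
    unfolding f_def using smooth_slice2[OF O(3)] p sr by (auto intro!: derivative_eq_intros)
  moreover have "(pd2 P p * r - P p) / (r * r) = pd2 P p / r - P p / r\<^sup>2"
    using sr by (simp add: field_simps power2_eq_square)
  ultimately show "pd2 f p = pd2 P p / snd p - P p / (snd p)\<^sup>2"
    using DERIV_unique smooth_slice2[OF sf] p sr by fastforce
qed

lemma spherical_differential:
  assumes T: "open T" "q \<in> T" "T \<subseteq> chart_dom" "\<And>q. q \<in> T \<Longrightarrow> u q = complex_of_real (f (q $ 1, rad q))"
    and "(f has_derivative fpair a b) (at (q $ 1, rad q))"
  shows "differential u q X = complex_of_real (a * X $ 1 + b * radial_part q X)"
proof -
  have "((\<lambda>q. f (q $ 1, rad q)) has_derivative (\<lambda>X. a * X $ 1 + b * radial_part q X)) (at q)"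
    using assms by (intro spherical_has_derivative) auto
  then have "((\<lambda>q. complex_of_real (f (q $ 1, rad q))) has_derivative (\<lambda>X. complex_of_real (a * X $ 1 + b * radial_part q X))) (at q)"
    by (rule has_derivative_of_real)
  then have "(u has_derivative (\<lambda>X. complex_of_real (a * X $ 1 + b * radial_part q X))) (at q)"
    by (rule has_derivative_transform_within_open[OF _ T(1,2)]) (use T in auto)
  from frechet_derivative_at[OF this] show ?thesis by (simp add: differential_def fun_eq_iff)
qed

text \<open>The gradient of \<open>f\<close> has the component \<open>orient n * pd2 f\<close> in
  the null direction and is otherwise a radial field of strength \<open>B\<close>. The divergence of
  the latter is \<open>pd2 B + 2 * B / r\<close>; multiplying the total by \<open>r\<close> gives
  the radial equation.\<close>

lemma spherical_wave:
  assumes T: "open T" "T \<subseteq> chart_dom" "\<And>q. q \<in> T \<Longrightarrow> u q = complex_of_real (P (q $ 1, rad q) / rad q)"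
    and S: "open S" "S \<subseteq> {p. snd p > 0}" "smooth_on S P" "\<And>q. q \<in> T \<Longrightarrow> (q $ 1, rad q) \<in> S"
  shows "smooth_on T u"
    and "q \<in> T \<Longrightarrow> radial_wave m (orient n) P (q $ 1, rad q) \<Longrightarrow> box (ern_metric m n) u q = 0"
proof -
  define f where "f = (\<lambda>p. P p / snd p)"
  note qp = quotient_pd[OF S(1-3), folded f_def]
  have uf: "u q = complex_of_real (f (q $ 1, rad q))" if "q \<in> T" for q
    using T(3)[OF that] by (simp add: f_def)
  have co: "smooth_on T (\<lambda>q. (q $ 1, rad q))"
    by (intro smooth_on_Pair smooth_on_bounded_linear bounded_linear_vec_nth T(1) smooth_on_subset[OF rad_smooth T(2)])
  have "smooth_on T (\<lambda>q. complex_of_real (f (q $ 1, rad q)))"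
    by (intro smooth_on_bounded_linear_compose[OF T(1) bounded_linear_of_real]
        smooth_on_compose[OF T(1) S(1) _ co qp(1)]) (use S(4) in auto)
  then show "smooth_on T u" by (rule smooth_on_cong[OF T(1), rotated]) (use uf in auto)
  assume q: "q \<in> T" and rw: "radial_wave m (orient n) P (q $ 1, rad q)"
  define s r where "s = q $ 1" and "r = rad q"
  define o1 where "o1 = orient n"
  define B where "B = (\<lambda>p. o1 * pd1 f p + D m (snd p) * pd2 f p)"
  have qd: "q \<in> chart_dom" using q T by auto
  have rp: "r > 0" using rad_pos[OF qd] by (simp add: r_def)
  have srS: "(s, r) \<in> S" using S(4)[OF q] by (simp add: s_def r_def)
  note sf1 = smooth_on_pd(1)[OF qp(1)] and sf2 = smooth_on_pd(2)[OF qp(1)]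
  have sB: "smooth_on S B"
    unfolding B_def
    by (intro smooth_on_add smooth_on_mult smooth_on_const sf1 sf2 S(1)
        smooth_on_compose[OF S(1) _ _ smooth_on_snd[OF S(1)] D_smooth])
      (use S(2) in auto)
  \<comment> \<open>The components of the gradient raised with \<open>inv_gram\<close>; the index 1
    is the null coordinate.\<close>
  define V where "V = (\<lambda>(i::4) q. if i = 1 then o1 * pd2 f (q $ 1, rad q) else q $ i / rad q * B (q $ 1, rad q))"
  have flux: "(\<Sum>j\<in>UNIV. (sqrt \<bar>det (gram (ern_metric m n) q)\<bar> * matrix_inv (gram (ern_metric m n) q) $ i $ j) *\<^sub>R
               differential u q (axis j 1)) = complex_of_real (V i q)" if qT: "q \<in> T" for i q
  proof -
    have qd: "q \<in> chart_dom" using qT T by auto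
    let ?a = "pd1 f (q $ 1, rad q)" and ?b = "pd2 f (q $ 1, rad q)"
    have dif: "differential u q X = complex_of_real (?a * X $ 1 + ?b * radial_part q X)" for X
      by (rule spherical_differential[OF T(1) qT T(2) uf smooth_on_has_derivative_pd[OF qp(1) S(4)[OF qT]]])
    define a b c where "a = q $ 2 / rad q" and "b = q $ 3 / rad q" and "c = q $ 4 / rad q"
    have abc: "a * a + b * b + c * c = 1"
      unfolding a_def b_def c_def by (rule radial_unit[OF qd])
    have c2: "c * c = 1 - a * a - b * b" using abc by simp
    have c2': "c * (c * x) = x - a * a * x - b * b * x" for x
      using c2 by (metis (no_types, opaque_lifting) left_diff_distrib mult.assoc mult_1)
    have rp: "radial_part q (axis 1 1) = 0" "radial_part q (axis 2 1) = a" "radial_part q (axis 3 1) = b"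
      "radial_part q (axis 4 1) = c"
      by (simp_all add: radial_part_alt axis_def a_def b_def c_def)
    have "\<forall>i. (\<Sum>j\<in>UNIV. inv_gram m n q $ i $ j * (?a * (axis j 1 :: real^4) $ 1 + ?b * radial_part q (axis j 1))) = V i q"
      by (simp add: forall_4 V_def B_def inv_gram_def sum_4 rp inner_3 o1_def a_def[symmetric] b_def[symmetric] c_def[symmetric])
        (simp add: axis_def algebra_simps c2 c2')
    then have "(\<Sum>j\<in>UNIV. inv_gram m n q $ i $ j * (?a * (axis j 1 :: real^4) $ 1 + ?b * radial_part q (axis j 1))) = V i q"
      by blast
    then have "complex_of_real (\<Sum>j\<in>UNIV. inv_gram m n q $ i $ j * (?a * (axis j 1 :: real^4) $ 1 + ?b * radial_part q (axis j 1))) = complex_of_real (V i q)"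
      by simp
    then show ?thesis
      by (simp add: matrix_inv_gram[OF qd] gram_facts(3)[OF qd] dif scaleR_conv_of_real)
  qed
  have frV: "frechet_derivative (\<lambda>q. \<Sum>j\<in>UNIV. (sqrt \<bar>det (gram (ern_metric m n) q)\<bar> * matrix_inv (gram (ern_metric m n) q) $ i $ j) *\<^sub>R
               differential u q (axis j 1)) (at q) X = complex_of_real (V' X)"
    if "(V i has_derivative V') (at q)" for i V' X
  proof -
    have "((\<lambda>q. complex_of_real (V i q)) has_derivative (\<lambda>X. complex_of_real (V' X))) (at q)"
      using that by (rule has_derivative_of_real)
    then have "((\<lambda>q. \<Sum>j\<in>UNIV. (sqrt \<bar>det (gram (ern_metric m n) q)\<bar> * matrix_inv (gram (ern_metric m n) q) $ i $ j) *\<^sub>R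
               differential u q (axis j 1)) has_derivative (\<lambda>X. complex_of_real (V' X))) (at q)"
      by (rule has_derivative_transform_within_open[OF _ T(1) q]) (use flux in auto)
    from frechet_derivative_at[OF this] show ?thesis by (simp add: fun_eq_iff)
  qed
  have sd: "((\<lambda>q. g (q $ 1, rad q)) has_derivative (\<lambda>X. pd1 g (s, r) * X $ 1 + pd2 g (s, r) * radial_part q X)) (at q)"
    if "smooth_on S g" for g
    unfolding s_def r_def
    by (rule spherical_has_derivative[OF qd smooth_on_has_derivative_pd[OF that S(4)[OF q]]])
  have V1: "(V 1 has_derivative (\<lambda>X. o1 * (pd1 (pd2 f) (s, r) * X $ 1 + pd2 (pd2 f) (s, r) * radial_part q X))) (at q)"
    using has_derivative_mult_right[OF sd[OF sf2]] by (simp add: V_def)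
  have Vi: "(V i has_derivative (\<lambda>X. q $ i / r * (pd1 B (s, r) * X $ 1 + pd2 B (s, r) * radial_part q X)
      + (X $ i * r - q $ i * radial_part q X) / (r * r) * B (s, r))) (at q)"
    if "i \<noteq> 1" for i
  proof -
    have "((\<lambda>q. q $ i / rad q) has_derivative (\<lambda>X. (X $ i * r - q $ i * radial_part q X) / (r * r))) (at q)"
      unfolding r_def using rad_pos[OF qd]
      by (intro has_derivative_divide' bounded_linear_imp_has_derivative bounded_linear_vec_nth rad_has_derivative qd) auto
    from has_derivative_mult[OF this sd[OF sB]] show ?thesis
      using that by (simp add: V_def r_def s_def)
  qed
  have box: "box (ern_metric m n) u q =
      complex_of_real (o1 * pd1 (pd2 f) (s, r) + pd2 B (s, r) + 2 * B (s, r) / r)"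
  proof -
    have rs: "r * r = q $ 2 * q $ 2 + q $ 3 * q $ 3 + q $ 4 * q $ 4"
      using rad_square[of q] by (simp add: r_def power2_eq_square)
    have ax: "(axis 1 1 :: real^4) $ 1 = 1" "(axis 2 1 :: real^4) $ 2 = 1" "(axis 3 1 :: real^4) $ 3 = 1" "(axis 4 1 :: real^4) $ 4 = 1"
      "(axis 2 1 :: real^4) $ 1 = 0" "(axis 3 1 :: real^4) $ 1 = 0" "(axis 4 1 :: real^4) $ 1 = 0"
      by (simp_all add: axis_def)
    have rp': "radial_part q (axis 1 1) = 0" "radial_part q (axis 2 1) = q $ 2 / r" "radial_part q (axis 3 1) = q $ 3 / r"
      "radial_part q (axis 4 1) = q $ 4 / r"
      by (simp_all add: radial_part_alt axis_def r_def)
    have term_i: "x / r * (pd2 B (s, r) * (x / r)) + (1 * r - x * (x / r)) / (r * r) * B (s, r)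
        = x * x / (r * r) * pd2 B (s, r) + (1 / r - x * x / (r * r) / r) * B (s, r)" for x
      using rp by (simp add: field_simps)
    have "q $ 2 * q $ 2 / (r * r) + q $ 3 * q $ 3 / (r * r) + q $ 4 * q $ 4 / (r * r) = 1"
      using rp by (simp add: add_divide_distrib[symmetric] rs[symmetric])
    moreover define x2 x3 x4 where x: "x2 = q $ 2 * q $ 2 / (r * r)" "x3 = q $ 3 * q $ 3 / (r * r)" "x4 = q $ 4 * q $ 4 / (r * r)"
    ultimately have xs: "x4 = 1 - x2 - x3" by linarith
    have "(x2 * pd2 B (s, r) + (1 / r - x2 / r) * B (s, r)) + (x3 * pd2 B (s, r) + (1 / r - x3 / r) * B (s, r))
        + (x4 * pd2 B (s, r) + (1 / r - x4 / r) * B (s, r)) = pd2 B (s, r) + 2 * B (s, r) / r"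
      unfolding xs by (simp add: algebra_simps diff_divide_distrib add_divide_distrib)
    note total = this
    define V' where "V' = (\<lambda>i::4. if i = 1 then (\<lambda>X. o1 * (pd1 (pd2 f) (s, r) * X $ 1 + pd2 (pd2 f) (s, r) * radial_part q X))
      else (\<lambda>X. q $ i / r * (pd1 B (s, r) * X $ 1 + pd2 B (s, r) * radial_part q X)
      + (X $ i * r - q $ i * radial_part q X) / (r * r) * B (s, r)))"
    have "(V i has_derivative V' i) (at q)" for i using V1 Vi by (simp add: V'_def)
    then have "box (ern_metric m n) u q = (1 / sqrt \<bar>det (gram (ern_metric m n) q)\<bar>) *\<^sub>R (\<Sum>i\<in>UNIV. complex_of_real (V' i (axis i 1)))"
      unfolding box_def by (intro arg_cong2[where f = "(*\<^sub>R)"] sum.cong refl frV)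
    also have "\<dots> = complex_of_real (\<Sum>i\<in>UNIV. V' i (axis i 1))" by (simp add: gram_facts(3)[OF qd])
    also have "(\<Sum>i\<in>UNIV. V' i (axis i 1)) = o1 * pd1 (pd2 f) (s, r) +
        ((x2 * pd2 B (s, r) + (1 / r - x2 / r) * B (s, r)) + (x3 * pd2 B (s, r) + (1 / r - x3 / r) * B (s, r))
        + (x4 * pd2 B (s, r) + (1 / r - x4 / r) * B (s, r)))"
      unfolding x term_i[symmetric] by (simp add: sum_4 V'_def ax rp')
    finally show ?thesis unfolding total by (simp add: add.assoc)
  qed
  have f2s: "((\<lambda>s. pd2 P (s, r) / r - P (s, r) / r\<^sup>2) has_real_derivative pd1 (pd2 P) (s, r) / r - pd1 P (s, r) / r\<^sup>2) (at s)"
    by (intro DERIV_diff DERIV_cdivide smooth_slice1[OF smooth_on_pd(2)[OF S(3)] srS] smooth_slice1[OF S(3) srS])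
  obtain U1 U2 where U: "open U1" "open U2" "s \<in> U1" "r \<in> U2" "U1 \<times> U2 \<subseteq> S"
    using open_slices[OF S(1) srS] by metis
  have "((\<lambda>s. pd2 f (s, r)) has_real_derivative pd1 (pd2 P) (s, r) / r - pd1 P (s, r) / r\<^sup>2) (at s)"
    by (rule has_field_derivative_transform_within_open[OF f2s U(1,3)]) (use U qp(3) in auto)
  then have e1: "pd1 (pd2 f) (s, r) = pd1 (pd2 P) (s, r) / r - pd1 P (s, r) / r\<^sup>2"
    using DERIV_unique smooth_slice1[OF sf2 srS] by blast
  have dD: "(D m has_real_derivative D1 m r) (at r)" using rp by (intro D_has_derivative) auto
  have sq: "((\<lambda>r::real. r\<^sup>2) has_real_derivative 2 * r) (at r)" by (auto intro!: derivative_eq_intros)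
  have q1: "((\<lambda>r. pd1 P (s, r) / r) has_real_derivative (pd2 (pd1 P) (s, r) * r - pd1 P (s, r)) / (r * r)) (at r)"
    using DERIV_divide[OF smooth_slice2[OF smooth_on_pd(1)[OF S(3)] srS] DERIV_ident] rp by simp
  have q2: "((\<lambda>r. pd2 P (s, r) / r) has_real_derivative (pd2 (pd2 P) (s, r) * r - pd2 P (s, r)) / (r * r)) (at r)"
    using DERIV_divide[OF smooth_slice2[OF smooth_on_pd(2)[OF S(3)] srS] DERIV_ident] rp by simp
  have q3: "((\<lambda>r. P (s, r) / r\<^sup>2) has_real_derivative (pd2 P (s, r) * r\<^sup>2 - P (s, r) * (2 * r)) / (r\<^sup>2 * r\<^sup>2)) (at r)"
    using DERIV_divide[OF smooth_slice2[OF S(3) srS] sq] rp by simp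
  note Br = DERIV_add[OF DERIV_cmult[OF q1, of o1] DERIV_mult'[OF dD DERIV_diff[OF q2 q3]]]
  have "((\<lambda>r. B (s, r)) has_real_derivative
      o1 * ((pd2 (pd1 P) (s, r) * r - pd1 P (s, r)) / (r * r)) +
      (D m r * ((pd2 (pd2 P) (s, r) * r - pd2 P (s, r)) / (r * r) - (pd2 P (s, r) * r\<^sup>2 - P (s, r) * (2 * r)) / (r\<^sup>2 * r\<^sup>2))
       + D1 m r * (pd2 P (s, r) / r - P (s, r) / r\<^sup>2))) (at r)"
    by (rule has_field_derivative_transform_within_open[OF Br U(2,4)]) (use U qp in \<open>auto simp: B_def subset_iff\<close>)
  then have e2: "pd2 B (s, r) = o1 * ((pd2 (pd1 P) (s, r) * r - pd1 P (s, r)) / (r * r)) +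
      (D m r * ((pd2 (pd2 P) (s, r) * r - pd2 P (s, r)) / (r * r) - (pd2 P (s, r) * r\<^sup>2 - P (s, r) * (2 * r)) / (r\<^sup>2 * r\<^sup>2))
       + D1 m r * (pd2 P (s, r) / r - P (s, r) / r\<^sup>2))"
    using DERIV_unique smooth_slice2[OF sB srS] by blast
  have e3: "B (s, r) = o1 * (pd1 P (s, r) / r) + D m r * (pd2 P (s, r) / r - P (s, r) / r\<^sup>2)"
    using qp(2,3)[OF srS] by (simp add: B_def)
  have "r * (o1 * pd1 (pd2 f) (s, r) + pd2 B (s, r) + 2 * B (s, r) / r)
     = 2 * o1 * pd2 (pd1 P) (s, r) + D m r * pd2 (pd2 P) (s, r) + D1 m r * pd2 P (s, r) - D1 m r / r * P (s, r)"
    unfolding e1 e2 e3 pd_mixed_symmetric[OF S(1,3) srS]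
    using rp by (simp add: field_simps power2_eq_square)
  also have "\<dots> = 0" using rw by (simp add: radial_wave_def s_def r_def o1_def)
  finally have "o1 * pd1 (pd2 f) (s, r) + pd2 B (s, r) + 2 * B (s, r) / r = 0" using rp by simp
  then show "box (ern_metric m n) u q = 0" by (simp add: box)
qed

section \<open>Extension of a radial solution to the chain of regions\<close>

fun lift :: "real \<Rightarrow> (real \<times> real \<Rightarrow> real) \<Rightarrow> ern \<Rightarrow> complex" where
  "lift m P (Region k t x) =
     (if k = 0 \<or> k = 1 then complex_of_real (P (t + rstar m (norm x), norm x) / norm x) else 0)"
| "lift m P (Horizon k v x) = (if k = 0 then complex_of_real (P (v, norm x) / norm x) else 0)"

lemma radial_wave_zero: "radial_wave m s (\<lambda>_. 0) p"
  by (simp add: radial_wave_def pd1_def[abs_def] pd2_def[abs_def])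

lemma rstar_smooth: "smooth_on ({0<..} - {m}) (rstar m)"
proof (rule smooth_on_real_derivI[where f' = "\<lambda>r. 1 / D m r"])
  show "smooth_on ({0<..} - {m}) (\<lambda>r. 1 / D m r)"
  proof (rule smooth_on_divide[OF _ smooth_on_const smooth_on_subset[OF D_smooth]])
    show "D m x \<noteq> 0" if "x \<in> {0<..} - {m}" for x using D_pos[of x m] that by auto
  qed (auto intro!: open_Diff)
qed (auto intro!: rstar_deriv open_Diff)

lemma open_rad_set: "open S \<Longrightarrow> open {q \<in> chart_dom. (q $ 1, rad q) \<in> S}"
proof -
  assume S: "open S"
  have "continuous_on chart_dom (\<lambda>q. (q $ 1, rad q))"
    by (intro continuous_intros continuous_on_rad)
  from continuous_open_preimage[OF this open_chart_dom S] show ?thesis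
    by (simp add: Int_def vimage_def conj_commute)
qed

text \<open>Regions I and II are also seen by outgoing charts: \<open>Region 1\<close> by chart 1
  and \<open>Region 0\<close> by chart -1. There \<open>v = u + 2 * rstar m r\<close>, and this
  substitution reverses the sign in the radial equation. It is singular at \<open>r = m\<close>,
  which has to be removed.\<close>

lemma outgoing_wave:
  assumes S: "open S" "smooth_on S P" "S \<subseteq> {p. snd p > 0}" and rw: "\<And>p. p \<in> S \<Longrightarrow> radial_wave m 1 P p"
  defines "S' \<equiv> {p. snd p > 0 \<and> snd p \<noteq> m \<and> (fst p + 2 * rstar m (snd p), snd p) \<in> S}"
    and "P' \<equiv> \<lambda>p. P (fst p + 2 * rstar m (snd p), snd p)"
  shows "open S'" "smooth_on S' P'" "\<And>p. p \<in> S' \<Longrightarrow> radial_wave m (- 1) P' p"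
proof -
  let ?c = "\<lambda>p. (fst p + 2 * rstar m (snd p), snd p)"
  have o0: "open (UNIV \<times> ({0<..} - {m}))" by (auto intro!: open_Times open_Diff)
  have sc: "smooth_on (UNIV \<times> ({0<..} - {m})) ?c"
  proof (intro smooth_on_Pair smooth_on_add smooth_on_mult smooth_on_const smooth_on_fst smooth_on_snd o0)
    show "smooth_on (UNIV \<times> ({0<..} - {m})) (\<lambda>p :: real \<times> real. rstar m (snd p))"
      by (rule smooth_on_compose[OF o0 _ _ smooth_on_snd[OF o0] rstar_smooth]) (auto intro!: open_Diff)
  qed
  have S': "S' = (UNIV \<times> ({0<..} - {m})) \<inter> ?c -` S" by (auto simp: S'_def)
  show oS': "open S'"
    unfolding S' by (rule continuous_open_preimage[OF smooth_on_imp_continuous_on[OF sc] o0 S(1)])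
  have scS: "smooth_on S' ?c" by (rule smooth_on_subset[OF sc]) (auto simp: S')
  show sP: "smooth_on S' P'"
    unfolding P'_def by (rule smooth_on_compose[OF oS' S(1) _ scS S(2)]) (auto simp: S')
  fix p assume p: "p \<in> S'"
  obtain u r where ur: "p = (u, r)" by (cases p)
  have pd: "pd1 P' (u, r) = pd1 P (u + 2 * rstar m r, r) \<and>
      pd2 P' (u, r) = pd1 P (u + 2 * rstar m r, r) * (2 / D m r) + pd2 P (u + 2 * rstar m r, r)"
    if "(u, r) \<in> S'" for u r
  proof -
    have r: "r > 0" "r \<noteq> m" "(u + 2 * rstar m r, r) \<in> S" using that by (auto simp: S'_def)
    note hd = smooth_on_has_derivative_pd[OF S(2) r(3)]
    have "((\<lambda>u. P (u + 2 * rstar m r, r)) has_real_derivative pd1 P (u + 2 * rstar m r, r) * 1 + pd2 P (u + 2 * rstar m r, r) * 0) (at u)"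
      by (rule has_real_derivative_fpair_compose[where g = "\<lambda>u. u + 2 * rstar m r" and h = "\<lambda>_. r", OF hd])
        (auto intro!: derivative_eq_intros)
    then have 1: "((\<lambda>u. P' (u, r)) has_real_derivative pd1 P (u + 2 * rstar m r, r)) (at u)" by (simp add: P'_def)
    have "((\<lambda>r. P (u + 2 * rstar m r, r)) has_real_derivative
        pd1 P (u + 2 * rstar m r, r) * (2 / D m r) + pd2 P (u + 2 * rstar m r, r) * 1) (at r)"
      by (rule has_real_derivative_fpair_compose[where g = "\<lambda>r. u + 2 * rstar m r" and h = "\<lambda>r. r", OF hd])
        (use rstar_deriv[OF r(1,2)] in \<open>auto intro!: derivative_eq_intros\<close>)
    then have 2: "((\<lambda>r. P' (u, r)) has_real_derivative
        pd1 P (u + 2 * rstar m r, r) * (2 / D m r) + pd2 P (u + 2 * rstar m r, r)) (at r)" by (simp add: P'_def)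
    show ?thesis
      using DERIV_unique[OF smooth_slice1[OF sP that] 1] DERIV_unique[OF smooth_slice2[OF sP that] 2] by simp
  qed
  have r: "r > 0" "r \<noteq> m" "(u + 2 * rstar m r, r) \<in> S" using p ur by (auto simp: S'_def)
  let ?v = "u + 2 * rstar m r"
  have Dr: "D m r > 0" using D_pos r by auto
  note sP1 = smooth_on_pd(1)[OF sP] and sP2 = smooth_on_pd(2)[OF sP]
  obtain A B where AB: "open A" "open B" "u \<in> A" "r \<in> B" "A \<times> B \<subseteq> S'"
    using open_slices[OF oS'] p ur by metis
  have chain: "((\<lambda>r. g (u + 2 * rstar m r, r)) has_real_derivative pd1 g (?v, r) * (2 / D m r) + pd2 g (?v, r)) (at r)"
    if "smooth_on S g" for g
  proof -
    have "((\<lambda>r. g (u + 2 * rstar m r, r)) has_real_derivative pd1 g (?v, r) * (2 / D m r) + pd2 g (?v, r) * 1) (at r)"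
      by (rule has_real_derivative_fpair_compose[where g = "\<lambda>r. u + 2 * rstar m r" and h = "\<lambda>r. r", OF smooth_on_has_derivative_pd[OF that r(3)]])
        (use rstar_deriv[OF r(1,2)] in \<open>auto intro!: derivative_eq_intros\<close>)
    then show ?thesis by simp
  qed
  have "((\<lambda>r. pd1 P' (u, r)) has_real_derivative pd1 (pd1 P) (?v, r) * (2 / D m r) + pd2 (pd1 P) (?v, r)) (at r)"
    by (rule has_field_derivative_transform_within_open[OF chain[OF smooth_on_pd(1)[OF S(2)]] AB(2,4)])
      (use AB pd in auto)
  then have e1: "pd2 (pd1 P') (u, r) = pd1 (pd1 P) (?v, r) * (2 / D m r) + pd2 (pd1 P) (?v, r)"
    using DERIV_unique[OF smooth_slice2[OF sP1]] p ur by blast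
  have "((\<lambda>r. pd1 P (u + 2 * rstar m r, r) * (2 / D m r) + pd2 P (u + 2 * rstar m r, r)) has_real_derivative
      (pd1 (pd1 P) (?v, r) * (2 / D m r) + pd2 (pd1 P) (?v, r)) * (2 / D m r)
      + (- (2 * D1 m r) / (D m r * D m r)) * pd1 P (?v, r)
      + (pd1 (pd2 P) (?v, r) * (2 / D m r) + pd2 (pd2 P) (?v, r))) (at r)"
    using Dr r by (intro DERIV_add DERIV_mult chain smooth_on_pd S)
      (auto intro!: derivative_eq_intros D_has_derivative)
  then have "((\<lambda>r. pd2 P' (u, r)) has_real_derivative
      (pd1 (pd1 P) (?v, r) * (2 / D m r) + pd2 (pd1 P) (?v, r)) * (2 / D m r)
      + (- (2 * D1 m r) / (D m r * D m r)) * pd1 P (?v, r)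
      + (pd1 (pd2 P) (?v, r) * (2 / D m r) + pd2 (pd2 P) (?v, r))) (at r)"
    by (rule has_field_derivative_transform_within_open[OF _ AB(2,4)]) (use AB pd in auto)
  then have e2: "pd2 (pd2 P') (u, r) = (pd1 (pd1 P) (?v, r) * (2 / D m r) + pd2 (pd1 P) (?v, r)) * (2 / D m r)
      + (- (2 * D1 m r) / (D m r * D m r)) * pd1 P (?v, r)
      + (pd1 (pd2 P) (?v, r) * (2 / D m r) + pd2 (pd2 P) (?v, r))"
    using DERIV_unique[OF smooth_slice2[OF sP2]] p ur by blast
  have e: "2 * pd2 (pd1 P) (?v, r) + D m r * pd2 (pd2 P) (?v, r) + D1 m r * pd2 P (?v, r) = D1 m r / r * P (?v, r)"
    using rw[OF r(3)] by (simp add: radial_wave_def)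
  have "2 * (- 1) * pd2 (pd1 P') (u, r) + D m r * pd2 (pd2 P') (u, r) + D1 m r * pd2 P' (u, r)
     = 2 * pd2 (pd1 P) (?v, r) + D m r * pd2 (pd2 P) (?v, r) + D1 m r * pd2 P (?v, r)"
    unfolding e1 e2 conjunct2[OF pd[OF p[unfolded ur]]] pd_mixed_symmetric[OF S(1,2) r(3)]
    using Dr by (simp add: field_simps)
  then show "radial_wave m (- 1) P' p" using e by (simp add: radial_wave_def ur P'_def)
qed

text \<open>\<open>lift\<close> drops to 0 outside regions I and II and the event horizon. No jump
  becomes visible on \<open>A\<close>: by \<open>hor\<close> the set meets no other horizon, so
  around each of its points \<open>lift\<close> is either the given solution or identically
  zero.\<close>

lemma wave_solution_lift:
  assumes S: "open S" "smooth_on S P" "S \<subseteq> {p. snd p > 0}" and rw: "\<And>p. p \<in> S \<Longrightarrow> radial_wave m 1 P p"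
    and reg: "\<And>k t x. Region k t x \<in> A \<Longrightarrow> k = 0 \<or> k = 1 \<Longrightarrow> (t + rstar m (norm x), norm x) \<in> S"
    and hor: "\<And>k v x. Horizon k v x \<in> A \<Longrightarrow> k = 0 \<and> (v, norm x) \<in> S"
  shows "wave_solution m A (lift m P)"
proof -
  define S' where "S' = {p. snd p > 0 \<and> snd p \<noteq> m \<and> (fst p + 2 * rstar m (snd p), snd p) \<in> S}"
  define P' where "P' = (\<lambda>p. P (fst p + 2 * rstar m (snd p), snd p))"
  note ow = outgoing_wave[OF S rw, folded S'_def P'_def]
  have loc: "\<exists>T Q R. open T \<and> q \<in> T \<and> T \<subseteq> chart_dom \<and>
      (\<forall>q\<in>T. (lift m P \<circ> chart m n) q = complex_of_real (Q (q $ 1, rad q) / rad q)) \<and>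
      open R \<and> R \<subseteq> {p. snd p > 0} \<and> smooth_on R Q \<and> (\<forall>q\<in>T. (q $ 1, rad q) \<in> R) \<and>
      (\<forall>p\<in>R. radial_wave m (orient n) Q p)"
    if q: "q \<in> chart_preimage m n A" for n q
  proof -
    have qd: "q \<in> chart_dom" and qA: "chart m n q \<in> A" using q by (auto simp: chart_preimage_def)
    have zero: ?thesis if "open T" "q \<in> T" "T \<subseteq> chart_dom" "\<And>q. q \<in> T \<Longrightarrow> lift m P (chart m n q) = 0" for T
      by (rule exI[of _ T], rule exI[of _ "\<lambda>_. 0"], rule exI[of _ "UNIV \<times> {0<..}"])
        (use that rad_pos in \<open>auto simp: smooth_on_const radial_wave_zero intro!: open_Times\<close>)
    \<comment> \<open>Only the charts -1, 0 and 1 meet \<open>Region 0\<close> or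
      \<open>Region 1\<close>, and by \<open>hor\<close> a horizon point occurs in chart 0
      only.\<close>
    consider "n = 0" | "n = 1 \<or> n = - 1" "rad q \<noteq> m" | "n \<noteq> 0" "n \<noteq> 1" "n \<noteq> - 1"
      using hor[of n "q $ 1" "spat q"] qA by (cases "rad q = m") (auto simp: chart_def)
    then show ?thesis
    proof cases
      case 1
      have eq: "lift m P (chart m 0 q) = complex_of_real (P (q $ 1, rad q) / rad q)" for q
        by (simp add: chart_def orient_def rad_def)
      have "(q $ 1, rad q) \<in> S"
        using qA reg[of 0 "q $ 1 - rstar m (rad q)" "spat q"] reg[of 1 "q $ 1 - rstar m (rad q)" "spat q"]
          hor[of 0 "q $ 1" "spat q"] 1
        by (auto simp: chart_def rad_def orient_def split: if_splits)
      then show ?thesis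
        by (intro exI[of _ "{q \<in> chart_dom. (q $ 1, rad q) \<in> S}"] exI[of _ P] exI[of _ S])
          (use S rw qd 1 in \<open>auto simp: eq orient_def intro: open_rad_set\<close>)
    next
      case 2
      have od: "odd n" using 2 by auto
      show ?thesis
      proof (cases "(n = 1 \<and> rad q < m) \<or> (n = - 1 \<and> rad q > m)")
        case True
        \<comment> \<open>The half of the chart that lies in region I or II. The other half,
          \<open>Region 2\<close> or \<open>Region (-1)\<close>, carries the zero function.\<close>
        define I where "I = (if n = 1 then {..<m} else {m<..})"
        have oI: "open I" by (simp add: I_def)
        have eq: "lift m P (chart m n q) = complex_of_real (P' (q $ 1, rad q) / rad q)" if "rad q \<in> I" for q
          using 2 that by (auto simp: chart_def orient_def rad_def P'_def I_def algebra_simps split: if_splits)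
        have "chart m n q = Region (if n = 1 then 1 else 0) (q $ 1 + rstar m (rad q)) (spat q)"
          using True 2 od by (auto simp: chart_def orient_def)
        then have "(q $ 1 + rstar m (rad q) + rstar m (norm (spat q)), norm (spat q)) \<in> S"
          using qA by (intro reg[of "if n = 1 then 1 else 0"]) auto
        then have "(q $ 1, rad q) \<in> S'"
          using rad_pos[OF qd] 2 by (simp add: S'_def rad_def algebra_simps)
        moreover have "rad q \<in> I" using True by (auto simp: I_def)
        moreover have oR: "open (S' \<inter> UNIV \<times> I)" by (intro open_Int open_Times ow oI) auto
        moreover have "S' \<subseteq> {p. snd p > 0}" by (auto simp: S'_def)
        ultimately show ?thesis
          by (intro exI[of _ "{q \<in> chart_dom. (q $ 1, rad q) \<in> S' \<inter> UNIV \<times> I}"] exI[of _ P'] exI[of _ "S' \<inter> UNIV \<times> I"])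
            (use ow qd od open_rad_set[OF oR] in \<open>auto simp: eq orient_def intro: smooth_on_subset\<close>)
      next
        case False
        define I where "I = (if n = 1 then {m<..} else {..<m})"
        have oI: "open I" by (simp add: I_def)
        have qI: "rad q \<in> I" using False 2 by (auto simp: I_def)
        show ?thesis
        proof (rule zero)
          show "open {q \<in> chart_dom. (q $ 1, rad q) \<in> UNIV \<times> I}" by (intro open_rad_set open_Times oI) auto
          show "lift m P (chart m n q') = 0" if "q' \<in> {q \<in> chart_dom. (q $ 1, rad q) \<in> UNIV \<times> I}" for q'
            using that 2 by (auto simp: chart_def I_def split: if_splits)
        qed (use qI qd in auto)
      qed
    next
      case 3
      show ?thesis
        by (rule zero[OF open_chart_dom qd]) (use 3 in \<open>auto simp: chart_def\<close>)
    qed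
  qed
  show ?thesis
    unfolding wave_solution_def
  proof (intro allI conjI ballI)
    fix n
    show "smooth_on (chart_preimage m n A) (lift m P \<circ> chart m n)"
    proof (rule smooth_on_local)
      fix q assume "q \<in> chart_preimage m n A"
      from loc[OF this] obtain T Q R where *: "open T" "q \<in> T" "T \<subseteq> chart_dom"
        "\<forall>q\<in>T. (lift m P \<circ> chart m n) q = complex_of_real (Q (q $ 1, rad q) / rad q)"
        "open R" "R \<subseteq> {p. snd p > 0}" "smooth_on R Q" "\<forall>q\<in>T. (q $ 1, rad q) \<in> R" by blast
      have "smooth_on T (lift m P \<circ> chart m n)"
        by (rule spherical_wave(1)[OF *(1,3) _ *(5-7)]) (use * in auto)
      then show "\<exists>T. open T \<and> q \<in> T \<and> smooth_on T (lift m P \<circ> chart m n)" using * by blast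
    qed
    fix q assume "q \<in> chart_preimage m n A"
    from loc[OF this] obtain T Q R where *: "open T" "q \<in> T" "T \<subseteq> chart_dom"
      "\<forall>q\<in>T. (lift m P \<circ> chart m n) q = complex_of_real (Q (q $ 1, rad q) / rad q)"
      "open R" "R \<subseteq> {p. snd p > 0}" "smooth_on R Q" "\<forall>q\<in>T. (q $ 1, rad q) \<in> R"
      "\<forall>p\<in>R. radial_wave m (orient n) Q p" by blast
    show "box (ern_metric m n) (lift m P \<circ> chart m n) q = 0"
      by (rule spherical_wave(2)[OF *(1,3) _ *(5-7)]) (use * in auto)
  qed
qed

section \<open>Energy of spherically symmetric functions\<close>

text \<open>The squared length of the tangent to the profile curve with \<open>dr = 1\<close>, that
  is, the radial coefficient of the induced metric.\<close>

definition lapse2 :: "real \<Rightarrow> int \<Rightarrow> (real \<Rightarrow> real) \<Rightarrow> real \<Rightarrow> real" where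
  "lapse2 m n f r = 2 * (orient n * deriv f r) - D m r * (orient n * deriv f r)\<^sup>2"

text \<open>\<open>\<T>(n, n)\<close> times the volume density, for a differential with components
  \<open>a\<close> along the null coordinate and \<open>b\<close> along \<open>r\<close>. Up to
  slope factors, the two squares are those of the derivatives in the two radial null
  directions.\<close>

definition edens :: "real \<Rightarrow> int \<Rightarrow> (real \<Rightarrow> real) \<Rightarrow> real \<Rightarrow> real \<Rightarrow> real \<Rightarrow> real" where
  "edens m n f r a b =
     ((orient n * deriv f r * (orient n * a + D m r / 2 * b))\<^sup>2 + ((1 - D m r / 2 * (orient n * deriv f r)) * b)\<^sup>2)
       / sqrt (lapse2 m n f r)"

lemma coord_linear: "coord (a * s) (a *\<^sub>R x) = a *\<^sub>R coord s x" "coord s x + coord s' x' = coord (s + s') (x + x')"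
  by (auto simp: vec_eq_iff forall_4)

lemma coord_collapse: "coord (X $ 1) (spat X) = X"
  by (simp add: vec_eq_iff forall_4)

lemma graph_map_facts:
  "spat (graph_map f x) = x" "rad (graph_map f x) = norm x" "graph_map f x $ 1 = f (norm x)"
  "radial_part (graph_map f x) X = (x \<bullet> spat X) / norm x" "x \<noteq> 0 \<Longrightarrow> graph_map f x \<in> chart_dom"
  by (auto simp: graph_map_def rad_def radial_part_def chart_dom_def)

lemma tangent_eq:
  assumes "x \<noteq> 0" "(f has_real_derivative f') (at (norm x))"
  shows "tangent f x w = coord (f' * ((x \<bullet> w) / norm x)) w"
proof -
  have bl: "bounded_linear (\<lambda>p. coord (fst p) (snd p))"
    unfolding linear_conv_bounded_linear[symmetric]
    by (rule linearI) (auto simp: vec_eq_iff forall_4)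
  have "((\<lambda>x. f (norm x)) has_derivative (\<lambda>w. f' * (w \<bullet> sgn x))) (at x)"
    by (rule has_derivative_compose[OF has_derivative_norm]) (use assms in \<open>auto simp: has_field_derivative_def\<close>)
  then have "((\<lambda>x. (f (norm x), x)) has_derivative (\<lambda>w. (f' * (w \<bullet> sgn x), w))) (at x)"
    by (intro has_derivative_Pair has_derivative_ident)
  from bounded_linear.has_derivative[OF bl this]
  have "(graph_map f has_derivative (\<lambda>w. coord (f' * (w \<bullet> sgn x)) w)) (at x)"
    by (simp add: graph_map_def[abs_def])
  from frechet_derivative_at[OF this, symmetric]
  have "tangent f x w = coord (f' * (w \<bullet> sgn x)) w" by (simp add: tangent_def)
  moreover have "w \<bullet> sgn x = (x \<bullet> w) / norm x"
    by (simp add: sgn_div_norm inner_commute divide_inverse mult.commute)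
  ultimately show ?thesis by (simp only:)
qed

section \<open>Integration in polar coordinates and the Cauchy-Schwarz bound\<close>

lemma emeasure_annulus:
  assumes "0 \<le> a" "a \<le> b"
  shows "emeasure lborel {x :: real^3. a < norm x \<and> norm x \<le> b} = ennreal (4 / 3 * pi * b ^ 3 - 4 / 3 * pi * a ^ 3)"
proof -
  have c: "emeasure lborel (cball (0 :: real^3) r) = ennreal (4 / 3 * pi * r ^ 3)" if "r \<ge> 0" for r
    using emeasure_cball[OF that, of "0 :: real^3"] by (simp add: unit_ball_vol_3)
  have "{x :: real^3. a < norm x \<and> norm x \<le> b} = cball 0 b - cball 0 a" by auto
  then have "emeasure lborel {x :: real^3. a < norm x \<and> norm x \<le> b} = emeasure lborel (cball (0 :: real^3) b) - emeasure lborel (cball (0 :: real^3) a)"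
    using assms by (simp add: emeasure_Diff c subset_iff)
  also have "\<dots> = ennreal (4 / 3 * pi * b ^ 3 - 4 / 3 * pi * a ^ 3)"
    using assms by (simp add: c ennreal_minus)
  finally show ?thesis .
qed

text \<open>Both sides integrate \<open>g\<close> against measures on the line; these coincide
  because they agree on all half lines, by the volume of balls. The cut-off \<open>b\<close> makes
  the measures finite, as this uniqueness argument demands.\<close>

lemma nn_integral_radial:
  fixes g :: "real \<Rightarrow> ennreal"
  assumes [measurable]: "g \<in> borel_measurable borel" and b: "b \<ge> 0"
  shows "(\<integral>\<^sup>+x. g (norm x) * indicator {..b} (norm (x :: real^3)) \<partial>lborel)
    = (\<integral>\<^sup>+r. g r * (ennreal (4 * pi * r\<^sup>2) * indicator {0..b} r) \<partial>lborel)"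
proof -
  define M where "M = distr (density lborel (\<lambda>x :: real^3. indicator {..b} (norm x))) borel norm"
  define N where "N = density lborel (\<lambda>r. ennreal (4 * pi * r\<^sup>2) * indicator {0..b} r)"
  have eM: "emeasure M {x<..} = ennreal (4 / 3 * pi * b ^ 3 - 4 / 3 * pi * (min b (max 0 x)) ^ 3)"
    and eN: "emeasure N {x<..} = ennreal (4 / 3 * pi * b ^ 3 - 4 / 3 * pi * (min b (max 0 x)) ^ 3)" for x
  proof -
    let ?y = "min b (max 0 x)"
    have y: "0 \<le> ?y" "?y \<le> b" using b by auto
    have "emeasure M {x<..} = (\<integral>\<^sup>+z. indicator {..b} (norm z) * indicator {x<..} (norm (z :: real^3)) \<partial>lborel)"
      unfolding M_def by (subst emeasure_distr) (auto simp: emeasure_density vimage_def indicator_def intro!: nn_integral_cong)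
    also have "\<dots> = (\<integral>\<^sup>+z. indicator {z :: real^3. ?y < norm z \<and> norm z \<le> b} z \<partial>lborel)"
    proof (rule nn_integral_cong_AE)
      have "AE z in lborel. z \<noteq> (0 :: real^3)" by (rule AE_lborel_singleton)
      then show "AE z in lborel. indicator {..b} (norm z) * indicator {x<..} (norm z) =
          (indicator {z :: real^3. ?y < norm z \<and> norm z \<le> b} z :: ennreal)"
        by eventually_elim (auto simp: indicator_def min_less_iff_disj)
    qed
    also have "\<dots> = emeasure lborel {z :: real^3. ?y < norm z \<and> norm z \<le> b}"
      by (rule nn_integral_indicator) measurable
    finally show "emeasure M {x<..} = ennreal (4 / 3 * pi * b ^ 3 - 4 / 3 * pi * ?y ^ 3)"
      using emeasure_annulus[OF y] by simp
    have "emeasure N {x<..} = (\<integral>\<^sup>+r. ennreal (4 * pi * r\<^sup>2) * indicator {0..b} r * indicator {x<..} r \<partial>lborel)"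
      unfolding N_def by (subst emeasure_density) auto
    also have "\<dots> = (\<integral>\<^sup>+r. ennreal (4 * pi * r\<^sup>2) * indicator {?y..b} r \<partial>lborel)"
    proof (rule nn_integral_cong_AE)
      have "AE r in lborel. r \<noteq> x \<and> r \<noteq> b" by (auto simp: AE_conj_iff intro: AE_lborel_singleton)
      then show "AE r in lborel. ennreal (4 * pi * r\<^sup>2) * indicator {0..b} r * indicator {x<..} r = ennreal (4 * pi * r\<^sup>2) * indicator {?y..b} r"
        by eventually_elim (auto simp: indicator_def min_le_iff_disj)
    qed
    also have "\<dots> = ennreal (4 / 3 * pi * b ^ 3 - 4 / 3 * pi * ?y ^ 3)"
      by (rule nn_integral_FTC_Icc) (use y in \<open>auto intro!: derivative_eq_intros\<close>)
    finally show "emeasure N {x<..} = ennreal (4 / 3 * pi * b ^ 3 - 4 / 3 * pi * ?y ^ 3)" .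
  qed
  have "M = N"
  proof (rule measure_eqI_lessThan)
    show "sets M = sets borel" "sets N = sets borel" by (simp_all add: M_def N_def)
    show "emeasure M {x<..} < \<infinity>" for x unfolding eM by simp
    show "emeasure M {x<..} = emeasure N {x<..}" for x unfolding eM eN ..
  qed
  moreover have "(\<integral>\<^sup>+r. g r \<partial>M) = (\<integral>\<^sup>+x. g (norm x) * indicator {..b} (norm (x :: real^3)) \<partial>lborel)"
    unfolding M_def by (subst nn_integral_distr) (auto simp: nn_integral_density mult.commute)
  moreover have "(\<integral>\<^sup>+r. g r \<partial>N) = (\<integral>\<^sup>+r. g r * (ennreal (4 * pi * r\<^sup>2) * indicator {0..b} r) \<partial>lborel)"
    unfolding N_def by (subst nn_integral_density) (auto simp: mult.commute)
  ultimately show ?thesis by simp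
qed

lemma square_integral_lower:
  fixes y y' :: "real \<Rightarrow> real"
  assumes ab: "\<alpha> < \<beta>" "{\<alpha>..\<beta>} \<subseteq> R" "open R" "convex R"
    and d: "\<And>r. r \<in> R \<Longrightarrow> (y has_real_derivative y' r) (at r)" and c: "continuous_on R y'"
  shows "ennreal ((y \<beta> - y \<alpha>)\<^sup>2 / (\<beta> - \<alpha>)) \<le> (\<integral>\<^sup>+r. ennreal ((y' r)\<^sup>2 * indicator R r) * indicator {\<alpha>..\<beta>} r \<partial>lborel)"
proof -
  define G where "G = (\<lambda>r. I1 \<alpha> (\<lambda>p. (y' (fst p))\<^sup>2) (r, 0))"
  have aR: "\<alpha> \<in> R" using ab by auto
  have c2: "continuous_on (R \<times> (UNIV :: real set)) (\<lambda>p. (y' (fst p))\<^sup>2)"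
    by (intro continuous_intros continuous_on_compose2[OF c]) auto
  have G: "(G has_real_derivative (y' r)\<^sup>2) (at r)" if "r \<in> R" for r
    unfolding G_def using I1_deriv1[OF c2 ab(4,3) aR that] by simp
  have "(\<integral>\<^sup>+r. ennreal ((y' r)\<^sup>2 * indicator R r) * indicator {\<alpha>..\<beta>} r \<partial>lborel) = ennreal (G \<beta> - G \<alpha>)"
  proof (rule nn_integral_FTC_Icc)
    have "(\<lambda>r. indicator R r *\<^sub>R (y' r)\<^sup>2) \<in> borel_measurable borel"
      by (rule borel_measurable_continuous_on_indicator) (use ab c in \<open>auto intro!: continuous_intros\<close>)
    then show "(\<lambda>r. (y' r)\<^sup>2 * indicator R r) \<in> borel_measurable borel" by (simp add: mult.commute)
    show "(G has_real_derivative (y' r)\<^sup>2 * indicator R r) (at r)" if "r \<in> {\<alpha>..\<beta>}" for r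
      using G[of r] that ab by (auto simp: subset_iff)
  qed (use ab in auto)
  moreover have "(y \<beta> - y \<alpha>)\<^sup>2 / (\<beta> - \<alpha>) \<le> G \<beta> - G \<alpha>"
  proof -
    \<comment> \<open>The mean slope. Cauchy-Schwarz is the statement that
      \<open>(y' r - l)\<^sup>2\<close> has a nonnegative integral, here phrased as monotonicity of
      a primitive.\<close>
    define l where "l = (y \<beta> - y \<alpha>) / (\<beta> - \<alpha>)"
    have "G \<alpha> - 2 * l * y \<alpha> + l\<^sup>2 * \<alpha> \<le> G \<beta> - 2 * l * y \<beta> + l\<^sup>2 * \<beta>"
    proof (rule DERIV_nonneg_imp_nondecreasing[OF less_imp_le[OF ab(1)]])
      fix r assume "\<alpha> \<le> r" "r \<le> \<beta>"
      then have r: "r \<in> R" using ab by auto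
      have "((\<lambda>r. G r - 2 * l * y r + l\<^sup>2 * r) has_real_derivative (y' r)\<^sup>2 - 2 * l * y' r + l\<^sup>2) (at r)"
        using G[OF r] d[OF r] by (auto intro!: derivative_eq_intros)
      moreover have "(y' r)\<^sup>2 - 2 * l * y' r + l\<^sup>2 = (y' r - l)\<^sup>2" by (simp add: power2_eq_square algebra_simps)
      ultimately show "\<exists>z. ((\<lambda>r. G r - 2 * l * y r + l\<^sup>2 * r) has_real_derivative z) (at r) \<and> 0 \<le> z"
        by (intro exI[of _ "(y' r - l)\<^sup>2"]) auto
    qed
    then have "2 * l * (y \<beta> - y \<alpha>) - l\<^sup>2 * (\<beta> - \<alpha>) \<le> G \<beta> - G \<alpha>" by (simp add: algebra_simps)
    moreover have "l\<^sup>2 * (\<beta> - \<alpha>) = l * (y \<beta> - y \<alpha>)" "l * (y \<beta> - y \<alpha>) = (y \<beta> - y \<alpha>)\<^sup>2 / (\<beta> - \<alpha>)"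
      using ab by (simp_all add: l_def power2_eq_square)
    ultimately show ?thesis by linarith
  qed
  ultimately show ?thesis by (simp add: ennreal_leI)
qed

section \<open>Normal, volume and energy density of a spherically symmetric slice\<close>

locale spacelike_graph =
  fixes m :: real and n :: int and f :: "real \<Rightarrow> real" and R :: "real set"
  assumes m: "m > 0" and R: "open R" "R \<subseteq> {0<..}" and sl: "spacelike_slice m n f R"
begin

lemma f_deriv: "r \<in> R \<Longrightarrow> (f has_real_derivative deriv f r) (at r)"
  using sl smooth_on_differentiable[of R f r]
  by (simp add: spacelike_slice_def DERIV_deriv_iff_real_differentiable)

lemma induced_eq:
  assumes "norm x \<in> R"
  shows "induced_metric m n f x w z = w \<bullet> z + (lapse2 m n f (norm x) - 1) * ((x \<bullet> w) / norm x) * ((x \<bullet> z) / norm x)"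
proof -
  have x: "x \<noteq> 0" using assms R by auto
  show ?thesis
    unfolding induced_metric_def ern_metric_def tangent_eq[OF x f_deriv[OF assms]] graph_map_facts
    by (simp add: lapse2_def power2_eq_square algebra_simps)
qed

text \<open>The induced metric is evaluated on a radial vector. Since \<open>lapse2\<close> is the
  slope \<open>e\<close> times \<open>2 - D * e\<close> and \<open>D \<ge> 0\<close>, positivity
  puts \<open>e\<close> strictly between the two null slopes 0 and \<open>2 / D\<close>.\<close>

lemma lapse2_pos:
  assumes "r \<in> R"
  shows "lapse2 m n f r > 0" "orient n * deriv f r > 0" "D m r * (orient n * deriv f r) < 2"
proof -
  have r: "r > 0" using assms R by auto
  define x where "x = r *\<^sub>R (axis 1 1 :: real^3)"
  have nx: "norm x = r" using r by (simp add: x_def)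
  have "induced_metric m n f x x x > 0"
    using sl assms nx r by (auto simp: spacelike_slice_def)
  then have "x \<bullet> x + (lapse2 m n f r - 1) * ((x \<bullet> x) / r) * ((x \<bullet> x) / r) > 0"
    using induced_eq[of x x x] assms nx by simp
  moreover have "x \<bullet> x = r * r" by (metis nx power2_eq_square power2_norm_eq_inner)
  ultimately have "r * r * lapse2 m n f r > 0" using r by (simp add: algebra_simps)
  then show L: "lapse2 m n f r > 0" using r by (simp add: zero_less_mult_iff)
  let ?e = "orient n * deriv f r"
  have L': "?e * (2 - D m r * ?e) > 0" using L by (simp add: lapse2_def power2_eq_square algebra_simps)
  have D0: "D m r \<ge> 0" using D_nonneg r by auto
  show e: "?e > 0"
  proof (rule ccontr)
    assume "\<not> ?e > 0"
    then have "?e \<le> 0" by simp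
    moreover then have "D m r * ?e \<le> 0" using D0 by (simp add: mult_nonneg_nonpos)
    ultimately have "?e * (2 - D m r * ?e) \<le> 0" using mult_nonpos_nonneg[of ?e "2 - D m r * ?e"] by simp
    with L' show False by simp
  qed
  show "D m r * ?e < 2" using L' e by (simp add: zero_less_mult_iff)
qed

lemma volume_density_eq:
  assumes "norm x \<in> R"
  shows "volume_density m n f x = sqrt (lapse2 m n f (norm x))"
proof -
  have x: "norm x > 0" using assms R by auto
  define a b c where "a = x $ 1 / norm x" and "b = x $ 2 / norm x" and "c = x $ 3 / norm x"
  have "x $ 1 * x $ 1 + x $ 2 * x $ 2 + x $ 3 * x $ 3 = norm x * norm x"
    using power2_norm_eq_inner[of x] by (simp add: inner_3 power2_eq_square)
  then have "a * a + b * b + c * c = norm x * norm x / (norm x * norm x)"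
    by (simp add: a_def b_def c_def add_divide_distrib[symmetric])
  then have abc: "c * c = 1 - a * a - b * b" using x by simp
  have c2': "c * (c * y) = y - a * a * y - b * b * y" for y
    using abc by (metis (no_types, opaque_lifting) left_diff_distrib mult.assoc mult_1)
  define L where "L = lapse2 m n f (norm x)"
  have in1: "(x \<bullet> axis 1 1) / norm x = a" "(x \<bullet> axis 2 1) / norm x = b" "(x \<bullet> axis 3 1) / norm x = c"
    by (simp_all add: inner_3 axis_def a_def b_def c_def)
  have ax: "(axis i 1 :: real^3) \<bullet> axis j 1 = (if i = j then 1 else 0)" for i j
    by (simp add: inner_axis_axis)
  have "det ((\<chi> i j. induced_metric m n f x (axis i 1) (axis j 1)) :: real^3^3) = L"
    unfolding det_3 vec_lambda_beta induced_eq[OF assms] in1 ax L_def[symmetric]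
    by (simp add: algebra_simps abc c2')
  then show ?thesis by (simp add: volume_density_def L_def)
qed

lemma radial_metric:
  assumes "norm x = r" "r > 0"
  shows "ern_metric m n (graph_map f x) (coord p ((t / r) *\<^sub>R x)) (coord p' ((t' / r) *\<^sub>R x))
    = - D m r * p * p' + orient n * (p * t' + t * p')"
proof -
  have xx: "x \<bullet> x = r * r" by (metis assms(1) power2_eq_square power2_norm_eq_inner)
  have "(x \<bullet> (c / r) *\<^sub>R x) / r = c" for c using assms(2) by (simp add: xx)
  moreover have "(t / r) *\<^sub>R x \<bullet> (t' / r) *\<^sub>R x = t * t'" using assms(2) by (simp add: xx)
  ultimately show ?thesis
    unfolding ern_metric_def graph_map_facts assms(1) by simp
qed

text \<open>The definite description needs uniqueness: orthogonality to all tangents makes a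
  candidate radial and fixes the ratio of its two components, normalization fixes it up to sign, and
  the time orientation fixes the sign.\<close>

lemma unit_normal_eq:
  assumes "norm x \<in> R"
  shows "unit_normal m n f x = coord (orient n * deriv f (norm x) / sqrt (lapse2 m n f (norm x)))
      ((- orient n * (1 - D m (norm x) * (orient n * deriv f (norm x))) / sqrt (lapse2 m n f (norm x)) / norm x) *\<^sub>R x)"
proof -
  define r where "r = norm x"
  define e where "e = orient n * deriv f r"
  define d where "d = D m r"
  define w where "w = sqrt (lapse2 m n f r)"
  define o1 where "o1 = orient n"
  have r: "r > 0" using assms R by (auto simp: r_def)
  then have x: "x \<noteq> 0" by (auto simp: r_def)
  note lp = lapse2_pos[OF assms, folded r_def]
  have e: "e > 0" using lp by (simp add: e_def)
  have w: "w > 0" "w * w = 2 * e - d * e * e"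
    using lp by (auto simp: w_def lapse2_def e_def d_def power2_eq_square)
  have oo: "o1 * o1 = 1" "\<And>y. o1 * (o1 * y) = y" by (simp_all add: o1_def)
  have fo: "deriv f r = o1 * e" by (simp add: e_def o1_def)
  let ?q = "graph_map f x"
  have xx: "x \<bullet> x = r * r" by (metis r_def power2_eq_square power2_norm_eq_inner)
  have met: "ern_metric m n ?q X Y = - d * X $ 1 * Y $ 1 + o1 * (X $ 1 * ((x \<bullet> spat Y) / r) + (x \<bullet> spat X) / r * Y $ 1)
      + (spat X \<bullet> spat Y - (x \<bullet> spat X) / r * ((x \<bullet> spat Y) / r))" for X Y
    by (simp add: ern_metric_def graph_map_facts r_def d_def o1_def)
  have tan: "tangent f x z = coord (o1 * e * ((x \<bullet> z) / r)) z" for z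
    using tangent_eq[OF x f_deriv[OF assms]] fo by (simp add: r_def)
  have fn: "future_null n ?q = coord 0 ((- o1 / r) *\<^sub>R x)" by (simp add: future_null_def graph_map_facts r_def o1_def)
  let ?N = "coord (e / w) ((- o1 * (1 - d * e) / w / r) *\<^sub>R x)"
  \<comment> \<open>Pairing with the reference null field merely reads off the first component, so
    the time orientation becomes a sign condition on that component.\<close>
  have metfn: "ern_metric m n ?q X (future_null n ?q) = - X $ 1" for X
    unfolding met fn using r by (simp add: xx inner_commute field_simps oo)
  have NN: "ern_metric m n ?q ?N ?N = - 1"
  proof -
    have "ern_metric m n ?q ?N ?N = - d * (e / w) * (e / w) + 2 * o1 * (e / w) * (- o1 * (1 - d * e) / w)"
      unfolding radial_metric[OF r_def[symmetric] r] by (simp add: d_def o1_def algebra_simps)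
    also have "\<dots> = - ((2 * e - d * e * e) / (w * w))"
      using w(1) by (simp add: field_simps oo)
    also have "\<dots> = - 1" using w(1) unfolding w(2)[symmetric] by simp
    finally show ?thesis .
  qed
  have ex: "future_causal m n ?q ?N \<and> ern_metric m n ?q ?N ?N = - 1 \<and>
      (\<forall>z. ern_metric m n ?q ?N (tangent f x z) = 0)"
  proof (intro conjI allI)
    have "?N \<noteq> 0" using e w by (metis coord_nth(1) divide_eq_0_iff less_irrefl zero_index)
    then show "future_causal m n ?q ?N"
      unfolding future_causal_def using NN e w by (auto simp: metfn)
    show "ern_metric m n ?q ?N (tangent f x z) = 0" for z
      unfolding met tan using r w(1) by (simp add: xx field_simps oo)
  qed (rule NN)
  have uniq: "N = ?N" if N: "future_causal m n ?q N" "ern_metric m n ?q N N = - 1" "\<forall>z. ern_metric m n ?q N (tangent f x z) = 0" for N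
  proof -
    define N1 Nr where "N1 = N $ 1" and "Nr = (x \<bullet> spat N) / r"
    \<comment> \<open>Chosen so that orthogonality to the tangent of \<open>z\<close> says that
      \<open>spat N + (A / r) *\<^sub>R x\<close> is orthogonal to \<open>z\<close>.\<close>
    define A where "A = - d * N1 * (o1 * e) + o1 * (N1 + Nr * (o1 * e)) - Nr"
    have "(spat N + (A / r) *\<^sub>R x) \<bullet> z = 0" for z
    proof -
      have "0 = - d * N1 * (o1 * e * ((x \<bullet> z) / r)) + o1 * (N1 * ((x \<bullet> z) / r) + Nr * (o1 * e * ((x \<bullet> z) / r)))
          + (spat N \<bullet> z - Nr * ((x \<bullet> z) / r))"
        using N(3)[rule_format, of z] unfolding met tan by (simp add: N1_def Nr_def)
      then have "spat N \<bullet> z + A * ((x \<bullet> z) / r) = 0" by (simp add: A_def algebra_simps)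
      then show ?thesis by (simp add: inner_add_left)
    qed
    then have "spat N + (A / r) *\<^sub>R x = 0" by (metis inner_eq_zero_iff)
    then have sN: "spat N = (- A / r) *\<^sub>R x" by (simp add: add_eq_0_iff)
    have NrA: "Nr = - A" unfolding Nr_def sN using r by (simp add: xx)
    have "- d * N1 * (o1 * e) + o1 * (N1 + Nr * (o1 * e)) = 0" using NrA unfolding A_def by linarith
    moreover have "o1 * (N1 * (1 - d * e) + Nr * (o1 * e)) = - d * N1 * (o1 * e) + o1 * (N1 + Nr * (o1 * e))"
      by (simp add: algebra_simps)
    ultimately have "o1 * (N1 * (1 - d * e) + Nr * (o1 * e)) = 0" by simp
    moreover have "o1 \<noteq> 0" using oo(1) by auto
    ultimately have rel: "Nr * (o1 * e) = - (N1 * (1 - d * e))" by (simp add: add_eq_0_iff)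
    then have "o1 * (Nr * (o1 * e)) = - (o1 * (N1 * (1 - d * e)))" by simp
    then have Nr: "Nr = - o1 * (1 - d * e) * N1 / e" using e by (simp add: field_simps oo)
    have "- 1 = - d * N1 * N1 + 2 * o1 * (N1 * Nr)"
      using N(2) unfolding met N1_def[symmetric] Nr_def[symmetric]
      unfolding sN NrA[symmetric] minus_minus using r NrA by (simp add: xx algebra_simps)
    also have "\<dots> = - (N1 * N1 * (2 * e - d * e * e) / (e * e))" unfolding Nr using e by (simp add: field_simps oo)
    finally have "N1 * N1 * (w * w) = e * e" using e by (simp add: w field_simps)
    then have "(N1 * w)\<^sup>2 = e\<^sup>2" by (simp add: power2_eq_square algebra_simps)
    moreover have "N1 > 0"
    proof -
      have False if "c > 0" "N = c *\<^sub>R future_null n ?q" for c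
      proof -
        have "N = coord 0 ((- c * o1 / r) *\<^sub>R x)" using that unfolding fn by (simp add: vec_eq_iff forall_4)
        then have "ern_metric m n ?q N N = 0" by (simp only: radial_metric[OF r_def[symmetric] r]) simp
        with N(2) show False by simp
      qed
      then have "ern_metric m n ?q N (future_null n ?q) < 0"
        using N(1) unfolding future_causal_def by blast
      then show ?thesis by (simp add: metfn N1_def)
    qed
    ultimately have "N1 * w = e" using e w by (simp add: power2_eq_iff_nonneg)
    then have N1: "N1 = e / w" using w by (simp add: field_simps)
    have "N = coord N1 (spat N)" by (simp add: N1_def coord_collapse)
    also have "spat N = (Nr / r) *\<^sub>R x" using sN NrA by simp
    also have "Nr = - o1 * (1 - d * e) / w" unfolding Nr N1 using e by simp
    finally show ?thesis by (simp add: N1)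
  qed
  have "unit_normal m n f x = ?N"
    unfolding unit_normal_def by (rule the_equality) (rule ex, use uniq in blast)
  then show ?thesis by (simp add: w_def e_def d_def o1_def r_def)
qed

lemma energy_density_eq:
  assumes x: "norm x \<in> R" and du: "\<And>X. differential u (graph_map f x) X = complex_of_real (a * X $ 1 + b * radial_part (graph_map f x) X)"
  shows "Re (stress_energy (ern_metric m n) u (graph_map f x) (unit_normal m n f x) (unit_normal m n f x))
      * volume_density m n f x = edens m n f (norm x) a b"
proof -
  define r where "r = norm x"
  define e where "e = orient n * deriv f r"
  define d where "d = D m r"
  define w where "w = sqrt (lapse2 m n f r)"
  define o1 where "o1 = orient n"
  have r: "r > 0" using x R by (auto simp: r_def)
  then have x0: "x \<noteq> 0" by (auto simp: r_def)
  note lp = lapse2_pos[OF x, folded r_def]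
  have w: "w > 0" "w * w = 2 * e - d * e * e"
    using lp by (auto simp: w_def lapse2_def e_def d_def power2_eq_square)
  have oo: "o1 * o1 = 1" "\<And>y. o1 * (o1 * y) = y" by (simp_all add: o1_def)
  let ?q = "graph_map f x" and ?N = "coord (e / w) ((- o1 * (1 - d * e) / w / r) *\<^sub>R x)"
  have un: "unit_normal m n f x = ?N"
    using unit_normal_eq[OF x] by (simp add: w_def e_def d_def o1_def r_def)
  have xx: "x \<bullet> x = r * r" by (metis r_def power2_eq_square power2_norm_eq_inner)
  have NN: "ern_metric m n ?q ?N ?N = - 1"
  proof -
    have "ern_metric m n ?q ?N ?N = - d * (e / w) * (e / w) + 2 * o1 * (e / w) * (- o1 * (1 - d * e) / w)"
      unfolding radial_metric[OF r_def[symmetric] r] by (simp add: d_def o1_def algebra_simps)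
    also have "\<dots> = - ((2 * e - d * e * e) / (w * w))"
      using w(1) by (simp add: field_simps oo)
    also have "\<dots> = - 1" using w(1) unfolding w(2)[symmetric] by simp
    finally show ?thesis .
  qed
  have duN: "differential u ?q ?N = complex_of_real (a * (e / w) + b * (- o1 * (1 - d * e) / w))"
    unfolding du graph_map_facts r_def[symmetric] using r by (simp add: xx)
  have qd: "?q \<in> chart_dom" using graph_map_facts(5)[OF x0] .
  define \<alpha> \<beta> \<gamma> where "\<alpha> = ?q $ 2 / r" and "\<beta> = ?q $ 3 / r" and "\<gamma> = ?q $ 4 / r"
  have abc: "\<alpha> * \<alpha> + \<beta> * \<beta> + \<gamma> * \<gamma> = 1"
    using radial_unit[OF qd] by (simp add: \<alpha>_def \<beta>_def \<gamma>_def graph_map_facts r_def)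
  have c2: "\<gamma> * \<gamma> = 1 - \<alpha> * \<alpha> - \<beta> * \<beta>" using abc by simp
  have c2': "\<gamma> * (\<gamma> * y) = y - \<alpha> * \<alpha> * y - \<beta> * \<beta> * y" for y
    using c2 by (metis (no_types, opaque_lifting) left_diff_distrib mult.assoc mult_1)
  have rp: "radial_part ?q (axis 1 1) = 0" "radial_part ?q (axis 2 1) = \<alpha>" "radial_part ?q (axis 3 1) = \<beta>"
    "radial_part ?q (axis 4 1) = \<gamma>"
    by (simp_all add: radial_part_alt axis_def \<alpha>_def \<beta>_def \<gamma>_def graph_map_facts r_def)
  let ?L = "\<lambda>X. a * X $ 1 + b * radial_part ?q X"
  have "(\<Sum>i\<in>UNIV. \<Sum>j\<in>UNIV. inv_gram m n ?q $ i $ j * ?L (axis i 1) * ?L (axis j 1)) = d * b * b + 2 * o1 * a * b"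
    by (simp add: inv_gram_def sum_4 rp inner_3 o1_def[symmetric] graph_map_facts(2) r_def[symmetric] d_def[symmetric])
      (simp add: axis_def algebra_simps c2 c2')
  then have "complex_of_real (\<Sum>i\<in>UNIV. \<Sum>j\<in>UNIV. inv_gram m n ?q $ i $ j * ?L (axis i 1) * ?L (axis j 1)) = complex_of_real (d * b * b + 2 * o1 * a * b)"
    by (rule arg_cong)
  then have inv: "inverse_metric (ern_metric m n) ?q (differential u ?q) (\<lambda>Z. cnj (differential u ?q Z)) = complex_of_real (d * b * b + 2 * o1 * a * b)"
    unfolding inverse_metric_def matrix_inv_gram[OF qd] du by simp
  have "Re (stress_energy (ern_metric m n) u ?q ?N ?N) = (a * (e / w) + b * (- o1 * (1 - d * e) / w))\<^sup>2 + 1/2 * (d * b * b + 2 * o1 * a * b)"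
    unfolding stress_energy_def inv duN NN by (simp add: power2_eq_square)
  then have "Re (stress_energy (ern_metric m n) u ?q ?N ?N) * w =
      ((a * e - o1 * b * (1 - d * e))\<^sup>2 + 1/2 * (w * w) * (d * b * b + 2 * o1 * a * b)) / w"
    using w(1) by (simp add: field_simps power2_eq_square)
  \<comment> \<open>Completing the squares by means of
    \<open>w * w = 2 * e - d * e * e\<close>.\<close>
  also have "(a * e - o1 * b * (1 - d * e))\<^sup>2 + 1/2 * (w * w) * (d * b * b + 2 * o1 * a * b)
      = (e * (o1 * a + d / 2 * b))\<^sup>2 + ((1 - d / 2 * e) * b)\<^sup>2"
    unfolding w(2) by (simp add: power2_eq_square algebra_simps oo)
  finally show ?thesis
    unfolding un volume_density_eq[OF x] edens_def r_def[symmetric]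
    by (simp add: w_def e_def d_def o1_def)
qed

text \<open>The derivative along the slice is the sum of exactly those two quantities whose squares
  make up \<open>edens\<close>.\<close>

lemma density_lower:
  assumes "r \<in> R"
  shows "(a * deriv f r + b)\<^sup>2 / (2 * sqrt (lapse2 m n f r)) \<le> edens m n f r a b"
proof -
  let ?e = "orient n * deriv f r"
  let ?X = "?e * (orient n * a + D m r / 2 * b)" and ?Y = "(1 - D m r / 2 * ?e) * b"
  have "deriv f r = orient n * ?e" by simp
  then have "a * deriv f r + b = ?X + ?Y" by (simp add: algebra_simps)
  moreover have "(?X + ?Y)\<^sup>2 \<le> 2 * (?X\<^sup>2 + ?Y\<^sup>2)" using sum_squares_bound[of ?X ?Y] by (simp add: power2_sum)
  moreover have "sqrt (lapse2 m n f r) > 0" using lapse2_pos(1)[OF assms] by simp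
  moreover have "A / (2 * s) \<le> B / s" if "A \<le> 2 * B" "s > 0" for A B s :: real
    using that by (simp add: field_simps)
  ultimately show ?thesis unfolding edens_def by metis
qed

lemma deriv_continuous: "continuous_on R (deriv f)"
proof -
  have "smooth_on R f" using sl by (simp add: spacelike_slice_def)
  from smooth_on_frechet[OF this, of 1] have "continuous_on R (\<lambda>r. frechet_derivative f (at r) 1)"
    by (simp add: smooth_on_imp_continuous_on)
  moreover have "frechet_derivative f (at r) 1 = deriv f r" if "r \<in> R" for r
    using frechet_derivative_at[OF f_deriv[OF that, unfolded has_field_derivative_def]] by (metis mult.right_neutral)
  ultimately show ?thesis by (simp cong: continuous_on_cong)
qed

text \<open>\<open>density_lower\<close> and Cauchy-Schwarz in polar coordinates: only the values of
  the field at both ends of the shell enter. The set \<open>Q\<close> confines the regularity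
  demanded of the field to a neighbourhood of the shell.\<close>

lemma energy_lower:
  assumes u: "\<And>r. r \<in> {\<alpha>..\<beta>} \<Longrightarrow> \<exists>T. open T \<and> T \<subseteq> chart_dom \<and> (\<forall>x. norm x = r \<longrightarrow> graph_map f x \<in> T) \<and>
        (\<forall>q\<in>T. (u \<circ> chart m n) q = complex_of_real (F (q $ 1, rad q)))"
    and S: "smooth_on S F" "\<And>r. r \<in> Q \<Longrightarrow> (f r, r) \<in> S"
    and ab: "\<alpha> < \<beta>" "{\<alpha>..\<beta>} \<subseteq> Q" "open Q" "convex Q" "Q \<subseteq> R"
    and K: "\<And>r. r \<in> {\<alpha>..\<beta>} \<Longrightarrow> sqrt (lapse2 m n f r) \<le> K"
  shows "ennreal (4 * pi * \<alpha>\<^sup>2 / (2 * K) * ((F (f \<beta>, \<beta>) - F (f \<alpha>, \<alpha>))\<^sup>2 / (\<beta> - \<alpha>))) \<le> energy m n f R u"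
proof -
  define y where "y = (\<lambda>r. F (f r, r))"
  define y' where "y' = (\<lambda>r. pd1 F (f r, r) * deriv f r + pd2 F (f r, r))"
  have "\<alpha> \<in> R" using ab(1,2,5) by (meson atLeastAtMost_iff less_imp_le order_refl subsetD)
  then have a: "\<alpha> > 0" using R by auto
  have "0 < sqrt (lapse2 m n f \<alpha>)" using lapse2_pos(1)[OF \<open>\<alpha> \<in> R\<close>] by simp
  also have "\<dots> \<le> K" using ab(1) by (intro K) auto
  finally have K0: "K > 0" .
  have dy: "(y has_real_derivative y' r) (at r)" if "r \<in> Q" for r
  proof -
    have "((\<lambda>r. F (f r, r)) has_real_derivative pd1 F (f r, r) * deriv f r + pd2 F (f r, r) * 1) (at r)"
      by (rule has_real_derivative_fpair_compose[where g = f and h = "\<lambda>r. r", OF smooth_on_has_derivative_pd[OF S(1) S(2)[OF that]]])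
        (use f_deriv[of r] that ab in auto)
    then show ?thesis by (simp add: y_def y'_def)
  qed
  have cf: "continuous_on Q f" using f_deriv ab by (meson DERIV_continuous_on has_field_derivative_at_within subsetD)
  have cf': "continuous_on Q (deriv f)" using deriv_continuous ab(5) continuous_on_subset by blast
  have cc: "continuous_on Q (\<lambda>r. g (f r, r))" if "smooth_on S g" for g :: "real \<times> real \<Rightarrow> real"
    by (rule continuous_on_compose2[OF smooth_on_imp_continuous_on[OF that]])
      (use S(2) in \<open>auto intro!: continuous_intros cf\<close>)
  have cy': "continuous_on Q y'"
    unfolding y'_def by (intro continuous_intros cf' cc smooth_on_pd S)
  have dens: "(y' (norm x))\<^sup>2 / (2 * K) \<le> Re (stress_energy (ern_metric m n) (u \<circ> chart m n) (graph_map f x)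
                       (unit_normal m n f x) (unit_normal m n f x)) * volume_density m n f x"
    if x: "norm x \<in> {\<alpha>..\<beta>}" for x
  proof -
    have xR: "norm x \<in> R" "norm x \<in> Q" using x ab by auto
    obtain T where T: "open T" "T \<subseteq> chart_dom" "graph_map f x \<in> T" "\<And>q. q \<in> T \<Longrightarrow> (u \<circ> chart m n) q = complex_of_real (F (q $ 1, rad q))"
      using u[OF x] by blast
    let ?a = "pd1 F (f (norm x), norm x)" and ?b = "pd2 F (f (norm x), norm x)"
    have du: "differential (u \<circ> chart m n) (graph_map f x) X = complex_of_real (?a * X $ 1 + ?b * radial_part (graph_map f x) X)" for X
      by (rule spherical_differential[where u = "u \<circ> chart m n" and f = F, OF T(1,3,2,4)])
        (use smooth_on_has_derivative_pd[OF S(1) S(2)[OF xR(2)]] in \<open>auto simp: graph_map_facts\<close>)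
    have "(y' (norm x))\<^sup>2 / (2 * K) \<le> (y' (norm x))\<^sup>2 / (2 * sqrt (lapse2 m n f (norm x)))"
      using K[OF x] lapse2_pos(1)[OF xR(1)] K0 by (intro divide_left_mono) auto
    also have "\<dots> \<le> edens m n f (norm x) ?a ?b"
      unfolding y'_def by (rule density_lower[OF xR(1)])
    finally show ?thesis using energy_density_eq[OF xR(1) du] by simp
  qed
  \<comment> \<open>The indicator of \<open>Q\<close> makes the integrand measurable on the whole
    line, since \<open>y'\<close> is continuous on \<open>Q\<close> only.\<close>
  let ?g = "\<lambda>r. ennreal ((y' r)\<^sup>2 * indicator Q r / (2 * K)) * indicator {\<alpha>..\<beta>} r"
  have m0: "(\<lambda>r. (y' r)\<^sup>2 * indicator Q r) \<in> borel_measurable borel"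
  proof -
    have "(\<lambda>r. indicator Q r *\<^sub>R (y' r)\<^sup>2) \<in> borel_measurable borel"
      by (rule borel_measurable_continuous_on_indicator) (use ab cy' in \<open>auto intro!: continuous_intros\<close>)
    then show ?thesis by (simp add: mult.commute)
  qed
  have "(\<lambda>r. ennreal (Y r / (2 * K)) * indicator {\<alpha>..\<beta>} r) \<in> borel_measurable borel"
    if [measurable]: "Y \<in> borel_measurable borel" for Y :: "real \<Rightarrow> real" by measurable
  from this[OF m0] have mg: "?g \<in> borel_measurable borel" .
  have "ennreal (4 * pi * \<alpha>\<^sup>2 / (2 * K) * ((y \<beta> - y \<alpha>)\<^sup>2 / (\<beta> - \<alpha>)))
      = ennreal (4 * pi * \<alpha>\<^sup>2 / (2 * K)) * ennreal ((y \<beta> - y \<alpha>)\<^sup>2 / (\<beta> - \<alpha>))"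
    using ab K0 by (intro ennreal_mult) auto
  also have "\<dots> \<le> ennreal (4 * pi * \<alpha>\<^sup>2 / (2 * K)) * (\<integral>\<^sup>+r. ennreal ((y' r)\<^sup>2 * indicator Q r) * indicator {\<alpha>..\<beta>} r \<partial>lborel)"
    by (intro mult_left_mono square_integral_lower[OF ab(1-4) dy cy']) auto
  also have "\<dots> = (\<integral>\<^sup>+r. ennreal (4 * pi * \<alpha>\<^sup>2 / (2 * K)) * (ennreal ((y' r)\<^sup>2 * indicator Q r) * indicator {\<alpha>..\<beta>} r) \<partial>lborel)"
  proof (rule nn_integral_cmult[symmetric])
    have "(\<lambda>r. ennreal (Y r) * indicator {\<alpha>..\<beta>} r) \<in> borel_measurable lborel"
      if [measurable]: "Y \<in> borel_measurable borel" for Y :: "real \<Rightarrow> real" by measurable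
    from this[OF m0] show "(\<lambda>r. ennreal ((y' r)\<^sup>2 * indicator Q r) * indicator {\<alpha>..\<beta>} r) \<in> borel_measurable lborel" .
  qed
  also have "\<dots> \<le> (\<integral>\<^sup>+r. ?g r * (ennreal (4 * pi * r\<^sup>2) * indicator {0..\<beta>} r) \<partial>lborel)"
  proof (rule nn_integral_mono)
    fix r
    have "4 * pi * \<alpha>\<^sup>2 / (2 * K) * ((y' r)\<^sup>2 * indicator Q r) \<le> (y' r)\<^sup>2 * indicator Q r / (2 * K) * (4 * pi * r\<^sup>2)" if "\<alpha> \<le> r"
    proof -
      have "(y' r)\<^sup>2 * indicator Q r / (2 * K) * (4 * pi * \<alpha>\<^sup>2) \<le> (y' r)\<^sup>2 * indicator Q r / (2 * K) * (4 * pi * r\<^sup>2)"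
        using that a K0 by (intro mult_left_mono power_mono) auto
      then show ?thesis by (simp add: mult_ac)
    qed
    then show "ennreal (4 * pi * \<alpha>\<^sup>2 / (2 * K)) * (ennreal ((y' r)\<^sup>2 * indicator Q r) * indicator {\<alpha>..\<beta>} r) \<le> ?g r * (ennreal (4 * pi * r\<^sup>2) * indicator {0..\<beta>} r)"
      using a K0 by (cases "r \<in> {\<alpha>..\<beta>}") (auto simp: ennreal_mult[symmetric] simp del: ennreal_mult' intro!: ennreal_leI)
  qed
  also have "\<dots> = (\<integral>\<^sup>+x. ?g (norm x) * indicator {..\<beta>} (norm (x :: real^3)) \<partial>lborel)"
    using a ab by (intro nn_integral_radial[OF mg, symmetric]) auto
  also have "\<dots> \<le> energy m n f R u"
    unfolding energy_def
  proof (rule nn_integral_mono)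
    fix x :: "real^3"
    show "?g (norm x) * indicator {..\<beta>} (norm x) \<le> ennreal (Re (stress_energy (ern_metric m n) (u \<circ> chart m n) (graph_map f x)
                       (unit_normal m n f x) (unit_normal m n f x)) * volume_density m n f x) * indicator {x. norm x \<in> R} x"
    proof (cases "norm x \<in> {\<alpha>..\<beta>}")
      case True
      then have "norm x \<in> R" "norm x \<in> Q" using ab by auto
      then show ?thesis using dens[OF True] True by (auto simp: indicator_def intro!: ennreal_leI)
    qed simp
  qed
  finally show ?thesis by (simp add: y_def)
qed

text \<open>Two shells with a common inner radius: a thin one for the leading term of the packet and
  a larger one for the tail behind it.\<close>

lemma energy_upper:
  assumes u: "\<And>x. norm x \<in> R \<Longrightarrow> \<exists>a b. (\<forall>X. differential (u \<circ> chart m n) (graph_map f x) X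
        = complex_of_real (a * X $ 1 + b * radial_part (graph_map f x) X))
        \<and> edens m n f (norm x) a b \<le> c1 * indicator {\<alpha>..\<beta>} (norm x) + c2 * indicator {\<alpha>..\<gamma>} (norm x)"
    and c: "0 \<le> c1" "0 \<le> c2" "0 < \<alpha>" "\<alpha> \<le> \<beta>" "\<beta> \<le> \<gamma>"
  shows "energy m n f R u \<le> ennreal (4 * pi * (c1 * \<beta>\<^sup>2 * (\<beta> - \<alpha>) + c2 * \<gamma>\<^sup>2 * (\<gamma> - \<alpha>)))"
proof -
  let ?g = "\<lambda>r. ennreal (c1 * indicator {\<alpha>..\<beta>} r + c2 * indicator {\<alpha>..\<gamma>} r)"
  have "energy m n f R u \<le> (\<integral>\<^sup>+x. ?g (norm x) * indicator {..\<gamma>} (norm (x :: real^3)) \<partial>lborel)"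
    unfolding energy_def
  proof (rule nn_integral_mono)
    fix x :: "real^3"
    show "ennreal (Re (stress_energy (ern_metric m n) (u \<circ> chart m n) (graph_map f x)
         (unit_normal m n f x) (unit_normal m n f x)) * volume_density m n f x) * indicator {x. norm x \<in> R} x
         \<le> ?g (norm x) * indicator {..\<gamma>} (norm x)"
    proof (cases "norm x \<in> R")
      case True
      from u[OF True] obtain a b where ab: "\<And>X. differential (u \<circ> chart m n) (graph_map f x) X
        = complex_of_real (a * X $ 1 + b * radial_part (graph_map f x) X)"
        "edens m n f (norm x) a b \<le> c1 * indicator {\<alpha>..\<beta>} (norm x) + c2 * indicator {\<alpha>..\<gamma>} (norm x)" by blast
      show ?thesis
        using True ab(2) c unfolding energy_density_eq[OF True ab(1)]
        by (cases "norm x \<le> \<gamma>") (auto simp: indicator_def ennreal_neg simp del: ennreal_plus intro!: ennreal_leI split: if_splits)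
    qed simp
  qed
  also have "\<dots> = (\<integral>\<^sup>+r. ?g r * (ennreal (4 * pi * r\<^sup>2) * indicator {0..\<gamma>} r) \<partial>lborel)"
    using c by (intro nn_integral_radial) auto
  also have "\<dots> \<le> (\<integral>\<^sup>+r. ennreal (4 * pi * c1 * \<beta>\<^sup>2) * indicator {\<alpha>..\<beta>} r + ennreal (4 * pi * c2 * \<gamma>\<^sup>2) * indicator {\<alpha>..\<gamma>} r \<partial>lborel)"
  proof (rule nn_integral_mono)
    fix r
    have 1: "c1 * (4 * pi * r\<^sup>2) \<le> 4 * pi * c1 * \<beta>\<^sup>2" if "\<alpha> \<le> r" "r \<le> \<beta>"
    proof -
      have "(4 * pi * c1) * r\<^sup>2 \<le> (4 * pi * c1) * \<beta>\<^sup>2" using that c by (intro mult_left_mono power_mono) auto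
      then show ?thesis by (simp add: mult_ac)
    qed
    have 2: "c2 * (4 * pi * r\<^sup>2) \<le> 4 * pi * c2 * \<gamma>\<^sup>2" if "\<alpha> \<le> r" "r \<le> \<gamma>"
    proof -
      have "(4 * pi * c2) * r\<^sup>2 \<le> (4 * pi * c2) * \<gamma>\<^sup>2" using that c by (intro mult_left_mono power_mono) auto
      then show ?thesis by (simp add: mult_ac)
    qed
    show "?g r * (ennreal (4 * pi * r\<^sup>2) * indicator {0..\<gamma>} r) \<le>
        ennreal (4 * pi * c1 * \<beta>\<^sup>2) * indicator {\<alpha>..\<beta>} r + ennreal (4 * pi * c2 * \<gamma>\<^sup>2) * indicator {\<alpha>..\<gamma>} r"
      using 1 2 c
      by (cases "r \<in> {\<alpha>..\<beta>}"; cases "r \<in> {\<alpha>..\<gamma>}")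
        (auto simp: indicator_def ennreal_mult[symmetric] ennreal_plus[symmetric] distrib_right
          simp del: ennreal_plus ennreal_mult' intro!: ennreal_leI add_mono)
  qed
  also have "\<dots> = ennreal (4 * pi * c1 * \<beta>\<^sup>2) * ennreal (\<beta> - \<alpha>) + ennreal (4 * pi * c2 * \<gamma>\<^sup>2) * ennreal (\<gamma> - \<alpha>)"
    using c by (subst nn_integral_add) (auto simp: nn_integral_cmult_indicator)
  also have "\<dots> = ennreal (4 * pi * (c1 * \<beta>\<^sup>2 * (\<beta> - \<alpha>) + c2 * \<gamma>\<^sup>2 * (\<gamma> - \<alpha>)))"
  proof -
    have "ennreal (4 * pi * c1 * \<beta>\<^sup>2) * ennreal (\<beta> - \<alpha>) + ennreal (4 * pi * c2 * \<gamma>\<^sup>2) * ennreal (\<gamma> - \<alpha>)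
        = ennreal (4 * pi * c1 * \<beta>\<^sup>2 * (\<beta> - \<alpha>) + 4 * pi * c2 * \<gamma>\<^sup>2 * (\<gamma> - \<alpha>))"
      using c by (simp add: ennreal_mult)
    then show ?thesis by (simp add: algebra_simps)
  qed
  finally show ?thesis .
qed

end

section \<open>The domain of dependence\<close>

text \<open>Unlike the coordinates, the area radius is continuous on the entire extension, so it can
  show that a curve has no limit point.\<close>

fun radius :: "ern \<Rightarrow> real" where
  "radius (Region k t x) = norm x"
| "radius (Horizon k v x) = norm x"

lemma radius_chart: "radius (chart m n q) = rad q"
  by (simp add: chart_def rad_def)

lemma topspace_ern: "topspace (ern_top m) = ern_space m"
proof -
  have "chart_preimage m n (ern_space m) = chart_dom" for n
    by (auto simp: chart_preimage_def ern_space_def)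
  then have "openin (ern_top m) (ern_space m)" by (simp add: openin_ern_top open_chart_dom)
  then show ?thesis by (auto simp: topspace_def openin_ern_top)
qed

lemma openin_radius:
  assumes "open S"
  shows "openin (ern_top m) {p \<in> ern_space m. radius p \<in> S}"
proof -
  have e: "chart_preimage m n {p \<in> ern_space m. radius p \<in> S} = {q \<in> chart_dom. (q $ 1, rad q) \<in> UNIV \<times> S}" for n
    by (auto simp: chart_preimage_def ern_space_def radius_chart)
  have "open (UNIV \<times> S :: (real \<times> real) set)" by (intro open_Times assms) auto
  from open_rad_set[OF this] show ?thesis unfolding openin_ern_top e by blast
qed

lemma ern_spaceE:
  assumes "p \<in> ern_space m"
  obtains n q where "q \<in> chart_dom" "p = chart m n q"
  using assms by (auto simp: ern_space_def)

lemma radius_pos: "p \<in> ern_space m \<Longrightarrow> radius p > 0"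
  by (elim ern_spaceE) (auto simp: radius_chart rad_pos)

lemma Horizon_norm: "Horizon k v x \<in> ern_space m \<Longrightarrow> norm x = m"
  by (elim ern_spaceE) (auto simp: chart_def rad_def split: if_splits)

lemma Region_norm:
  assumes "Region k t x \<in> ern_space m"
  shows "norm x > 0" "if even k then norm x > m else norm x < m"
proof -
  obtain n q where "q \<in> chart_dom" "Region k t x = chart m n q" using assms by (rule ern_spaceE)
  then show "if even k then norm x > m else norm x < m"
    by (auto simp: chart_def rad_def split: if_splits)
qed (use radius_pos[OF assms] in auto)

lemma limitin_radius:
  assumes "limitin (ern_top m) \<gamma> q F"
  shows "((\<lambda>\<tau>. radius (\<gamma> \<tau>)) \<longlongrightarrow> radius q) F"
proof (rule topological_tendstoI)
  fix S assume "open S" "radius q \<in> S"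
  then have "\<forall>\<^sub>F \<tau> in F. \<gamma> \<tau> \<in> {p \<in> ern_space m. radius p \<in> S}"
    using assms openin_radius[of S m] unfolding limitin_def topspace_ern by blast
  then show "\<forall>\<^sub>F \<tau> in F. radius (\<gamma> \<tau>) \<in> S" by eventually_elim simp
qed

text \<open>Any candidate limit has a neighbourhood which contains only a bounded part of each
  generator of the horizon. It is built by deleting the rest of the horizon, a set which is closed
  in every chart.\<close>

lemma horizon_no_limit:
  assumes "filterlim g at_top F \<or> filterlim g at_bot F" "F \<noteq> bot"
  shows "\<not> limitin (ern_top m) (\<lambda>\<tau>. Horizon n (g \<tau>) x) q F"
proof
  assume l: "limitin (ern_top m) (\<lambda>\<tau>. Horizon n (g \<tau>) x) q F"
  then have q: "q \<in> ern_space m" by (simp add: limitin_def topspace_ern)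
  \<comment> \<open>If the candidate lies in an open region, any value will do, because only horizon
    points are deleted.\<close>
  define c where "c = (case q of Horizon k v y \<Rightarrow> v | Region k t y \<Rightarrow> 0)"
  define U where "U = ern_space m - {Horizon n v y |v y. \<bar>v - c\<bar> \<ge> 1}"
  have "openin (ern_top m) U"
    unfolding openin_ern_top
  proof (intro conjI allI)
    fix k
    have e: "chart_preimage m k U = (if k = n then {q \<in> chart_dom. (q $ 1, rad q) \<in> UNIV \<times> (- {m}) \<union> {c - 1<..<c + 1} \<times> UNIV} else chart_dom)"
    proof -
      have "chart m k q \<in> ern_space m" if "q \<in> chart_dom" for q using that by (auto simp: ern_space_def)
      then have "chart_preimage m k U = {q \<in> chart_dom. chart m k q \<notin> {Horizon n v y |v y. \<bar>v - c\<bar> \<ge> 1}}"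
        by (auto simp: chart_preimage_def U_def)
      also have "\<dots> = (if k = n then {q \<in> chart_dom. (q $ 1, rad q) \<in> UNIV \<times> (- {m}) \<union> {c - 1<..<c + 1} \<times> UNIV} else chart_dom)"
        by (auto simp: chart_def abs_less_iff not_le split: if_splits)
      finally show ?thesis .
    qed
    have "open (UNIV \<times> (- {m}) \<union> {c - 1<..<c + 1} \<times> UNIV :: (real \<times> real) set)"
      by (intro open_Un open_Times) auto
    from open_rad_set[OF this] open_chart_dom show "open (chart_preimage m k U)"
      unfolding e by (rule if_split[THEN iffD2, OF conjI, OF impI impI])
  qed (auto simp: U_def)
  moreover have "q \<in> U" using q by (auto simp: U_def c_def)
  ultimately have "\<forall>\<^sub>F \<tau> in F. Horizon n (g \<tau>) x \<in> U" using l by (simp add: limitin_def)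
  then have ev: "\<forall>\<^sub>F \<tau> in F. \<bar>g \<tau> - c\<bar> < 1" by eventually_elim (auto simp: U_def)
  from assms(1) have "\<forall>\<^sub>F \<tau> in F. \<bar>g \<tau> - c\<bar> \<ge> 1"
  proof
    assume "filterlim g at_top F"
    then have "\<forall>\<^sub>F \<tau> in F. g \<tau> \<ge> c + 1" by (simp add: filterlim_at_top)
    then show ?thesis by eventually_elim auto
  next
    assume "filterlim g at_bot F"
    then have "\<forall>\<^sub>F \<tau> in F. g \<tau> \<le> c - 1" by (simp add: filterlim_at_bot)
    then show ?thesis by eventually_elim auto
  qed
  with ev have "\<forall>\<^sub>F \<tau> in F. False" by eventually_elim auto
  then show False using assms(2) by (simp add: trivial_limit_def)
qed

lemma causal_curveI:
  assumes "\<And>\<tau>. c \<tau> \<in> chart_dom" "\<And>\<tau>. (c has_vector_derivative c' \<tau>) (at \<tau>)" "continuous_on UNIV c'"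
    "\<And>\<tau>. future_causal m n (c \<tau>) (c' \<tau>)"
  shows "causal_curve m J (\<lambda>\<tau>. chart m n (c \<tau>))"
  unfolding causal_curve_def
proof
  fix s assume "s \<in> J"
  have "continuous_on UNIV c"
    using assms(2) by (meson continuous_at_imp_continuous_on has_vector_derivative_continuous)
  then show "\<exists>n' d d' e S. e > 0 \<and> finite S \<and>
        continuous_on (J \<inter> ball s e) d \<and> continuous_on (J \<inter> ball s e - S) d' \<and>
        (\<forall>\<tau>\<in>J \<inter> ball s e. d \<tau> \<in> chart_dom \<and> chart m n (c \<tau>) = chart m n' (d \<tau>)) \<and>
        (\<forall>\<tau>\<in>J \<inter> ball s e - S. (d has_vector_derivative d' \<tau>) (at \<tau> within J) \<and>
           future_causal m n' (d \<tau>) (d' \<tau>))"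
    using assms
    by (intro exI[of _ n] exI[of _ c] exI[of _ c'] exI[of _ "1 :: real"] exI[of _ "{} :: real set"])
      (auto intro: continuous_on_subset has_vector_derivative_at_within)
qed

text \<open>A curve that is inextendible in both directions treats the future and the past part of
  the domain of dependence alike.\<close>

lemma dom_dep_curve:
  assumes p: "p \<in> dom_dep m A" and c: "\<And>J. causal_curve m J \<gamma>" "\<gamma> 0 = p"
    and l: "\<nexists>q. limitin (ern_top m) \<gamma> q at_bot" "\<nexists>q. limitin (ern_top m) \<gamma> q at_top"
  obtains \<tau> where "\<gamma> \<tau> \<in> A"
  using assms unfolding dom_dep_def future_dom_dep_def past_dom_dep_def by blast

lemma dom_dep_space: "dom_dep m A \<subseteq> ern_space m"
  by (auto simp: dom_dep_def future_dom_dep_def past_dom_dep_def)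

lemma slice_Horizon: "Horizon k v x \<in> slice m 0 h R \<Longrightarrow> k = 0"
  by (auto simp: slice_def chart_def split: if_splits)

lemma coord_has_vector_derivative:
  assumes "(f has_real_derivative f') (at \<tau>)" "(g has_vector_derivative g') (at \<tau>)"
  shows "((\<lambda>\<tau>. coord (f \<tau>) (g \<tau>)) has_vector_derivative coord f' g') (at \<tau>)"
proof -
  have bl: "bounded_linear (\<lambda>p. coord (fst p) (snd p))"
    unfolding linear_conv_bounded_linear[symmetric]
    by (rule linearI) (auto simp: vec_eq_iff forall_4)
  have "((\<lambda>\<tau>. (f \<tau>, g \<tau>)) has_vector_derivative (f', g')) (at \<tau>)"
    using has_derivative_Pair[of f "\<lambda>h. h * f'" \<tau> UNIV g "\<lambda>h. h *\<^sub>R g'"] assms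
    by (simp add: has_vector_derivative_def has_field_derivative_def mult_commute_abs)
  from bounded_linear.has_vector_derivative[OF bl this] show ?thesis by simp
qed

text \<open>The generator of a horizon through the point is null because \<open>D\<close> vanishes
  there, it is inextendible in both directions, and it never leaves \<open>Horizon n\<close>; but
  the slice meets no horizon other than \<open>Horizon 0\<close>.\<close>

lemma dom_dep_Horizon:
  assumes m: "m > 0" and p: "Horizon n v x \<in> dom_dep m (slice m 0 h R)"
  shows "n = 0"
proof -
  have x: "norm x = m" using p dom_dep_space Horizon_norm by blast
  define c where "c = (\<lambda>\<tau>. coord (v + \<tau>) x)"
  have c: "spat (c \<tau>) = x" "rad (c \<tau>) = m" for \<tau> using x by (auto simp: c_def rad_def)
  have ch: "chart m n (c \<tau>) = Horizon n (v + \<tau>) x" for \<tau>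
    using c by (simp add: chart_def) (simp add: c_def)
  have x0: "x \<noteq> 0" using x m by auto
  have cv: "causal_curve m J (\<lambda>\<tau>. chart m n (c \<tau>))" for J
  proof (rule causal_curveI)
    show "c \<tau> \<in> chart_dom" for \<tau> using c(1) x0 by (simp add: chart_dom_def)
    show "(c has_vector_derivative coord 1 0) (at \<tau>)" for \<tau>
      unfolding c_def by (intro coord_has_vector_derivative) (auto intro!: derivative_eq_intros)
    show "future_causal m n (c \<tau>) (coord 1 0)" for \<tau>
    proof -
      have "x \<bullet> x = m * m" using x by (metis power2_eq_square power2_norm_eq_inner)
      then have "ern_metric m n (c \<tau>) (coord 1 0) (future_null n (c \<tau>)) = - 1"
        using m by (simp add: ern_metric_def future_null_def radial_part_def c)
      moreover have "coord 1 0 \<noteq> 0" by (metis coord_nth(1) zero_index zero_neq_one)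
      ultimately show ?thesis
        using m by (simp add: future_causal_def ern_metric_def radial_part_def c D_self)
    qed
  qed auto
  have "\<exists>\<tau>. chart m n (c \<tau>) \<in> slice m 0 h R"
  proof (rule dom_dep_curve[OF p cv])
    have f: "filterlim (\<lambda>\<tau>. v + \<tau>) at_bot at_bot" "filterlim (\<lambda>\<tau>. v + \<tau>) at_top at_top"
      by real_asymp+
    show "\<nexists>q. limitin (ern_top m) (\<lambda>\<tau>. chart m n (c \<tau>)) q at_bot" "\<nexists>q. limitin (ern_top m) (\<lambda>\<tau>. chart m n (c \<tau>)) q at_top"
      unfolding ch using horizon_no_limit[OF disjI2[OF f(1)] trivial_limit_at_bot_linorder]
        horizon_no_limit[OF disjI1[OF f(2)] trivial_limit_at_top_linorder] by blast+
  qed (use ch in auto)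
  then show ?thesis unfolding ch using slice_Horizon by blast
qed

text \<open>The outgoing radial null line through the point must cross the slice, which expresses
  its \<open>u\<close> by a slice point in region II. This controls how far \<open>u\<close> can
  grow, and with it whether the ray can be traced to the reference cone.\<close>

lemma dom_dep_Region_1:
  assumes m: "m > 0" and p: "Region 1 t x \<in> dom_dep m (slice m 0 h R)"
  shows "\<exists>r\<in>R. 0 < r \<and> r < m \<and> t - rstar m (norm x) = h r - 2 * rstar m r"
proof -
  have x: "0 < norm x" "norm x < m" using p dom_dep_space Region_norm[of 1 t x m] by auto
  define u where "u = t - rstar m (norm x)"
  \<comment> \<open>The exponential parameter runs over the whole line: the radius tends to 0 at one
    end and to infinity at the other, and neither is the radius of a point of the spacetime.\<close>
  define c where "c = (\<lambda>\<tau>. coord u (exp \<tau> *\<^sub>R x))"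
  have c: "spat (c \<tau>) = exp \<tau> *\<^sub>R x" "rad (c \<tau>) = exp \<tau> * norm x" "c \<tau> $ 1 = u" for \<tau> by (auto simp: c_def rad_def)
  have c0: "chart m 1 (c 0) = Region 1 t x"
    using x c[of 0] by (simp add: chart_def orient_def u_def)
  have cv: "causal_curve m J (\<lambda>\<tau>. chart m 1 (c \<tau>))" for J
  proof (rule causal_curveI)
    show cd: "c \<tau> \<in> chart_dom" for \<tau> using c(1) x by (simp add: chart_dom_def)
    show "(c has_vector_derivative coord 0 (exp \<tau> *\<^sub>R x)) (at \<tau>)" for \<tau>
      unfolding c_def
      by (intro coord_has_vector_derivative)
        (auto intro!: derivative_eq_intros has_vector_derivative_scaleR[THEN has_vector_derivative_eq_rhs])
    show "continuous_on UNIV (\<lambda>\<tau>. coord 0 (exp \<tau> *\<^sub>R x))"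
      unfolding coord_def by (intro continuous_intros)
    show "future_causal m 1 (c \<tau>) (coord 0 (exp \<tau> *\<^sub>R x))" for \<tau>
    proof -
      have xx: "x \<bullet> x = norm x * norm x" by (metis power2_eq_square power2_norm_eq_inner)
      have "ern_metric m 1 (c \<tau>) (coord 0 (exp \<tau> *\<^sub>R x)) (coord 0 (exp \<tau> *\<^sub>R x)) = 0"
        using x by (simp add: ern_metric_def radial_part_def c xx field_simps)
      moreover have "coord 0 (exp \<tau> *\<^sub>R x) = (exp \<tau> * norm x) *\<^sub>R future_null 1 (c \<tau>)"
        using x by (simp add: future_null_def c orient_def coord_linear(1)[of _ 0, simplified, symmetric])
      moreover have "coord 0 (exp \<tau> *\<^sub>R x) \<noteq> 0"
      proof
        assume "coord 0 (exp \<tau> *\<^sub>R x) = 0"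
        then have "spat (coord 0 (exp \<tau> *\<^sub>R x)) = spat 0" by simp
        moreover have "spat 0 = 0" by (simp add: vec_eq_iff forall_3)
        ultimately show False using x by simp
      qed
      ultimately show ?thesis
        unfolding future_causal_def using x by (intro conjI disjI2 exI[of _ "exp \<tau> * norm x"]) auto
    qed
  qed
  have rc: "radius (chart m 1 (c \<tau>)) = exp \<tau> * norm x" for \<tau> by (simp add: radius_chart c)
  have "\<exists>\<tau>. chart m 1 (c \<tau>) \<in> slice m 0 h R"
  proof (rule dom_dep_curve[OF p cv c0])
    show "\<nexists>q. limitin (ern_top m) (\<lambda>\<tau>. chart m 1 (c \<tau>)) q at_bot"
    proof
      assume "\<exists>q. limitin (ern_top m) (\<lambda>\<tau>. chart m 1 (c \<tau>)) q at_bot"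
      then obtain q where q: "limitin (ern_top m) (\<lambda>\<tau>. chart m 1 (c \<tau>)) q at_bot" by blast
      then have "radius q > 0" using radius_pos[of q m] by (simp add: limitin_def topspace_ern)
      moreover have l1: "((\<lambda>\<tau>. exp \<tau> * norm x) \<longlongrightarrow> radius q) at_bot" using limitin_radius[OF q] by (simp add: rc)
      have l2: "((\<lambda>\<tau>. exp \<tau> * norm x) \<longlongrightarrow> 0 * norm x) at_bot"
        by (intro tendsto_mult exp_at_bot tendsto_const)
      have "radius q = 0" using tendsto_unique[OF trivial_limit_at_bot_linorder l1 l2] by simp
      ultimately show False by simp
    qed
    show "\<nexists>q. limitin (ern_top m) (\<lambda>\<tau>. chart m 1 (c \<tau>)) q at_top"
    proof
      assume "\<exists>q. limitin (ern_top m) (\<lambda>\<tau>. chart m 1 (c \<tau>)) q at_top"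
      then obtain q where q: "limitin (ern_top m) (\<lambda>\<tau>. chart m 1 (c \<tau>)) q at_top" by blast
      have "((\<lambda>\<tau>. exp \<tau> * norm x) \<longlongrightarrow> radius q) at_top" using limitin_radius[OF q] by (simp add: rc)
      moreover have "filterlim (\<lambda>\<tau>. exp \<tau> * norm x) at_top at_top"
        by (rule filterlim_at_top_mult_tendsto_pos[OF tendsto_const x(1) exp_at_top])
      ultimately show False
        using filterlim_at_top_imp_at_infinity not_tendsto_and_filterlim_at_infinity trivial_limit_at_top_linorder by blast
    qed
  qed blast
  then obtain \<tau> y where y: "norm y \<in> R" "chart m 1 (c \<tau>) = chart m 0 (graph_map h y)"
    by (auto simp: slice_def)
  have ry: "norm y = exp \<tau> * norm x" using arg_cong[OF y(2), of radius] by (simp add: radius_chart c graph_map_facts)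
  \<comment> \<open>The line passes through \<open>Region 1\<close>, \<open>Horizon 1\<close> and
    \<open>Region 2\<close>; chart 0, which contains the slice, shares only the first of
    these.\<close>
  have "norm y < m \<and> u + rstar m (norm y) = h (norm y) - rstar m (norm y)"
    using y(2) ry by (auto simp: chart_def c graph_map_facts orient_def split: if_splits)
  then show ?thesis using y(1) ry x by (intro bexI[of _ "norm y"]) (auto simp: u_def)
qed

section \<open>A smooth step function\<close>

text \<open>The powers of \<open>1 / x\<close> make the family closed under differentiation up to
  linear combinations, so that all orders of smoothness follow in one induction.\<close>

definition flat :: "nat \<Rightarrow> real \<Rightarrow> real" where
  "flat n x = (if x > 0 then (1 / x) ^ n * exp (- (1 / x)) else 0)"

lemma flat_tendsto: "(flat n \<longlongrightarrow> 0) (at 0)"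
proof -
  have "filterlim (\<lambda>x::real. 1 / x) at_top (at_right 0)" by real_asymp
  from filterlim_compose[OF tendsto_power_div_exp_0 this]
  have "((\<lambda>x. (1 / x) ^ n / exp (1 / x :: real)) \<longlongrightarrow> 0) (at_right 0)" .
  then have r: "(flat n \<longlongrightarrow> 0) (at_right 0)"
    by (rule Lim_transform_eventually)
      (auto simp: flat_def eventually_at_right_field exp_minus divide_inverse intro!: exI[of _ 1])
  have l: "(flat n \<longlongrightarrow> 0) (at_left 0)"
    by (rule Lim_transform_eventually[OF tendsto_const])
      (auto simp: flat_def eventually_at_left_field intro!: exI[of _ "-1"])
  show ?thesis using l r by (simp add: filterlim_split_at)
qed

lemma flat_deriv: "(flat n has_real_derivative flat (n + 2) x - real n * flat (n + 1) x) (at x)"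
proof (cases x "0 :: real" rule: linorder_cases)
  case less
  have "((\<lambda>_. 0) has_real_derivative flat (n + 2) x - real n * flat (n + 1) x) (at x)"
    using less by (simp add: flat_def)
  then show ?thesis
    by (rule has_field_derivative_transform_within_open[where S = "{..<0}"]) (use less in \<open>auto simp: flat_def\<close>)
next
  case equal
  \<comment> \<open>The difference quotient at 0 is the next member of the family, which tends to
    0.\<close>
  have "((\<lambda>h. flat n h / h) \<longlongrightarrow> 0) (at 0)"
    by (rule Lim_transform_eventually[OF flat_tendsto[of "n + 1"]])
      (auto simp: flat_def eventually_at_filter)
  then show ?thesis using equal by (simp add: DERIV_def flat_def[of _ 0])
next
  case greater
  have "((\<lambda>x. (1 / x) ^ n) has_real_derivative - (real n * (1 / x) ^ (n + 1))) (at x)"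
  proof -
    have "((\<lambda>x. 1 / x) has_real_derivative - ((1 / x) ^ 2)) (at x)"
      using greater by (auto intro!: derivative_eq_intros simp: power2_eq_square)
    from DERIV_power[OF this, of n] show ?thesis by (cases n) (simp_all add: power2_eq_square mult_ac)
  qed
  moreover have "((\<lambda>x. exp (- (1 / x))) has_real_derivative exp (- (1 / x)) * (1 / x) ^ 2) (at x)"
    using greater by (auto intro!: derivative_eq_intros simp: field_simps power2_eq_square)
  ultimately have "((\<lambda>x. (1 / x) ^ n * exp (- (1 / x))) has_real_derivative
      (1 / x) ^ n * (exp (- (1 / x)) * (1 / x) ^ 2) + - (real n * (1 / x) ^ (n + 1)) * exp (- (1 / x))) (at x)"
    by (rule DERIV_mult')
  moreover have "(1 / x) ^ n * (exp (- (1 / x)) * (1 / x) ^ 2) + - (real n * (1 / x) ^ (n + 1)) * exp (- (1 / x))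
      = flat (n + 2) x - real n * flat (n + 1) x"
    using greater by (simp add: flat_def power2_eq_square power_add mult_ac)
  ultimately have "((\<lambda>x. (1 / x) ^ n * exp (- (1 / x))) has_real_derivative flat (n + 2) x - real n * flat (n + 1) x) (at x)"
    by simp
  then show ?thesis
    by (rule has_field_derivative_transform_within_open[where S = "{0<..}"]) (use greater in \<open>auto simp: flat_def\<close>)
qed

lemma flat_smooth: "smooth_on UNIV (flat n)"
proof -
  have "Ck_on k UNIV (flat n)" for k n
  proof (induction k arbitrary: n)
    case 0
    show ?case using DERIV_isCont[OF flat_deriv] by (auto intro!: continuous_at_imp_continuous_on)
  next
    case (Suc k)
    have "Ck_on k UNIV (\<lambda>x. flat (n + 2) x + (- real n) * flat (n + 1) x)"
      by (intro Ck_on_add Ck_on_bilinear[OF _ bounded_bilinear_mult] Ck_on_const Suc) auto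
    then show ?case
      by (intro Ck_on_real_SucI[where f' = "\<lambda>x. flat (n + 2) x - real n * flat (n + 1) x"] flat_deriv) auto
  qed
  then show ?thesis by (simp add: smooth_on_def)
qed

definition step :: "real \<Rightarrow> real" where
  "step x = flat 0 x / (flat 0 x + flat 0 (1 - x))"

lemma step_denom_pos: "flat 0 x + flat 0 (1 - x) > 0"
  by (auto simp: flat_def intro: add_pos_pos)

lemma step_smooth: "smooth_on UNIV step"
proof -
  have "smooth_on UNIV (\<lambda>x. flat 0 (1 - x))"
    by (rule smooth_on_compose[OF _ _ _ _ flat_smooth]) (auto intro!: smooth_on_diff smooth_on_const smooth_on_ident)
  then show ?thesis
    unfolding step_def[abs_def]
    by (intro smooth_on_divide smooth_on_add flat_smooth) (use step_denom_pos in \<open>auto simp: less_imp_neq[symmetric]\<close>)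
qed

lemma step_props: "0 \<le> step x" "step x \<le> 1" "x \<le> 0 \<Longrightarrow> step x = 0" "x \<ge> 1 \<Longrightarrow> step x = 1"
proof -
  have "flat 0 y \<ge> 0" for y by (simp add: flat_def)
  then show "0 \<le> step x" "step x \<le> 1" using step_denom_pos[of x] by (auto simp: step_def)
  show "x \<le> 0 \<Longrightarrow> step x = 0" by (simp add: step_def flat_def)
  show "x \<ge> 1 \<Longrightarrow> step x = 1" by (simp add: step_def flat_def)
qed

lemma step_DERIV: "(step has_real_derivative deriv step x) (at x)"
  using smooth_on_differentiable[OF step_smooth] by (simp add: DERIV_deriv_iff_real_differentiable)

lemma step_deriv_outside: "x < 0 \<or> x > 1 \<Longrightarrow> deriv step x = 0"
proof -
  have *: "deriv step x = 0" if "open S" "x \<in> S" "\<And>y. y \<in> S \<Longrightarrow> step y = c" for S c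
  proof -
    have "((\<lambda>_. c) has_real_derivative 0) (at x)" by simp
    then have "(step has_real_derivative 0) (at x)"
      by (rule has_field_derivative_transform_within_open[OF _ that(1,2)]) (use that(3) in auto)
    then show ?thesis by (rule DERIV_imp_deriv)
  qed
  assume "x < 0 \<or> x > 1"
  then show ?thesis using *[of "{..<0}" 0] *[of "{1<..}" 1] step_props by auto
qed

lemma step_deriv_bound: obtains C where "C > 0" "\<And>x. \<bar>deriv step x\<bar> \<le> C"
proof -
  have "continuous_on UNIV (\<lambda>x. frechet_derivative step (at x) 1)"
    using smooth_on_frechet[OF step_smooth, of 1] by (simp add: smooth_on_imp_continuous_on)
  moreover have "frechet_derivative step (at x) 1 = deriv step x" for x
    using frechet_derivative_at[OF step_DERIV[unfolded has_field_derivative_def]] by (metis mult.right_neutral)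
  ultimately have "continuous_on UNIV (deriv step)" by simp
  then have "continuous_on {0..1} (deriv step)" by (rule continuous_on_subset) simp
  then have "bounded (deriv step ` {0..1})"
    by (intro compact_imp_bounded compact_continuous_image) auto
  then obtain C where C: "C > 0" "\<And>x. x \<in> {0..1} \<Longrightarrow> \<bar>deriv step x\<bar> \<le> C"
    by (auto simp: bounded_pos)
  show ?thesis
  proof (rule that[OF C(1)])
    show "\<bar>deriv step x\<bar> \<le> C" for x
      using C step_deriv_outside[of x] by (cases "x \<in> {0..1}") auto
  qed
qed

section \<open>Wave packets\<close>

lemma product_pd:
  assumes f: "\<And>x. (f has_real_derivative f' x) (at x)" and g: "\<And>x. (g has_real_derivative g' x) (at x)"
  shows "pd1 (\<lambda>p. f (fst p) * g (snd p)) = (\<lambda>p. f' (fst p) * g (snd p))"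
    "pd2 (\<lambda>p. f (fst p) * g (snd p)) = (\<lambda>p. f (fst p) * g' (snd p))"
proof -
  have "((\<lambda>p. f (fst p) * g (snd p)) has_derivative fpair (f' (fst p) * g (snd p)) (f (fst p) * g' (snd p))) (at p)" for p
  proof -
    have 1: "((\<lambda>p. f (fst p)) has_derivative (\<lambda>h. f' (fst p) * fst h)) (at p)"
      using has_derivative_compose[OF has_derivative_fst[OF has_derivative_ident] f[unfolded has_field_derivative_def]] .
    have 2: "((\<lambda>p. g (snd p)) has_derivative (\<lambda>h. g' (snd p) * snd h)) (at p)"
      using has_derivative_compose[OF has_derivative_snd[OF has_derivative_ident] g[unfolded has_field_derivative_def]] .
    show ?thesis
      using has_derivative_mult[OF 1 2] by (rule has_derivative_eq_rhs) (auto simp: fpair_def algebra_simps)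
  qed
  from pd_eq[OF this] show "pd1 (\<lambda>p. f (fst p) * g (snd p)) = (\<lambda>p. f' (fst p) * g (snd p))"
    "pd2 (\<lambda>p. f (fst p) * g (snd p)) = (\<lambda>p. f (fst p) * g' (snd p))" by auto
qed

lemma pd_cong:
  assumes "open N" "\<And>p. p \<in> N \<Longrightarrow> f p = g p" "smooth_on N g" "p \<in> N"
  shows "pd1 f p = pd1 g p" "pd2 f p = pd2 g p"
proof -
  have "(f has_derivative fpair (pd1 g p) (pd2 g p)) (at p)"
    by (rule has_derivative_transform_within_open[OF smooth_on_has_derivative_pd[OF assms(3,4)] assms(1,4)])
      (use assms(2) in auto)
  from pd_eq[OF this] show "pd1 f p = pd1 g p" "pd2 f p = pd2 g p" .
qed

lemma pd_minus:
  assumes "smooth_on N f" "open N" "p \<in> N"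
  shows "pd1 (\<lambda>q. - f q) p = - pd1 f p" "pd2 (\<lambda>q. - f q) p = - pd2 f p"
proof -
  have "((\<lambda>q. - f q) has_derivative (\<lambda>h. - fpair (pd1 f p) (pd2 f p) h)) (at p)"
    by (intro has_derivative_minus smooth_on_has_derivative_pd[OF assms(1,3)])
  then have "((\<lambda>q. - f q) has_derivative fpair (- pd1 f p) (- pd2 f p)) (at p)"
    by (rule has_derivative_eq_rhs) (auto simp: fpair_def)
  from pd_eq[OF this] show "pd1 (\<lambda>q. - f q) p = - pd1 f p" "pd2 (\<lambda>q. - f q) p = - pd2 f p" .
qed

lemma pd_diff:
  assumes "smooth_on N f" "smooth_on N g" "p \<in> N"
  shows "pd1 (\<lambda>q. f q - g q) p = pd1 f p - pd1 g p" "pd2 (\<lambda>q. f q - g q) p = pd2 f p - pd2 g p"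
proof -
  have "((\<lambda>q. f q - g q) has_derivative (\<lambda>h. fpair (pd1 f p) (pd2 f p) h - fpair (pd1 g p) (pd2 g p) h)) (at p)"
    by (intro has_derivative_diff smooth_on_has_derivative_pd[OF assms(1,3)] smooth_on_has_derivative_pd[OF assms(2,3)])
  then have "((\<lambda>q. f q - g q) has_derivative fpair (pd1 f p - pd1 g p) (pd2 f p - pd2 g p)) (at p)"
    by (rule has_derivative_eq_rhs) (auto simp: fpair_def algebra_simps)
  from pd_eq[OF this] show "pd1 (\<lambda>q. f q - g q) p = pd1 f p - pd1 g p" "pd2 (\<lambda>q. f q - g q) p = pd2 f p - pd2 g p" .
qed

text \<open>
  In the coordinates \<open>U\<close> and \<open>s = v - vref\<close>, where \<open>r = fl m (U, s / 2)\<close>, the wave equation reads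
  \<open>\<partial>\<^sub>s \<partial>\<^sub>U P = cf m (U, s) P\<close>.
\<close>

definition cdom :: "real \<Rightarrow> (real \<times> real) set" where
  "cdom m = {p. (fst p, snd p / 2) \<in> flow_dom m}"

definition cf :: "real \<Rightarrow> real \<times> real \<Rightarrow> real" where
  "cf m p = pd1 (fl m) (fst p, snd p / 2) * D1 m (fl m (fst p, snd p / 2)) / (2 * fl m (fst p, snd p / 2))"

lemma half_smooth: "open S \<Longrightarrow> smooth_on S (\<lambda>p :: real \<times> real. (fst p, snd p / 2))"
  by (intro smooth_on_Pair smooth_on_fst smooth_on_divide smooth_on_snd smooth_on_const) auto

lemma open_cdom: "m > 0 \<Longrightarrow> open (cdom m)"
proof -
  assume "m > 0"
  then have "open ((\<lambda>p. (fst p, snd p / 2)) -` flow_dom m)"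
    by (intro open_vimage[OF open_flow_dom] continuous_intros) auto
  moreover have "cdom m = (\<lambda>p. (fst p, snd p / 2)) -` flow_dom m" by (auto simp: cdom_def)
  ultimately show ?thesis by (simp only:)
qed

lemma cf_smooth:
  assumes m: "m > 0"
  shows "smooth_on (cdom m) (cf m)"
proof -
  note o = open_cdom[OF m]
  have s: "smooth_on (cdom m) (\<lambda>p. g (fst p, snd p / 2))" if "smooth_on (flow_dom m) g" for g :: "real \<times> real \<Rightarrow> real"
    by (rule smooth_on_compose[OF o open_flow_dom[OF m] _ half_smooth[OF o] that]) (auto simp: cdom_def)
  have pos: "fl m (fst p, snd p / 2) > 0" if "p \<in> cdom m" for p using fl_pos[OF m] that by (auto simp: cdom_def)
  have sD: "smooth_on (cdom m) (\<lambda>p. D1 m (fl m (fst p, snd p / 2)))"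
    by (rule smooth_on_compose[OF o _ _ s[OF fl_smooth[OF m]] D1_smooth]) (use pos in force)+
  show ?thesis
    unfolding cf_def[abs_def]
    by (intro smooth_on_divide smooth_on_mult smooth_on_const sD s[OF smooth_on_pd(1)[OF fl_smooth[OF m]]]
        s[OF fl_smooth[OF m]] o) (use pos in force)
qed

lemma cdomI: "m > 0 \<Longrightarrow> 0 < U \<Longrightarrow> m \<le> U \<or> 0 \<le> s \<Longrightarrow> (U, s) \<in> cdom m"
  using rstar_zero_less[of m U] by (auto simp: cdom_def flow_dom_def)

section \<open>The packet as the difference of a retarded and an advanced field\<close>

locale wave_packet =
  fixes m vref U1 \<eta> :: real
  assumes m: "m > 0" and U1: "U1 > m" and eta: "\<eta> > 0"
begin

text \<open>Towards the future \<open>s\<close> increases and \<open>U\<close> decreases: a later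
  outgoing ray meets the reference cone at a smaller radius. The cut-off \<open>chi\<close> is thus
  switched on towards the future, as \<open>prof\<close> is.\<close>

definition chi :: "real \<Rightarrow> real" where "chi U = step (U1 + 1 - U)"
definition prof :: "real \<Rightarrow> real" where "prof s = step ((s - 1) / \<eta>)"
definition chi' :: "real \<Rightarrow> real" where "chi' U = - deriv step (U1 + 1 - U)"
definition prof' :: "real \<Rightarrow> real" where "prof' s = deriv step ((s - 1) / \<eta>) / \<eta>"

lemma chi_deriv: "(chi has_real_derivative chi' U) (at U)"
  unfolding chi_def[abs_def] chi'_def
proof -
  have d: "((\<lambda>U. U1 + 1 - U) has_real_derivative - 1) (at U)" by (auto intro!: derivative_eq_intros)
  from DERIV_chain2[where f = step and g = "\<lambda>U. U1 + 1 - U", OF step_DERIV d]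
  show "((\<lambda>U. step (U1 + 1 - U)) has_real_derivative - deriv step (U1 + 1 - U)) (at U)" by simp
qed

lemma prof_deriv: "(prof has_real_derivative prof' s) (at s)"
  unfolding prof_def[abs_def] prof'_def
proof -
  have d: "((\<lambda>s. (s - 1) / \<eta>) has_real_derivative 1 / \<eta>) (at s)" using eta by (auto intro!: derivative_eq_intros)
  from DERIV_chain2[where f = step and g = "\<lambda>s. (s - 1) / \<eta>", OF step_DERIV d]
  show "((\<lambda>s. step ((s - 1) / \<eta>)) has_real_derivative deriv step ((s - 1) / \<eta>) / \<eta>) (at s)" by simp
qed

lemma chi_smooth: "smooth_on UNIV chi" and prof_smooth: "smooth_on UNIV prof"
  unfolding chi_def[abs_def] prof_def[abs_def]
  by (rule smooth_on_compose[OF _ _ _ _ step_smooth];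
      (intro smooth_on_diff smooth_on_add smooth_on_divide smooth_on_const smooth_on_ident)?; use eta in auto)+

lemma chi_values: "U \<le> U1 \<Longrightarrow> chi U = 1" "U \<ge> U1 + 1 \<Longrightarrow> chi U = 0" "\<bar>chi U\<bar> \<le> 1"
  using step_props[of "U1 + 1 - U"] by (auto simp: chi_def)

lemma prof_values: "s \<le> 1 \<Longrightarrow> prof s = 0" "s \<ge> 1 + \<eta> \<Longrightarrow> prof s = 1" "\<bar>prof s\<bar> \<le> 1"
  using step_props[of "(s - 1) / \<eta>"] eta by (auto simp: prof_def field_simps)

lemma chi'_zero: "U < U1 \<Longrightarrow> chi' U = 0"
  using step_deriv_outside[of "U1 + 1 - U"] by (auto simp: chi'_def)

lemma prof'_zero: "s < 1 \<or> s > 1 + \<eta> \<Longrightarrow> prof' s = 0"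
  using step_deriv_outside[of "(s - 1) / \<eta>"] eta by (auto simp: prof'_def field_simps)

text \<open>
  Both products have the mixed derivative \<open>chi' U * prof' s\<close>, which is the source of the packet; the
  corresponding Goursat solutions are its retarded and its advanced field.
\<close>

definition t_ret :: "real \<times> real \<Rightarrow> real" where "t_ret p = chi (fst p) * prof (snd p)"
definition t_adv :: "real \<times> real \<Rightarrow> real" where "t_adv p = (chi (fst p) - 1) * (prof (snd p) - 1)"

lemma t_smooth: "open S \<Longrightarrow> smooth_on S t_ret" "open S \<Longrightarrow> smooth_on S t_adv"
proof -
  assume S: "open S"
  have 1: "smooth_on S (\<lambda>p. chi (fst p))" by (rule smooth_on_compose[OF S _ _ smooth_on_fst[OF S] chi_smooth]) auto
  have 2: "smooth_on S (\<lambda>p. prof (snd p))" by (rule smooth_on_compose[OF S _ _ smooth_on_snd[OF S] prof_smooth]) auto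
  show "smooth_on S t_ret" "smooth_on S t_adv"
    unfolding t_ret_def[abs_def] t_adv_def[abs_def]
    by (intro smooth_on_mult smooth_on_diff smooth_on_const 1 2 S)+
qed

lemma t_pd:
  "pd1 t_ret = (\<lambda>p. chi' (fst p) * prof (snd p))" "pd2 t_ret = (\<lambda>p. chi (fst p) * prof' (snd p))"
  "pd2 (pd1 t_ret) p = chi' (fst p) * prof' (snd p)" "pd2 (pd1 t_adv) p = chi' (fst p) * prof' (snd p)"
proof -
  note r = product_pd[OF chi_deriv prof_deriv, folded t_ret_def[abs_def]]
  show "pd1 t_ret = (\<lambda>p. chi' (fst p) * prof (snd p))" "pd2 t_ret = (\<lambda>p. chi (fst p) * prof' (snd p))" by (rule r)+
  have sd: "pd2 (\<lambda>p. chi' (fst p) * g (snd p)) p = chi' (fst p) * prof' (snd p)"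
    if g: "\<And>s. (g has_real_derivative prof' s) (at s)" and sm: "smooth_on UNIV (\<lambda>p. chi' (fst p) * g (snd p))" for g
  proof -
    obtain U s where p: "p = (U, s)" by (cases p)
    have "((\<lambda>s. chi' U * g s) has_real_derivative chi' U * prof' s) (at s)" by (rule DERIV_cmult[OF g])
    with smooth_slice2[OF sm, of U s] show ?thesis using DERIV_unique p by force
  qed
  have d1: "((\<lambda>U. chi U - 1) has_real_derivative chi' U) (at U)" for U using DERIV_diff[OF chi_deriv DERIV_const] by simp
  have d2: "((\<lambda>s. prof s - 1) has_real_derivative prof' s) (at s)" for s using DERIV_diff[OF prof_deriv DERIV_const] by simp
  note a = product_pd(1)[OF d1 d2, folded t_adv_def[abs_def]]
  show "pd2 (pd1 t_ret) p = chi' (fst p) * prof' (snd p)"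
    unfolding r(1) by (rule sd[OF prof_deriv]) (use smooth_on_pd(1)[OF t_smooth(1)[OF open_UNIV]] r in simp)
  show "pd2 (pd1 t_adv) p = chi' (fst p) * prof' (snd p)"
    unfolding a by (rule sd[OF d2]) (use smooth_on_pd(1)[OF t_smooth(2)[OF open_UNIV]] a in simp)
qed

text \<open>The base point is the past corner of the source rectangle. Restricting to
  \<open>s > 0\<close> admits all labels \<open>U > 0\<close>, because the forward flow never
  reaches \<open>r = 0\<close>.\<close>

sublocale R: goursat "{0<..}" "{0<..}" "U1 + 1" 1 "cf m" t_ret
proof
  show "smooth_on ({0<..} \<times> {0<..}) (cf m)"
    by (rule smooth_on_subset[OF cf_smooth[OF m]]) (auto intro!: cdomI m)
qed (use m U1 in \<open>auto intro!: t_smooth open_Times\<close>)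

sublocale A: goursat "{m<..}" UNIV U1 "1 + \<eta>" "cf m" t_adv
proof
  show "smooth_on ({m<..} \<times> UNIV) (cf m)"
    by (rule smooth_on_subset[OF cf_smooth[OF m]]) (use m in \<open>auto intro!: cdomI\<close>)
qed (use m U1 in \<open>auto intro!: t_smooth open_Times\<close>)

lemma ret_zero: "U > 0 \<Longrightarrow> s > 0 \<Longrightarrow> s \<le> 1 \<or> U1 + 1 \<le> U \<Longrightarrow> R.sol (U, s) = 0"
  using R.sol_zero[of "(U, s)" "{q. snd q \<le> 1}"] R.sol_zero[of "(U, s)" "{q. U1 + 1 \<le> fst q}"]
  by (auto simp: t_ret_def chi_values prof_values)

lemma adv_zero: "U > m \<Longrightarrow> U \<le> U1 \<or> 1 + \<eta> \<le> s \<Longrightarrow> A.sol (U, s) = 0"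
  using A.sol_zero[of "(U, s)" "{q. fst q \<le> U1}"] A.sol_zero[of "(U, s)" "{q. 1 + \<eta> \<le> snd q}"]
  by (auto simp: t_adv_def chi_values prof_values)

text \<open>Each field is continued by zero beyond its domain. This is smooth since the retarded
  field already vanishes for \<open>s \<le> 1\<close>, before the edge \<open>s = 0\<close>, and the
  advanced field for \<open>U \<le> U1\<close>, before the edge \<open>U = m\<close>.\<close>

definition Psi :: "real \<times> real \<Rightarrow> real" where
  "Psi p = (if fst p > 0 \<and> snd p > 0 then R.sol p else 0) - (if fst p > m then A.sol p else 0)"

text \<open>Where both fields are present their equal sources cancel. On the patches with only one
  field, \<open>U < U1\<close> or \<open>s < 1\<close>, the source is zero.\<close>

lemma Psi_local:
  assumes "p \<in> cdom m"
  shows "\<exists>N g. open N \<and> p \<in> N \<and> (\<forall>q\<in>N. Psi q = g q) \<and> smooth_on N g \<and> (\<forall>q\<in>N. pd2 (pd1 g) q = cf m q * g q)"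
proof -
  obtain U s where p: "p = (U, s)" by (cases p)
  have U: "U > 0" using assms by (simp add: p cdom_def flow_dom_def)
  have o: "open ({0<..} \<times> {0<..} :: (real \<times> real) set)" "open ({m<..} \<times> UNIV :: (real \<times> real) set)" by (auto intro!: open_Times)
  consider (1) "s > 0" "U > m" | (2) "s > 0" "U \<le> m" | (3) "s \<le> 0" "U > m" | (4) "s \<le> 0" "U \<le> m" by linarith
  then show ?thesis
  proof cases
    case 1
    let ?N = "{m<..} \<times> {0<..} :: (real \<times> real) set"
    have oN: "open ?N" by (auto intro!: open_Times)
    have sR: "smooth_on ?N R.sol" by (rule smooth_on_subset[OF R.sol_smooth]) (use m in auto)
    have sA: "smooth_on ?N A.sol" by (rule smooth_on_subset[OF A.sol_smooth]) auto
    have "pd2 (pd1 (\<lambda>q. R.sol q - A.sol q)) q = cf m q * (R.sol q - A.sol q)" if q: "q \<in> ?N" for q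
    proof -
      have "pd2 (pd1 (\<lambda>q. R.sol q - A.sol q)) q = pd2 (\<lambda>q. pd1 R.sol q - pd1 A.sol q) q"
        by (rule pd_cong(2)[OF oN pd_diff(1)[OF sR sA] smooth_on_diff[OF oN smooth_on_pd(1)[OF sR] smooth_on_pd(1)[OF sA]] q])
      also have "\<dots> = pd2 (pd1 R.sol) q - pd2 (pd1 A.sol) q"
        by (rule pd_diff(2)[OF smooth_on_pd(1)[OF sR] smooth_on_pd(1)[OF sA] q])
      also have "\<dots> = cf m q * (R.sol q - A.sol q)"
        using R.sol_mixed[of q] A.sol_mixed[of q] q m t_pd(3,4) by (auto simp: algebra_simps mem_Times_iff)
      finally show ?thesis .
    qed
    then show ?thesis
      using 1 p m by (intro exI[of _ ?N] exI[of _ "\<lambda>q. R.sol q - A.sol q"])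
        (auto simp: Psi_def intro!: oN smooth_on_diff sR sA)
  next
    case 2
    let ?N = "{0<..<U1} \<times> {0<..} :: (real \<times> real) set"
    have oN: "open ?N" by (auto intro!: open_Times)
    have sR: "smooth_on ?N R.sol" by (rule smooth_on_subset[OF R.sol_smooth]) (use m in auto)
    have "pd2 (pd1 R.sol) q = cf m q * R.sol q" if q: "q \<in> ?N" for q
      using R.sol_mixed[of q] q t_pd(3) chi'_zero[of "fst q"] by (auto simp: mem_Times_iff)
    then show ?thesis
      using 2 p U U1 by (intro exI[of _ ?N] exI[of _ R.sol])
        (auto simp: Psi_def adv_zero intro!: oN sR)
  next
    case 3
    let ?N = "{m<..} \<times> {..<1} :: (real \<times> real) set"
    have oN: "open ?N" by (auto intro!: open_Times)
    have sA: "smooth_on ?N A.sol" by (rule smooth_on_subset[OF A.sol_smooth]) auto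
    have "pd2 (pd1 (\<lambda>q. - A.sol q)) q = cf m q * - A.sol q" if q: "q \<in> ?N" for q
    proof -
      have "pd2 (pd1 (\<lambda>q. - A.sol q)) q = pd2 (\<lambda>q. - pd1 A.sol q) q"
        by (rule pd_cong(2)[OF oN pd_minus(1)[OF sA oN] smooth_on_minus[OF oN smooth_on_pd(1)[OF sA]] q])
      also have "\<dots> = - pd2 (pd1 A.sol) q"
        by (rule pd_minus(2)[OF smooth_on_pd(1)[OF sA] oN q])
      also have "\<dots> = cf m q * - A.sol q"
        using A.sol_mixed[of q] q t_pd(4) prof'_zero[of "snd q"] by (auto simp: mem_Times_iff)
      finally show ?thesis .
    qed
    then show ?thesis
      using 3 p m by (intro exI[of _ ?N] exI[of _ "\<lambda>q. - A.sol q"])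
        (auto simp: Psi_def ret_zero intro!: oN smooth_on_minus sA)
  next
    case 4
    let ?N = "{0<..<U1} \<times> {..<1} :: (real \<times> real) set"
    have oN: "open ?N" by (auto intro!: open_Times)
    have "pd2 (pd1 (\<lambda>_. 0)) q = 0" for q by (simp add: pd1_def[abs_def] pd2_def[abs_def])
    then show ?thesis
      using 4 p U U1 by (intro exI[of _ ?N] exI[of _ "\<lambda>_. 0"])
        (auto simp: Psi_def ret_zero adv_zero intro!: oN smooth_on_const)
  qed
qed

lemma Psi_smooth: "smooth_on (cdom m) Psi"
proof (rule smooth_on_local)
  fix p assume "p \<in> cdom m"
  from Psi_local[OF this] obtain N g where N: "open N" "p \<in> N" "\<forall>q\<in>N. Psi q = g q" "smooth_on N g" by blast
  then have "smooth_on N Psi" using smooth_on_cong[OF N(1) _ N(4)] by simp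
  then show "\<exists>T. open T \<and> p \<in> T \<and> smooth_on T Psi" using N by blast
qed

lemma Psi_mixed:
  assumes "p \<in> cdom m"
  shows "pd2 (pd1 Psi) p = cf m p * Psi p"
proof -
  from Psi_local[OF assms] obtain N g where N: "open N" "p \<in> N" "\<And>q. q \<in> N \<Longrightarrow> Psi q = g q" "smooth_on N g"
    "\<And>q. q \<in> N \<Longrightarrow> pd2 (pd1 g) q = cf m q * g q" by blast
  have "pd2 (pd1 Psi) p = pd2 (pd1 g) p"
    by (rule pd_cong(2)[OF N(1) pd_cong(1)[OF N(1,3,4)] smooth_on_pd(1)[OF N(4)] N(2)])
  then show ?thesis using N by simp
qed

end

section \<open>The packet in the coordinates \<open>(v, r)\<close>\<close>

context wave_packet
begin

definition Ut :: "real \<times> real \<Rightarrow> real" where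
  "Ut p = fl m (snd p, - (fst p - vref) / 2)"

text \<open>The points whose outgoing ray meets the reference cone at a positive radius, so that the
  label \<open>Ut\<close> exists. The half is there because \<open>dr / dv = D / 2\<close> along
  such a ray.\<close>

definition S :: "(real \<times> real) set" where
  "S = {p. (snd p, - (fst p - vref) / 2) \<in> flow_dom m}"

definition comp :: "(real \<times> real \<Rightarrow> real) \<Rightarrow> real \<times> real \<Rightarrow> real" where
  "comp g p = g (Ut p, fst p - vref)"

definition P :: "real \<times> real \<Rightarrow> real" where
  "P = comp Psi"

lemma aff_smooth: "open T \<Longrightarrow> smooth_on T (\<lambda>p :: real \<times> real. (snd p, - (fst p - vref) / 2))"
  by (intro smooth_on_Pair smooth_on_divide smooth_on_minus smooth_on_diff smooth_on_fst smooth_on_snd smooth_on_const) auto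

lemma open_S: "open S"
proof -
  have "open ((\<lambda>p. (snd p, - (fst p - vref) / 2)) -` flow_dom m)"
    by (intro open_vimage[OF open_flow_dom[OF m]] continuous_intros) auto
  moreover have "S = (\<lambda>p. (snd p, - (fst p - vref) / 2)) -` flow_dom m" by (auto simp: S_def)
  ultimately show ?thesis by (simp only:)
qed

lemma S_pos: "S \<subseteq> {p. snd p > 0}" by (auto simp: S_def flow_dom_def)

lemma Ut_smooth: "smooth_on S Ut"
  unfolding Ut_def[abs_def]
  by (rule smooth_on_compose[OF open_S open_flow_dom[OF m] _ aff_smooth[OF open_S] fl_smooth[OF m]])
    (auto simp: S_def)

lemma Ut_pd:
  assumes "(v, r) \<in> S"
  shows "pd1 Ut (v, r) = - D m (Ut (v, r)) / 2" "pd2 Ut (v, r) = pd1 (fl m) (r, - (v - vref) / 2)"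
    "D m r * pd2 Ut (v, r) = D m (Ut (v, r))"
proof -
  let ?\<sigma> = "- (v - vref) / 2"
  have d: "(r, ?\<sigma>) \<in> flow_dom m" using assms by (simp add: S_def)
  note fd = smooth_on_has_derivative_pd[OF fl_smooth[OF m] d]
  have "((\<lambda>v. fl m (r, - (v - vref) / 2)) has_real_derivative pd1 (fl m) (r, ?\<sigma>) * 0 + pd2 (fl m) (r, ?\<sigma>) * (- 1 / 2)) (at v)"
    by (rule has_real_derivative_fpair_compose[where g = "\<lambda>_. r" and h = "\<lambda>v. - (v - vref) / 2", OF fd])
      (auto intro!: derivative_eq_intros)
  then have "((\<lambda>v. Ut (v, r)) has_real_derivative - D m (Ut (v, r)) / 2) (at v)"
    using fl_pd(1)[OF m d] by (simp add: Ut_def)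
  then show "pd1 Ut (v, r) = - D m (Ut (v, r)) / 2"
    using DERIV_unique[OF smooth_slice1[OF Ut_smooth assms]] by blast
  have "((\<lambda>r. fl m (r, ?\<sigma>)) has_real_derivative pd1 (fl m) (r, ?\<sigma>) * 1 + pd2 (fl m) (r, ?\<sigma>) * 0) (at r)"
    by (rule has_real_derivative_fpair_compose[where g = "\<lambda>r. r" and h = "\<lambda>_. ?\<sigma>", OF fd])
      (auto intro!: derivative_eq_intros)
  then have "((\<lambda>r. Ut (v, r)) has_real_derivative pd1 (fl m) (r, ?\<sigma>)) (at r)" by (simp add: Ut_def)
  then show u2: "pd2 Ut (v, r) = pd1 (fl m) (r, ?\<sigma>)"
    using DERIV_unique[OF smooth_slice2[OF Ut_smooth assms]] by blast
  show "D m r * pd2 Ut (v, r) = D m (Ut (v, r))"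
    using fl_pd(2)[OF m d] u2 by (simp add: Ut_def)
qed

lemma Ut_cdom:
  assumes "p \<in> S"
  shows "(Ut p, fst p - vref) \<in> cdom m" "fl m (Ut p, (fst p - vref) / 2) = snd p"
proof -
  have e: "- (- (fst p - vref) / 2) = (fst p - vref) / 2" by (simp only: minus_divide_left minus_minus)
  have "(snd p, - (fst p - vref) / 2) \<in> flow_dom m" using assms by (simp only: S_def mem_Collect_eq)
  from fl_inverse[OF m this, unfolded e] show "(Ut p, fst p - vref) \<in> cdom m" "fl m (Ut p, (fst p - vref) / 2) = snd p"
    by (simp_all only: Ut_def cdom_def mem_Collect_eq fst_conv snd_conv)
qed

lemma comp_smooth:
  assumes "open N" "smooth_on N g"
  shows "open {p \<in> S. (Ut p, fst p - vref) \<in> N}" "smooth_on {p \<in> S. (Ut p, fst p - vref) \<in> N} (comp g)"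
proof -
  let ?T = "{p \<in> S. (Ut p, fst p - vref) \<in> N}"
  have sm: "smooth_on S (\<lambda>p. (Ut p, fst p - vref))"
    by (intro smooth_on_Pair Ut_smooth smooth_on_diff smooth_on_fst smooth_on_const open_S)
  have "open (S \<inter> (\<lambda>p. (Ut p, fst p - vref)) -` N)"
    by (rule continuous_open_preimage[OF smooth_on_imp_continuous_on[OF sm] open_S assms(1)])
  then show o: "open ?T" by (simp add: Int_def vimage_def)
  show "smooth_on ?T (comp g)"
    unfolding comp_def[abs_def]
    by (rule smooth_on_compose[OF o assms(1) _ smooth_on_subset[OF sm] assms(2)]) auto
qed

lemma comp_pd:
  assumes N: "open N" "smooth_on N g" and p: "(v, r) \<in> S" "(Ut (v, r), v - vref) \<in> N"
  shows "pd1 (comp g) (v, r) = pd1 g (Ut (v, r), v - vref) * (- D m (Ut (v, r)) / 2) + pd2 g (Ut (v, r), v - vref)"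
    "pd2 (comp g) (v, r) = pd1 g (Ut (v, r), v - vref) * pd2 Ut (v, r)"
proof -
  note gd = smooth_on_has_derivative_pd[OF N(2) p(2)]
  have pT: "(v, r) \<in> {p \<in> S. (Ut p, fst p - vref) \<in> N}" using p by simp
  note cs = comp_smooth(2)[OF N]
  have "((\<lambda>v. g (Ut (v, r), v - vref)) has_real_derivative
      pd1 g (Ut (v, r), v - vref) * (- D m (Ut (v, r)) / 2) + pd2 g (Ut (v, r), v - vref) * 1) (at v)"
    by (rule has_real_derivative_fpair_compose[where g = "\<lambda>v. Ut (v, r)" and h = "\<lambda>v. v - vref", OF gd])
      (use smooth_slice1[OF Ut_smooth p(1)] Ut_pd(1)[OF p(1)] in \<open>auto intro!: derivative_eq_intros\<close>)
  then have "((\<lambda>v. comp g (v, r)) has_real_derivative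
      pd1 g (Ut (v, r), v - vref) * (- D m (Ut (v, r)) / 2) + pd2 g (Ut (v, r), v - vref)) (at v)" by (simp add: comp_def)
  then show "pd1 (comp g) (v, r) = pd1 g (Ut (v, r), v - vref) * (- D m (Ut (v, r)) / 2) + pd2 g (Ut (v, r), v - vref)"
    using DERIV_unique[OF smooth_slice1[OF cs pT]] by blast
  have "((\<lambda>r. g (Ut (v, r), v - vref)) has_real_derivative
      pd1 g (Ut (v, r), v - vref) * pd2 Ut (v, r) + pd2 g (Ut (v, r), v - vref) * 0) (at r)"
    by (rule has_real_derivative_fpair_compose[where g = "\<lambda>r. Ut (v, r)" and h = "\<lambda>_. v - vref", OF gd])
      (use smooth_slice2[OF Ut_smooth p(1)] in \<open>auto intro!: derivative_eq_intros\<close>)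
  then have "((\<lambda>r. comp g (v, r)) has_real_derivative pd1 g (Ut (v, r), v - vref) * pd2 Ut (v, r)) (at r)"
    by (simp add: comp_def)
  then show "pd2 (comp g) (v, r) = pd1 g (Ut (v, r), v - vref) * pd2 Ut (v, r)"
    using DERIV_unique[OF smooth_slice2[OF cs pT]] by blast
qed

lemma S_cdom: "{p \<in> S. (Ut p, fst p - vref) \<in> cdom m} = S" using Ut_cdom(1) by auto

lemma P_smooth: "smooth_on S P"
  using comp_smooth(2)[OF open_cdom[OF m] Psi_smooth] by (simp add: S_cdom P_def)

text \<open>The third identity holds because \<open>pd1 + D / 2 * pd2\<close> differentiates along
  outgoing rays, hence at fixed label.\<close>

lemma P_pd:
  assumes "(v, r) \<in> S"
  shows "pd1 P (v, r) = pd1 Psi (Ut (v, r), v - vref) * (- D m (Ut (v, r)) / 2) + pd2 Psi (Ut (v, r), v - vref)"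
    "pd2 P (v, r) = pd1 Psi (Ut (v, r), v - vref) * pd2 Ut (v, r)"
    "pd1 P (v, r) + D m r / 2 * pd2 P (v, r) = pd2 Psi (Ut (v, r), v - vref)"
proof -
  have c: "(Ut (v, r), v - vref) \<in> cdom m" using Ut_cdom(1)[OF assms] by simp
  show 1: "pd1 P (v, r) = pd1 Psi (Ut (v, r), v - vref) * (- D m (Ut (v, r)) / 2) + pd2 Psi (Ut (v, r), v - vref)"
    and 2: "pd2 P (v, r) = pd1 Psi (Ut (v, r), v - vref) * pd2 Ut (v, r)"
    unfolding P_def by (rule comp_pd[OF open_cdom[OF m] Psi_smooth assms c])+
  have "D m r / 2 * pd2 P (v, r) = pd1 Psi (Ut (v, r), v - vref) * (D m r * pd2 Ut (v, r)) / 2" unfolding 2 by simp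
  then show "pd1 P (v, r) + D m r / 2 * pd2 P (v, r) = pd2 Psi (Ut (v, r), v - vref)"
    unfolding 1 Ut_pd(3)[OF assms] by simp
qed

text \<open>The left side of the radial equation is the derivative in \<open>r\<close> of
  \<open>2 * pd1 P + D * pd2 P\<close>, which is twice the derivative of \<open>Psi\<close> along
  rays. The chain rule then produces the mixed derivative \<open>cf * Psi\<close>, and the factor
  \<open>pd1 (fl m)\<close> in \<open>cf\<close> cancels against the derivative of the
  label.\<close>

lemma P_wave:
  assumes "p \<in> S"
  shows "radial_wave m 1 P p"
proof -
  obtain v r where p: "p = (v, r)" by (cases p)
  have pS: "(v, r) \<in> S" using assms p by simp
  have r: "r > 0" using S_pos pS by auto
  let ?q = "(Ut (v, r), v - vref)"
  have c: "?q \<in> cdom m" and flr: "fl m (Ut (v, r), (v - vref) / 2) = r" using Ut_cdom[OF pS] by auto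
  note sP = smooth_on_pd[OF P_smooth]
  have sl: "((\<lambda>r. 2 * pd1 P (v, r) + D m r * pd2 P (v, r)) has_real_derivative
      2 * pd2 (pd1 P) (v, r) + (D m r * pd2 (pd2 P) (v, r) + D1 m r * pd2 P (v, r))) (at r)"
    using r by (intro DERIV_add DERIV_cmult DERIV_mult' smooth_slice2[OF sP(1) pS] smooth_slice2[OF sP(2) pS] D_has_derivative) auto
  obtain A B where AB: "open A" "open B" "v \<in> A" "r \<in> B" "A \<times> B \<subseteq> S" using open_slices[OF open_S pS] by metis
  have sq: "smooth_on S (comp (pd2 Psi))"
    using comp_smooth(2)[OF open_cdom[OF m] smooth_on_pd(2)[OF Psi_smooth]] by (simp add: S_cdom)
  have "((\<lambda>r. 2 * comp (pd2 Psi) (v, r)) has_real_derivative 2 * pd2 (comp (pd2 Psi)) (v, r)) (at r)"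
    by (intro DERIV_cmult smooth_slice2[OF sq pS])
  then have "((\<lambda>r. 2 * pd1 P (v, r) + D m r * pd2 P (v, r)) has_real_derivative 2 * pd2 (comp (pd2 Psi)) (v, r)) (at r)"
  proof (rule has_field_derivative_transform_within_open[OF _ AB(2,4)])
    fix r' assume "r' \<in> B"
    then have "(v, r') \<in> S" using AB by auto
    from P_pd(3)[OF this] show "2 * comp (pd2 Psi) (v, r') = 2 * pd1 P (v, r') + D m r' * pd2 P (v, r')"
      by (simp add: comp_def)
  qed
  then have "2 * pd2 (pd1 P) (v, r) + (D m r * pd2 (pd2 P) (v, r) + D1 m r * pd2 P (v, r)) = 2 * pd2 (comp (pd2 Psi)) (v, r)"
    using DERIV_unique[OF sl] by blast
  also have "\<dots> = 2 * (pd1 (pd2 Psi) ?q * pd2 Ut (v, r))"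
    by (simp only: comp_pd(2)[OF open_cdom[OF m] smooth_on_pd(2)[OF Psi_smooth] pS c])
  also have "pd1 (pd2 Psi) ?q = cf m ?q * Psi ?q"
    using pd_mixed_symmetric[OF open_cdom[OF m] Psi_smooth c] Psi_mixed[OF c] by simp
  also have "2 * (cf m ?q * Psi ?q * pd2 Ut (v, r)) = D1 m r / r * Psi ?q * (pd1 (fl m) (Ut (v, r), (v - vref) / 2) * pd2 Ut (v, r))"
    by (simp add: cf_def flr)
  also have "pd1 (fl m) (Ut (v, r), (v - vref) / 2) * pd2 Ut (v, r) = 1"
  proof -
    have "(r, - (v - vref) / 2) \<in> flow_dom m" using pS by (simp only: S_def mem_Collect_eq fst_conv snd_conv)
    moreover have e: "- (- (v - vref) / 2) = (v - vref) / 2" by (simp only: minus_divide_left minus_minus)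
    ultimately show ?thesis
      unfolding Ut_pd(2)[OF pS] using fl_pd1_inverse[OF m, of r "- (v - vref) / 2", unfolded e]
      by (simp only: Ut_def fst_conv snd_conv)
  qed
  finally have "2 * pd2 (pd1 P) (v, r) + (D m r * pd2 (pd2 P) (v, r) + D1 m r * pd2 P (v, r)) = D1 m r / r * Psi ?q * 1" .
  moreover have "P (v, r) = Psi ?q" by (simp add: P_def comp_def)
  ultimately show ?thesis by (simp add: radial_wave_def p add.assoc)
qed

definition ret :: "real \<times> real \<Rightarrow> real" where "ret = R.sol"

text \<open>On this open set the advanced field is zero, so that derivatives agree along with
  values.\<close>

lemma Psi_ret:
  assumes "0 < U" "0 < s" "U < U1 \<or> 1 + \<eta> < s"
  shows "Psi (U, s) = ret (U, s)" "pd1 Psi (U, s) = pd1 ret (U, s)" "pd2 Psi (U, s) = pd2 ret (U, s)"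
proof -
  let ?N = "({0<..} \<times> {0<..}) \<inter> ({..<U1} \<times> UNIV \<union> UNIV \<times> {1 + \<eta><..}) :: (real \<times> real) set"
  have oN: "open ?N" by (auto intro!: open_Int open_Un open_Times)
  have eq: "Psi q = ret q" if "q \<in> ?N" for q
    using that adv_zero[of "fst q" "snd q"] by (auto simp: Psi_def ret_def)
  have sm: "smooth_on ?N ret" unfolding ret_def by (rule smooth_on_subset[OF R.sol_smooth]) auto
  have q: "(U, s) \<in> ?N" using assms by auto
  show "Psi (U, s) = ret (U, s)" by (rule eq[OF q])
  show "pd1 Psi (U, s) = pd1 ret (U, s)" by (rule pd_cong(1)[OF oN eq sm q])
  show "pd2 Psi (U, s) = pd2 ret (U, s)" by (rule pd_cong(2)[OF oN eq sm q])
qed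

text \<open>The two parts of the initial slice away from the packet fall under the two alternatives:
  ahead of it \<open>s < 1\<close>, outside it \<open>U > U1 + 1\<close>. On each, both fields
  vanish.\<close>

lemma Psi_zero:
  assumes "0 < U" "U < U1 \<and> s < 1 \<or> U1 + 1 < U \<and> 1 + \<eta> < s"
  shows "Psi (U, s) = 0" "pd1 Psi (U, s) = 0" "pd2 Psi (U, s) = 0"
proof -
  let ?N = "({0<..<U1} \<times> {..<1}) \<union> ({U1 + 1<..} \<times> {1 + \<eta><..}) :: (real \<times> real) set"
  have oN: "open ?N" by (auto intro!: open_Un open_Times)
  have eq: "Psi q = 0" if "q \<in> ?N" for q
    using that adv_zero[of "fst q" "snd q"] ret_zero[of "fst q" "snd q"] m U1 eta by (auto simp: Psi_def)
  have q: "(U, s) \<in> ?N" using assms by auto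
  show "Psi (U, s) = 0" by (rule eq[OF q])
  show "pd1 Psi (U, s) = 0" "pd2 Psi (U, s) = 0"
    using pd_cong[OF oN eq smooth_on_const q] by (simp_all add: pd1_def pd2_def)
qed

text \<open>The constant \<open>C\<close> does not involve \<eta>, which enters through
  \<open>prof'\<close> alone. It collects the bounds of \<open>sol_bound\<close>, with the supremum
  of \<open>t_ret\<close> being at most 1 and \<open>sb\<close> bounding the extent in
  \<open>s\<close>, and the bound \<open>G\<close> on \<open>chi'\<close>.\<close>

lemma ret_bounds:
  assumes Uc: "0 < Uc" "Uc < U1" and sb: "1 \<le> sb" and M: "M > 0" "\<And>p. p \<in> {Uc..U1 + 1} \<times> {1..sb} \<Longrightarrow> \<bar>cf m p\<bar> \<le> M"
    and G: "\<And>x. \<bar>deriv step x\<bar> \<le> G"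
  defines "L \<equiv> U1 + 1 - Uc"
  defines "K \<equiv> 2 * exp (2 * M * L * sb)"
  defines "C \<equiv> K + L * (M * K) + G + sb * (M * K)"
  assumes p: "U \<in> {Uc..U1 + 1}" "s \<in> {1..sb}"
  shows "\<bar>ret (U, s)\<bar> \<le> C" "\<bar>ret (U, s) - chi U * prof s\<bar> \<le> C * (s - 1)"
    "\<bar>pd1 ret (U, s)\<bar> \<le> C" "\<bar>pd2 ret (U, s)\<bar> \<le> C + \<bar>prof' s\<bar>"
proof -
  have G0: "G \<ge> 0" using G[of 0] by linarith
  have L: "L > 0" using Uc by (simp add: L_def)
  have K0: "K > 0" by (simp add: K_def)
  have MK: "M * K > 0" using M K0 by simp
  have Q: "R.box_ok {Uc..U1 + 1} {1..sb} M L"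
    unfolding R.box_ok_def using Uc sb M L U1 m by (auto simp: L_def)
  have t1: "\<bar>t_ret p\<bar> \<le> 1" for p
    using mult_mono[OF chi_values(3)[of "fst p"] prof_values(3)[of "snd p"]] by (simp add: t_ret_def abs_mult)
  have R: "\<bar>y - 1\<bar> \<le> sb" if "y \<in> {1..sb}" for y using that by auto
  note b = R.sol_bound[OF Q _ t1 R p, simplified, folded K_def ret_def]
  have LMK: "L * (M * K) \<ge> 0" "sb * (M * K) \<ge> 0" using L MK sb by auto
  show "\<bar>ret (U, s)\<bar> \<le> C" using b(1) LMK G0 unfolding C_def by linarith
  have "L * ((s - 1) * (M * K)) = (L * (M * K)) * (s - 1)" by simp
  also have "\<dots> \<le> C * (s - 1)" unfolding C_def using LMK G0 K0 p by (intro mult_right_mono) auto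
  finally show "\<bar>ret (U, s) - chi U * prof s\<bar> \<le> C * (s - 1)"
    using b(2) p by (simp add: t_ret_def)
  have "\<bar>chi' U * prof s\<bar> \<le> G * 1" unfolding abs_mult
    by (intro mult_mono) (use G prof_values(3) G0 in \<open>auto simp: chi'_def\<close>)
  then show "\<bar>pd1 ret (U, s)\<bar> \<le> C" using b(3) LMK K0 unfolding C_def t_pd by simp
  have "\<bar>chi U * prof' s\<bar> \<le> 1 * \<bar>prof' s\<bar>" unfolding abs_mult
    by (intro mult_right_mono chi_values) auto
  then show "\<bar>pd2 ret (U, s)\<bar> \<le> C + \<bar>prof' s\<bar>" using b(4) LMK K0 G0 unfolding C_def t_pd by simp
qed

end

section \<open>Energy estimates\<close>

lemma orient_0_1 [simp]: "orient 0 = 1" "orient 1 = - 1"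
  by (simp_all add: orient_def)

locale slices =
  fixes m r0 r1 :: real and h k :: "real \<Rightarrow> real"
  assumes m: "m > 0" and init: "initial_slice m r0 h" and ext: "extendible_slice m r1 k"
begin

lemma r0: "0 \<le> r0" "r0 < m" and r1: "0 \<le> r1" "r1 < m"
  using init ext by (auto simp: initial_slice_def extendible_slice_def)

sublocale S0: spacelike_graph m 0 h "{r0<..}"
  using init r0 by unfold_locales (auto simp: initial_slice_def m)

sublocale S1: spacelike_graph m 1 k "{r1<..<m}"
proof
  obtain r2 where "m < r2" "spacelike_slice m 1 k {r1<..<r2}" using ext by (auto simp: extendible_slice_def)
  then show "spacelike_slice m 1 k {r1<..<m}"
    unfolding spacelike_slice_def by (auto intro: smooth_on_subset)
qed (use m r1 in auto)

lemma h_deriv: "r > r0 \<Longrightarrow> (h has_real_derivative deriv h r) (at r)"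
  and h_deriv_pos: "r > r0 \<Longrightarrow> deriv h r > 0"
  and h_deriv_less: "r > r0 \<Longrightarrow> D m r * deriv h r < 2"
  using S0.f_deriv[of r] S0.lapse2_pos[of r] by auto

lemma h_less:
  assumes "r0 < r" "r < r'"
  shows "h r < h r'"
proof (rule DERIV_pos_imp_increasing[OF assms(2)])
  fix x assume "r \<le> x"
  then have "r0 < x" using assms by simp
  then show "\<exists>y. (h has_real_derivative y) (at x) \<and> 0 < y" using h_deriv h_deriv_pos by blast
qed

lemma h_cont: "continuous_on {r0<..} h"
  by (rule continuous_at_imp_continuous_on) (auto intro: DERIV_isCont[OF h_deriv])

lemma h_limit: obtains t0 where "((\<lambda>r. h r - rstar m r) \<longlongrightarrow> t0) at_top"
  using init by (auto simp: initial_slice_def)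

lemma h_at_top: "filterlim h at_top at_top"
proof -
  obtain t0 where "((\<lambda>r. h r - rstar m r) \<longlongrightarrow> t0) at_top" by (rule h_limit)
  from filterlim_tendsto_add_at_top[OF this rstar_at_top[OF m]] show ?thesis by simp
qed

lemma h_surj:
  assumes "r0 < a" "h a < y"
  obtains b where "a < b" "h b = y"
proof -
  have "eventually (\<lambda>r. y < h r \<and> a < r) at_top"
    using filterlim_at_top_dense[THEN iffD1, OF h_at_top, rule_format, of y] eventually_gt_at_top[of a]
    by (rule eventually_conj)
  then obtain c where c: "y < h c" "a < c"
    using eventually_happens'[OF trivial_limit_at_top_linorder] by blast
  have "continuous_on {a..c} h" by (rule continuous_on_subset[OF h_cont]) (use assms in auto)
  then obtain x where "a \<le> x" "x \<le> c" "h x = y" using IVT'[of h a y c] c assms by force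
  then show ?thesis using that[of x] assms by (cases "x = a") auto
qed

text \<open>Since \<open>h - r*\<close> converges, the slice cannot stay close to an outgoing null ray near infinity.\<close>

lemma good_point: "\<exists>r>a. D m r * deriv h r \<le> 3 / 2"
proof (rule ccontr)
  assume "\<not> (\<exists>r>a. D m r * deriv h r \<le> 3 / 2)"
  \<comment> \<open>Any threshold strictly between 1, the limit slope of a slice of constant
    \<open>t\<close>, and the null value 2 would do. Above 3/2 the function
    \<open>h - 3 / 2 * rstar\<close> is nondecreasing, which forces \<open>h - rstar\<close> to
    infinity.\<close>
  then have c: "D m r * deriv h r > 3 / 2" if "r > a" for r using that by force
  define b where "b = max a m + 1"
  have b: "b > a" "b > m" by (auto simp: b_def)
  have "h b - 3 / 2 * rstar m b + rstar m r / 2 \<le> h r - rstar m r" if "r \<ge> b" for r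
  proof -
    have "h b - 3 / 2 * rstar m b \<le> h r - 3 / 2 * rstar m r"
    proof (rule DERIV_nonneg_imp_nondecreasing[OF that])
      fix x assume x: "b \<le> x" "x \<le> r"
      have Dp: "D m x > 0" using D_pos x b m by auto
      have "((\<lambda>r. h r - 3 / 2 * rstar m r) has_real_derivative deriv h x - 3 / 2 * (1 / D m x)) (at x)"
        by (intro DERIV_diff DERIV_cmult h_deriv rstar_deriv) (use x b m r0 in auto)
      moreover have "deriv h x - 3 / 2 * (1 / D m x) \<ge> 0" using c[of x] x b Dp by (simp add: field_simps)
      ultimately show "\<exists>y. ((\<lambda>r. h r - 3 / 2 * rstar m r) has_real_derivative y) (at x) \<and> 0 \<le> y" by blast
    qed
    then show ?thesis by (simp add: algebra_simps)
  qed
  then have "eventually (\<lambda>r. h b - 3 / 2 * rstar m b + rstar m r / 2 \<le> h r - rstar m r) at_top"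
    unfolding eventually_at_top_linorder by blast
  moreover have "filterlim (\<lambda>r. h b - 3 / 2 * rstar m b + rstar m r / 2) at_top at_top"
    by (intro filterlim_tendsto_add_at_top[OF tendsto_const] filterlim_at_top_mult_tendsto_pos[OF tendsto_const _ rstar_at_top[OF m], of "1/2", simplified])
  ultimately have "filterlim (\<lambda>r. h r - rstar m r) at_top at_top" by (rule filterlim_at_top_mono[rotated])
  moreover obtain t0 where "((\<lambda>r. h r - rstar m r) \<longlongrightarrow> t0) at_top" by (rule h_limit)
  ultimately show False
    using filterlim_at_top_imp_at_infinity not_tendsto_and_filterlim_at_infinity trivial_limit_at_top_linorder by blast
qed

text \<open>The ingoing null coordinate \<open>v = u + 2 * rstar\<close> along the second
  slice.\<close>

definition nu :: "real \<Rightarrow> real" where "nu r = k r + 2 * rstar m r"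

lemma k_facts:
  assumes "r1 < r" "r < m"
  shows "(k has_real_derivative deriv k r) (at r)" "deriv k r < 0" "D m r * - deriv k r < 2"
  using S1.f_deriv[of r] S1.lapse2_pos[of r] assms by auto

lemma nu_deriv:
  assumes "r1 < r" "r < m"
  shows "(nu has_real_derivative deriv k r + 2 / D m r) (at r)" "deriv k r + 2 / D m r > 0"
proof -
  have r: "r > 0" using assms r1 by simp
  have Dp: "D m r > 0" using D_pos assms r by auto
  show "(nu has_real_derivative deriv k r + 2 / D m r) (at r)"
    unfolding nu_def[abs_def] using DERIV_add[OF k_facts(1)[OF assms] DERIV_cmult[OF rstar_deriv[of r m], of 2]] r assms by simp
  show "deriv k r + 2 / D m r > 0" using k_facts(3)[OF assms] Dp by (simp add: field_simps)
qed

text \<open>Along the slice \<open>v\<close> tends to infinity at the Cauchy horizon, because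
  \<open>u\<close> stays bounded below there while \<open>rstar\<close> diverges.\<close>

lemma nu_surj:
  assumes a: "r1 < a" "a < m" "nu a < y" and kB: "\<And>r. a \<le> r \<Longrightarrow> r < m \<Longrightarrow> c \<le> k r"
  obtains b where "a < b" "b < m" "nu b = y"
proof -
  have "eventually (\<lambda>r. (y - c) / 2 < rstar m r \<and> a < r \<and> r < m) (at_left m)"
    using filterlim_at_top_dense[THEN iffD1, OF rstar_at_left[OF m], rule_format, of "(y - c) / 2"]
      eventually_at_left_real[OF a(2)] by (auto elim: eventually_elim2)
  then obtain d where d: "(y - c) / 2 < rstar m d" "a < d" "d < m"
    using eventually_happens'[of "at_left m"] by auto
  have "y < nu d" using d kB[of d] by (simp add: nu_def field_simps)
  moreover have "continuous_on {a..d} nu"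
    by (rule continuous_at_imp_continuous_on) (use a d in \<open>auto intro!: DERIV_isCont[OF nu_deriv(1)]\<close>)
  ultimately obtain x where "a \<le> x" "x \<le> d" "nu x = y" using IVT'[of nu a y d] d a by force
  then show ?thesis using that[of x] a d by (cases "x = a") auto
qed

text \<open>Here extendibility enters: \<open>k\<close> and its derivative are continuous on a
  compact interval that includes \<open>m\<close>, hence bounded up to the Cauchy horizon. As
  \<open>D\<close> vanishes at \<open>m\<close>, the product \<open>D m r * B\<close> can be kept
  below 1, and then \<open>nu\<close> has slope at least \<open>1 / D\<close>.\<close>

lemma cauchy_horizon_bounds:
  obtains \<rho> B kc where "r1 < \<rho>" "m / 2 < \<rho>" "\<rho> < m" "B > 0"
    "\<And>r. \<rho> \<le> r \<Longrightarrow> r < m \<Longrightarrow> - deriv k r \<le> B \<and> D m r * B \<le> 1 \<and> \<bar>k r\<bar> \<le> kc"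
proof -
  obtain r2 where r2: "m < r2" "spacelike_slice m 1 k {r1<..<r2}" using ext by (auto simp: extendible_slice_def)
  interpret SS: spacelike_graph m 1 k "{r1<..<r2}"
    by unfold_locales (use r2 r1 m in auto)
  define a where "a = (max r1 (m / 2) + m) / 2"
  have a: "r1 < a" "m / 2 < a" "a < m" using r1 m by (auto simp: a_def)
  have sub: "{a..m} \<subseteq> {r1<..<r2}" using a r2 by auto
  have "bounded (deriv k ` {a..m})"
    by (intro compact_imp_bounded compact_continuous_image continuous_on_subset[OF SS.deriv_continuous sub]) auto
  then obtain B where B: "B > 0" "\<And>r. r \<in> {a..m} \<Longrightarrow> \<bar>deriv k r\<bar> \<le> B" by (auto simp: bounded_pos)
  have "continuous_on {a..m} k"
    by (rule continuous_at_imp_continuous_on) (use sub in \<open>auto intro!: DERIV_isCont[OF SS.f_deriv]\<close>)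
  then have "bounded (k ` {a..m})" by (intro compact_imp_bounded compact_continuous_image) auto
  then have "\<exists>kc. \<forall>r\<in>{a..m}. \<bar>k r\<bar> \<le> kc" by (auto simp: bounded_iff)
  then obtain kc where kc: "\<And>r. r \<in> {a..m} \<Longrightarrow> \<bar>k r\<bar> \<le> kc" by blast
  have "isCont (D m) m" using DERIV_isCont[OF D_has_derivative] m by auto
  then have "((\<lambda>r. D m r * B) \<longlongrightarrow> D m m * B) (at_left m)"
    by (intro tendsto_mult tendsto_const) (auto simp: isCont_def intro: tendsto_within_subset)
  then have "eventually (\<lambda>r. D m r * B < 1) (at_left m)"
    using D_self[OF m] by (auto intro: order_tendstoD)
  then obtain b where b: "b < m" "\<And>y. b < y \<Longrightarrow> y < m \<Longrightarrow> D m y * B < 1"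
    by (auto simp: eventually_at_left_field)
  define \<rho> where "\<rho> = max a ((b + m) / 2)"
  have rho: "a \<le> \<rho>" "b < \<rho>" "\<rho> < m" using a b by (auto simp: \<rho>_def less_max_iff_disj)
  show ?thesis
  proof (rule that[of \<rho> B kc])
    fix r assume r: "\<rho> \<le> r" "r < m"
    have "r \<in> {a..m}" "b < r" using rho r by auto
    then show "- deriv k r \<le> B \<and> D m r * B \<le> 1 \<and> \<bar>k r\<bar> \<le> kc"
      using B(2)[of r] kc[of r] b(2)[of r] r by auto
  qed (use rho a B in auto)
qed

lemma D_small:
  assumes "e > 0"
  obtains \<rho> where "\<rho> < m" "\<And>r. \<rho> \<le> r \<Longrightarrow> r < m \<Longrightarrow> D m r \<le> e"
proof -
  have "isCont (D m) m" using DERIV_isCont[OF D_has_derivative] m by auto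
  then have "(D m \<longlongrightarrow> D m m) (at_left m)"
    by (auto simp: isCont_def intro: tendsto_within_subset)
  then have "eventually (\<lambda>r. D m r < e) (at_left m)"
    using D_self[OF m] assms by (auto intro: order_tendstoD)
  then obtain b where b: "b < m" "\<And>y. b < y \<Longrightarrow> y < m \<Longrightarrow> D m y < e"
    by (auto simp: eventually_at_left_field)
  show ?thesis by (rule that[of "(b + m) / 2"]) (use b in \<open>auto intro!: less_imp_le\<close>)
qed

end

text \<open>The slice meets the cones \<open>s = 1\<close> and \<open>s = 2\<close> at
  \<open>ri\<close> and \<open>rp\<close>. The flow time -1 is half of the advance
  \<open>s = 2\<close>, so \<open>U1\<close> labels the outgoing ray through the slice at
  \<open>rp\<close>. As \<eta> < 1, the source, with \<open>U \<ge> U1\<close> and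
  \<open>s \<le> 1 + \<eta>\<close>, lies to the past of the slice.\<close>

locale packet_on_slices = slices m r0 r1 h k + wave_packet m vref U1 \<eta>
  for m r0 r1 h k vref U1 \<eta> +
  fixes ri rp :: real
  assumes eta1: "\<eta> < 1" and ri: "2 * m \<le> ri" "h ri = vref + 1" and rp: "ri < rp" "h rp = vref + 2"
    and U1_def: "U1 = fl m (rp, - 1)" and vref: "h m < vref"
begin

text \<open>Slice points inside the horizon have \<open>v < vref\<close>; their rays reach the cone
  by a forward flow, which always exists.\<close>

lemma on_slice:
  assumes "r > r0"
  shows "(h r, r) \<in> S"
proof -
  have r: "r > 0" using assms r0 by simp
  show ?thesis
  proof (cases "r < m")
    case True
    have "h r < vref" using h_less[OF assms True] vref by simp
    moreover have "rstar m 0 < rstar m r" using rstar_zero_less m r True by simp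
    ultimately have "rstar m 0 < rstar m r + - (h r - vref) / 2" by (simp add: field_simps)
    then show ?thesis using r by (simp add: S_def flow_dom_def)
  qed (use r in \<open>simp add: S_def flow_dom_def\<close>)
qed

text \<open>The label of the ray through a slice point, measured by \<open>rstar\<close>.\<close>

definition gs :: "real \<Rightarrow> real" where "gs r = rstar m r - (h r - vref) / 2"

lemma Ut_outer:
  assumes "r > m"
  shows "Ut (h r, r) > m" "rstar m (Ut (h r, r)) = gs r"
proof -
  have d: "(r, - (h r - vref) / 2) \<in> flow_dom m" using on_slice[of r] assms r0 by (simp add: S_def)
  show "Ut (h r, r) > m" using fl_props(3)[OF m d] assms by (simp add: Ut_def)
  show "rstar m (Ut (h r, r)) = gs r" using fl_props(4)[OF m d] assms by (simp add: Ut_def gs_def diff_divide_distrib)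
qed

text \<open>The derivative \<open>1 / D - h' / 2\<close> is positive exactly because the slope of
  the slice is below the null slope \<open>2 / D\<close>.\<close>

lemma gs_less:
  assumes "m < r" "r < r'"
  shows "gs r < gs r'"
proof (rule DERIV_pos_imp_increasing[OF assms(2)])
  fix x assume x: "r \<le> x" "x \<le> r'"
  have Dp: "D m x > 0" using D_pos x assms m by auto
  have "(gs has_real_derivative 1 / D m x - (deriv h x - 0) / 2) (at x)"
    unfolding gs_def[abs_def]
    by (intro DERIV_diff DERIV_cdivide h_deriv rstar_deriv DERIV_const) (use x assms m r0 in auto)
  moreover have "1 / D m x - (deriv h x - 0) / 2 > 0" using h_deriv_less[of x] Dp x assms r0 by (simp add: field_simps)
  ultimately show "\<exists>y. (gs has_real_derivative y) (at x) \<and> 0 < y" by blast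
qed

lemma Ut_less:
  assumes "m < r" "r < r'"
  shows "Ut (h r, r) < Ut (h r', r')"
proof (rule ccontr)
  assume n: "\<not> ?thesis"
  have "rstar m (Ut (h r', r')) \<le> rstar m (Ut (h r, r))"
    using n rstar_less[of "Ut (h r', r')" "Ut (h r, r)" m] Ut_outer(1)[of r'] assms m
    by (cases "Ut (h r', r') = Ut (h r, r)") auto
  then show False using gs_less[OF assms] Ut_outer(2) assms by auto
qed

lemma Ut_rp: "Ut (h rp, rp) = U1"
  using rp by (simp add: Ut_def U1_def)

lemma Ut_pos: "p \<in> S \<Longrightarrow> Ut p > 0"
  using fl_pos[OF m] by (auto simp: S_def Ut_def)

lemma Ut_before:
  assumes "r > r0" "r < rp"
  shows "Ut (h r, r) < U1"
proof (cases "r > m")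
  case True
  then show ?thesis using Ut_less[OF True assms(2)] Ut_rp by simp
next
  case False
  have d: "(r, - (h r - vref) / 2) \<in> flow_dom m" using on_slice[OF assms(1)] by (simp add: S_def)
  have "fl m (r, - (h r - vref) / 2) \<le> m"
    using False fl_props(2)[OF m d] by (cases "r = m") auto
  then show ?thesis using U1 by (simp add: Ut_def)
qed

text \<open>The two cases meet at \<open>rp\<close>: before it labels are below \<open>U1\<close>,
  from it on \<open>s \<ge> 2 > 1 + \<eta>\<close>. Hence on the part of the slice with
  \<open>s > 0\<close> the field is the retarded one.\<close>

lemma slice_regime:
  assumes "r > r0"
  shows "Ut (h r, r) < U1 \<or> 1 + \<eta> < h r - vref"
proof (cases "r < rp")
  case False
  then have "h rp \<le> h r" using h_less[of rp r] rp ri m r0 by (cases "r = rp") auto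
  then show ?thesis using rp eta1 by simp
qed (use Ut_before[OF assms] in auto)

definition F0 :: "real \<times> real \<Rightarrow> real" where "F0 p = P p / snd p"

lemma F0_facts:
  "smooth_on S F0" "(v, r) \<in> S \<Longrightarrow> pd1 F0 (v, r) = pd1 P (v, r) / r"
  "(v, r) \<in> S \<Longrightarrow> pd2 F0 (v, r) = pd2 P (v, r) / r - P (v, r) / r\<^sup>2"
  using quotient_pd[OF open_S S_pos P_smooth, folded F0_def[abs_def]] by auto

lemma lift_chart_0: "(lift m P \<circ> chart m 0) q = complex_of_real (F0 (q $ 1, rad q))"
  by (simp add: chart_def rad_def F0_def)

text \<open>The coefficient with which the square of \<open>prof'\<close> enters the energy density;
  it alone determines the energy to leading order in 1 / \<eta>.\<close>

definition hh :: "real \<Rightarrow> real" where "hh r = (deriv h r / r)\<^sup>2 / sqrt (lapse2 m 0 h r)"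

text \<open>All remaining terms of the energy density. They depend on the field only through the
  bound \<open>C\<close>, hence not on \<eta>.\<close>

definition Bf :: "real \<Rightarrow> real \<Rightarrow> real" where
  "Bf C r = (4 * (deriv h r / r)\<^sup>2 * C\<^sup>2 + 2 * (deriv h r * (D m r / 2) * C / r\<^sup>2)\<^sup>2
     + 2 * (1 - D m r / 2 * deriv h r)\<^sup>2 * ((C * pd2 Ut (h r, r) / r)\<^sup>2 + (C / r\<^sup>2)\<^sup>2)) / sqrt (lapse2 m 0 h r)"

text \<open>The derivative of the field along outgoing rays is \<open>pd2 Psi / r\<close> plus terms
  without derivatives of \<open>Psi\<close>, and the derivative along ingoing rays contains only
  \<open>pd1 Psi\<close>. The steep profile, measured by \<open>z\<close>, thus appears in one of
  the two squares only.\<close>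

lemma edens_bound:
  assumes r: "r > r0" and C: "\<bar>P (h r, r)\<bar> \<le> C" "\<bar>pd1 Psi (Ut (h r, r), h r - vref)\<bar> \<le> C"
    "\<bar>pd2 Psi (Ut (h r, r), h r - vref)\<bar> \<le> C + z"
  shows "edens m 0 h r (pd1 F0 (h r, r)) (pd2 F0 (h r, r)) \<le> 4 * hh r * z\<^sup>2 + Bf C r"
proof -
  note rS = on_slice[OF r]
  define d where "d = D m r / 2"
  define e where "e = deriv h r"
  define w where "w = sqrt (lapse2 m 0 h r)"
  define Q PU Ps W where "Q = P (h r, r)" and "PU = pd1 Psi (Ut (h r, r), h r - vref)"
    and "Ps = pd2 Psi (Ut (h r, r), h r - vref)" and "W = pd2 Ut (h r, r)"
  have w: "w > 0" using S0.lapse2_pos(1)[of r] r by (simp add: w_def)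
  have a: "pd1 F0 (h r, r) + d * pd2 F0 (h r, r) = Ps / r - d * Q / r\<^sup>2"
    unfolding F0_facts(2,3)[OF rS] Ps_def Q_def P_pd(3)[OF rS, symmetric]
    by (simp add: d_def algebra_simps add_divide_distrib diff_divide_distrib)
  have b: "pd2 F0 (h r, r) = PU * W / r - Q / r\<^sup>2"
    unfolding F0_facts(3)[OF rS] P_pd(2)[OF rS] by (simp add: PU_def W_def Q_def)
  have sq2: "(x - y)\<^sup>2 \<le> 2 * x\<^sup>2 + 2 * y\<^sup>2" for x y :: real
    using sum_squares_bound[of x "- y"] by (simp add: power2_diff)
  have ab: "x\<^sup>2 \<le> y\<^sup>2" if "\<bar>x\<bar> \<le> y" for x y :: real using that by (metis abs_le_square_iff abs_of_nonneg abs_ge_zero order_trans)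
  have 1: "(e * (Ps / r - d * Q / r\<^sup>2))\<^sup>2 \<le> 4 * (e / r)\<^sup>2 * z\<^sup>2 + 4 * (e / r)\<^sup>2 * C\<^sup>2 + 2 * (e * d * C / r\<^sup>2)\<^sup>2"
  proof -
    have "(e * (Ps / r - d * Q / r\<^sup>2))\<^sup>2 = (e / r * Ps - e * d / r\<^sup>2 * Q)\<^sup>2" by (simp add: algebra_simps)
    also have "\<dots> \<le> 2 * (e / r * Ps)\<^sup>2 + 2 * (e * d / r\<^sup>2 * Q)\<^sup>2" by (rule sq2)
    also have "\<dots> = 2 * (e / r)\<^sup>2 * Ps\<^sup>2 + 2 * (e * d / r\<^sup>2)\<^sup>2 * Q\<^sup>2" by (simp only: power_mult_distrib mult.assoc)
    also have "\<dots> \<le> 2 * (e / r)\<^sup>2 * (2 * z\<^sup>2 + 2 * C\<^sup>2) + 2 * (e * d / r\<^sup>2)\<^sup>2 * C\<^sup>2"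
    proof (intro add_mono mult_left_mono)
      have "Ps\<^sup>2 \<le> (z - - C)\<^sup>2" using C(3) by (intro ab) (simp add: Ps_def add.commute)
      also have "\<dots> \<le> 2 * z\<^sup>2 + 2 * (- C)\<^sup>2" by (rule sq2)
      finally show "Ps\<^sup>2 \<le> 2 * z\<^sup>2 + 2 * C\<^sup>2" by simp
      show "Q\<^sup>2 \<le> C\<^sup>2" using C(1) by (intro ab) (simp add: Q_def)
    qed auto
    also have "\<dots> = 4 * (e / r)\<^sup>2 * z\<^sup>2 + 4 * (e / r)\<^sup>2 * C\<^sup>2 + 2 * (e * d * C / r\<^sup>2)\<^sup>2"
      by (simp add: power_mult_distrib power_divide algebra_simps)
    finally show ?thesis .
  qed
  have 2: "((1 - d * e) * (PU * W / r - Q / r\<^sup>2))\<^sup>2 \<le> 2 * (1 - d * e)\<^sup>2 * ((C * W / r)\<^sup>2 + (C / r\<^sup>2)\<^sup>2)"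
  proof -
    have "(PU * W / r - Q / r\<^sup>2)\<^sup>2 \<le> 2 * (PU * W / r)\<^sup>2 + 2 * (Q / r\<^sup>2)\<^sup>2" by (rule sq2)
    also have "\<dots> = 2 * (W / r)\<^sup>2 * PU\<^sup>2 + 2 * (1 / r\<^sup>2)\<^sup>2 * Q\<^sup>2" by (simp add: power_mult_distrib power_divide)
    also have "\<dots> \<le> 2 * (W / r)\<^sup>2 * C\<^sup>2 + 2 * (1 / r\<^sup>2)\<^sup>2 * C\<^sup>2"
      using C(1,2) by (intro add_mono mult_left_mono ab) (auto simp: PU_def Q_def)
    also have "\<dots> = 2 * ((C * W / r)\<^sup>2 + (C / r\<^sup>2)\<^sup>2)" by (simp add: power_mult_distrib power_divide)
    finally have "(1 - d * e)\<^sup>2 * (PU * W / r - Q / r\<^sup>2)\<^sup>2 \<le> (1 - d * e)\<^sup>2 * (2 * ((C * W / r)\<^sup>2 + (C / r\<^sup>2)\<^sup>2))"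
      by (rule mult_left_mono) simp
    then show ?thesis by (simp only: power_mult_distrib mult.assoc mult.left_commute[of "2 :: real"])
  qed
  have "edens m 0 h r (pd1 F0 (h r, r)) (pd2 F0 (h r, r))
      = ((e * (pd1 F0 (h r, r) + d * pd2 F0 (h r, r)))\<^sup>2 + ((1 - d * e) * pd2 F0 (h r, r))\<^sup>2) / w"
    by (simp add: edens_def d_def e_def w_def)
  also have "\<dots> = ((e * (Ps / r - d * Q / r\<^sup>2))\<^sup>2 + ((1 - d * e) * (PU * W / r - Q / r\<^sup>2))\<^sup>2) / w"
    unfolding a unfolding b ..
  also have "\<dots> \<le> (4 * (e / r)\<^sup>2 * z\<^sup>2 + 4 * (e / r)\<^sup>2 * C\<^sup>2 + 2 * (e * d * C / r\<^sup>2)\<^sup>2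
      + 2 * (1 - d * e)\<^sup>2 * ((C * W / r)\<^sup>2 + (C / r\<^sup>2)\<^sup>2)) / w"
    using 1 2 w by (intro divide_right_mono add_mono) auto
  also have "\<dots> = 4 * hh r * z\<^sup>2 + Bf C r"
    by (simp add: hh_def Bf_def d_def e_def w_def W_def add_divide_distrib)
  finally show ?thesis .
qed

lemma slice_continuous:
  "continuous_on {r0<..} (lapse2 m 0 h)" "continuous_on {r0<..} hh" "continuous_on {r0<..} (Bf C)"
proof -
  have cD: "continuous_on {r0<..} (D m)"
    by (rule continuous_at_imp_continuous_on) (use r0 in \<open>auto intro!: DERIV_isCont[OF D_has_derivative]\<close>)
  show cl: "continuous_on {r0<..} (lapse2 m 0 h)"
    unfolding lapse2_def[abs_def] by (intro continuous_intros cD S0.deriv_continuous)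
  have lp: "lapse2 m 0 h r > 0" if "r > r0" for r using S0.lapse2_pos(1)[of r] that by simp
  show "continuous_on {r0<..} hh"
    unfolding hh_def[abs_def] using r0 lp
    by (intro continuous_intros cl S0.deriv_continuous) (auto simp: less_imp_neq[symmetric])
  have cU: "continuous_on {r0<..} (\<lambda>r. pd2 Ut (h r, r))"
    by (rule continuous_on_compose2[OF smooth_on_imp_continuous_on[OF smooth_on_pd(2)[OF Ut_smooth]]])
      (use on_slice in \<open>auto intro!: continuous_intros h_cont\<close>)
  show "continuous_on {r0<..} (Bf C)"
    unfolding Bf_def[abs_def] using r0 lp
    by (intro continuous_intros cl S0.deriv_continuous cD cU) (auto simp: less_imp_neq[symmetric])
qed

text \<open>Whether a ray of region II can be traced to the reference cone depends on its
  \<open>u\<close> alone, and \<open>dom_dep_Region_1\<close> provides a slice point with the same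
  \<open>u\<close> and \<open>v < vref\<close>. In region I and on the event horizon the flow is
  complete.\<close>

lemma dom_dep_in_S:
  shows "\<And>kk t x. Region kk t x \<in> dom_dep m (slice m 0 h {r0<..}) \<Longrightarrow> kk = 0 \<or> kk = 1 \<Longrightarrow> (t + rstar m (norm x), norm x) \<in> S"
    and "\<And>kk v x. Horizon kk v x \<in> dom_dep m (slice m 0 h {r0<..}) \<Longrightarrow> kk = 0 \<and> (v, norm x) \<in> S"
proof -
  fix kk t x assume R: "Region kk t x \<in> dom_dep m (slice m 0 h {r0<..})" "kk = 0 \<or> kk = 1"
  have sp: "Region kk t x \<in> ern_space m" using R dom_dep_space by blast
  show "(t + rstar m (norm x), norm x) \<in> S"
  proof (cases "kk = 0")
    case True
    then show ?thesis using Region_norm[OF sp] m by (auto simp: S_def flow_dom_def)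
  next
    case False
    then have k1: "kk = 1" using R by simp
    have x: "0 < norm x" "norm x < m" using Region_norm[OF sp] k1 by auto
    obtain r where r: "r > r0" "0 < r" "r < m" "t - rstar m (norm x) = h r - 2 * rstar m r"
      using dom_dep_Region_1[OF m R(1)[unfolded k1]] by auto
    have "h r < vref" using h_less[OF r(1,3)] vref by simp
    moreover have "rstar m 0 < rstar m r" using rstar_zero_less m r by simp
    ultimately have "rstar m 0 < rstar m (norm x) + - (t + rstar m (norm x) - vref) / 2"
      using r(4) by (simp add: field_simps)
    then show ?thesis using x by (simp add: S_def flow_dom_def)
  qed
next
  fix kk v x assume "Horizon kk v x \<in> dom_dep m (slice m 0 h {r0<..})"
  moreover then have "norm x = m" using dom_dep_space Horizon_norm by blast
  ultimately show "kk = 0 \<and> (v, norm x) \<in> S"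
    using dom_dep_Horizon[OF m] m by (auto simp: S_def flow_dom_def)
qed

end

lemma pd_cmult:
  assumes "smooth_on N f" "p \<in> N"
  shows "pd1 (\<lambda>q. a * f q) p = a * pd1 f p" "pd2 (\<lambda>q. a * f q) p = a * pd2 f p"
proof -
  have "((\<lambda>q. a * f q) has_derivative (\<lambda>h. a * fpair (pd1 f p) (pd2 f p) h)) (at p)"
    by (intro has_derivative_mult_right smooth_on_has_derivative_pd[OF assms])
  then have "((\<lambda>q. a * f q) has_derivative fpair (a * pd1 f p) (a * pd2 f p)) (at p)"
    by (rule has_derivative_eq_rhs) (auto simp: fpair_def algebra_simps)
  from pd_eq[OF this] show "pd1 (\<lambda>q. a * f q) p = a * pd1 f p" "pd2 (\<lambda>q. a * f q) p = a * pd2 f p" .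
qed

lemma smooth_on_cmult:
  fixes f :: "'a::euclidean_space \<Rightarrow> real"
  shows "open S \<Longrightarrow> smooth_on S f \<Longrightarrow> smooth_on S (\<lambda>x. a * f x)"
  by (intro smooth_on_mult smooth_on_const)

lemma radial_wave_cmult:
  assumes "open N" "smooth_on N P" "p \<in> N" "radial_wave m s P p"
  shows "radial_wave m s (\<lambda>q. a * P q) p"
proof -
  have 1: "pd2 (pd1 (\<lambda>q. a * P q)) p = a * pd2 (pd1 P) p"
    using pd_cong(2)[OF assms(1) pd_cmult(1)[OF assms(2), of _ a] smooth_on_cmult[OF assms(1) smooth_on_pd(1)[OF assms(2)]] assms(3)]
      pd_cmult(2)[OF smooth_on_pd(1)[OF assms(2)] assms(3)] by simp
  have 2: "pd2 (pd2 (\<lambda>q. a * P q)) p = a * pd2 (pd2 P) p"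
    using pd_cong(2)[OF assms(1) pd_cmult(2)[OF assms(2), of _ a] smooth_on_cmult[OF assms(1) smooth_on_pd(2)[OF assms(2)]] assms(3)]
      pd_cmult(2)[OF smooth_on_pd(2)[OF assms(2)] assms(3)] by simp
  have "a * (2 * s * pd2 (pd1 P) p + D m (snd p) * pd2 (pd2 P) p + D1 m (snd p) * pd2 P p) = a * (D1 m (snd p) / snd p * P p)"
    using assms(4) by (simp add: radial_wave_def)
  then show ?thesis
    unfolding radial_wave_def 1 2 pd_cmult[OF assms(2,3)] by (simp add: algebra_simps)
qed

context packet_on_slices
begin

lemma wave_scaled: "wave_solution m (dom_dep m (slice m 0 h {r0<..})) (lift m (\<lambda>p. a * P p))"
  by (rule wave_solution_lift[OF open_S smooth_on_cmult[OF open_S P_smooth] S_pos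
        radial_wave_cmult[OF open_S P_smooth _ P_wave] dom_dep_in_S])

definition dens0 :: "real \<Rightarrow> real" where
  "dens0 r = edens m 0 h r (pd1 F0 (h r, r)) (pd2 F0 (h r, r))"

lemma differential_0:
  assumes "norm x \<in> {r0<..}"
  shows "differential (lift m (\<lambda>p. a * P p) \<circ> chart m 0) (graph_map h x) X =
    complex_of_real (a * pd1 F0 (h (norm x), norm x) * X $ 1 + a * pd2 F0 (h (norm x), norm x) * radial_part (graph_map h x) X)"
proof (rule spherical_differential[where f = "\<lambda>p. a * F0 p", OF open_chart_dom])
  have "x \<noteq> 0" using assms r0 by auto
  then show "graph_map h x \<in> chart_dom" by (rule graph_map_facts(5))
  show "(lift m (\<lambda>p. a * P p) \<circ> chart m 0) q = complex_of_real (a * F0 (q $ 1, rad q))" for q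
    by (simp add: chart_def rad_def F0_def)
  have hS: "(h (norm x), norm x) \<in> S" using on_slice assms by simp
  have "((\<lambda>p. a * F0 p) has_derivative fpair (pd1 (\<lambda>p. a * F0 p) (h (norm x), norm x)) (pd2 (\<lambda>p. a * F0 p) (h (norm x), norm x))) (at (h (norm x), norm x))"
    by (rule smooth_on_has_derivative_pd[OF smooth_on_cmult[OF open_S F0_facts(1)] hS])
  then show "((\<lambda>p. a * F0 p) has_derivative fpair (a * pd1 F0 (h (norm x), norm x)) (a * pd2 F0 (h (norm x), norm x)))
      (at (graph_map h x $ 1, rad (graph_map h x)))"
    by (simp add: graph_map_facts pd_cmult[OF F0_facts(1) hS])
qed simp

lemma energy_0_formula:
  "energy m 0 h {r0<..} (lift m (\<lambda>p. a * P p)) = (\<integral>\<^sup>+x. ennreal (a\<^sup>2) * (ennreal (indicator {r0<..} (norm (x :: real^3)) *\<^sub>R dens0 (norm x))) \<partial>lborel)"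
  unfolding energy_def
proof (rule nn_integral_cong)
  fix x :: "real^3"
  show "ennreal (Re (stress_energy (ern_metric m 0) (lift m (\<lambda>p. a * P p) \<circ> chart m 0) (graph_map h x)
      (unit_normal m 0 h x) (unit_normal m 0 h x)) * volume_density m 0 h x) * indicator {x. norm x \<in> {r0<..}} x
      = ennreal (a\<^sup>2) * ennreal (indicator {r0<..} (norm x) *\<^sub>R dens0 (norm x))"
  proof (cases "norm x \<in> {r0<..}")
    case True
    have "edens m 0 h r (a * y) (a * z) = a\<^sup>2 * edens m 0 h r y z" for r y z
    proof -
      have "edens m 0 h r (a * y) (a * z) = ((a * (orient 0 * deriv h r * (orient 0 * y + D m r / 2 * z)))\<^sup>2
          + (a * ((1 - D m r / 2 * (orient 0 * deriv h r)) * z))\<^sup>2) / sqrt (lapse2 m 0 h r)"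
        by (simp add: edens_def algebra_simps)
      also have "\<dots> = a\<^sup>2 * edens m 0 h r y z"
        unfolding edens_def power_mult_distrib[of a] distrib_left[symmetric] by simp
      finally show ?thesis .
    qed
    then show ?thesis
      using True S0.energy_density_eq[OF True differential_0[OF True]] by (simp add: dens0_def ennreal_mult')
  qed simp
qed

lemma dens0_measurable: "(\<lambda>x :: real^3. ennreal (indicator {r0<..} (norm x) *\<^sub>R dens0 (norm x))) \<in> borel_measurable lborel"
proof -
  have lp: "lapse2 m 0 h r > 0" if "r > r0" for r using S0.lapse2_pos(1)[of r] that by simp
  have cD: "continuous_on {r0<..} (D m)"
    by (rule continuous_at_imp_continuous_on) (use r0 in \<open>auto intro!: DERIV_isCont[OF D_has_derivative]\<close>)
  have cF: "continuous_on {r0<..} (\<lambda>r. g (h r, r))" if "smooth_on S g" for g :: "real \<times> real \<Rightarrow> real"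
    by (rule continuous_on_compose2[OF smooth_on_imp_continuous_on[OF that]])
      (use on_slice in \<open>auto intro!: continuous_intros h_cont\<close>)
  have "continuous_on {r0<..} dens0"
    unfolding dens0_def[abs_def] edens_def
    by (intro continuous_intros slice_continuous cD S0.deriv_continuous cF smooth_on_pd F0_facts)
      (use lp in \<open>auto simp: less_imp_neq[symmetric]\<close>)
  then have w: "(\<lambda>r. indicator {r0<..} r *\<^sub>R dens0 r) \<in> borel_measurable borel"
    by (intro borel_measurable_continuous_on_indicator) auto
  have "(\<lambda>x :: real^3. ennreal (w (norm x))) \<in> borel_measurable lborel"
    if [measurable]: "w \<in> borel_measurable borel" for w :: "real \<Rightarrow> real" by measurable
  from this[OF w] show ?thesis .
qed

text \<open>Quadratic homogeneity, by which the initial energy is normalized in the end. Pulling the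
  constant out of the integral is what the measurability of the density is for.\<close>

lemma energy_0_scaled:
  "energy m 0 h {r0<..} (lift m (\<lambda>p. a * P p)) = ennreal (a\<^sup>2) * energy m 0 h {r0<..} (lift m P)"
proof -
  have "energy m 0 h {r0<..} (lift m P) = energy m 0 h {r0<..} (lift m (\<lambda>p. 1 * P p))" by simp
  also have "\<dots> = (\<integral>\<^sup>+x. ennreal (indicator {r0<..} (norm (x :: real^3)) *\<^sub>R dens0 (norm x)) \<partial>lborel)"
    unfolding energy_0_formula by simp
  finally show ?thesis
    unfolding energy_0_formula by (simp only: nn_integral_cmult[OF dens0_measurable])
qed

text \<open>Across the rise of the profile the field jumps by at least 1/2: the pure product jumps
  from 0 to 1, and the deviation from it at \<open>s = 1 + \<eta>\<close> is at most
  \<open>C * \<eta>\<close>. This serves for both slices.\<close>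

lemma slice_values:
  assumes C: "\<And>U s. U \<in> {Uc..U1 + 1} \<Longrightarrow> s \<in> {1..sb} \<Longrightarrow> \<bar>ret (U, s) - chi U * prof s\<bar> \<le> C * (s - 1)"
    and Ce: "C * \<eta> \<le> 1 / 2" "1 + \<eta> \<le> sb" and p: "p \<in> S" "Uc \<le> Ut p" "Ut p < U1"
  shows "fst p = vref + 1 \<Longrightarrow> P p = 0" "fst p = vref + 1 + \<eta> \<Longrightarrow> P p \<ge> 1 / 2"
proof -
  have U0: "Ut p > 0" using Ut_pos[OF p(1)] .
  show "P p = 0" if "fst p = vref + 1"
    using Psi_ret(1)[of "Ut p" 1] ret_zero[of "Ut p" 1] U0 p that by (simp add: P_def comp_def ret_def)
  show "P p \<ge> 1 / 2" if f: "fst p = vref + 1 + \<eta>"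
  proof -
    have "P p = ret (Ut p, 1 + \<eta>)"
      using Psi_ret(1)[of "Ut p" "1 + \<eta>"] U0 p f eta by (simp add: P_def comp_def)
    moreover have "\<bar>ret (Ut p, 1 + \<eta>) - chi (Ut p) * prof (1 + \<eta>)\<bar> \<le> C * (1 + \<eta> - 1)"
      by (rule C) (use p eta Ce in auto)
    moreover have "chi (Ut p) = 1" "prof (1 + \<eta>) = 1" using chi_values(1) prof_values(2) p by auto
    ultimately show ?thesis using Ce by simp
  qed
qed

text \<open>The rise of the profile takes place between \<alpha> and \<beta>, where
  \<open>nu\<close> increases by \<eta>; the steepness of \<open>nu\<close> makes this shell thin,
  and \<open>energy_lower\<close> turns the jump of the field into energy.\<close>

lemma cauchy_energy:
  assumes rho: "r1 < \<rho>" "m / 2 < \<rho>" "\<rho> < m" and B: "B > 0"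
    "\<And>r. \<rho> \<le> r \<Longrightarrow> r < m \<Longrightarrow> - deriv k r \<le> B \<and> D m r * B \<le> 1 \<and> \<bar>k r\<bar> \<le> kc"
    and al: "\<rho> < \<alpha>" "\<alpha> < m" "nu \<alpha> = vref + 1" and de: "\<delta> > 0" "\<And>r. \<alpha> \<le> r \<Longrightarrow> r < m \<Longrightarrow> D m r \<le> \<delta>"
    and Uc: "0 < Uc" "Uc < m" "rstar m Uc = (vref - kc) / 2"
    and C: "\<And>U s. U \<in> {Uc..U1 + 1} \<Longrightarrow> s \<in> {1..sb} \<Longrightarrow> \<bar>ret (U, s) - chi U * prof s\<bar> \<le> C * (s - 1)"
    and Ce: "C * \<eta> \<le> 1 / 2" "1 + \<eta> \<le> sb"
  shows "ennreal (a\<^sup>2 * (pi / (8 * sqrt (2 * B)) / (\<eta> * \<delta>))) \<le> energy m 1 k {r1<..<m} (lift m (\<lambda>p. a * P p))"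
proof -
  have kc: "- kc \<le> k r" if "\<alpha> \<le> r" "r < m" for r using B(2)[of r] that al by auto
  obtain \<beta> where be: "\<alpha> < \<beta>" "\<beta> < m" "nu \<beta> = vref + 1 + \<eta>"
    using nu_surj[of \<alpha> "vref + 1 + \<eta>" "- kc"] al rho eta kc by auto
  have ba: "\<beta> - \<alpha> \<le> \<eta> * \<delta>"
  proof -
    \<comment> \<open>On the shell the slope of \<open>nu\<close> is at least
      \<open>2 / D - B \<ge> 1 / D \<ge> 1 / \<delta>\<close>.\<close>
    have "\<exists>z. \<alpha> < z \<and> z < \<beta> \<and> nu \<beta> - nu \<alpha> = (\<beta> - \<alpha>) * (deriv k z + 2 / D m z)"
      by (rule MVT2[OF be(1)]) (use nu_deriv(1) al be rho in auto)
    then obtain z where z: "\<alpha> < z" "z < \<beta>" "\<eta> = (\<beta> - \<alpha>) * (deriv k z + 2 / D m z)"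
      using be al by auto
    have zz: "\<rho> \<le> z" "z < m" using z al be by auto
    have Dz: "D m z > 0" "D m z \<le> \<delta>" using D_pos[of z m] de(2)[of z] z zz rho m by auto
    have "B \<le> 1 / D m z" using B(2)[OF zz] Dz by (simp add: field_simps)
    then have "deriv k z + 2 / D m z \<ge> 1 / D m z" using B(2)[OF zz] by (simp add: field_simps)
    moreover have "1 / D m z \<ge> 1 / \<delta>" using Dz by (simp add: frac_le)
    ultimately have "(\<beta> - \<alpha>) * (1 / \<delta>) \<le> \<eta>" using z be by (metis diff_ge_0_iff_ge less_imp_le mult_left_mono order_trans)
    then show ?thesis using de by (simp add: field_simps)
  qed
  define S' where "S' = {p. snd p > 0 \<and> snd p \<noteq> m \<and> (fst p + 2 * rstar m (snd p), snd p) \<in> S}"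
  define P' where "P' = (\<lambda>p. P (fst p + 2 * rstar m (snd p), snd p))"
  note ow = outgoing_wave[OF open_S P_smooth S_pos P_wave, folded S'_def P'_def]
  define F where "F = (\<lambda>p. a * (P' p / snd p))"
  have sF: "smooth_on S' F"
    unfolding F_def by (intro smooth_on_cmult quotient_pd(1) ow) (auto simp: S'_def)
  \<comment> \<open>Along the second slice \<open>rstar\<close> of the label equals
    \<open>(vref - k r) / 2\<close>, so the bound on \<open>k\<close> keeps the labels above
    \<open>Uc\<close> all the way to the Cauchy horizon. The bounds on one fixed box of labels
    therefore suffice.\<close>
  have fd: "(r, - (nu r - vref) / 2) \<in> flow_dom m \<and> rstar m Uc \<le> rstar m r + - (nu r - vref) / 2"
    if "\<rho> < r" "r < m" for r
  proof -
    have "k r \<le> kc" using B(2)[of r] that by auto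
    then have "rstar m Uc \<le> rstar m r + - (nu r - vref) / 2" unfolding Uc(3) nu_def by (simp add: field_simps)
    moreover have "rstar m 0 < rstar m Uc" using rstar_zero_less m Uc by simp
    ultimately show ?thesis using that rho m by (auto simp: flow_dom_def)
  qed
  have inS: "(nu r, r) \<in> S" "(k r, r) \<in> S'" if "\<rho> < r" "r < m" for r
    using fd[OF that] that rho m by (auto simp: S_def S'_def nu_def)
  have Ur: "Uc \<le> Ut (nu r, r)" "Ut (nu r, r) < U1" if r: "\<rho> < r" "r < m" for r
  proof -
    note d = conjunct1[OF fd[OF r]]
    have U: "Ut (nu r, r) = fl m (r, - (nu r - vref) / 2)" by (simp add: Ut_def)
    have l: "Ut (nu r, r) < m" "0 < Ut (nu r, r)" "rstar m (Ut (nu r, r)) = rstar m r + - (nu r - vref) / 2"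
      using fl_props[OF m d] r unfolding U by auto
    then show "Ut (nu r, r) < U1" using U1 by simp
    have "rstar m Uc \<le> rstar m (Ut (nu r, r))" using fd[OF r] l(3) by (simp only:)
    then show "Uc \<le> Ut (nu r, r)"
      using rstar_less[of "Ut (nu r, r)" Uc m] l(2) Uc(2) by (meson linorder_not_le)
  qed
  have Pa: "P (nu \<alpha>, \<alpha>) = 0"
    by (rule slice_values(1)[OF C Ce inS(1)]) (use al Ur[of \<alpha>] in auto)
  have Pb: "P (nu \<beta>, \<beta>) \<ge> 1 / 2"
    by (rule slice_values(2)[OF C Ce inS(1)]) (use al be Ur[of \<beta>] in auto)
  have Fa: "F (k \<alpha>, \<alpha>) = 0" using Pa by (simp add: F_def P'_def nu_def)
  have Fb: "(F (k \<beta>, \<beta>))\<^sup>2 \<ge> a\<^sup>2 * (1 / (2 * m))\<^sup>2"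
  proof -
    have "1 / (2 * m) \<le> P (nu \<beta>, \<beta>) / \<beta>"
      using frac_le[of "P (nu \<beta>, \<beta>)" "1/2" \<beta> m] Pb be al rho m by simp
    then have "(1 / (2 * m))\<^sup>2 \<le> (P (nu \<beta>, \<beta>) / \<beta>)\<^sup>2" using m by (intro power_mono) auto
    moreover have "F (k \<beta>, \<beta>) = a * (P (nu \<beta>, \<beta>) / \<beta>)" by (simp add: F_def P'_def nu_def)
    ultimately show ?thesis
      unfolding power_mult_distrib[of a] by (simp only: power_mult_distrib[of a] mult_left_mono zero_le_power2)
  qed
  have "ennreal (4 * pi * \<alpha>\<^sup>2 / (2 * sqrt (2 * B)) * ((F (k \<beta>, \<beta>) - F (k \<alpha>, \<alpha>))\<^sup>2 / (\<beta> - \<alpha>)))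
      \<le> energy m 1 k {r1<..<m} (lift m (\<lambda>p. a * P p))"
  proof (rule S1.energy_lower[where S = S' and Q = "{\<rho><..<m}"])
    fix r assume "r \<in> {\<alpha>..\<beta>}"
    then have r: "r < m" "\<rho> < r" using be al by auto
    let ?T = "{q \<in> chart_dom. (q $ 1, rad q) \<in> UNIV \<times> {..<m}}"
    have oT: "open ?T" by (intro open_rad_set open_Times) auto
    show "\<exists>T. open T \<and> T \<subseteq> chart_dom \<and> (\<forall>x. norm x = r \<longrightarrow> graph_map k x \<in> T) \<and>
        (\<forall>q\<in>T. (lift m (\<lambda>p. a * P p) \<circ> chart m 1) q = complex_of_real (F (q $ 1, rad q)))"
    proof (intro exI[of _ ?T] conjI allI impI ballI)
      fix x :: "real^3" assume x: "norm x = r"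
      then have "x \<noteq> 0" using r rho m by auto
      then show "graph_map k x \<in> ?T" using graph_map_facts(5)[of x k] x r by (simp add: graph_map_facts)
    next
      fix q assume "q \<in> ?T"
      then have "rad q < m" by simp
      then show "(lift m (\<lambda>p. a * P p) \<circ> chart m 1) q = complex_of_real (F (q $ 1, rad q))"
        by (simp add: chart_def rad_def F_def P'_def add.commute)
    qed (use oT in auto)
    have "lapse2 m 1 k r \<le> 2 * B"
    proof -
      have "- deriv k r \<le> B" using B(2)[of r] r by auto
      moreover have "D m r * (deriv k r)\<^sup>2 \<ge> 0" using D_nonneg[of r m] r rho m by auto
      ultimately show ?thesis by (simp add: lapse2_def)
    qed
    then show "sqrt (lapse2 m 1 k r) \<le> sqrt (2 * B)" by simp
  qed (use sF inS be al rho in auto)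
  \<comment> \<open>The factor \<open>pi / (8 * sqrt (2 * B))\<close> collects the inner radius
    \<open>\<alpha> \<ge> m / 2\<close>, the bound \<open>sqrt (2 * B)\<close> on the volume
    density, and the jump of at least \<open>1 / (2 * m)\<close> of the field.\<close>
  moreover have "a\<^sup>2 * (pi / (8 * sqrt (2 * B)) / (\<eta> * \<delta>)) \<le> 4 * pi * \<alpha>\<^sup>2 / (2 * sqrt (2 * B)) * ((F (k \<beta>, \<beta>) - F (k \<alpha>, \<alpha>))\<^sup>2 / (\<beta> - \<alpha>))"
  proof -
    have "a\<^sup>2 * (1 / (2 * m))\<^sup>2 / (\<eta> * \<delta>) \<le> (F (k \<beta>, \<beta>))\<^sup>2 / (\<beta> - \<alpha>)"
      using Fb ba be by (intro frac_le) auto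
    moreover have "4 * pi * (m / 2)\<^sup>2 / (2 * sqrt (2 * B)) \<le> 4 * pi * \<alpha>\<^sup>2 / (2 * sqrt (2 * B))"
      using al rho m B by (intro divide_right_mono mult_left_mono power_mono) auto
    ultimately have "4 * pi * (m / 2)\<^sup>2 / (2 * sqrt (2 * B)) * (a\<^sup>2 * (1 / (2 * m))\<^sup>2 / (\<eta> * \<delta>))
        \<le> 4 * pi * \<alpha>\<^sup>2 / (2 * sqrt (2 * B)) * ((F (k \<beta>, \<beta>))\<^sup>2 / (\<beta> - \<alpha>))"
      using eta de B by (intro mult_mono) auto
    moreover have "4 * pi * (m / 2)\<^sup>2 / (2 * sqrt (2 * B)) * (a\<^sup>2 * (1 / (2 * m))\<^sup>2 / (\<eta> * \<delta>))
        = a\<^sup>2 * (pi / (8 * sqrt (2 * B)) / (\<eta> * \<delta>))"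
      using m by (simp add: field_simps power2_eq_square)
    ultimately show ?thesis by (simp add: Fa)
  qed
  ultimately show ?thesis by (meson ennreal_leI order_trans)
qed

lemma Ut_range:
  assumes rb: "rp < rb" "gs rb = rstar m (U1 + 1)" and r: "m < r"
  shows "r \<le> rb \<Longrightarrow> Ut (h r, r) \<le> U1 + 1" "rb < r \<Longrightarrow> U1 + 1 < Ut (h r, r)"
proof -
  have rbm: "rb > m" using rb rp ri m by simp
  have e: "Ut (h rb, rb) = U1 + 1"
    by (rule rstar_inj[of _ _ m]) (use Ut_outer[OF rbm] rb U1 m in auto)
  show "Ut (h r, r) \<le> U1 + 1" if "r \<le> rb" using that Ut_less[OF r, of rb] e by (cases "r = rb") auto
  show "U1 + 1 < Ut (h r, r)" if "rb < r" using Ut_less[OF rbm that] e by simp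
qed

text \<open>The radii are those at which the slice meets the start (\<open>ri\<close>) and end
  (\<open>re\<close>) of the rise and the ray \<open>U1 + 1\<close> (\<open>rb\<close>). The steep
  profile contributes on \<open>{ri..re}\<close>, the tail on \<open>{ri..rb}\<close>, and nothing
  remains outside.\<close>

lemma initial_energy:
  assumes rb: "rp < rb" "gs rb = rstar m (U1 + 1)" and Uc: "0 < Uc" "Uc < m" and sb: "h rb - vref \<le> sb"
    and C: "\<And>U s. U \<in> {Uc..U1 + 1} \<Longrightarrow> s \<in> {1..sb} \<Longrightarrow>
      \<bar>ret (U, s)\<bar> \<le> C \<and> \<bar>pd1 ret (U, s)\<bar> \<le> C \<and> \<bar>pd2 ret (U, s)\<bar> \<le> C + \<bar>prof' s\<bar>"
    and G: "\<And>x. \<bar>deriv step x\<bar> \<le> G"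
    and c2: "\<And>r. r \<in> {ri..rb} \<Longrightarrow> Bf C r \<le> c2" "c2 \<ge> 0"
    and re: "ri < re" "h re = vref + 1 + \<eta>" and Hb: "\<And>r. r \<in> {ri..re} \<Longrightarrow> hh r \<le> Hm"
  shows "energy m 0 h {r0<..} (lift m P) \<le> ennreal (4 * pi * ((4 * Hm * (G / \<eta>)\<^sup>2) * re\<^sup>2 * (re - ri) + c2 * rb\<^sup>2 * (rb - ri)))"
proof -
  have rim: "m < ri" using ri m by simp
  have rer: "re \<le> rp"
    using h_less[of rp re] re rp rim r0 eta1 by force
  have hm: "h x \<le> h y \<longleftrightarrow> x \<le> y" if "r0 < x" "r0 < y" for x y
    using h_less[of x y] h_less[of y x] that by (cases x y rule: linorder_cases) auto
  have hhp: "hh r \<ge> 0" if "r > r0" for r using S0.lapse2_pos(1)[of r] that by (simp add: hh_def)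
  have Hm0: "Hm \<ge> 0" using hhp[of ri] Hb[of ri] rim r0 re by auto
  show ?thesis
  proof (rule S0.energy_upper)
    fix x :: "real^3" assume x: "norm x \<in> {r0<..}"
    define r where "r = norm x"
    have r: "r > r0" using x by (simp add: r_def)
    let ?a = "pd1 F0 (h r, r)" and ?b = "pd2 F0 (h r, r)"
    let ?U = "Ut (h r, r)" and ?s = "h r - vref"
    have dif: "differential (lift m P \<circ> chart m 0) (graph_map h x) X = complex_of_real (?a * X $ 1 + ?b * radial_part (graph_map h x) X)" for X
      using differential_0[OF x, of 1 X] by (simp add: r_def)
    have PP: "P (h r, r) = Psi (?U, ?s)" by (simp add: P_def comp_def)
    have U0: "?U > 0" using Ut_pos on_slice[OF r] by blast
    have bound: "edens m 0 h r ?a ?b \<le> (4 * Hm * (G / \<eta>)\<^sup>2) * indicator {ri..re} r + c2 * indicator {ri..rb} r"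
    proof (cases "r \<in> {ri..rb}")
      case False
      \<comment> \<open>Inside \<open>ri\<close> one has \<open>s < 1\<close> and
        \<open>U < U1\<close>; outside \<open>rb\<close> one has \<open>U > U1 + 1\<close> and
        \<open>s > 2\<close>. In both cases the field vanishes with its derivatives.\<close>
      have z: "Psi (?U, ?s) = 0 \<and> pd1 Psi (?U, ?s) = 0 \<and> pd2 Psi (?U, ?s) = 0"
      proof (cases "r < ri")
        case True
        have "?s < 1" using h_less[OF r True] ri by simp
        moreover have "?U < U1" using Ut_before[OF r] True rp by simp
        ultimately show ?thesis using Psi_zero[OF U0] by blast
      next
        case nl: False
        then have rr: "rb < r" using False by auto
        have "?s > 1 + \<eta>" using h_less[of rp r] rp rb rr rim r0 eta1 by simp
        moreover have "U1 + 1 < ?U" using Ut_range(2)[OF rb _ rr] rr rb rp rim by simp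
        ultimately show ?thesis using Psi_zero[OF U0] by blast
      qed
      have "edens m 0 h r ?a ?b \<le> 4 * hh r * 0\<^sup>2 + Bf 0 r"
        by (rule edens_bound[OF r]) (use z PP in auto)
      also have "\<dots> = 0" by (simp add: Bf_def)
      also have "\<dots> \<le> (4 * Hm * (G / \<eta>)\<^sup>2) * indicator {ri..re} r + c2 * indicator {ri..rb} r"
        using Hm0 c2 by (auto simp: indicator_def)
      finally show ?thesis .
    next
      case True
      then have rm: "r > m" using rim by simp
      have s1: "1 \<le> ?s" using hm[of ri r] True ri rim r0 by auto
      have s2: "?s \<le> sb" using hm[of r rb] True r sb by auto
      have U: "?U \<in> {Uc..U1 + 1}" using Ut_range(1)[OF rb rm] True Ut_outer(1)[OF rm] Uc by auto
      have reg: "?U < U1 \<or> 1 + \<eta> < ?s" by (rule slice_regime[OF r])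
      note Pr = Psi_ret[OF U0 _ reg]
      have Cb: "\<bar>ret (?U, ?s)\<bar> \<le> C \<and> \<bar>pd1 ret (?U, ?s)\<bar> \<le> C \<and> \<bar>pd2 ret (?U, ?s)\<bar> \<le> C + \<bar>prof' ?s\<bar>"
        by (rule C) (use U s1 s2 in auto)
      have 1: "edens m 0 h r ?a ?b \<le> 4 * hh r * \<bar>prof' ?s\<bar>\<^sup>2 + Bf C r"
        by (rule edens_bound[OF r]) (use Cb Pr PP s1 in auto)
      have 2: "4 * hh r * \<bar>prof' ?s\<bar>\<^sup>2 \<le> (4 * Hm * (G / \<eta>)\<^sup>2) * indicator {ri..re} r"
      proof (cases "r \<le> re")
        case le: True
        have "\<bar>prof' ?s\<bar> \<le> G / \<eta>" using G eta by (simp add: prof'_def divide_right_mono)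
        then have "\<bar>prof' ?s\<bar>\<^sup>2 \<le> (G / \<eta>)\<^sup>2" by (intro power_mono) auto
        then have "4 * hh r * \<bar>prof' ?s\<bar>\<^sup>2 \<le> 4 * Hm * (G / \<eta>)\<^sup>2"
          using Hb[of r] hhp[OF r] le True by (intro mult_mono) auto
        then show ?thesis using le True by simp
      next
        case gt: False
        then have "?s > 1 + \<eta>" using h_less[of re r] re rim r0 by simp
        then have "prof' ?s = 0" by (simp add: prof'_zero)
        then show ?thesis using Hm0 by simp
      qed
      show ?thesis using 1 2 c2(1)[OF True] True by simp
    qed
    show "\<exists>a b. (\<forall>X. differential (lift m P \<circ> chart m 0) (graph_map h x) X = complex_of_real (a * X $ 1 + b * radial_part (graph_map h x) X))
        \<and> edens m 0 h (norm x) a b \<le> (4 * Hm * (G / \<eta>)\<^sup>2) * indicator {ri..re} (norm x) + c2 * indicator {ri..rb} (norm x)"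
      using dif bound unfolding r_def[symmetric] by blast
  qed (use Hm0 c2 rim m re rer rb in auto)
qed

text \<open>The jump of the field between \<open>ri\<close> and \<open>re\<close> already costs
  energy; positivity is needed in order to normalize.\<close>

lemma initial_energy_pos:
  assumes Uc: "0 < Uc" "Uc < m"
    and C: "\<And>U s. U \<in> {Uc..U1 + 1} \<Longrightarrow> s \<in> {1..sb} \<Longrightarrow> \<bar>ret (U, s) - chi U * prof s\<bar> \<le> C * (s - 1)"
    and Ce: "C * \<eta> \<le> 1 / 2" "1 + \<eta> \<le> sb"
    and re: "ri < re" "re < rp" "h re = vref + 1 + \<eta>"
  shows "energy m 0 h {r0<..} (lift m P) > 0"
proof -
  have rim: "m < ri" using ri m by simp
  have U: "Uc \<le> Ut (h r, r)" "Ut (h r, r) < U1" if "m < r" "r < rp" for r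
    using Ut_outer(1)[OF that(1)] Ut_before[of r] that Uc r0 by auto
  have Pi: "P (h ri, ri) = 0"
    by (rule slice_values(1)[OF C Ce on_slice]) (use U[of ri] ri rp rim r0 in auto)
  have Pe: "P (h re, re) \<ge> 1 / 2"
    by (rule slice_values(2)[OF C Ce on_slice]) (use U[of re] re rim r0 in auto)
  have "compact ((\<lambda>r. sqrt (lapse2 m 0 h r)) ` {ri..re})"
    by (intro compact_continuous_image continuous_intros continuous_on_subset[OF slice_continuous(1)]) (use rim r0 in auto)
  then obtain K where K: "\<And>r. r \<in> {ri..re} \<Longrightarrow> sqrt (lapse2 m 0 h r) \<le> K"
    using compact_imp_bounded bounded_imp_bdd_above by (metis bdd_above.E image_eqI)
  have "0 < sqrt (lapse2 m 0 h ri)" using S0.lapse2_pos(1)[of ri] rim r0 by simp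
  also have "\<dots> \<le> K" by (rule K) (use re in auto)
  finally have K0: "K > 0" .
  have "ennreal (4 * pi * ri\<^sup>2 / (2 * K) * ((F0 (h re, re) - F0 (h ri, ri))\<^sup>2 / (re - ri))) \<le> energy m 0 h {r0<..} (lift m P)"
  proof (rule S0.energy_lower[where S = S and Q = "{r0<..}"])
    fix r assume "r \<in> {ri..re}"
    then have r: "r > 0" using rim m by auto
    show "\<exists>T. open T \<and> T \<subseteq> chart_dom \<and> (\<forall>x. norm x = r \<longrightarrow> graph_map h x \<in> T) \<and>
        (\<forall>q\<in>T. (lift m P \<circ> chart m 0) q = complex_of_real (F0 (q $ 1, rad q)))"
      using r graph_map_facts(5) lift_chart_0 open_chart_dom by (intro exI[of _ chart_dom]) auto
  qed (use F0_facts on_slice re rim r0 K in auto)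
  moreover have "4 * pi * ri\<^sup>2 / (2 * K) * ((F0 (h re, re) - F0 (h ri, ri))\<^sup>2 / (re - ri)) > 0"
  proof -
    have "F0 (h ri, ri) = 0" "F0 (h re, re) > 0" using Pi Pe re rim m by (auto simp: F0_def)
    then show ?thesis using re rim m K0 by (intro mult_pos_pos divide_pos_pos) auto
  qed
  ultimately show ?thesis by (meson ennreal_less_zero_iff less_le_trans)
qed

end

context packet_on_slices
begin

text \<open>As \<open>h - rstar\<close> converges, \<open>gs\<close> grows like
  \<open>rstar / 2\<close>, so labels on the slice are unbounded and every ray further out is
  eventually met.\<close>

lemma outer_crossing:
  obtains rb where "rp < rb" "gs rb = rstar m (U1 + 1)"
proof -
  have rpm: "rp > m" using rp ri m by simp
  have "gs rp = rstar m U1" using Ut_outer(2)[OF rpm] Ut_rp by simp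
  also have "\<dots> < rstar m (U1 + 1)" by (rule rstar_less) (use U1 m in auto)
  finally have l: "gs rp < rstar m (U1 + 1)" .
  obtain t0 where t0: "((\<lambda>r. h r - rstar m r) \<longlongrightarrow> t0) at_top" by (rule h_limit)
  have "filterlim (\<lambda>r. (vref - (h r - rstar m r)) / 2 + 1 / 2 * rstar m r) at_top at_top"
    by (intro filterlim_tendsto_add_at_top[where c = "(vref - t0) / 2"] tendsto_intros t0
        filterlim_tendsto_pos_mult_at_top[OF tendsto_const _ rstar_at_top[OF m]]) auto
  moreover have "(vref - (h r - rstar m r)) / 2 + 1 / 2 * rstar m r = gs r" for r
    by (simp add: gs_def field_simps)
  ultimately have "filterlim gs at_top at_top" by simp
  then have "eventually (\<lambda>r. rstar m (U1 + 1) < gs r \<and> rp < r) at_top"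
    using eventually_gt_at_top[of rp] by (auto simp: filterlim_at_top_dense intro: eventually_conj)
  then obtain c where c: "rstar m (U1 + 1) < gs c" "rp < c"
    using eventually_happens'[OF trivial_limit_at_top_linorder] by blast
  have "continuous_on {rp..c} gs"
    unfolding gs_def[abs_def]
    by (intro continuous_intros rstar_cont continuous_on_subset[OF h_cont]) (use rpm r0 m in auto)
  then obtain x where "rp \<le> x" "x \<le> c" "gs x = rstar m (U1 + 1)"
    using IVT'[of gs rp "rstar m (U1 + 1)" c] c l by force
  then show ?thesis using that[of x] l by (cases "x = rp") auto
qed

text \<open>The rise of the profile shrinks to \<open>ri\<close> with \<eta>, so by continuity the
  slice may be treated there as having constant coefficients up to factors of 2. The size of the
  neighbourhood does not depend on \<eta>.\<close>

lemma near_ri: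
  obtains e where "e > 0" "\<And>r. r \<in> {ri..ri + e} \<Longrightarrow> hh r \<le> 2 * hh ri \<and> deriv h ri / 2 \<le> deriv h r \<and> r \<le> 2 * ri"
proof -
  have rim: "ri > m" using ri m by simp
  have rr: "ri > r0" using rim r0 by simp
  have hp: "deriv h ri > 0" by (rule h_deriv_pos[OF rr])
  have hhp: "hh ri > 0" using S0.lapse2_pos(1)[of ri] rr hp rim m by (simp add: hh_def)
  have "isCont hh ri" "isCont (deriv h) ri"
    using slice_continuous(2) S0.deriv_continuous rr by (auto simp: continuous_on_eq_continuous_at open_greaterThan)
  then have t: "(hh \<longlongrightarrow> hh ri) (at ri)" "(deriv h \<longlongrightarrow> deriv h ri) (at ri)" by (auto simp: isCont_def)
  have "eventually (\<lambda>r. hh r < 2 * hh ri) (at ri)" "eventually (\<lambda>r. deriv h ri / 2 < deriv h r) (at ri)"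
    "eventually (\<lambda>r. r < 2 * ri) (at ri)"
    using order_tendstoD(2)[OF t(1), of "2 * hh ri"] order_tendstoD(1)[OF t(2), of "deriv h ri / 2"]
      order_tendstoD(2)[OF tendsto_ident_at, of ri "2 * ri" UNIV] hhp hp rim m by auto
  then have "eventually (\<lambda>r. hh r < 2 * hh ri \<and> deriv h ri / 2 < deriv h r \<and> r < 2 * ri) (at ri)"
    by (intro eventually_conj)
  then obtain d where d: "d > 0" "\<And>r. r \<noteq> ri \<Longrightarrow> dist r ri < d \<Longrightarrow> hh r < 2 * hh ri \<and> deriv h ri / 2 < deriv h r \<and> r < 2 * ri"
    by (auto simp: eventually_at)
  show ?thesis
  proof (rule that[of "d / 2"])
    fix r assume r: "r \<in> {ri..ri + d / 2}"
    show "hh r \<le> 2 * hh ri \<and> deriv h ri / 2 \<le> deriv h r \<and> r \<le> 2 * ri"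
    proof (cases "r = ri")
      case False
      then show ?thesis using d(2)[of r] r d(1) by (auto simp: dist_real_def intro: less_imp_le)
    qed (use hhp hp rim m in auto)
  qed (use d in simp)
qed

text \<open>\<open>ri \<ge> 2 * m\<close> gives \<open>D \<ge> 1 / 4\<close>, hence
  \<open>h' \<le> 6\<close> under the assumption. Then
  \<open>lapse2 = h' * (2 - D * h') \<ge> h' / 2\<close>, which dominates
  \<open>(h' / 4)\<^sup>2\<close>.\<close>

lemma deriv_le_lapse:
  assumes "D m ri * deriv h ri \<le> 3 / 2"
  shows "deriv h ri \<le> 4 * sqrt (lapse2 m 0 h ri)"
proof -
  have rim: "ri > m" using ri m by simp
  let ?d = "deriv h ri"
  have hp: "?d > 0" by (rule h_deriv_pos) (use rim r0 in simp)
  have "1 / 2 \<le> (ri - m) / ri" using ri m by (simp add: field_simps)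
  then have "(1 / 2)\<^sup>2 \<le> D m ri" unfolding D_eq[of ri m, OF less_imp_neq[symmetric, OF less_trans[OF m rim]]] by (intro power_mono) auto
  then have "1 / 4 * ?d \<le> D m ri * ?d" using hp by (intro mult_right_mono) (auto simp: power2_eq_square)
  then have d6: "?d \<le> 6" using assms by simp
  have "(?d / 4)\<^sup>2 \<le> ?d * (1 / 2)" using mult_left_mono[OF d6, of ?d] hp by (simp add: power2_eq_square)
  also have "\<dots> \<le> ?d * (2 - D m ri * ?d)" using assms hp by (intro mult_left_mono) auto
  also have "\<dots> = lapse2 m 0 h ri" by (simp add: lapse2_def power2_eq_square algebra_simps)
  finally have "?d / 4 \<le> sqrt (lapse2 m 0 h ri)" by (rule real_le_rsqrt)
  then show ?thesis by simp
qed

text \<open>Everything that depends on \<open>ri\<close> cancels: the area factor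
  \<open>re\<^sup>2 \<le> 4 * ri\<^sup>2\<close> against \<open>1 / ri\<^sup>2\<close> in
  \<open>hh\<close>, and the thickness \<open>re - ri \<le> 2 * \<eta> / h'\<close> against one
  factor \<open>h'\<close>. What is left is \<open>h' / sqrt lapse2\<close>, at most 4 by
  \<open>deriv_le_lapse\<close>; 1024 is 4 times 64 times 4.\<close>

lemma main_term_bound:
  assumes g: "D m ri * deriv h ri \<le> 3 / 2" and re: "ri < re" "h re = vref + 1 + \<eta>" "re \<le> 2 * ri"
    and d: "\<And>r. r \<in> {ri..re} \<Longrightarrow> deriv h ri / 2 \<le> deriv h r"
  shows "4 * pi * ((4 * (2 * hh ri) * (G / \<eta>)\<^sup>2) * re\<^sup>2 * (re - ri)) \<le> 1024 * pi * G\<^sup>2 / \<eta>"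
proof -
  have rim: "ri > m" using ri m by simp
  have rr: "ri > r0" using rim r0 by simp
  define h1 where "h1 = deriv h ri"
  define l where "l = sqrt (lapse2 m 0 h ri)"
  have hp: "h1 > 0" unfolding h1_def by (rule h_deriv_pos[OF rr])
  have l: "l > 0" "h1 \<le> 4 * l" using S0.lapse2_pos(1)[of ri] rr deriv_le_lapse[OF g] by (auto simp: l_def h1_def)
  have "\<exists>z. ri < z \<and> z < re \<and> h re - h ri = (re - ri) * deriv h z"
    by (rule MVT2[OF re(1)]) (use h_deriv rr in auto)
  then obtain z where z: "ri < z" "z < re" "\<eta> = (re - ri) * deriv h z" using re ri by auto
  have "(re - ri) * (h1 / 2) \<le> \<eta>" unfolding z(3) h1_def using d[of z] z re by (intro mult_left_mono) auto
  then have 1: "re - ri \<le> 2 * \<eta> / h1" using hp by (simp add: field_simps)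
  have 2: "re\<^sup>2 \<le> 4 * ri\<^sup>2" using power_mono[of re "2 * ri" 2] re rim m by (simp add: power_mult_distrib)
  have hh: "hh ri = h1\<^sup>2 / ri\<^sup>2 / l" by (simp add: hh_def h1_def l_def power_divide)
  have "(4 * (2 * hh ri) * (G / \<eta>)\<^sup>2) * re\<^sup>2 * (re - ri) \<le> (4 * (2 * hh ri) * (G / \<eta>)\<^sup>2) * (4 * ri\<^sup>2) * (2 * \<eta> / h1)"
    using 1 2 re hp l eta by (intro mult_mono mult_left_mono) (auto simp: hh)
  also have "\<dots> = 64 * G\<^sup>2 / \<eta> * (h1 / l)"
    using hp l eta rim m by (simp add: hh field_simps power2_eq_square)
  also have "\<dots> \<le> 64 * G\<^sup>2 / \<eta> * 4" using l eta by (intro mult_left_mono) (auto simp: field_simps)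
  finally have "4 * pi * ((4 * (2 * hh ri) * (G / \<eta>)\<^sup>2) * re\<^sup>2 * (re - ri)) \<le> 4 * pi * (64 * G\<^sup>2 / \<eta> * 4)"
    by (rule mult_left_mono) simp
  then show ?thesis by simp
qed

end

section \<open>Choice of the parameters and conclusion\<close>

context slices
begin

text \<open>Each constant depends only on those chosen before it, and \<eta> comes last; so the
  tail, however large for the given \<open>ri\<close>, is absorbed by the leading term of order 1 /
  \<eta>.\<close>

lemma amplification:
  assumes "Kc > 0"
  shows "\<exists>u. wave_solution m (dom_dep m (slice m 0 h {r0<..})) u \<and> energy m 0 h {r0<..} u = 1
    \<and> ennreal Kc \<le> energy m 1 k {r1<..<m} u"
proof -
  obtain G where G: "G > 0" "\<And>x. \<bar>deriv step x\<bar> \<le> G" by (rule step_deriv_bound) blast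
  obtain \<rho> B kc where rho: "r1 < \<rho>" "m / 2 < \<rho>" "\<rho> < m" and B: "B > 0"
    "\<And>r. \<rho> \<le> r \<Longrightarrow> r < m \<Longrightarrow> - deriv k r \<le> B \<and> D m r * B \<le> 1 \<and> \<bar>k r\<bar> \<le> kc"
    using cauchy_horizon_bounds by metis
  define c1 where "c1 = pi / (8 * sqrt (2 * B))"
  define c0 where "c0 = 1024 * pi * G\<^sup>2"
  \<comment> \<open>The initial energy will be at most \<open>2 * c0 / \<eta>\<close> and the final
    one at least \<open>c1 / (\<eta> * \<delta>)\<close>; this \<delta> makes their ratio at least
    \<open>Kc\<close>.\<close>
  define \<delta> where "\<delta> = c1 / (2 * c0 * Kc)"
  have c1: "c1 > 0" using B by (simp add: c1_def)
  have c0: "c0 > 0" using G by (simp add: c0_def)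
  have de: "\<delta> > 0" using c0 c1 assms by (simp add: \<delta>_def)
  obtain \<rho>' where rho': "\<rho>' < m" "\<And>r. \<rho>' \<le> r \<Longrightarrow> r < m \<Longrightarrow> D m r \<le> \<delta>" using D_small[OF de] by blast
  define \<rho>2 where "\<rho>2 = max \<rho> \<rho>'"
  have rho2: "\<rho> \<le> \<rho>2" "\<rho>' \<le> \<rho>2" "\<rho>2 < m" using rho rho' by (auto simp: \<rho>2_def)
  \<comment> \<open>The conditions on \<open>vref = h ri - 1\<close>: the reference cone meets the
    slice outside the horizon, \<open>(vref - kc) / 2\<close> is a value of \<open>rstar\<close> in
    the interior, and the packet meets the second slice beyond \<open>\<rho>2\<close>. The summand 1
    compensates the shift by 1.\<close>
  have "eventually (\<lambda>r. max (max (h m) (kc + 2 * rstar m 0)) (nu \<rho>2) + 1 < h r \<and> 2 * m \<le> r) at_top"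
    using filterlim_at_top_dense[THEN iffD1, OF h_at_top, rule_format] eventually_ge_at_top[of "2 * m"]
    by (intro eventually_conj) auto
  then obtain N where N: "\<And>r. r \<ge> N \<Longrightarrow> max (max (h m) (kc + 2 * rstar m 0)) (nu \<rho>2) + 1 < h r \<and> 2 * m \<le> r"
    by (auto simp: eventually_at_top_linorder)
  obtain ri where ri: "ri > N" "D m ri * deriv h ri \<le> 3 / 2" using good_point by blast
  define vref where "vref = h ri - 1"
  have v: "h m < vref" "kc + 2 * rstar m 0 < vref" "nu \<rho>2 < vref + 1" "2 * m \<le> ri"
    using N[of ri] ri by (auto simp: vref_def)
  have hri: "h ri = vref + 1" by (simp add: vref_def)
  have rim: "ri > m" "ri > r0" using v m r0 by auto
  obtain rp where rp: "ri < rp" "h rp = vref + 2" using h_surj[OF rim(2), of "vref + 2"] hri by auto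
  define U1 where "U1 = fl m (rp, - 1)"
  have U1: "U1 > m" unfolding U1_def using fl_props(3)[OF m, of rp "- 1"] rp rim m by (auto simp: flow_dom_def)
  have kB: "- kc \<le> k r" if "\<rho>2 \<le> r" "r < m" for r using B(2)[of r] that rho2 by force
  obtain \<alpha> where al: "\<rho>2 < \<alpha>" "\<alpha> < m" "nu \<alpha> = vref + 1"
    using nu_surj[of \<rho>2 "vref + 1" "- kc"] rho rho2 v kB by auto
  obtain Uc where Uc: "0 < Uc" "Uc < m" "rstar m Uc = (vref - kc) / 2"
    using rstar_surj_inner[OF m, of "(vref - kc) / 2"] v by auto
  have pk: "packet_on_slices m r0 r1 h k vref U1 \<eta> ri rp" if "0 < \<eta>" "\<eta> < 1" for \<eta>
    by unfold_locales (use m U1 that v hri rp U1_def in auto)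
  \<comment> \<open>An auxiliary width: \<open>gs\<close>, \<open>Bf\<close> and \<open>hh\<close>
    do not involve it, so the quantities derived from them are available before \<eta> is
    chosen.\<close>
  interpret X: packet_on_slices m r0 r1 h k vref U1 "1 / 2" ri rp by (rule pk) auto
  obtain rb where rb: "rp < rb" "X.gs rb = rstar m (U1 + 1)" by (rule X.outer_crossing)
  define sb where "sb = max 2 (h rb - vref)"
  have sb: "sb \<ge> 2" "h rb - vref \<le> sb" by (auto simp: sb_def)
  have "bounded (cf m ` ({Uc..U1 + 1} \<times> {1..sb}))"
  proof (intro compact_imp_bounded compact_continuous_image compact_Times)
    show "continuous_on ({Uc..U1 + 1} \<times> {1..sb}) (cf m)"
      by (rule continuous_on_subset[OF smooth_on_imp_continuous_on[OF cf_smooth[OF m]]])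
        (use Uc in \<open>auto intro!: cdomI m\<close>)
  qed auto
  then obtain M where M: "M > 0" "\<And>p. p \<in> {Uc..U1 + 1} \<times> {1..sb} \<Longrightarrow> \<bar>cf m p\<bar> \<le> M"
    unfolding bounded_pos by (auto simp del: mem_Sigma_iff)
  define L where "L = U1 + 1 - Uc"
  define K where "K = 2 * exp (2 * M * L * sb)"
  define C where "C = K + L * (M * K) + G + sb * (M * K)"
  have "L > 0" using Uc U1 by (simp add: L_def)
  then have C0: "C > 0" using M G sb unfolding C_def K_def by (intro add_pos_pos mult_pos_pos) auto
  have "compact (X.Bf C ` {ri..rb})"
    by (intro compact_continuous_image continuous_on_subset[OF X.slice_continuous(3)]) (use rim in auto)
  then have "\<exists>c. \<forall>r\<in>{ri..rb}. X.Bf C r \<le> c"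
    using compact_imp_bounded bounded_imp_bdd_above by (metis bdd_above.E image_eqI)
  then obtain c where c: "\<And>r. r \<in> {ri..rb} \<Longrightarrow> X.Bf C r \<le> c" by blast
  define c2 where "c2 = max 0 c"
  have c2: "c2 \<ge> 0" "\<And>r. r \<in> {ri..rb} \<Longrightarrow> X.Bf C r \<le> c2" using c by (auto simp: c2_def le_max_iff_disj)
  obtain e where e: "e > 0"
    "\<And>r. r \<in> {ri..ri + e} \<Longrightarrow> X.hh r \<le> 2 * X.hh ri \<and> deriv h ri / 2 \<le> deriv h r \<and> r \<le> 2 * ri"
    by (rule X.near_ri) blast
  \<comment> \<open>The energy of the tail; the summand 1 makes it a legitimate denominator.\<close>
  define q where "q = 4 * pi * (c2 * rb\<^sup>2 * (rb - ri)) + 1"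
  have q: "q > 0" using c2 rb rp by (simp add: q_def add_nonneg_pos)
  have he: "h (ri + e) > h ri" using h_less rim e by simp
  \<comment> \<open>In this order the entries ensure \<eta> < 1, that the rise of the profile stays
    in the neighbourhood of \<open>ri\<close> from \<open>near_ri\<close>, that the deviation
    \<open>C * \<eta>\<close> is at most 1/2, and that the tail is at most
    \<open>c0 / \<eta>\<close>.\<close>
  define \<eta> where "\<eta> = Min {1 / 2, h (ri + e) - h ri, 1 / (2 * C), c0 / q}"
  have eta: "\<eta> > 0" "\<eta> \<le> 1 / 2" "\<eta> \<le> h (ri + e) - h ri" "\<eta> \<le> 1 / (2 * C)" "\<eta> \<le> c0 / q"
    unfolding \<eta>_def using he C0 q c0 by (subst Min_gr_iff; simp) (intro Min_le; simp)+
  interpret Y: packet_on_slices m r0 r1 h k vref U1 \<eta> ri rp by (rule pk) (use eta in auto)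
  obtain re where re: "ri < re" "h re = vref + 1 + \<eta>"
    using h_surj[OF rim(2), of "vref + 1 + \<eta>"] hri eta by auto
  have re2: "re \<le> ri + e" using h_less[of "ri + e" re] re hri eta rim e by force
  have re3: "re < rp" using h_less[of rp re] re rp eta rim by (cases "re = rp") force+
  have Ce: "C * \<eta> \<le> 1 / 2" "1 + \<eta> \<le> sb" using eta C0 sb by (auto simp: field_simps)
  have UU: "Uc < U1" "1 \<le> sb" using Uc U1 sb by auto
  have rt: "\<bar>Y.ret (U, s)\<bar> \<le> C" "\<bar>Y.ret (U, s) - Y.chi U * Y.prof s\<bar> \<le> C * (s - 1)"
    "\<bar>pd1 Y.ret (U, s)\<bar> \<le> C" "\<bar>pd2 Y.ret (U, s)\<bar> \<le> C + \<bar>Y.prof' s\<bar>"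
    if "U \<in> {Uc..U1 + 1}" "s \<in> {1..sb}" for U s
    unfolding C_def K_def L_def
    by (rule Y.ret_bounds[OF Uc(1) UU M(1) _ G(2) that], erule M(2))+
  let ?E0 = "energy m 0 h {r0<..} (lift m Y.P)"
  have "?E0 \<le> ennreal (4 * pi * ((4 * (2 * Y.hh ri) * (G / \<eta>)\<^sup>2) * re\<^sup>2 * (re - ri) + c2 * rb\<^sup>2 * (rb - ri)))"
  proof (rule Y.initial_energy[OF rb Uc(1,2) sb(2) _ G(2) c2(2,1) re])
    show "\<bar>Y.ret (U, s)\<bar> \<le> C \<and> \<bar>pd1 Y.ret (U, s)\<bar> \<le> C \<and> \<bar>pd2 Y.ret (U, s)\<bar> \<le> C + \<bar>Y.prof' s\<bar>"
      if "U \<in> {Uc..U1 + 1}" "s \<in> {1..sb}" for U s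
      using rt(1,3,4)[OF that] by simp
  qed (use e(2) re2 in auto)
  also have "\<dots> \<le> ennreal (2 * c0 / \<eta>)"
  proof (rule ennreal_leI)
    have "4 * pi * ((4 * (2 * Y.hh ri) * (G / \<eta>)\<^sup>2) * re\<^sup>2 * (re - ri)) \<le> c0 / \<eta>"
      unfolding c0_def by (rule Y.main_term_bound[OF ri(2) re]) (use e(2) re2 re in auto)
    moreover have "4 * pi * (c2 * rb\<^sup>2 * (rb - ri)) \<le> c0 / \<eta>"
    proof -
      have "q \<le> c0 / \<eta>" using eta q by (simp add: field_simps)
      then show ?thesis by (simp add: q_def)
    qed
    ultimately show "4 * pi * ((4 * (2 * Y.hh ri) * (G / \<eta>)\<^sup>2) * re\<^sup>2 * (re - ri) + c2 * rb\<^sup>2 * (rb - ri)) \<le> 2 * c0 / \<eta>"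
      unfolding distrib_left by linarith
  qed
  finally have E0: "?E0 \<le> ennreal (2 * c0 / \<eta>)" .
  have E0p: "?E0 > 0" by (rule Y.initial_energy_pos[OF Uc(1,2) rt(2) Ce re(1) re3 re(2)])
  obtain E where E: "E \<ge> 0" "?E0 = ennreal E"
    using E0 by (cases ?E0 rule: ennreal_cases) (auto simp: top_unique)
  have E1: "E > 0" "E \<le> 2 * c0 / \<eta>" using E0 E0p E c0 eta by (auto simp: ennreal_le_iff)
  \<comment> \<open>Energies scale by the square of the amplitude, so this factor normalizes the
    initial energy.\<close>
  define a where "a = 1 / sqrt E"
  have a2: "a\<^sup>2 = 1 / E" using E1 by (simp add: a_def power_divide)
  have "energy m 0 h {r0<..} (lift m (\<lambda>p. a * Y.P p)) = ennreal (1 / E) * ennreal E"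
    unfolding Y.energy_0_scaled E(2) a2 ..
  also have "\<dots> = 1" using E1 by (simp add: ennreal_mult'[symmetric])
  finally have 1: "energy m 0 h {r0<..} (lift m (\<lambda>p. a * Y.P p)) = 1" .
  have "ennreal (a\<^sup>2 * (c1 / (\<eta> * \<delta>))) \<le> energy m 1 k {r1<..<m} (lift m (\<lambda>p. a * Y.P p))"
    unfolding c1_def
  proof (rule Y.cauchy_energy[OF rho B _ al(2,3) de _ Uc _ Ce])
    show "\<rho> < \<alpha>" using al rho2 by simp
    show "D m r \<le> \<delta>" if "\<alpha> \<le> r" "r < m" for r using rho'(2)[of r] that al rho2 by simp
  qed (use rt(2) in auto)
  moreover have "Kc \<le> a\<^sup>2 * (c1 / (\<eta> * \<delta>))"
  proof -
    have "Kc = \<eta> / (2 * c0) * (c1 / (\<eta> * \<delta>))" using eta c0 c1 assms by (simp add: \<delta>_def field_simps)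
    also have "\<dots> \<le> 1 / E * (c1 / (\<eta> * \<delta>))"
      using E1 eta c0 c1 de by (intro mult_right_mono) (auto simp: field_simps)
    finally show ?thesis by (simp only: a2)
  qed
  ultimately have 2: "ennreal Kc \<le> energy m 1 k {r1<..<m} (lift m (\<lambda>p. a * Y.P p))"
    by (meson ennreal_leI order_trans)
  show ?thesis using Y.wave_scaled[of a] 1 2 by blast
qed

end

theorem mainTheorem7:
  fixes m r0 r1 :: real and h k :: "real \<Rightarrow> real" and \<Sigma>0 \<Sigma>1 :: "ern set"
  assumes "m > 0"
    and "initial_slice m r0 h"
    and "\<Sigma>0 = slice m 0 h {r0<..}"
    and "extendible_slice m r1 k"
    and "\<Sigma>1 = slice m 1 k {r1<..<m}"
    and "\<Sigma>1 \<subseteq> dom_dep m \<Sigma>0 \<inter> causal_future m \<Sigma>0"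
  shows "\<exists>u :: nat \<Rightarrow> ern \<Rightarrow> complex.
           (\<forall>i. wave_solution m (dom_dep m \<Sigma>0) (u i) \<and> energy m 0 h {r0<..} (u i) = 1) \<and>
           (\<lambda>i. energy m 1 k {r1<..<m} (u i)) \<longlonglongrightarrow> \<infinity>"
proof -
  interpret slices m r0 r1 h k by unfold_locales (use assms in auto)
  \<comment> \<open>\<open>Suc i\<close> instead of \<open>i\<close>, because
    \<open>amplification\<close> asks for a positive factor.\<close>
  have "\<forall>i. \<exists>u. wave_solution m (dom_dep m \<Sigma>0) u \<and> energy m 0 h {r0<..} u = 1
      \<and> ennreal (real (Suc i)) \<le> energy m 1 k {r1<..<m} u"
    using amplification[of "real (Suc _)"] assms(3) by (auto simp del: of_nat_Suc)
  then obtain u where u: "\<And>i. wave_solution m (dom_dep m \<Sigma>0) (u i)" "\<And>i. energy m 0 h {r0<..} (u i) = 1"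
    "\<And>i. ennreal (real (Suc i)) \<le> energy m 1 k {r1<..<m} (u i)"
    by metis
  have "(\<lambda>i. ennreal (real (Suc i))) \<longlonglongrightarrow> \<infinity>"
    using LIMSEQ_Suc[OF of_nat_tendsto_top_ennreal] by (simp only: ennreal_of_nat_eq_real_of_nat infinity_ennreal_def)
  then have "(\<lambda>i. energy m 1 k {r1<..<m} (u i)) \<longlonglongrightarrow> \<infinity>"
    by (rule tendsto_sandwich[OF _ _ _ tendsto_const, rotated 2]) (use u(3) in auto)
  then show ?thesis using u by blast
qed

end
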